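(* Let $(\mu_n)_{n\in\mathbb N\cup\{\infty\}}\subset\mathscr K(X)$ be such that $\mu_n\to\mu_\infty$ vaguely and $G^{\mu_n}1\to G^{\mu_\infty}1$ uniformly on $X$. Let $F_n$ and $F$ be the fine supports of $\mu_n$ ($n\in\mathbb N$) and $\mu_\infty$, respectively. Assume that $F_n$ and $F$ are closed and $F_n\subset F$ for every $n\in\mathbb N$. Then for all $u\in C_0(X)$, $\lim_{n\to\infty}\|\check{\bf P}^n_tu-\check{\bf P}^\infty_tu\|_\infty=0$ locally uniformly in $t\in[0,\infty)$.
   Context: $X$ is a locally compact separable metric space, $m$ a positive Radon measure on the Borel sets of $X$ with full support, $X_\partial=X\cup\{\partial\}$ the one-point compactification; every function $u$ on $X$ is extended by $u(\partial)=0$. $\mathscr B_b(X)$ denotes the bounded Borel functions on $X$ with the sup norm $\|\cdot\|_\infty$, and $C_0(X)$ the continuous functions vanishing at infinity. $\mathbb X=(\Omega,\mathscr M,\mathscr M_t,(\mathbb P_x)_{x\in X_\partial},(\mathbb X_t)_{0\le t\le\infty},(\theta_t),\zeta)$ is a standard process in the sense of Blumenthal–Getoor (not necessarily symmetric) with state space $X$ and cemetery $\partial$ (with $\mathbb X_\infty=\partial$). It is transient and has a dual standard process $\hat{\mathbb X}$ (duality with respect to $m$) with the same properties. Its transition semigroup ${\bf P}_tu(x)=\mathbb E_x[u(\mathbb X_t)]$ has a jointly measurable density $p_t(x,y)$ with respect to $m$, with $p_t(x,y)>0$ for all $t>0$, $x,y\in X$. For $\alpha\ge0$, $G_\alpha(x,y)=\int_0^\infty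 e^{-\alpha t}p_t(x,y)\,dt$, $G:=G_0\not\equiv\infty$, and $G:X\times X\to(0,\infty]$ is lower semicontinuous. For a positive Radon measure $\mu$ on $X$, $G^\mu u(x)=\int_XG(x,y)u(y)\,d\mu(y)$; $\mu$ is $G$-Kato if $G^\mu1\in C_0(X)$, and $\mathscr K(X)$ is the set of $G$-Kato measures. Each $\mu\in\mathscr K(X)$ has a unique (up to equivalence) positive continuous additive functional (PCAF) ${\bf A}$ of $\mathbb X$ with Revuz measure $\mu$; it satisfies $\mathbb E_x[\int_0^\infty e^{-\alpha t}u(\mathbb X_t)\,d{\bf A}_t]=\int_XG_\alpha(x,y)u(y)\,d\mu(y)$ for $u\in\mathscr B_b(X)$, $\alpha\ge0$, $x\in X$. For $n\in\mathbb N\cup\{\infty\}$ let ${\bf A}^n$ be the PCAF of $\mu_n$, $\tau^n_t=\inf\{s\ge0:{\bf A}^n_s>t\}$, and $\check{\bf P}^n_tu(x)=\mathbb E_x[u(\mathbb X_{\tau^n_t})]$ for $u\in\mathscr B_b(X)$, $x\in X$. The fine support of $\mu\in\mathscr K(X)$ is the smallest nearly Borel finely closed set $B\subset X$ with $\mu(B^c)=0$; it equals $\{x\in X:\mathbb P_x(\tau_0=0)=1\}$, where $\tau_0=\inf\{s\ge0:{\bf A}_s>0\}$. Vague convergence means convergence of integrals of continuous functions with compact support. *)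

theory Defs
  imports "HOL-Probability.Probability"
begin

section \<open>Function spaces and measures on the state space\<close>

text \<open>The state space \<open>X\<close> is the whole type \<open>'x\<close>; for metric spaces, the class
  \<^class>\<open>second_countable_topology\<close> expresses separability.  Sample spaces are whole types as well.\<close>

definition C0 :: "('x::topological_space \<Rightarrow> real) set" where
  "C0 = {u. continuous_on UNIV u \<and> (\<forall>\<epsilon>>0. \<exists>K. compact K \<and> (\<forall>x. x \<notin> K \<longrightarrow> \<bar>u x\<bar> < \<epsilon>))}"

definition Cc :: "('x::topological_space \<Rightarrow> real) set" where
  "Cc = {u. continuous_on UNIV u \<and> compact (closure {x. u x \<noteq> 0})}"

text \<open>Only meant for bounded functions.\<close>
definition sup_norm :: "('x \<Rightarrow> real) \<Rightarrow> real" where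
  "sup_norm f = (SUP x. \<bar>f x\<bar>)"

definition lower_semicontinuous :: "('z::topological_space \<Rightarrow> ennreal) \<Rightarrow> bool" where
  "lower_semicontinuous f \<longleftrightarrow> (\<forall>c. open {z. c < f z})"

text \<open>On a locally compact separable metric space, regularity is automatic for Borel measures that
  are finite on compact sets.\<close>
definition radon_measure :: "'x::topological_space measure \<Rightarrow> bool" where
  "radon_measure \<mu> \<longleftrightarrow> sets \<mu> = sets borel \<and> (\<forall>K. compact K \<longrightarrow> emeasure \<mu> K < \<infinity>)"

definition full_support :: "'x::topological_space measure \<Rightarrow> bool" where
  "full_support \<mu> \<longleftrightarrow> (\<forall>U. open U \<and> U \<noteq> {} \<longrightarrow> emeasure \<mu> U > 0)"

definition vague_limit :: "(nat \<Rightarrow> 'x::topological_space measure) \<Rightarrow> 'x measure \<Rightarrow> bool" where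
  "vague_limit \<mu> \<nu> \<longleftrightarrow>
     (\<forall>f\<in>Cc. (\<lambda>n. \<integral>x. f x \<partial>\<mu> n) \<longlonglongrightarrow> (\<integral>x. f x \<partial>\<nu>))"


section \<open>The one-point compactification\<close>

text \<open>\<^term>\<open>None\<close> is the cemetery.  It is the point at infinity if \<open>X\<close> is not compact and an
  isolated point if \<open>X\<close> is compact.\<close>

definition one_point_topology :: "'x::t2_space option topology" where
  "one_point_topology =
     topology (\<lambda>U. open (Some -` U) \<and> (None \<in> U \<longrightarrow> compact (- (Some -` U))))"

lemma openin_one_point_topology:
  "openin one_point_topology (U :: 'x::t2_space option set) \<longleftrightarrow>
     open (Some -` U) \<and> (None \<in> U \<longrightarrow> compact (- (Some -` U)))"
proof -
  have "istopology (\<lambda>U :: 'x option set.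
          open (Some -` U) \<and> (None \<in> U \<longrightarrow> compact (- (Some -` U))))"
    unfolding istopology_def
  proof (intro conjI allI impI)
    fix S T :: "'x option set"
    assume S: "open (Some -` S) \<and> (None \<in> S \<longrightarrow> compact (- (Some -` S)))"
      and T: "open (Some -` T) \<and> (None \<in> T \<longrightarrow> compact (- (Some -` T)))"
    show "open (Some -` (S \<inter> T))"
      using S T by (simp add: vimage_Int open_Int)
    assume "None \<in> S \<inter> T"
    then show "compact (- (Some -` (S \<inter> T)))"
      using S T by (simp add: vimage_Int Compl_Int compact_Un)
  next
    fix K :: "'x option set set"
    assume K: "\<forall>U\<in>K. open (Some -` U) \<and> (None \<in> U \<longrightarrow> compact (- (Some -` U)))"
    then show o: "open (Some -` (\<Union>K))"
      by (auto simp: vimage_Union)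
    assume "None \<in> \<Union>K"
    then obtain U where U: "U \<in> K" "None \<in> U" by blast
    then have "compact (- (Some -` U) \<inter> (- (Some -` (\<Union>K))))"
      using K o by (intro compact_Int_closed) (auto simp: closed_Compl)
    moreover have "- (Some -` U) \<inter> (- (Some -` (\<Union>K))) = - (Some -` (\<Union>K))"
      using U by auto
    ultimately show "compact (- (Some -` (\<Union>K)))" by simp
  qed
  then show ?thesis
    unfolding one_point_topology_def by (simp add: topology_inverse')
qed

definition borel_cem :: "'x::t2_space option measure" where
  "borel_cem = sigma UNIV {U. openin one_point_topology U}"

definition ext0 :: "('x \<Rightarrow> 'b::zero) \<Rightarrow> 'x option \<Rightarrow> 'b" where
  "ext0 u z = (case z of None \<Rightarrow> 0 | Some x \<Rightarrow> u x)"


section \<open>Standard processes\<close>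

text \<open>Times range over \<open>[0,\<infinity>]\<close>, i.e. over \<^typ>\<open>ennreal\<close>.  Of \<^term>\<open>events\<close> and
  \<^term>\<open>filt\<close> only the \<open>\<sigma>\<close>-algebras matter.\<close>

record ('w, 'x) process =
  events :: "'w measure"
  filt :: "ennreal \<Rightarrow> 'w measure"
  law :: "'x option \<Rightarrow> 'w measure"
  pos :: "ennreal \<Rightarrow> 'w \<Rightarrow> 'x option"
  shift :: "ennreal \<Rightarrow> 'w \<Rightarrow> 'w"

definition lifetime :: "('w, 'x) process \<Rightarrow> 'w \<Rightarrow> ennreal" where
  "lifetime X \<omega> = Inf {t. pos X t \<omega> = None}"

text \<open>Markov processes with translation operators (Blumenthal--Getoor, Chapter I).\<close>
definition markov_process :: "('w, 'x::t2_space) process \<Rightarrow> bool" where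
  "markov_process X \<longleftrightarrow>
     space (events X) = UNIV \<and>
     filtration UNIV (filt X) \<and> (\<forall>t. sets (filt X t) \<subseteq> sets (events X)) \<and>
     (\<forall>z. prob_space (law X z) \<and> sets (law X z) = sets (events X)) \<and>
     (\<forall>t. pos X t \<in> filt X t \<rightarrow>\<^sub>M borel_cem) \<and>
     (\<forall>\<omega>. pos X \<infinity> \<omega> = None) \<and>
     (\<forall>s t \<omega>. s \<le> t \<and> pos X s \<omega> = None \<longrightarrow> pos X t \<omega> = None) \<and>
     (\<forall>s t \<omega>. pos X s (shift X t \<omega>) = pos X (t + s) \<omega>) \<and>
     (\<forall>t. \<forall>B\<in>sets borel_cem.
        (\<lambda>z. emeasure (law X z) {\<omega>. pos X t \<omega> \<in> B}) \<in> borel_measurable borel_cem) \<and>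
     (AE \<omega> in law X None. pos X 0 \<omega> = None) \<and>
     (\<forall>z. \<forall>s<\<infinity>. \<forall>t<\<infinity>. \<forall>B\<in>sets borel_cem. \<forall>\<Lambda>\<in>sets (filt X t).
        emeasure (law X z) (\<Lambda> \<inter> {\<omega>. pos X (t + s) \<omega> \<in> B}) =
        (\<integral>\<^sup>+\<omega>\<in>\<Lambda>. emeasure (law X (pos X t \<omega>)) {\<omega>'. pos X s \<omega>' \<in> B} \<partial>law X z))"

text \<open>The uncompleted natural filtration; for \<open>t = \<infinity>\<close> it is generated by all \<^term>\<open>pos X s\<close>.\<close>
definition natural0 :: "('w, 'x::t2_space) process \<Rightarrow> ennreal \<Rightarrow> 'w set set" where
  "natural0 X t = sigma_sets UNIV {pos X s -` B | s B. s \<le> t \<and> B \<in> sets borel_cem}"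

text \<open>Null sets of \<open>P\<^sub>\<nu> = \<integral> P\<^sub>z \<nu>(dz)\<close>.  The measure \<open>P\<^sub>\<nu>\<close> is only evaluated on the natural
  \<open>\<sigma>\<close>-algebra, where the integrand is Borel.\<close>
definition negligible_under ::
    "('w, 'x::t2_space) process \<Rightarrow> 'x option measure \<Rightarrow> 'w set \<Rightarrow> bool" where
  "negligible_under X \<nu> S \<longleftrightarrow>
     (\<exists>N\<in>natural0 X \<infinity>. S \<subseteq> N \<and> (\<integral>\<^sup>+z. emeasure (law X z) N \<partial>\<nu>) = 0)"

definition initial_law :: "'x::t2_space option measure \<Rightarrow> bool" where
  "initial_law \<nu> \<longleftrightarrow> prob_space \<nu> \<and> sets \<nu> = sets borel_cem"

text \<open>Completion of a system of events with respect to the family of all \<open>P\<^sub>\<nu>\<close>.\<close>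
definition completed :: "('w, 'x::t2_space) process \<Rightarrow> 'w set set \<Rightarrow> 'w set set" where
  "completed X \<G> =
     {S. \<forall>\<nu>. initial_law \<nu> \<longrightarrow> (\<exists>B\<in>\<G>. negligible_under X \<nu> (sym_diff S B))}"

definition natural :: "('w, 'x::t2_space) process \<Rightarrow> ennreal \<Rightarrow> 'w measure" where
  "natural X t = sigma UNIV (completed X (natural0 X t))"

text \<open>Standard processes (Blumenthal--Getoor, Definition I.9.2): a normal strong Markov process with
  a right continuous and complete filtration, whose paths are almost surely right continuous on
  \<open>[0,\<infinity>)\<close> with left limits on \<open>[0,\<zeta>)\<close>, and which is quasi-left-continuous on \<open>[0,\<zeta>)\<close>.\<close>
definition standard_process :: "('w, 'x::t2_space) process \<Rightarrow> bool" where
  "standard_process X \<longleftrightarrow>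
     markov_process X \<and>
     (\<forall>z. AE \<omega> in law X z. pos X 0 \<omega> = z) \<and>
     completed X (sets (events X)) \<subseteq> sets (events X) \<and>
     (\<forall>t. completed X (sets (filt X t)) \<subseteq> sets (filt X t)) \<and>
     (\<forall>t<\<infinity>. sets (filt X t) = (\<Inter>s\<in>{t<..}. sets (filt X s))) \<and>
     (\<forall>z. AE \<omega> in law X z.
        (\<forall>t<\<infinity>. limitin one_point_topology (\<lambda>s. pos X s \<omega>) (pos X t \<omega>) (at_right t)) \<and>
        (\<forall>t. 0 < t \<and> t < lifetime X \<omega> \<longrightarrow>
           (\<exists>l. limitin one_point_topology (\<lambda>s. pos X s \<omega>) l (at_left t)))) \<and>
     (\<forall>T. stopping_time (filt X) T \<longrightarrow>
        (\<lambda>\<omega>. pos X (T \<omega>) \<omega>) \<in> filtration.pre_sigma UNIV (filt X) T \<rightarrow>\<^sub>M borel_cem \<and>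
        (\<forall>z. \<forall>s<\<infinity>. \<forall>B\<in>sets borel_cem. \<forall>\<Lambda>\<in>sets (filtration.pre_sigma UNIV (filt X) T).
           emeasure (law X z) (\<Lambda> \<inter> {\<omega>. pos X (T \<omega> + s) \<omega> \<in> B}) =
           (\<integral>\<^sup>+\<omega>\<in>\<Lambda>. emeasure (law X (pos X (T \<omega>) \<omega>)) {\<omega>'. pos X s \<omega>' \<in> B} \<partial>law X z))) \<and>
     (\<forall>T. (\<forall>n::nat. stopping_time (filt X) (T n)) \<and> (\<forall>\<omega>. incseq (\<lambda>n. T n \<omega>)) \<longrightarrow>
        (\<forall>z. AE \<omega> in law X z. (SUP n. T n \<omega>) < lifetime X \<omega> \<longrightarrow>
           limitin one_point_topology (\<lambda>n. pos X (T n \<omega>) \<omega>)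
             (pos X (SUP n. T n \<omega>) \<omega>) sequentially))"


section \<open>Semigroup, duality, Green function\<close>

definition semigroup_op :: "('w, 'x) process \<Rightarrow> real \<Rightarrow> ('x \<Rightarrow> ennreal) \<Rightarrow> 'x \<Rightarrow> ennreal" where
  "semigroup_op X t u x = (\<integral>\<^sup>+\<omega>. ext0 u (pos X (ennreal t) \<omega>) \<partial>law X (Some x))"

text \<open>Transience in the sense of Getoor: some strictly positive function has a finite potential.\<close>
definition transient :: "('w, 'x::t2_space) process \<Rightarrow> bool" where
  "transient X \<longleftrightarrow>
     (\<exists>g\<in>borel_measurable borel. (\<forall>x. 0 < g x) \<and>
        (\<forall>x. (\<integral>\<^sup>+t\<in>{0<..}. semigroup_op X t g x \<partial>lborel) < \<infinity>))"

definition in_duality ::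
    "'x::t2_space measure \<Rightarrow> ('w, 'x) process \<Rightarrow> ('v, 'x) process \<Rightarrow> bool" where
  "in_duality m X Y \<longleftrightarrow>
     (\<forall>t>0. \<forall>u\<in>borel_measurable borel. \<forall>v\<in>borel_measurable borel.
        (\<integral>\<^sup>+x. semigroup_op X t u x * v x \<partial>m) = (\<integral>\<^sup>+x. u x * semigroup_op Y t v x \<partial>m))"

definition transition_density ::
    "('w, 'x::t2_space) process \<Rightarrow> 'x measure \<Rightarrow> (real \<Rightarrow> 'x \<Rightarrow> 'x \<Rightarrow> ennreal) \<Rightarrow> bool" where
  "transition_density X m p \<longleftrightarrow>
     (\<lambda>(t, x, y). p t x y) \<in> borel_measurable (restrict_space borel ({0<..} \<times> UNIV \<times> UNIV)) \<and>
     (\<forall>t>0. \<forall>x. \<forall>u\<in>borel_measurable borel.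
        semigroup_op X t u x = (\<integral>\<^sup>+y. p t x y * u y \<partial>m))"

definition green :: "(real \<Rightarrow> 'x \<Rightarrow> 'x \<Rightarrow> ennreal) \<Rightarrow> real \<Rightarrow> 'x \<Rightarrow> 'x \<Rightarrow> ennreal" where
  "green p \<alpha> x y = (\<integral>\<^sup>+t\<in>{0<..}. ennreal (exp (- \<alpha> * t)) * p t x y \<partial>lborel)"

definition green_op ::
    "('x \<Rightarrow> 'x \<Rightarrow> ennreal) \<Rightarrow> 'x measure \<Rightarrow> ('x \<Rightarrow> ennreal) \<Rightarrow> 'x \<Rightarrow> ennreal" where
  "green_op G \<mu> u x = (\<integral>\<^sup>+y. G x y * u y \<partial>\<mu>)"

definition kato_measure ::
    "('x::topological_space \<Rightarrow> 'x \<Rightarrow> ennreal) \<Rightarrow> 'x measure \<Rightarrow> bool" where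
  "kato_measure G \<mu> \<longleftrightarrow> radon_measure \<mu> \<and> (\<forall>x. green_op G \<mu> (\<lambda>_. 1) x < \<infinity>) \<and>
     (\<lambda>x. enn2real (green_op G \<mu> (\<lambda>_. 1) x)) \<in> C0"


section \<open>Additive functionals and time change\<close>

text \<open>Positive continuous additive functionals without exceptional starting points.  The continuity
  on \<open>[0,\<infinity>]\<close> includes the convention that \<open>A\<^sub>\<infinity>\<close> is the limit of \<open>A\<^sub>t\<close> as \<open>t \<rightarrow> \<infinity>\<close>.  Finiteness on
  \<open>[0,\<infinity>)\<close> instead of \<open>[0,\<zeta>)\<close> is no restriction for the functionals of Kato measures, as
  \<open>A\<^sub>\<infinity>\<close> is then integrable and \<open>\<Lambda>\<close> can be shrunk to the paths with \<open>A\<^sub>\<infinity> < \<infinity>\<close>.\<close>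
definition pcaf :: "('w, 'x::t2_space) process \<Rightarrow> (ennreal \<Rightarrow> 'w \<Rightarrow> ennreal) \<Rightarrow> bool" where
  "pcaf X A \<longleftrightarrow>
     (\<forall>t. A t \<in> borel_measurable (natural X t)) \<and>
     (\<exists>\<Lambda>\<in>sets (natural X \<infinity>).
        (\<forall>x. AE \<omega> in law X (Some x). \<omega> \<in> \<Lambda>) \<and>
        (\<forall>t<\<infinity>. shift X t ` \<Lambda> \<subseteq> \<Lambda>) \<and>
        (\<forall>\<omega>\<in>\<Lambda>. A 0 \<omega> = 0 \<and>
           continuous_on UNIV (\<lambda>t. A t \<omega>) \<and>
           (\<forall>t<\<infinity>. A t \<omega> < \<infinity>) \<and>
           (\<forall>t\<ge>lifetime X \<omega>. A t \<omega> = A (lifetime X \<omega>) \<omega>) \<and>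
           (\<forall>t<\<infinity>. \<forall>s. A (t + s) \<omega> = A t \<omega> + A s (shift X t \<omega>))))"

text \<open>The Lebesgue--Stieltjes measure \<open>dA\<^sub>t(\<omega>)\<close>; it is carried by \<open>[0,\<infinity>)\<close> since
  \<^term>\<open>ennreal t = 0\<close> for \<open>t \<le> 0\<close>.\<close>
definition stieltjes :: "(ennreal \<Rightarrow> 'w \<Rightarrow> ennreal) \<Rightarrow> 'w \<Rightarrow> real measure" where
  "stieltjes A \<omega> = interval_measure (\<lambda>t. enn2real (A (ennreal t) \<omega>))"

definition revuz_measure ::
    "('w, 'x::t2_space) process \<Rightarrow> 'x measure \<Rightarrow> (ennreal \<Rightarrow> 'w \<Rightarrow> ennreal) \<Rightarrow> 'x measure \<Rightarrow> bool"
  where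
  "revuz_measure X m A \<mu> \<longleftrightarrow> sets \<mu> = sets borel \<and>
     (\<forall>f\<in>borel_measurable borel.
        ((\<lambda>t. (\<integral>\<^sup>+x. (\<integral>\<^sup>+\<omega>. (\<integral>\<^sup>+s\<in>{0..t}. ext0 f (pos X (ennreal s) \<omega>) \<partial>stieltjes A \<omega>)
                  \<partial>law X (Some x)) \<partial>m) / ennreal t)
          \<longlongrightarrow> (\<integral>\<^sup>+x. f x \<partial>\<mu>)) (at_right 0))"

text \<open>The identity
    \<open>E\<^sub>x[\<integral> e\<^sup>-\<^sup>\<alpha>\<^sup>t u(X\<^sub>t) dA\<^sub>t] = \<integral> G\<^sub>\<alpha>(x,y) u(y) \<mu>(dy)\<close>.
  It links \<open>A\<close> to the chosen version of the density, which by itself is determined only up to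
  \<open>m\<close>-null sets while \<open>\<mu>\<close> may be singular to \<open>m\<close>.  By linearity and monotone convergence,
  non-negative \<open>u\<close> are equivalent to bounded \<open>u\<close> if \<open>\<mu>\<close> is a Kato measure.\<close>
definition green_potential_of ::
    "('w, 'x::t2_space) process \<Rightarrow> (real \<Rightarrow> 'x \<Rightarrow> 'x \<Rightarrow> ennreal) \<Rightarrow>
     (ennreal \<Rightarrow> 'w \<Rightarrow> ennreal) \<Rightarrow> 'x measure \<Rightarrow> bool" where
  "green_potential_of X p A \<mu> \<longleftrightarrow>
     (\<forall>\<alpha>\<ge>0. \<forall>x. \<forall>u\<in>borel_measurable borel.
        (\<integral>\<^sup>+\<omega>. (\<integral>\<^sup>+t\<in>{0..}. ennreal (exp (- \<alpha> * t)) * ext0 u (pos X (ennreal t) \<omega>)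
           \<partial>stieltjes A \<omega>) \<partial>law X (Some x)) = green_op (green p \<alpha>) \<mu> u x)"

definition right_inverse :: "(ennreal \<Rightarrow> 'w \<Rightarrow> ennreal) \<Rightarrow> real \<Rightarrow> 'w \<Rightarrow> ennreal" where
  "right_inverse A t \<omega> = Inf {s. A s \<omega> > ennreal t}"

definition time_changed ::
    "('w, 'x) process \<Rightarrow> (ennreal \<Rightarrow> 'w \<Rightarrow> ennreal) \<Rightarrow> real \<Rightarrow> ('x \<Rightarrow> real) \<Rightarrow> 'x \<Rightarrow> real" where
  "time_changed X A t u x =
     (\<integral>\<omega>. ext0 u (pos X (right_inverse A t \<omega>) \<omega>) \<partial>law X (Some x))"


section \<open>Fine topology and fine support\<close>

definition nearly_borel :: "('w, 'x::t2_space) process \<Rightarrow> 'x set \<Rightarrow> bool" where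
  "nearly_borel X B \<longleftrightarrow>
     (\<forall>\<nu>. initial_law \<nu> \<longrightarrow>
        (\<exists>B1\<in>sets borel. \<exists>B2\<in>sets borel. B1 \<subseteq> B \<and> B \<subseteq> B2 \<and>
           negligible_under X \<nu> {\<omega>. \<exists>t. pos X t \<omega> \<in> Some ` (B2 - B1)}))"

definition hitting_time :: "('w, 'x) process \<Rightarrow> 'x set \<Rightarrow> 'w \<Rightarrow> ennreal" where
  "hitting_time X D \<omega> = Inf {t. 0 < t \<and> pos X t \<omega> \<in> Some ` D}"

definition finely_open :: "('w, 'x::t2_space) process \<Rightarrow> 'x set \<Rightarrow> bool" where
  "finely_open X U \<longleftrightarrow>
     (\<forall>x\<in>U. \<exists>D. nearly_borel X D \<and> - U \<subseteq> D \<and> (AE \<omega> in law X (Some x). 0 < hitting_time X D \<omega>))"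

definition finely_closed :: "('w, 'x::t2_space) process \<Rightarrow> 'x set \<Rightarrow> bool" where
  "finely_closed X B \<longleftrightarrow> finely_open X (- B)"

text \<open>Nearly Borel sets are universally measurable; the AE-quantifier says that the complement is
  null for the completion of \<open>\<mu>\<close>.\<close>
definition fine_support :: "('w, 'x::t2_space) process \<Rightarrow> 'x measure \<Rightarrow> 'x set \<Rightarrow> bool" where
  "fine_support X \<mu> B \<longleftrightarrow>
     nearly_borel X B \<and> finely_closed X B \<and> (AE y in \<mu>. y \<in> B) \<and>
     (\<forall>C. nearly_borel X C \<and> finely_closed X C \<and> (AE y in \<mu>. y \<in> C) \<longrightarrow> B \<subseteq> C)"

end

theory Submission
  imports Defs
begin

text \<open>Let \<open>P\<^sup>n\<close> be the time-changed semigroup and \<open>U\<^sup>n f = G\<^sup>\<mu> f\<close>, for \<open>\<mu> = \<mu>\<^sub>n\<close>, its potential operator.  Lower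
  semicontinuity of \<open>G\<close>, applied to \<open>f\<close> and to \<open>c - f\<close>, upgrades the two convergence hypotheses to uniform
  convergence of \<open>U\<^sup>n f\<close> for every bounded continuous \<open>f\<close>.  Since \<open>P\<^sup>n\<^sub>t U\<^sup>n f\<close> is the integral of
  \<open>P\<^sup>n\<^sub>s f\<close> over \<open>s \<ge> t\<close>, it is Lipschitz in \<open>t\<close> uniformly in \<open>n\<close>, and its Laplace transforms in \<open>t\<close> are
  given by the resolvents, which converge along with \<open>U\<^sup>n\<close>; hence \<open>P\<^sup>n\<^sub>t U\<^sup>n f\<close> converges uniformly,
  locally uniformly in \<open>t\<close>.

  It remains to approximate \<open>u\<close> by potentials \<open>U\<^sup>\<infinity> f\<close>, and only uniformly on \<open>F\<close>, because \<open>P\<^sup>n\<^sub>t\<close> is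
  carried by \<open>F\<^sub>n \<subseteq> F\<close>.  At every point of \<open>F\<close> the clock starts at once, so \<open>P\<^sup>\<infinity>\<^sub>t u \<longlongrightarrow> u\<close> pointwise on \<open>F\<close>,
  and a lattice argument makes this uniform.  The regularity of the points of \<open>F\<close> comes from the minimality
  of the fine support: the set of regular points is a countable intersection of \<open>\<sigma>\<close>-compact sets that
  carries \<open>\<mu>\<^sub>\<infinity>\<close>, and it is finely closed by Choquet's capacitability argument and quasi-left-continuity.\<close>

section \<open>Laplace transforms of sub-Markovian flows\<close>

text \<open>The time-changed semigroups are out of reach of the usual convergence theorems for
  semigroups: started off the fine support, \<open>P_t\<close> does not tend to the identity as t
  decreases to 0, and \<open>P_t f\<close> is not known to be continuous for continuous f. A flow is
  therefore handled through the scalars \<open>q t x f\<close>, and its resolvents are built on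
  bounded continuous functions from the potential operator alone. The same defect limits the
  approximation by potentials: averages over short times can recover u only at points where
  \<open>P_t u\<close> returns to u, that is at regular points, so the set carrying all the flows
  must consist of such points. The definition of the fine support does not mention regular points;
  it only speaks of the smallest nearly Borel finely closed carrier. The set of regular points has
  to be produced as a competitor, and its fine closedness concerns hitting times of a set that need
  be neither open nor closed. This is what brings outer measures and capacities into a statement
  about semigroups.\<close>

abbreviation exp_law :: "real measure" where
  "exp_law \<equiv> density lborel (exponential_density 1)"

interpretation exp_law: prob_space exp_law
  by (rule prob_space_exponential_density) simp

lemma sets_exp_law [measurable_cong]: "sets exp_law = sets borel" by simp

lemma AE_exp_law: "(\<And>t. 0 < t \<Longrightarrow> P t) \<Longrightarrow> AE t in exp_law. P t"
proof -
  assume P: "\<And>t. 0 < t \<Longrightarrow> P t"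
  have "AE t in lborel. t \<noteq> (0::real)" by (rule AE_lborel_singleton)
  then have "AE t in lborel. 0 < ennreal (exponential_density 1 t) \<longrightarrow> P t"
    by eventually_elim (auto simp: exponential_density_def P not_less split: if_splits)
  then show ?thesis by (subst AE_density) auto
qed

text \<open>Substitution t = a s. The average over an exponential time of mean 1 / a is a times the
  Laplace transform at a; writing it with \<open>t / a\<close> under \<open>exp_law\<close> keeps
  one probability measure for all rates.\<close>

lemma integral_exp_law_scale:
  fixes h :: "real \<Rightarrow> real"
  assumes [measurable]: "h \<in> borel_measurable borel" and a: "0 < a"
  shows "(\<integral>t. h (t / a) \<partial>exp_law) = a * (\<integral>s. indicator {0..} s * exp (- a * s) * h s \<partial>lborel)"
proof -
  have "(\<integral>t. h (t / a) \<partial>exp_law) = (\<integral>t. exponential_density 1 t * h (t / a) \<partial>lborel)"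
    by (subst integral_density) (auto simp: exponential_density_nonneg)
  also have "\<dots> = a * (\<integral>s. exponential_density 1 (0 + a * s) * h ((0 + a * s) / a) \<partial>lborel)"
    using a by (subst lborel_integral_real_affine[where c=a and t=0]) auto
  also have "(\<lambda>s. exponential_density 1 (0 + a * s) * h ((0 + a * s) / a)) =
      (\<lambda>s. indicator {0..} s * exp (- a * s) * h s)"
    using a by (auto simp: exponential_density_def fun_eq_iff indicator_def mult_less_0_iff)
  finally show ?thesis by simp
qed

lemma measure_exp_law_atMost: "0 \<le> a \<Longrightarrow> measure exp_law {..a} = 1 - exp (- a)"
proof -
  assume a: "0 \<le> a"
  have "emeasure exp_law {..a} = ennreal (1 - exp (- a))"
    using emeasure_erlang_density[of 1 0 a] a by (simp add: erlang_CDF_def)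
  then show ?thesis using a by (simp add: measure_def)
qed

text \<open>The semigroup law enters only as \<open>q_R\<close>, the potential form P_t R = integral
  of P_s over s >= t. The constant \<open>C\<close> is a parameter so that a whole sequence of flows
  can share it.\<close>

locale sub_markov_flow =
  fixes q :: "real \<Rightarrow> 'x::metric_space \<Rightarrow> ('x \<Rightarrow>\<^sub>C real) \<Rightarrow> real"
    and R :: "('x \<Rightarrow>\<^sub>C real) \<Rightarrow> ('x \<Rightarrow>\<^sub>C real)" and C :: real
  assumes q_add: "q t x (f + g) = q t x f + q t x g"
    and q_scale: "q t x (c *\<^sub>R f) = c * q t x f"
    and q_nonneg: "(\<And>y. 0 \<le> f y) \<Longrightarrow> 0 \<le> q t x f"
    and q_bound: "\<bar>q t x f\<bar> \<le> norm f"
    and q_measurable [measurable]: "(\<lambda>t. q t x f) \<in> borel_measurable borel"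
    and q_integrable: "set_integrable lborel {0..} (\<lambda>t. q t x f)"
    and R_eq: "R f x = (LBINT t:{0..}. q t x f)"
    and q_R: "0 \<le> t \<Longrightarrow> q t x (R f) = (LBINT s:{t..}. q s x f)"
    and R_bound: "norm (R f) \<le> C * norm f"
begin

lemma q_diff: "q t x (f - g) = q t x f - q t x g"
  using q_add[of t x f "(-1) *\<^sub>R g"] q_scale[of t x "-1" g] by simp

lemma R_add: "R (f + g) = R f + R g"
  by (rule bcontfun_eqI) (simp add: R_eq q_add set_integral_add q_integrable)

lemma R_scale: "R (c *\<^sub>R f) = c *\<^sub>R R f"
  by (rule bcontfun_eqI) (simp add: R_eq q_scale)

lemma R_diff: "R (f - g) = R f - R g"
  using R_add[of f "(-1) *\<^sub>R g"] R_scale[of "-1" g] by simp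

lemma R_nonneg:
  fixes f :: "'x \<Rightarrow>\<^sub>C real"
  shows "(\<And>y. 0 \<le> f y) \<Longrightarrow> 0 \<le> R f x"
  unfolding R_eq set_lebesgue_integral_def by (intro integral_nonneg_AE AE_I2) (auto simp: q_nonneg)

lemma C_nonneg: "0 \<le> C"
proof -
  have "norm (R (const_bcontfun 1)) \<le> C * norm (const_bcontfun 1 :: 'x \<Rightarrow>\<^sub>C real)" by (rule R_bound)
  moreover have "1 \<le> norm (const_bcontfun 1 :: 'x \<Rightarrow>\<^sub>C real)"
    using norm_bounded[of "const_bcontfun 1 :: 'x \<Rightarrow>\<^sub>C real" undefined] by simp
  ultimately show ?thesis
    by (smt (verit) mult_neg_pos norm_ge_zero)
qed

text \<open>This is a times the resolvent at rate a, a normalisation that makes it sub-Markovian for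
  every a.\<close>

definition lap :: "real \<Rightarrow> 'x \<Rightarrow> ('x \<Rightarrow>\<^sub>C real) \<Rightarrow> real" where
  "lap a x f = (\<integral>t. q (t / a) x f \<partial>exp_law)"

lemma integrable_q: "integrable exp_law (\<lambda>t. q (t / a) x f)"
  by (rule exp_law.integrable_const_bound[where B="norm f"]) (auto simp: q_bound)

lemma lap_add: "lap a x (f + g) = lap a x f + lap a x g"
  unfolding lap_def q_add by (rule Bochner_Integration.integral_add[OF integrable_q integrable_q])

lemma lap_scale: "lap a x (c *\<^sub>R f) = c * lap a x f"
  unfolding lap_def q_scale by simp

lemma lap_diff: "lap a x (f - g) = lap a x f - lap a x g"
  unfolding lap_def q_diff by (rule Bochner_Integration.integral_diff[OF integrable_q integrable_q])

lemma lap_nonneg: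
  fixes f :: "'x \<Rightarrow>\<^sub>C real"
  shows "(\<And>y. 0 \<le> f y) \<Longrightarrow> 0 \<le> lap a x f"
  unfolding lap_def by (intro integral_nonneg_AE AE_I2 q_nonneg)

lemma lap_bound: "\<bar>lap a x f\<bar> \<le> norm f"
proof -
  have "\<bar>lap a x f\<bar> \<le> (\<integral>t. \<bar>q (t / a) x f\<bar> \<partial>exp_law)"
    unfolding lap_def by (rule integral_abs_bound)
  also have "\<dots> \<le> (\<integral>t. norm f \<partial>exp_law)"
    by (intro integral_mono integrable_abs integrable_q) (auto simp: q_bound)
  finally show ?thesis by (simp add: exp_law.prob_space[simplified])
qed

text \<open>The resolvent equation between the rates 0 and a. By \<open>q_R\<close> the left side is
  a double integral over t <= a s; exchanging the order leaves the weight 1 - exp (- a s), the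
  exponential probability of t <= a s.\<close>

lemma lap_R:
  assumes a: "0 < a"
  shows "lap a x (R f) = R f x - lap a x f / a"
proof -
  let ?k = "\<lambda>t s. indicator {0..} s * indicator {..a * s} t * q s x f :: real"
  interpret P: pair_sigma_finite exp_law lborel ..
  have m [measurable]: "Measurable.pred (exp_law \<Otimes>\<^sub>M lborel) (\<lambda>z. fst z \<le> a * snd z)"
    by measurable
  have [measurable]: "case_prod ?k \<in> borel_measurable (exp_law \<Otimes>\<^sub>M lborel)"
    unfolding case_prod_beta indicator_def atMost_iff by measurable
  have i0: "integrable lborel (\<lambda>s. indicator {0..} s * q s x f)"
    using q_integrable[of x f] by (simp add: set_integrable_def)
  have [measurable]: "(\<lambda>(s, t). ?k t s) \<in> borel_measurable (lborel \<Otimes>\<^sub>M exp_law)"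
    unfolding case_prod_beta indicator_def atMost_iff by measurable
  have k1: "(\<integral>t. ?k t s \<partial>exp_law) = indicator {0..} s * q s x f - indicator {0..} s * exp (- a * s) * q s x f" for s
  proof (cases "0 \<le> s")
    case True
    have "(\<integral>t. ?k t s \<partial>exp_law) = measure exp_law {..a * s} * q s x f"
      using True by (simp add: exp_law.emeasure_finite[simplified])
    also have "\<dots> = (1 - exp (- (a * s))) * q s x f"
      using True a measure_exp_law_atMost[of "a * s"] by simp
    finally show ?thesis using True by (simp add: algebra_simps)
  qed simp
  have int: "integrable (lborel \<Otimes>\<^sub>M exp_law) (\<lambda>(s, t). ?k t s)"
  proof (rule pair_sigma_finite.Fubini_integrable)
    show "pair_sigma_finite lborel exp_law" ..
    have "(\<integral>t. norm (?k t s) \<partial>exp_law) \<le> \<bar>indicator {0..} s * q s x f\<bar>" for s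
    proof -
      have "(\<integral>t. norm (?k t s) \<partial>exp_law) = indicator {0..} s * \<bar>q s x f\<bar> * measure exp_law {..a * s}"
        by (simp add: abs_mult mult.commute mult.left_commute)
      also have "\<dots> \<le> indicator {0..} s * \<bar>q s x f\<bar> * 1"
        by (intro mult_left_mono exp_law.prob_le_1) auto
      finally show ?thesis by (simp add: abs_mult)
    qed
    then show "integrable lborel (\<lambda>s. \<integral>t. norm (case (s, t) of (s, t) \<Rightarrow> ?k t s) \<partial>exp_law)"
      by (intro Bochner_Integration.integrable_bound[OF i0]) auto
    show "AE s in lborel. integrable exp_law (\<lambda>t. case (s, t) of (s, t) \<Rightarrow> ?k t s)"
      by (intro AE_I2) (auto intro!: integrable_real_mult_indicator simp: mult.assoc exp_law.emeasure_finite[simplified] less_top[symmetric])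
  qed measurable
  have e: "integrable lborel (\<lambda>s. indicator {0..} s * exp (- a * s) * q s x f)"
  proof (rule Bochner_Integration.integrable_bound[OF i0])
    show "AE s in lborel. norm (indicator {0..} s * exp (- a * s) * q s x f) \<le> norm (indicator {0..} s * q s x f)"
      using a by (intro AE_I2) (auto simp: abs_mult indicator_def mult_left_le_one_le)
  qed measurable
  have "lap a x (R f) = (\<integral>t. (\<integral>s. ?k t s \<partial>lborel) \<partial>exp_law)"
    unfolding lap_def
  proof (rule integral_cong_AE)
    show "AE t in exp_law. q (t / a) x (R f) = (\<integral>s. ?k t s \<partial>lborel)"
    proof (rule AE_exp_law)
      fix t :: real assume t: "0 < t"
      have "q (t / a) x (R f) = (LBINT s:{t / a..}. q s x f)"
        using t a by (intro q_R) simp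
      also have "\<dots> = (\<integral>s. ?k t s \<partial>lborel)"
        unfolding set_lebesgue_integral_def
      proof (rule Bochner_Integration.integral_cong[OF refl])
        fix s
        have "s \<in> {t / a..} \<longleftrightarrow> s \<in> {0..} \<and> t \<in> {..a * s}"
          using t a by (auto simp: pos_divide_le_eq mult.commute intro: order_trans[of 0 "t / a"])
        then show "indicator {t / a..} s *\<^sub>R q s x f = ?k t s" by (simp add: indicator_def)
      qed
      finally show "q (t / a) x (R f) = (\<integral>s. ?k t s \<partial>lborel)" .
    qed
  qed measurable
  also have "\<dots> = (\<integral>s. (\<integral>t. ?k t s \<partial>exp_law) \<partial>lborel)"
    using pair_sigma_finite.Fubini_integral[OF _ int] by (simp add: pair_sigma_finite_def lborel.sigma_finite_measure_axioms exp_law.sigma_finite_measure_axioms)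
  also have "\<dots> = (\<integral>s. indicator {0..} s * q s x f \<partial>lborel) - (\<integral>s. indicator {0..} s * exp (- a * s) * q s x f \<partial>lborel)"
    unfolding k1 by (rule Bochner_Integration.integral_diff[OF i0 e])
  also have "(\<integral>s. indicator {0..} s * q s x f \<partial>lborel) = R f x"
    by (simp add: R_eq set_lebesgue_integral_def)
  also have "(\<integral>s. indicator {0..} s * exp (- a * s) * q s x f \<partial>lborel) = lap a x f / a"
    unfolding lap_def using a by (subst integral_exp_law_scale) auto
  finally show ?thesis .
qed

text \<open>By \<open>lap_R\<close>, the sum of \<open>lap a h\<close> and a times
  \<open>lap a (R h)\<close> collapses to a R h. So \<open>lap a f\<close> is itself a potential
  once I + a R is inverted at f.\<close>

lemma lap_resolvent:
  assumes "0 < a" "h + a *\<^sub>R R h = f"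
  shows "lap a x f = a * R h x"
  unfolding assms(2)[symmetric] lap_add lap_scale lap_R[OF assms(1)] using assms(1) by (simp add: field_simps)

text \<open>Here h = f - a R h, and by \<open>lap_resolvent\<close> the subtracted term is the
  sub-Markovian average \<open>lap a f\<close>. Both terms are bounded by norm f, whatever a
  is.\<close>

lemma resolvent_bound:
  assumes "0 \<le> a" "h + a *\<^sub>R R h = f"
  shows "norm h \<le> 2 * norm f"
proof (rule norm_bound)
  fix x
  have eq: "h x = f x - a * R h x" unfolding assms(2)[symmetric] by simp
  have "\<bar>a * R h x\<bar> \<le> norm f"
  proof (cases "a = 0")
    case False
    then show ?thesis using lap_resolvent[of a h f x] assms lap_bound[of a x f] by simp
  qed simp
  moreover have "\<bar>f x\<bar> \<le> norm f" using norm_bounded[of f x] by simp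
  ultimately show "norm (h x) \<le> 2 * norm f" unfolding eq by simp
qed

text \<open>Method of continuity: the a priori bound \<open>resolvent_bound\<close> does not depend on \<open>a\<close>, so
  solvability propagates in steps of fixed length.\<close>
lemma resolvent_ex:
  assumes "0 \<le> a"
  shows "\<exists>h. h + a *\<^sub>R R h = f"
proof -
  \<comment> \<open>Moving the parameter by at most d makes the fixed point map below a contraction
    with factor 2 d C <= 1 / 2. The 2 is the constant of \<open>resolvent_bound\<close>; the + 1
    covers C = 0.\<close>
  define d where "d = 1 / (4 * (C + 1))"
  have d: "0 < d" "2 * d * C \<le> 1 / 2" using C_nonneg by (auto simp: d_def field_simps)
  have step: "\<forall>f. \<exists>h. h + b *\<^sub>R R h = f"
    if a: "0 \<le> a" "a \<le> b" "b \<le> a + d" and ex: "\<forall>f. \<exists>h. h + a *\<^sub>R R h = f" for a b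
  proof
    fix f
    obtain J where J: "\<And>f. J f + a *\<^sub>R R (J f) = f" using ex by metis
    have J_dist: "norm (J f - J g) \<le> 2 * norm (f - g)" for f g
      by (rule resolvent_bound[OF a(1)])
        (use J[of f] J[of g] in \<open>simp add: R_diff scaleR_diff_right algebra_simps\<close>)
    \<comment> \<open>The equation h + b R h = f is read as h + a R h = f - (b - a) R h, whose left
      side is inverted by J.\<close>
    let ?\<Phi> = "\<lambda>h. J (f - (b - a) *\<^sub>R R h)"
    have "dist (?\<Phi> h) (?\<Phi> h') \<le> (1 / 2) * dist h h'" for h h'
    proof -
      have "dist (?\<Phi> h) (?\<Phi> h') \<le> 2 * norm ((f - (b - a) *\<^sub>R R h) - (f - (b - a) *\<^sub>R R h'))"
        unfolding dist_norm by (rule J_dist)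
      also have "(f - (b - a) *\<^sub>R R h) - (f - (b - a) *\<^sub>R R h') = (b - a) *\<^sub>R R (h' - h)"
        by (simp add: R_diff scaleR_diff_right)
      also have "norm \<dots> \<le> d * (C * norm (h' - h))"
        unfolding norm_scaleR using a d R_bound by (intro mult_mono) auto
      also have "2 * (d * (C * norm (h' - h))) = (2 * d * C) * norm (h' - h)" by simp
      also have "\<dots> \<le> (1 / 2) * norm (h' - h)" using d(2) by (rule mult_right_mono) simp
      finally show ?thesis by (simp add: dist_norm norm_minus_commute)
    qed
    then obtain h where h: "?\<Phi> h = h"
      using banach_fix_type[of "1/2" ?\<Phi>] by auto
    have "h + a *\<^sub>R R h = f - (b - a) *\<^sub>R R h"
      using J[of "f - (b - a) *\<^sub>R R h"] unfolding h .
    then have "h + b *\<^sub>R R h = f" by (simp add: scaleR_diff_left algebra_simps)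
    then show "\<exists>h. h + b *\<^sub>R R h = f" ..
  qed
  have all: "\<forall>f. \<exists>h. h + a *\<^sub>R R h = f" if "0 \<le> a" "a \<le> real n * d" for n a
    using that
  proof (induction n arbitrary: a)
    case 0
    then show ?case by auto
  next
    case (Suc n)
    show ?case
    proof (cases "a \<le> real n * d")
      case True then show ?thesis using Suc by blast
    next
      case False
      have ex: "\<forall>f. \<exists>h. h + (real n * d) *\<^sub>R R h = f" using Suc.IH[of "real n * d"] d by simp
      show ?thesis
        by (rule step[OF _ _ _ ex]) (use False Suc.prems d in \<open>auto simp: algebra_simps\<close>)
    qed
  qed
  obtain n where "a / d \<le> real n" using real_arch_simple by blast
  then show ?thesis using all[of a n] assms d by (simp add: field_simps)
qed

end

section \<open>Uniform convergence from convergence of potentials\<close>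

lemma integrable_exp_law_mult:
  fixes f g :: "real \<Rightarrow> real"
  assumes [measurable]: "f \<in> borel_measurable borel" "g \<in> borel_measurable borel"
    and f: "\<And>t. 0 < t \<Longrightarrow> \<bar>f t\<bar> \<le> A" and g: "\<And>t. \<bar>g t\<bar> \<le> B"
  shows "integrable exp_law (\<lambda>t. f t * g t)"
proof (rule exp_law.integrable_const_bound[where B="A * B"])
  show "AE t in exp_law. norm (f t * g t) \<le> A * B"
    by (rule AE_exp_law) (use f g in \<open>auto simp: abs_mult intro!: mult_mono intro: order_trans[OF abs_ge_zero]\<close>)
qed simp

lemma uniform_limit_sum_finite:
  fixes f :: "'i \<Rightarrow> 'a \<Rightarrow> 'b \<Rightarrow> 'c::real_normed_vector"
  assumes "finite I" and "\<And>i. i \<in> I \<Longrightarrow> uniform_limit X (f i) (l i) F"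
  shows "uniform_limit X (\<lambda>n x. \<Sum>i\<in>I. f i n x) (\<lambda>x. \<Sum>i\<in>I. l i x) F"
  using assms by (induction I rule: finite_induct) (auto intro!: uniform_limit_add uniform_limit_const)

text \<open>The functions \<open>exp (- k t)\<close> span a dense set by Weierstrass' theorem, so small Laplace transforms
  give small averages against bumps, and the Lipschitz bound turns averages into point values.\<close>
lemma laplace_uniform_null:
  fixes D :: "nat \<Rightarrow> real \<Rightarrow> 'x \<Rightarrow> real"
  assumes [measurable]: "\<And>n x. (\<lambda>t. D n t x) \<in> borel_measurable borel"
    and bound: "\<And>n t x. \<bar>D n t x\<bar> \<le> B"
    and lipschitz: "\<And>n s t x. 0 \<le> s \<Longrightarrow> 0 \<le> t \<Longrightarrow> \<bar>D n s x - D n t x\<bar> \<le> L * \<bar>s - t\<bar>"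
    and lap: "\<And>k::nat. uniform_limit UNIV (\<lambda>n x. \<integral>t. D n (t / real (Suc k)) x \<partial>exp_law) (\<lambda>_. 0) sequentially"
    and e: "0 < e"
  shows "\<forall>\<^sub>F n in sequentially. \<forall>x. \<forall>t\<in>{0..T}. \<bar>D n t x\<bar> < e"
proof -
  let ?I = "\<lambda>\<psi> n x. \<integral>t. \<psi> (exp (- t)) * D n t x \<partial>exp_law"
  have B: "0 \<le> B" using bound[of undefined undefined undefined] by simp
  have L: "0 \<le> L" using lipschitz[of 0 1 0 undefined] by simp
  have int: "integrable exp_law (\<lambda>t. \<psi> (exp (- t)) * D n t x)"
    if [measurable]: "\<psi> \<in> borel_measurable borel" and "\<And>y. 0 < y \<Longrightarrow> y < 1 \<Longrightarrow> \<bar>\<psi> y\<bar> \<le> A" for \<psi> :: "real \<Rightarrow> real" and A n x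
    by (rule integrable_exp_law_mult[where A=A and B=B]) (use that bound in auto)
  \<comment> \<open>The monomials have the Bernstein form, so that Bernstein polynomials can be
    treated term by term. The induction on m uses y^k (1 - y)^(m + 1) = y^k (1 - y)^m - y^(k + 1) (1
    - y)^m.\<close>
  have pow: "uniform_limit UNIV (?I (\<lambda>y. y ^ k * (1 - y) ^ m)) (\<lambda>_. 0) sequentially" for k m
  proof (induction m arbitrary: k)
    case 0
    \<comment> \<open>The exponential density supplies one more factor exp (- t), so y^k corresponds
      to the Laplace transform at rate k + 1.\<close>
    have "?I (\<lambda>y. y ^ k * (1 - y) ^ 0) n x = (1 / real (Suc k)) * (\<integral>t. D n (t / real (Suc k)) x \<partial>exp_law)" for n x
    proof -
      have "?I (\<lambda>y. y ^ k * (1 - y) ^ 0) n x = (\<integral>t. exponential_density 1 t * (exp (- t) ^ k * D n t x) \<partial>lborel)"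
        by (subst integral_density) (auto simp: exponential_density_nonneg)
      also have "\<dots> = (\<integral>s. indicator {0..} s * exp (- real (Suc k) * s) * D n s x \<partial>lborel)"
        by (rule Bochner_Integration.integral_cong)
          (auto simp: exponential_density_def indicator_def exp_of_nat_mult[symmetric] exp_add[symmetric] algebra_simps simp flip: exp_of_nat_mult)
      also have "\<dots> = (1 / real (Suc k)) * (\<integral>t. D n (t / real (Suc k)) x \<partial>exp_law)"
        by (subst integral_exp_law_scale) auto
      finally show ?thesis .
    qed
    then show ?case
      using bounded_linear.uniform_limit[OF bounded_linear_mult_right lap[of k], of "1 / real (Suc k)"] by simp
  next
    case (Suc m)
    have "?I (\<lambda>y. y ^ k * (1 - y) ^ Suc m) n x
        = ?I (\<lambda>y. y ^ k * (1 - y) ^ m) n x - ?I (\<lambda>y. y ^ Suc k * (1 - y) ^ m) n x" for n x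
    proof -
      have i: "integrable exp_law (\<lambda>t. exp (- t) ^ j * (1 - exp (- t)) ^ m * D n t x)" for j
        by (rule int[where A=1 and \<psi>="\<lambda>y. y ^ j * (1 - y) ^ m"])
          (auto simp: abs_mult power_abs mult_le_one power_le_one)
      show ?thesis
        unfolding Bochner_Integration.integral_diff[OF i i, symmetric]
        by (intro Bochner_Integration.integral_cong) (auto simp: algebra_simps)
    qed
    then show ?case using uniform_limit_minus[OF Suc.IH[of k] Suc.IH[of "Suc k"]] by simp
  qed
  have cont: "uniform_limit UNIV (?I \<psi>) (\<lambda>_. 0) sequentially"
    if \<psi>: "continuous_on UNIV \<psi>" for \<psi> :: "real \<Rightarrow> real"
  proof (rule uniform_limitI)
    fix e :: real assume e: "0 < e"
    \<comment> \<open>Replacing \<psi> by a polynomial within d changes the average by at most d B,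
      because D is bounded by B and \<open>exp_law\<close> is a probability measure.\<close>
    define d where "d = e / (2 * (B + 1))"
    have d: "0 < d" "d * B < e / 2" using e B by (auto simp: d_def field_simps)
    have [measurable]: "\<psi> \<in> borel_measurable borel" using \<psi> by (rule borel_measurable_continuous_onI)
    obtain N where N: "\<And>y. y \<in> {0..1} \<Longrightarrow> \<bar>\<psi> y - (\<Sum>k\<le>N. \<psi> (k / N) * Bernstein N k y)\<bar> < d"
      using Bernstein_Weierstrass[of \<psi> d] \<psi> d continuous_on_subset[OF \<psi>] by auto
    define P where "P y = (\<Sum>k\<le>N. \<psi> (k / N) * Bernstein N k y)" for y
    have [measurable]: "P \<in> borel_measurable borel"
      unfolding P_def Bernstein_def by measurable
    have "bounded (\<psi> ` {0..1})"
      by (intro compact_imp_bounded compact_continuous_image continuous_on_subset[OF \<psi>]) auto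
    then obtain M where M: "\<And>y. y \<in> {0..1} \<Longrightarrow> \<bar>\<psi> y\<bar> \<le> M"
      unfolding bounded_iff by (metis imageI real_norm_def)
    have intP: "integrable exp_law (\<lambda>t. P (exp (- t)) * D n t x)" for n x
    proof (rule int[where A="M + d"])
      fix y :: real assume "0 < y" "y < 1"
      then show "\<bar>P y\<bar> \<le> M + d" using N[of y] M[of y] by (auto simp: P_def)
    qed simp
    have int\<psi>: "integrable exp_law (\<lambda>t. \<psi> (exp (- t)) * D n t x)" for n x
      by (rule int[where A=M]) (use M in auto)
    have "?I P n x = (\<Sum>k\<le>N. \<psi> (k / N) * real (N choose k) * ?I (\<lambda>y. y ^ k * (1 - y) ^ (N - k)) n x)" for n x
    proof -
      have "?I P n x = (\<integral>t. (\<Sum>k\<le>N. \<psi> (k / N) * real (N choose k) * (exp (- t) ^ k * (1 - exp (- t)) ^ (N - k) * D n t x)) \<partial>exp_law)"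
        by (intro Bochner_Integration.integral_cong) (simp_all add: P_def Bernstein_def sum_distrib_right sum_distrib_left mult_ac)
      also have "\<dots> = (\<Sum>k\<le>N. (\<integral>t. \<psi> (k / N) * real (N choose k) * (exp (- t) ^ k * (1 - exp (- t)) ^ (N - k) * D n t x) \<partial>exp_law))"
        by (intro Bochner_Integration.integral_sum integrable_mult_right int[where A=1 and \<psi>="\<lambda>y. y ^ k * (1 - y) ^ (N - k)" for k, simplified])
          (auto simp: abs_mult power_abs mult_le_one power_le_one)
      finally show ?thesis by simp
    qed
    moreover have "uniform_limit UNIV (\<lambda>n x. \<Sum>k\<le>N. \<psi> (k / N) * real (N choose k) * ?I (\<lambda>y. y ^ k * (1 - y) ^ (N - k)) n x)
        (\<lambda>x. \<Sum>k\<le>N. \<psi> (k / N) * real (N choose k) * 0) sequentially"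
      by (intro uniform_limit_sum_finite bounded_linear.uniform_limit[OF bounded_linear_mult_right] pow) simp
    ultimately have "uniform_limit UNIV (?I P) (\<lambda>_. 0) sequentially" by simp
    then have "\<forall>\<^sub>F n in sequentially. \<forall>x\<in>UNIV. dist (?I P n x) 0 < e / 2"
      using e by (intro uniform_limitD) auto
    then show "\<forall>\<^sub>F n in sequentially. \<forall>x\<in>UNIV. dist (?I \<psi> n x) 0 < e"
    proof eventually_elim
      case (elim n)
      show ?case
      proof
        fix x
        have "\<bar>?I \<psi> n x - ?I P n x\<bar> = \<bar>\<integral>t. \<psi> (exp (- t)) * D n t x - P (exp (- t)) * D n t x \<partial>exp_law\<bar>"
          by (subst Bochner_Integration.integral_diff[OF int\<psi> intP]) simp
        also have "\<dots> \<le> (\<integral>t. \<bar>\<psi> (exp (- t)) * D n t x - P (exp (- t)) * D n t x\<bar> \<partial>exp_law)"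
          by (rule integral_abs_bound)
        also have "\<dots> \<le> (\<integral>t. d * B \<partial>exp_law)"
        proof (rule integral_mono_AE)
          show "AE t in exp_law. \<bar>\<psi> (exp (- t)) * D n t x - P (exp (- t)) * D n t x\<bar> \<le> d * B"
          proof (rule AE_exp_law)
            fix t :: real assume "0 < t"
            then have "\<bar>\<psi> (exp (- t)) - P (exp (- t))\<bar> * \<bar>D n t x\<bar> \<le> d * B"
              using N[of "exp (- t)"] bound d by (intro mult_mono) (auto simp: P_def)
            then show "\<bar>\<psi> (exp (- t)) * D n t x - P (exp (- t)) * D n t x\<bar> \<le> d * B"
              by (simp add: abs_mult[symmetric] left_diff_distrib)
          qed
        qed (auto intro!: integrable_abs Bochner_Integration.integrable_diff int\<psi> intP)
        also have "\<dots> < e / 2" using d by (simp add: exp_law.prob_space[simplified])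
        finally show "dist (?I \<psi> n x) 0 < e" using bspec[OF elim UNIV_I, of x] unfolding dist_real_def diff_0_right by arith
      qed
    qed
  qed
  have point: "\<forall>\<^sub>F n in sequentially. \<forall>x. \<bar>D n s x\<bar> < e" if s: "0 \<le> s" and e: "0 < e" for s e
  proof -
    define d where "d = e / (2 * (L + 1))"
    have d: "0 < d" "L * d < e / 2" using e L by (auto simp: d_def field_simps)
    \<comment> \<open>Seen through y = exp (- t) this is a bump that is positive exactly for s < t <
      s + d; written in y it is a continuous function, to which \<open>cont\<close> applies.\<close>
    define \<psi> where "\<psi> y = max 0 (min (exp (- s) - y) (y - exp (- (s + d))))" for y :: real
    have \<psi>_cont: "continuous_on UNIV \<psi>" unfolding \<psi>_def by (intro continuous_intros)
    then have [measurable]: "\<psi> \<in> borel_measurable borel" by (rule borel_measurable_continuous_onI)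
    have \<psi>_pos: "0 < \<psi> (exp (- t)) \<longleftrightarrow> s < t \<and> t < s + d" for t
      unfolding \<psi>_def less_max_iff_disj min_less_iff_conj diff_gt_0_iff_gt exp_less_cancel_iff by auto
    have \<psi>_nn: "0 \<le> \<psi> y" for y by (simp add: \<psi>_def)
    have \<psi>_le: "0 < y \<Longrightarrow> \<bar>\<psi> y\<bar> \<le> 1" for y using s d by (auto simp: \<psi>_def intro: order_trans[of _ "exp (- s)"])
    have \<psi>_int: "integrable exp_law (\<lambda>t. \<psi> (exp (- t)))"
      by (rule exp_law.integrable_const_bound[where B=1]) (auto intro!: AE_I2 \<psi>_le)
    have \<psi>D_int: "integrable exp_law (\<lambda>t. \<psi> (exp (- t)) * D n t x)" for n x
      by (rule int[where A=1]) (simp_all add: \<psi>_le)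
    define c where "c = (\<integral>t. \<psi> (exp (- t)) \<partial>exp_law)"
    \<comment> \<open>Positivity of the mass of the bump is enough, without a quantitative bound: s
      and d are fixed before n tends to infinity.\<close>
    have "c \<noteq> 0"
    proof
      assume "c = 0"
      then have "AE t in exp_law. \<psi> (exp (- t)) = 0"
        unfolding c_def by (subst (asm) integral_nonneg_eq_0_iff_AE[OF \<psi>_int]) (auto simp: \<psi>_nn)
      then have "AE t in lborel. 0 < ennreal (exponential_density 1 t) \<longrightarrow> \<psi> (exp (- t)) = 0"
        by (subst (asm) AE_density) auto
      then have "AE t in lborel. t \<notin> {s<..<s + d}"
      proof eventually_elim
        case (elim t)
        then show ?case using \<psi>_pos[of t] s by (auto simp: exponential_density_def)
      qed
      then have "emeasure lborel {s<..<s + d} = 0"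
        by (subst (asm) AE_iff_measurable[of "{s<..<s + d}"]) auto
      then show False using d by simp
    qed
    moreover have "0 \<le> c" unfolding c_def by (intro integral_nonneg_AE AE_I2 \<psi>_nn)
    ultimately have c: "0 < c" by simp
    have "\<forall>\<^sub>F n in sequentially. \<forall>x\<in>UNIV. dist (?I \<psi> n x) 0 < c * (e / 2)"
      using cont[OF \<psi>_cont] c e by (intro uniform_limitD) auto
    then show ?thesis
    proof eventually_elim
      case (elim n)
      show ?case
      proof
        fix x
        have "\<bar>c * D n s x - ?I \<psi> n x\<bar> = \<bar>\<integral>t. \<psi> (exp (- t)) * D n s x - \<psi> (exp (- t)) * D n t x \<partial>exp_law\<bar>"
          unfolding c_def using \<psi>_int \<psi>D_int by (subst Bochner_Integration.integral_diff) auto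
        also have "\<dots> \<le> (\<integral>t. \<bar>\<psi> (exp (- t)) * D n s x - \<psi> (exp (- t)) * D n t x\<bar> \<partial>exp_law)"
          by (rule integral_abs_bound)
        also have "\<dots> \<le> (\<integral>t. \<psi> (exp (- t)) * (L * d) \<partial>exp_law)"
        proof (rule integral_mono)
          fix t
          show "\<bar>\<psi> (exp (- t)) * D n s x - \<psi> (exp (- t)) * D n t x\<bar> \<le> \<psi> (exp (- t)) * (L * d)"
          proof (cases "s < t \<and> t < s + d")
            case True
            have "\<bar>D n s x - D n t x\<bar> \<le> L * \<bar>s - t\<bar>" using True s by (intro lipschitz) auto
            also have "\<dots> \<le> L * d" using True L by (intro mult_left_mono) auto
            finally show ?thesis
              using \<psi>_nn[of "exp (- t)"] by (simp add: right_diff_distrib[symmetric] abs_mult mult_left_mono)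
          next
            case False
            then have "\<psi> (exp (- t)) = 0" using \<psi>_pos[of t] \<psi>_nn[of "exp (- t)"] by linarith
            then show ?thesis by simp
          qed
        qed (use \<psi>_int \<psi>D_int in auto)
        also have "\<dots> = c * (L * d)" unfolding c_def by simp
        also have "\<dots> < c * (e / 2)" using c d by simp
        finally have "\<bar>c * D n s x\<bar> < c * e"
          using bspec[OF elim UNIV_I, of x] unfolding dist_real_def diff_0_right by arith
        then show "\<bar>D n s x\<bar> < e" using c by (simp add: abs_mult)
      qed
    qed
  qed
  \<comment> \<open>The estimate at the finitely many grid points i d costs e / 2, and the Lipschitz
    bound between grid points costs another e / 2.\<close>
  define d where "d = e / (2 * (L + 1))"
  have d: "0 < d" "L * d < e / 2" using e L by (auto simp: d_def field_simps)
  obtain N where N: "T / d \<le> real N" using real_arch_simple by blast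
  have "\<forall>\<^sub>F n in sequentially. \<forall>i\<in>{..N}. \<forall>x. \<bar>D n (real i * d) x\<bar> < e / 2"
    by (intro eventually_ball_finite ballI point) (use d e in auto)
  then show ?thesis
  proof eventually_elim
    case (elim n)
    show ?case
    proof (intro allI ballI)
      fix x t assume t: "t \<in> {0..T}"
      define i where "i = nat \<lfloor>t / d\<rfloor>"
      have i: "real i \<le> t / d" "t / d < real i + 1"
        using t d by (auto simp: i_def)
      have "t / d \<le> T / d" using t d by (simp add: divide_right_mono)
      then have "real i \<le> real N" using i N by linarith
      then have "\<bar>D n (real i * d) x\<bar> < e / 2" using elim by simp
      moreover have "\<bar>D n t x - D n (real i * d) x\<bar> \<le> L * \<bar>t - real i * d\<bar>"
        using t d by (intro lipschitz) auto
      moreover have "L * \<bar>t - real i * d\<bar> \<le> L * d"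
        using i d L by (intro mult_left_mono) (auto simp: field_simps)
      ultimately show "\<bar>D n t x\<bar> < e" using d(2) by linarith
    qed
  qed
qed

context sub_markov_flow begin

text \<open>The difference is the integral of \<open>q r x f\<close> over the interval between the
  two times. The constant norm f does not depend on the flow, hence is uniform along a sequence of
  flows.\<close>

lemma q_R_lipschitz:
  assumes "0 \<le> s" "0 \<le> t"
  shows "\<bar>q s x (R f) - q t x (R f)\<bar> \<le> norm f * \<bar>s - t\<bar>"
proof -
  have *: "\<bar>q s x (R f) - q t x (R f)\<bar> \<le> norm f * (t - s)" if "0 \<le> s" "s \<le> t" for s t :: real
  proof -
    have i: "set_integrable lborel A (\<lambda>r. q r x f)" if "A \<subseteq> {0..}" "A \<in> sets borel" for A
      by (rule set_integrable_subset[OF q_integrable]) (use that in auto)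
    have "q s x (R f) = (LBINT r:{s..<t} \<union> {t..}. q r x f)"
      using that by (subst q_R) (auto simp: ivl_disj_un)
    also have "\<dots> = (LBINT r:{s..<t}. q r x f) + q t x (R f)"
      using that by (subst set_integral_Un) (auto intro!: i simp: q_R)
    finally have "\<bar>q s x (R f) - q t x (R f)\<bar> = \<bar>LBINT r:{s..<t}. q r x f\<bar>" by simp
    also have "\<dots> \<le> (\<integral>r. \<bar>indicator {s..<t} r *\<^sub>R q r x f\<bar> \<partial>lborel)"
      unfolding set_lebesgue_integral_def by (rule integral_abs_bound)
    also have "\<dots> \<le> (\<integral>r. indicator {s..<t} r *\<^sub>R norm f \<partial>lborel)"
    proof (intro integral_mono integrable_abs)
      have "{s..<t} \<subseteq> {0..}" using that by auto
      then show "integrable lborel (\<lambda>r. indicator {s..<t} r *\<^sub>R q r x f)"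
        using i[of "{s..<t}"] by (simp add: set_integrable_def)
      show "integrable lborel (\<lambda>r. indicator {s..<t} r *\<^sub>R norm f)"
        using that by (intro integrable_scaleR_left impI integrable_real_indicator) auto
    qed (auto simp: abs_mult q_bound mult_left_mono)
    also have "\<dots> = norm f * (t - s)" using that by simp
    finally show ?thesis .
  qed
  show ?thesis
  proof (cases "s \<le> t")
    case True then show ?thesis using *[of s t] assms by simp
  next
    case False then show ?thesis using *[of t s] assms by (simp add: abs_minus_commute)
  qed
qed

end

text \<open>The resolvent equation is solved for the limit flow only. Its solution h almost solves
  the equation of flow n, because R n h is close to R0 h; so convergence of the potentials of the
  two functions g and h controls the Laplace transform at the given rate.\<close>

lemma sub_markov_flow_converges:
  fixes q :: "nat \<Rightarrow> real \<Rightarrow> 'x::metric_space \<Rightarrow> ('x \<Rightarrow>\<^sub>C real) \<Rightarrow> real"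
  assumes n: "\<And>n. sub_markov_flow (q n) (R n) C" and lim: "sub_markov_flow q0 R0 C"
    and conv: "\<And>f. (\<lambda>n. R n f) \<longlonglongrightarrow> R0 f" and e: "0 < e"
  shows "\<forall>\<^sub>F n in sequentially. \<forall>x. \<forall>t\<in>{0..T}. \<bar>q n t x (R n g) - q0 t x (R0 g)\<bar> < e"
proof (rule laplace_uniform_null[OF _ _ _ _ e])
  interpret z: sub_markov_flow q0 R0 C by (rule lim)
  fix n :: nat
  interpret n: sub_markov_flow "q n" "R n" C by (rule n)
  show "(\<lambda>t. q n t x (R n g) - q0 t x (R0 g)) \<in> borel_measurable borel" for x by measurable
  show "\<bar>q n t x (R n g) - q0 t x (R0 g)\<bar> \<le> 2 * (C * norm g)" for t x
    using n.q_bound[of t x "R n g"] z.q_bound[of t x "R0 g"] n.R_bound[of g] z.R_bound[of g] by linarith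
  show "\<bar>(q n s x (R n g) - q0 s x (R0 g)) - (q n t x (R n g) - q0 t x (R0 g))\<bar> \<le> (2 * norm g) * \<bar>s - t\<bar>"
    if "0 \<le> s" "0 \<le> t" for s t x
    using n.q_R_lipschitz[OF that, of x g] z.q_R_lipschitz[OF that, of x g] by linarith
next
  interpret z: sub_markov_flow q0 R0 C by (rule lim)
  fix k :: nat
  define a where "a = real (Suc k)"
  have a: "0 < a" by (simp add: a_def)
  obtain h where h: "h + a *\<^sub>R R0 h = R0 g" using z.resolvent_ex[of a "R0 g"] a by auto
  have est: "\<bar>\<integral>t. q n (t / a) x (R n g) - q0 (t / a) x (R0 g) \<partial>exp_law\<bar>
      \<le> norm (R n g - R0 g) + 2 * a * norm (R n h - R0 h)" for n x
  proof -
    interpret n: sub_markov_flow "q n" "R n" C by (rule n)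
    have "(\<integral>t. q n (t / a) x (R n g) - q0 (t / a) x (R0 g) \<partial>exp_law) = n.lap a x (R n g) - z.lap a x (R0 g)"
      unfolding n.lap_def z.lap_def by (rule Bochner_Integration.integral_diff[OF n.integrable_q z.integrable_q])
    \<comment> \<open>The first summand has transform exactly a R n h under flow n; the second is a
      remainder of norm a times that of R0 h - R n h.\<close>
    moreover have "R0 g = (h + a *\<^sub>R R n h) + a *\<^sub>R (R0 h - R n h)"
      unfolding h[symmetric] by (simp add: scaleR_diff_right)
    then have "n.lap a x (R0 g) = a * R n h x + a * n.lap a x (R0 h - R n h)"
      using n.lap_add[of a x "h + a *\<^sub>R R n h" "a *\<^sub>R (R0 h - R n h)"] n.lap_scale n.lap_resolvent[OF a refl] by simp
    moreover have "n.lap a x (R n g) = n.lap a x (R n g - R0 g) + n.lap a x (R0 g)"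
      by (simp add: n.lap_diff)
    moreover have "z.lap a x (R0 g) = a * R0 h x" by (rule z.lap_resolvent[OF a h])
    ultimately have "(\<integral>t. q n (t / a) x (R n g) - q0 (t / a) x (R0 g) \<partial>exp_law)
        = n.lap a x (R n g - R0 g) + (a * (R n h - R0 h) x + a * n.lap a x (R0 h - R n h))"
      by (simp add: algebra_simps)
    moreover have "\<bar>n.lap a x (R n g - R0 g)\<bar> \<le> norm (R n g - R0 g)" by (rule n.lap_bound)
    moreover have "\<bar>a * (R n h - R0 h) x\<bar> \<le> a * norm (R n h - R0 h)"
      using a norm_bounded[of "R n h - R0 h" x] by (simp add: abs_mult)
    moreover have "\<bar>a * n.lap a x (R0 h - R n h)\<bar> \<le> a * norm (R n h - R0 h)"
      using a n.lap_bound[of a x "R0 h - R n h"] by (simp add: abs_mult norm_minus_commute)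
    ultimately show ?thesis by linarith
  qed
  have "(\<lambda>n. norm (R n g - R0 g) + 2 * a * norm (R n h - R0 h)) \<longlonglongrightarrow> 0 + 2 * a * 0"
    by (intro tendsto_intros tendsto_norm_zero) (auto simp: LIM_zero_iff conv)
  then have null: "(\<lambda>n. norm (R n g - R0 g) + 2 * a * norm (R n h - R0 h)) \<longlonglongrightarrow> 0" by simp
  show "uniform_limit UNIV (\<lambda>n x. \<integral>t. q n (t / real (Suc k)) x (R n g) - q0 (t / real (Suc k)) x (R0 g) \<partial>exp_law) (\<lambda>_. 0) sequentially"
  proof (rule uniform_limitI)
    fix e :: real assume "0 < e"
    with null have "\<forall>\<^sub>F n in sequentially. norm (R n g - R0 g) + 2 * a * norm (R n h - R0 h) < e"
      by (rule order_tendstoD)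
    then show "\<forall>\<^sub>F n in sequentially. \<forall>x\<in>UNIV. dist (\<integral>t. q n (t / real (Suc k)) x (R n g) - q0 (t / real (Suc k)) x (R0 g) \<partial>exp_law) 0 < e"
      by eventually_elim (use est in \<open>auto simp: a_def dist_real_def intro: le_less_trans\<close>)
  qed
qed

section \<open>Uniform approximation by potentials\<close>

lemma C0_compact_superlevel:
  "u \<in> C0 \<Longrightarrow> 0 < e \<Longrightarrow> \<exists>K. compact K \<and> (\<forall>x. x \<notin> K \<longrightarrow> \<bar>u x\<bar> < e)"
  unfolding C0_def by blast

lemma bcontfun_min:
  fixes f g :: "'x::metric_space \<Rightarrow>\<^sub>C real"
  obtains h :: "'x \<Rightarrow>\<^sub>C real" where "\<And>x. h x = min (f x) (g x)"
proof -
  have "continuous_on UNIV (\<lambda>x. min (f x) (g x))"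
    by (rule continuous_on_min) (rule continuous_on_apply_bcontfun)+
  moreover have "norm (min (f x) (g x)) \<le> norm f + norm g" for x
    using norm_bounded[of f x] norm_bounded[of g x] by (cases "f x \<le> g x") (simp_all add: min_def)
  ultimately have *: "(\<lambda>x. min (f x) (g x)) \<in> bcontfun" by (rule bcontfun_normI)
  show thesis by (rule that, subst Bcontfun_inverse[OF *], rule refl)
qed

text \<open>The covering argument behind Dini's theorem, in the form for increasing open
  sets.\<close>

lemma compact_finite_stage:
  fixes K :: "'a::topological_space set"
  assumes "compact K" and "\<And>n::nat. open (U n)" and "\<And>m n. m \<le> n \<Longrightarrow> U m \<subseteq> U n"
    and "K \<subseteq> (\<Union>n. U n)"
  obtains n where "K \<subseteq> U n"
proof -
  obtain D where D: "finite D" "K \<subseteq> (\<Union>n\<in>D. U n)"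
    by (rule compactE_image[OF assms(1), of UNIV U]) (use assms(2,4) in auto)
  have "U n \<subseteq> U (Max D)" if "n \<in> D" for n
    by (rule assms(3)) (use D(1) that in simp)
  then have "(\<Union>n\<in>D. U n) \<subseteq> U (Max D)" by (rule UN_least)
  with D(2) have "K \<subseteq> U (Max D)" by (rule order_trans)
  then show thesis by (rule that)
qed

section \<open>The uniform closure of the potentials on a subset of the state space\<close>

context sub_markov_flow begin

definition approximable :: "'x set \<Rightarrow> ('x \<Rightarrow> real) \<Rightarrow> bool" where
  "approximable F v \<longleftrightarrow> (\<forall>e>0. \<exists>g. \<forall>x\<in>F. \<bar>v x - R g x\<bar> < e)"

lemma approximableD: "approximable F v \<Longrightarrow> 0 < e \<Longrightarrow> \<exists>g. \<forall>x\<in>F. \<bar>v x - R g x\<bar> < e"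
  by (simp add: approximable_def)

lemma approximable_R: "approximable F (R g)"
  unfolding approximable_def by (intro allI impI exI[of _ g]) simp

lemma approximable_limit:
  assumes "\<And>e. 0 < e \<Longrightarrow> \<exists>w. approximable F w \<and> (\<forall>x\<in>F. \<bar>v x - w x\<bar> < e)"
  shows "approximable F v"
  unfolding approximable_def
proof (intro allI impI)
  fix e :: real assume e: "0 < e"
  then obtain w where w: "approximable F w" "\<forall>x\<in>F. \<bar>v x - w x\<bar> < e / 2"
    using assms[of "e / 2"] by auto
  obtain g where g: "\<forall>x\<in>F. \<bar>w x - R g x\<bar> < e / 2" using approximableD[OF w(1), of "e / 2"] e by auto
  have "\<bar>v x - R g x\<bar> < e" if "x \<in> F" for x
    using bspec[OF w(2) that] bspec[OF g that] by arith
  then show "\<exists>g. \<forall>x\<in>F. \<bar>v x - R g x\<bar> < e" by blast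
qed

lemma approximable_diff:
  assumes "approximable F v" "approximable F w"
  shows "approximable F (\<lambda>x. v x - w x)"
  unfolding approximable_def
proof (intro allI impI)
  fix e :: real assume e: "0 < e"
  obtain g where g: "\<forall>x\<in>F. \<bar>v x - R g x\<bar> < e / 2" using approximableD[OF assms(1), of "e / 2"] e by auto
  obtain h where h: "\<forall>x\<in>F. \<bar>w x - R h x\<bar> < e / 2" using approximableD[OF assms(2), of "e / 2"] e by auto
  have "\<bar>v x - w x - R (g - h) x\<bar> < e" if "x \<in> F" for x
    using g[rule_format, OF that] h[rule_format, OF that] unfolding R_diff minus_bcontfun.rep_eq by arith
  then show "\<exists>g. \<forall>x\<in>F. \<bar>v x - w x - R g x\<bar> < e" by blast
qed

lemma approximable_uminus: "approximable F v \<Longrightarrow> approximable F (\<lambda>x. - v x)"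
  using approximable_diff[OF approximable_R[of F 0], of v] R_scale[of 0 0] by simp

lemma lap_mono:
  fixes f g :: "'x \<Rightarrow>\<^sub>C real"
  shows "(\<And>y. f y \<le> g y) \<Longrightarrow> lap a x f \<le> lap a x g"
  using lap_nonneg[of "g - f" a x] by (simp add: lap_diff)

text \<open>With w = h + a R h, the resolvent equation reads b R h = \<open>lap b x w\<close> + (b -
  a) \<open>lap b x (R h)\<close>. After multiplication by a the last term contains a R h, which is
  the rate-a average of w and hence at most w; monotonicity of \<open>lap b\<close> finishes the
  estimate.\<close>

lemma lap_supermedian_mono:
  assumes w: "\<And>a x. 0 < a \<Longrightarrow> lap a x w \<le> w x" and ab: "0 < a" "a \<le> b"
  shows "lap a x w \<le> lap b x w"
proof -
  obtain h where h: "h + a *\<^sub>R R h = w" using resolvent_ex[of a w] ab by auto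
  have wa: "lap a y w = a * R h y" for y using lap_resolvent[OF ab(1) h] .
  have "lap b x w = lap b x h + a * lap b x (R h)"
    unfolding h[symmetric] lap_add lap_scale ..
  moreover have "b * lap b x (R h) = b * R h x - lap b x h"
    using lap_R[of b x h] ab by (simp add: field_simps)
  ultimately have "b * R h x = lap b x w + (b - a) * lap b x (R h)" by (simp add: algebra_simps)
  from arg_cong[OF this, of "times a"]
  have "b * (a * R h x) = a * lap b x w + (b - a) * lap b x (a *\<^sub>R R h)"
    by (simp add: lap_scale algebra_simps)
  also have "\<dots> \<le> a * lap b x w + (b - a) * lap b x w"
    using ab w[OF ab(1)] by (intro add_left_mono mult_left_mono lap_mono) (auto simp: wa)
  finally have "b * (a * R h x) \<le> b * lap b x w" by (simp add: algebra_simps)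
  then show ?thesis using ab by (simp add: wa)
qed

text \<open>Dominated convergence at a fixed x, along the times t / (k + 1). The convergence is only
  pointwise, so uniformity has to come from monotonicity and lattice operations.\<close>

lemma lap_tendsto:
  fixes f :: "'x \<Rightarrow>\<^sub>C real"
  assumes "((\<lambda>t. q t x f) \<longlongrightarrow> L) (at_right 0)"
  shows "(\<lambda>k. lap (real (Suc k)) x f) \<longlonglongrightarrow> L"
proof -
  have "(\<lambda>k. \<integral>t. q (t / real (Suc k)) x f \<partial>exp_law) \<longlonglongrightarrow> (\<integral>t. L \<partial>exp_law)"
  proof (rule integral_dominated_convergence[where w="\<lambda>_. norm f"])
    show "AE t in exp_law. (\<lambda>k. q (t / real (Suc k)) x f) \<longlonglongrightarrow> L"
    proof (rule AE_exp_law)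
      fix t :: real assume t: "0 < t"
      have "filterlim (\<lambda>k. t / real (Suc k)) (at_right 0) sequentially"
        unfolding filterlim_at
      proof
        have "(\<lambda>k. t * inverse (real (Suc k))) \<longlonglongrightarrow> t * 0" by (intro tendsto_intros LIMSEQ_inverse_real_of_nat)
        then show "(\<lambda>k. t / real (Suc k)) \<longlonglongrightarrow> 0" by (simp add: divide_inverse)
      qed (use t in auto)
      then show "(\<lambda>k. q (t / real (Suc k)) x f) \<longlonglongrightarrow> L"
        by (rule filterlim_compose[OF assms])
    qed
  qed (auto simp: q_bound)
  then show ?thesis unfolding lap_def by (simp add: exp_law.prob_space[simplified])
qed

text \<open>The source of regularity in x: nothing is assumed about \<open>q t x f\<close> as a
  function of x, but its exponential averages are potentials, hence continuous.\<close>

lemma lap_eq_R: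
  assumes "0 < a"
  obtains h where "(\<lambda>x. lap a x f) = R h"
proof -
  obtain h where h: "h + a *\<^sub>R R h = f" using resolvent_ex[of a f] assms by auto
  have "(\<lambda>x. lap a x f) = R (a *\<^sub>R h)"
    using lap_resolvent[OF assms h] by (simp add: R_scale fun_eq_iff)
  then show thesis by (rule that)
qed

lemma lap_approximable: "0 < a \<Longrightarrow> approximable F (\<lambda>x. lap a x f)"
  by (metis lap_eq_R approximable_R)

lemma continuous_on_lap: "0 < a \<Longrightarrow> continuous_on S (\<lambda>x. lap a x f)"
  by (metis lap_eq_R continuous_on_apply_bcontfun)

context
  fixes F :: "'x set"
  assumes F: "closed F" and reg: "\<And>x (f :: 'x \<Rightarrow>\<^sub>C real). x \<in> F \<Longrightarrow> ((\<lambda>t. q t x f) \<longlongrightarrow> f x) (at_right 0)"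
    and C0: "\<And>f. apply_bcontfun (R f) \<in> C0"
begin

lemma lap_C0: "0 < a \<Longrightarrow> (\<lambda>x. lap a x f) \<in> C0"
  by (metis lap_eq_R C0)

text \<open>Dini's theorem: on F the averages at rates k + 1 increase to w, and the gap is
  continuous, so it is uniformly small on the compact set K \<inter> F. Off K both functions lie
  between 0 and e.\<close>

lemma approximable_supermedian:
  assumes w: "\<And>a x. 0 < a \<Longrightarrow> lap a x w \<le> w x" "\<And>x. 0 \<le> w x" "apply_bcontfun w \<in> C0"
  shows "approximable F w"
proof (rule approximable_limit)
  fix e :: real assume e: "0 < e"
  obtain K where K: "compact K" "\<And>x. x \<notin> K \<Longrightarrow> \<bar>w x\<bar> < e" using C0_compact_superlevel[OF w(3) e] by blast
  define U where "U k = {x. w x - lap (real (Suc k)) x w < e}" for k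
  have "compact (K \<inter> F)" using K(1) F by blast
  moreover have "open (U k)" for k
    unfolding U_def by (intro open_Collect_less continuous_intros continuous_on_lap) auto
  moreover have "U m \<subseteq> U n" if "m \<le> n" for m n
  proof -
    have "lap (real (Suc m)) x w \<le> lap (real (Suc n)) x w" for x
      by (rule lap_supermedian_mono) (use that w(1) in auto)
    note mono = this
    show ?thesis unfolding U_def
    proof (intro Collect_mono impI)
      fix x assume "w x - lap (real (Suc m)) x w < e"
      then show "w x - lap (real (Suc n)) x w < e" using mono[of x] by linarith
    qed
  qed
  moreover have "K \<inter> F \<subseteq> (\<Union>n. U n)"
  proof
    fix x assume "x \<in> K \<inter> F"
    then have "(\<lambda>k. w x - lap (real (Suc k)) x w) \<longlonglongrightarrow> w x - w x"
      by (intro tendsto_diff tendsto_const lap_tendsto reg) auto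
    then have "\<forall>\<^sub>F k in sequentially. w x - lap (real (Suc k)) x w < e" using e by (intro order_tendstoD(2)) auto
    then show "x \<in> (\<Union>n. U n)" by (auto simp: U_def eventually_sequentially)
  qed
  ultimately obtain k where k: "K \<inter> F \<subseteq> U k" by (rule compact_finite_stage)
  have "\<bar>w x - lap (real (Suc k)) x w\<bar> < e" if "x \<in> F" for x
  proof (cases "x \<in> K")
    case True
    then show ?thesis using k that w(1)[of "real (Suc k)" x] by (auto simp: U_def)
  next
    case False
    then show ?thesis using K(2)[of x] lap_nonneg[of w "real (Suc k)" x] w(1)[of "real (Suc k)" x] w(2) by auto
  qed
  then show "\<exists>v. approximable F v \<and> (\<forall>x\<in>F. \<bar>w x - v x\<bar> < e)"
    using lap_approximable[of "real (Suc k)" F w] by (intro exI[of _ "\<lambda>x. lap (real (Suc k)) x w"]) auto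
qed

text \<open>Potentials need not be stable under minima, but supermedian functions are, and
  potentials of nonnegative functions are supermedian. The minimum is therefore taken first and
  approximated afterwards.\<close>

lemma approximable_min:
  assumes v: "approximable F v1" "approximable F v2"
  shows "approximable F (\<lambda>x. min (v1 x) (v2 x))"
proof (rule approximable_limit)
  fix e :: real assume e: "0 < e"
  obtain g1 where g1: "\<forall>x\<in>F. \<bar>v1 x - R g1 x\<bar> < e" using approximableD[OF v(1) e] by auto
  obtain g2 where g2: "\<forall>x\<in>F. \<bar>v2 x - R g2 x\<bar> < e" using approximableD[OF v(2) e] by auto
  \<comment> \<open>Adding c makes both functions nonnegative and raises both potentials by the same
    function R c, which is subtracted again at the end.\<close>
  define c :: "'x \<Rightarrow>\<^sub>C real" where "c = const_bcontfun (norm g1 + norm g2)"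
  have nn: "0 \<le> (g1 + c) y" "0 \<le> (g2 + c) y" for y
    using norm_bounded[of g1 y] norm_bounded[of g2 y] by (auto simp: c_def)
  obtain w :: "'x \<Rightarrow>\<^sub>C real" where w: "\<And>x. w x = min (R (g1 + c) x) (R (g2 + c) x)" by (rule bcontfun_min[of "R (g1 + c)" "R (g2 + c)"]) (rule that)
  have lapR: "lap a x (R g) \<le> R g x" if "0 < a" "\<And>y. 0 \<le> g y" for a x and g :: "'x \<Rightarrow>\<^sub>C real"
    using lap_R[OF that(1), of x g] lap_nonneg[of g a x] that by simp
  have w0: "approximable F w"
  proof (rule approximable_supermedian)
    show "lap a x w \<le> w x" if "0 < a" for a x
      using lap_mono[of w "R (g1 + c)" a x] lap_mono[of w "R (g2 + c)" a x]
        lapR[OF that nn(1), of x] lapR[OF that nn(2), of x] by (auto simp: w)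
    show "0 \<le> w x" for x using R_nonneg[OF nn(1), of x] R_nonneg[OF nn(2), of x] by (simp add: w)
    show "apply_bcontfun w \<in> C0"
      unfolding C0_def
    proof (intro CollectI conjI allI impI)
      fix d :: real assume d: "0 < d"
      obtain K where K: "compact K" "\<And>x. x \<notin> K \<Longrightarrow> \<bar>R (g1 + c) x\<bar> < d"
        using C0_compact_superlevel[OF C0[of "g1 + c"] d] by blast
      have "\<bar>w x\<bar> \<le> \<bar>R (g1 + c) x\<bar>" for x
        using R_nonneg[OF nn(1), of x] R_nonneg[OF nn(2), of x] by (auto simp: w)
      then show "\<exists>K. compact K \<and> (\<forall>x. x \<notin> K \<longrightarrow> \<bar>w x\<bar> < d)"
        using K by (intro exI[of _ K]) (auto intro: le_less_trans)
    qed simp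
  qed
  have "approximable F (\<lambda>x. w x - R c x)" by (rule approximable_diff[OF w0 approximable_R])
  moreover have "\<bar>min (v1 x) (v2 x) - (w x - R c x)\<bar> < e" if "x \<in> F" for x
    using g1[rule_format, OF that] g2[rule_format, OF that] by (auto simp: w R_add min_def abs_real_def split: if_splits)
  ultimately show "\<exists>w. approximable F w \<and> (\<forall>x\<in>F. \<bar>min (v1 x) (v2 x) - w x\<bar> < e)" by blast
qed

text \<open>Lattice version of the Stone--Weierstrass argument: finite maxima of tails of the pointwise
  approximations \<open>lap (Suc k) x u\<close> are almost above \<open>u\<close>, and finite minima of those are close to \<open>u\<close>.\<close>
lemma approximable_C0_nonneg:
  assumes u: "apply_bcontfun u \<in> C0" "\<And>x. 0 \<le> u x"
  shows "approximable F u"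
proof (rule approximable_limit)
  fix e :: real assume e: "0 < e"
  let ?f = "\<lambda>k x. lap (real (Suc k)) x u"
  note amin = approximable_min
  have amax: "approximable F (\<lambda>x. max (v x) (w x))" if "approximable F v" "approximable F w" for v w
    using approximable_uminus[OF amin[OF approximable_uminus[OF that(1)] approximable_uminus[OF that(2)]]]
    by (simp add: minus_min_eq_max)
  have f_lim: "(\<lambda>k. ?f k x) \<longlonglongrightarrow> u x" if "x \<in> F" for x by (intro lap_tendsto reg that)
  \<comment> \<open>The maximum runs over a tail starting at N: at each point of F all averages of
    sufficiently late index lie below u + e, so the maximum over a late tail does not overshoot
    there.\<close>
  define H where "H N M x = (MAX k\<in>{N..N + M}. ?f k x)" for N M x
  have H_Suc: "H N (Suc M) x = max (?f (N + Suc M) x) (H N M x)" for N M x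
    unfolding H_def add_Suc_right by (subst atLeastAtMostSuc_conv) auto
  have H_ge: "?f k x \<le> H N M x" if "N \<le> k" "k \<le> N + M" for N M k x
    unfolding H_def using that by (intro Max_ge) auto
  have H_approx: "approximable F (H N M)" for N M
  proof (induction M)
    case 0 show ?case using lap_approximable[of "real (Suc N)" F u] by (simp add: H_def)
  next
    case (Suc M) then show ?case using lap_approximable[of "real (Suc (N + Suc M))" F u] by (simp add: H_Suc amax)
  qed
  have H_cont: "continuous_on S (H N M)" for S N M
  proof (induction M)
    case 0 show ?case using continuous_on_lap[of "real (Suc N)" S u] by (simp add: H_def)
  next
    case (Suc M) then show ?case using continuous_on_lap[of "real (Suc (N + Suc M))" S u]
      by (simp add: H_Suc continuous_on_max)
  qed
  have H_C0: "H N M \<in> C0" for N M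
  proof (induction M)
    case 0 show ?case using lap_C0[of "real (Suc N)" u] by (simp add: H_def)
  next
    case (Suc M)
    show ?case unfolding C0_def
    proof (intro CollectI conjI allI impI)
      show "continuous_on UNIV (H N (Suc M))" by (rule H_cont)
      fix d :: real assume d: "0 < d"
      obtain K1 where K1: "compact K1" "\<And>x. x \<notin> K1 \<Longrightarrow> \<bar>H N M x\<bar> < d" using C0_compact_superlevel[OF Suc d] by blast
      obtain K2 where K2: "compact K2" "\<And>x. x \<notin> K2 \<Longrightarrow> \<bar>?f (N + Suc M) x\<bar> < d"
        using C0_compact_superlevel[OF lap_C0[of "real (Suc (N + Suc M))" u] d] by auto
      show "\<exists>K. compact K \<and> (\<forall>x. x \<notin> K \<longrightarrow> \<bar>H N (Suc M) x\<bar> < d)"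
        using K1 K2 by (intro exI[of _ "K1 \<union> K2"]) (auto simp: H_Suc max_def)
    qed
  qed
  have H_nn: "0 \<le> H N M x" for N M x
    using H_ge[of N N M x] lap_nonneg[of u "real (Suc N)" x] u(2) by simp
  have "\<exists>M. \<forall>x\<in>F. u x - e < H N M x" for N
  proof -
    obtain K where K: "compact K" "\<And>x. x \<notin> K \<Longrightarrow> \<bar>u x\<bar> < e" using C0_compact_superlevel[OF u(1) e] by blast
    define U where "U M = {x. u x - e < H N M x}" for M
    have "compact (K \<inter> F)" using K(1) F by blast
    moreover have "open (U M)" for M
      unfolding U_def by (intro open_Collect_less continuous_intros H_cont) auto
    moreover have "U m \<subseteq> U n" if "m \<le> n" for m n
    proof -
      have "H N m x \<le> H N n x" for x unfolding H_def using that by (intro Max_mono) auto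
      then show ?thesis by (auto simp: U_def intro: less_le_trans)
    qed
    moreover have "K \<inter> F \<subseteq> (\<Union>n. U n)"
    proof
      fix x assume x: "x \<in> K \<inter> F"
      then have "\<forall>\<^sub>F k in sequentially. u x - e < ?f k x" using e by (intro order_tendstoD(1)[OF f_lim]) auto
      then obtain k0 where "\<And>k. k0 \<le> k \<Longrightarrow> u x - e < ?f k x" by (auto simp: eventually_sequentially)
      from this[of "N + k0"] have "u x - e < H N k0 x" using H_ge[of N "N + k0" k0 x] by simp
      then show "x \<in> (\<Union>n. U n)" by (auto simp: U_def)
    qed
    ultimately obtain M where M: "K \<inter> F \<subseteq> U M" by (rule compact_finite_stage)
    have "u x - e < H N M x" if "x \<in> F" for x
    proof (cases "x \<in> K")
      case False
      then show ?thesis using K(2)[of x] H_nn[of N M x] by auto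
    qed (use M that in \<open>auto simp: U_def\<close>)
    then show ?thesis by blast
  qed
  then obtain M where M: "\<And>N x. x \<in> F \<Longrightarrow> u x - e < H N (M N) x" by metis
  \<comment> \<open>These minima decrease in n, which permits a second Dini argument from above,
    while each of them stays above u - e on F.\<close>
  define G where "G n x = (MIN N\<in>{..n}. H N (M N) x)" for n x
  have G_Suc: "G (Suc n) x = min (H (Suc n) (M (Suc n)) x) (G n x)" for n x
    unfolding G_def by (subst atMost_Suc) auto
  have G_le: "G n x \<le> H N (M N) x" if "N \<le> n" for N n x
    unfolding G_def using that by (intro Min_le) auto
  have G_approx: "approximable F (G n)" for n
  proof (induction n)
    case 0 show ?case using H_approx[of 0 "M 0"] by (simp add: G_def)
  next
    case (Suc n) then show ?case using H_approx[of "Suc n" "M (Suc n)"] by (simp add: G_Suc amin)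
  qed
  have G_cont: "continuous_on S (G n)" for S n
  proof (induction n)
    case 0 show ?case using H_cont[of S 0 "M 0"] by (simp add: G_def)
  next
    case (Suc n) then show ?case using H_cont[of S "Suc n" "M (Suc n)"] by (simp add: G_Suc continuous_on_min)
  qed
  have G_gt: "u x - e < G n x" if "x \<in> F" for n x
    unfolding G_def using M[OF that] by (subst Min_gr_iff) auto
  \<comment> \<open>Every \<open>G n\<close> lies below the maximum \<open>H 0 (M 0)\<close>, which
    vanishes at infinity, so this K serves all n at once.\<close>
  obtain K where K: "compact K" "\<And>x. x \<notin> K \<Longrightarrow> \<bar>H 0 (M 0) x\<bar> < e" using C0_compact_superlevel[OF H_C0 e] by blast
  define U where "U n = {x. G n x < u x + e}" for n
  have "compact (K \<inter> F)" using K(1) F by blast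
  moreover have "open (U n)" for n
    unfolding U_def by (intro open_Collect_less continuous_intros G_cont) auto
  moreover have "U m \<subseteq> U n" if "m \<le> n" for m n
  proof -
    have "G n x \<le> G m x" for x unfolding G_def using that by (intro Min_antimono) auto
    then show ?thesis by (auto simp: U_def intro: le_less_trans)
  qed
  moreover have "K \<inter> F \<subseteq> (\<Union>n. U n)"
  proof
    fix x assume x: "x \<in> K \<inter> F"
    then have "\<forall>\<^sub>F k in sequentially. ?f k x < u x + e" using e by (intro order_tendstoD(2)[OF f_lim]) auto
    then obtain N where N: "\<And>k. N \<le> k \<Longrightarrow> ?f k x < u x + e" by (auto simp: eventually_sequentially)
    have "H N (M N) x < u x + e" unfolding H_def using N by (subst Max_less_iff) auto
    then show "x \<in> (\<Union>n. U n)" using G_le[of N N x] by (auto simp: U_def intro: le_less_trans)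
  qed
  ultimately obtain n where n: "K \<inter> F \<subseteq> U n" by (rule compact_finite_stage)
  have "\<bar>u x - G n x\<bar> < e" if "x \<in> F" for x
  proof (cases "x \<in> K")
    case True
    then show ?thesis using n that G_gt[OF that, of n] by (auto simp: U_def)
  next
    case False
    then show ?thesis using K(2)[of x] G_le[of 0 n x] G_gt[OF that, of n] u(2)[of x] by auto
  qed
  then show "\<exists>w. approximable F w \<and> (\<forall>x\<in>F. \<bar>u x - w x\<bar> < e)" using G_approx by blast
qed

end

end

section \<open>Lower semicontinuous kernels and vague convergence\<close>

lemma lower_semicontinuous_measurable:
  "lower_semicontinuous (f :: 'z::topological_space \<Rightarrow> ennreal) \<Longrightarrow> f \<in> borel_measurable borel"
  unfolding lower_semicontinuous_def by (intro borel_measurableI_greater) auto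

lemma exists_open_compact_closure:
  fixes x :: "'x::metric_space"
  assumes "locally compact (UNIV :: 'x set)"
  shows "\<exists>U. open U \<and> x \<in> U \<and> compact (closure U)"
proof -
  obtain u v where uv: "open u" "compact v" "x \<in> u" "u \<subseteq> v"
    using assms locallyE[of compact "UNIV :: 'x set" UNIV x] by auto
  have "closure u \<subseteq> v" using uv by (intro closure_minimal compact_imp_closed)
  then have "compact (closure u)" using uv(2) by (metis closed_closure compact_Int_closed inf.absorb2)
  then show ?thesis using uv by blast
qed

lemma compact_exhaustion:
  assumes "locally compact (UNIV :: 'x::{metric_space, second_countable_topology} set)"
  obtains K :: "nat \<Rightarrow> 'x::{metric_space, second_countable_topology} set" where "\<And>i. compact (K i)" "incseq K" "(\<Union>i. K i) = UNIV"
proof -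
  obtain U :: "'x \<Rightarrow> 'x set" where U: "\<And>x. open (U x)" "\<And>x. x \<in> U x" "\<And>x. compact (closure (U x))"
    using exists_open_compact_closure[OF assms] by metis
  obtain \<F> where \<F>: "\<F> \<subseteq> range U" "countable \<F>" "\<Union>\<F> = \<Union>(range U)"
    by (rule Lindelof[of "range U"]) (use U in auto)
  have "\<Union>(range U) = UNIV" using U(2) by auto
  then have ne: "\<F> \<noteq> {}" and cov: "\<Union>\<F> = UNIV" using \<F>(3) by auto
  define V where "V = from_nat_into \<F>"
  have V: "range V = \<F>" unfolding V_def by (rule range_from_nat_into[OF ne \<F>(2)])
  have V_compact: "compact (closure (V i))" for i
    using V \<F>(1) U(3) by (metis image_iff rangeI subset_iff)
  show thesis
  proof (rule that[of "\<lambda>i. \<Union>j\<le>i. closure (V j)"])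
    show "compact (\<Union>j\<le>i. closure (V j))" for i by (intro compact_UN) (auto intro: V_compact)
    show "incseq (\<lambda>i. \<Union>j\<le>i. closure (V j))" by (intro monoI UN_mono) auto
    have "x \<in> (\<Union>i. \<Union>j\<le>i. closure (V j))" for x
    proof -
      have "x \<in> \<Union>(range V)" using V cov by simp
      then obtain i where "x \<in> closure (V i)" using subsetD[OF closure_subset] by blast
      then show ?thesis by (intro UN_I[of i]) auto
    qed
    then show "(\<Union>i. \<Union>j\<le>i. closure (V j)) = UNIV" by blast
  qed
qed

text \<open>A quotient built from the distances to K and to the complement of a relatively compact
  neighbourhood V. The cases K = {} and V = UNIV are split off because \<open>infdist\<close> to the
  empty set is 0.\<close>

lemma compact_cutoff:
  fixes K :: "'x::metric_space set"
  assumes lc: "locally compact (UNIV :: 'x set)" and K: "compact K"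
  obtains \<phi> :: "'x \<Rightarrow> real"
  where "\<phi> \<in> Cc" "\<And>y. 0 \<le> \<phi> y" "\<And>y. \<phi> y \<le> 1" "\<And>y. y \<in> K \<Longrightarrow> \<phi> y = 1"
proof (cases "K = {}")
  case True
  then show thesis using that[of "\<lambda>_. 0"] by (auto simp: Cc_def)
next
  case False
  obtain U :: "'x \<Rightarrow> 'x set" where U: "\<And>x. open (U x)" "\<And>x. x \<in> U x" "\<And>x. compact (closure (U x))"
    using exists_open_compact_closure[OF lc] by metis
  obtain D where D: "finite D" "K \<subseteq> (\<Union>x\<in>D. U x)"
    by (rule compactE_image[OF K, of UNIV U]) (use U(1,2) in blast)+
  define V where "V = (\<Union>x\<in>D. U x)"
  have V: "open V" "K \<subseteq> V" using U D by (auto simp: V_def)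
  have "closure V \<subseteq> (\<Union>x\<in>D. closure (U x))"
    unfolding V_def using D(1) by (intro closure_minimal closed_UN) (auto intro: subsetD[OF closure_subset])
  moreover have "compact (\<Union>x\<in>D. closure (U x))" using D(1) U(3) by (intro compact_UN) auto
  ultimately have cV: "compact (closure V)" by (metis closed_closure compact_Int_closed inf.absorb2)
  show thesis
  proof (cases "V = UNIV")
    case True
    then show thesis using that[of "\<lambda>_. 1"] cV by (auto simp: Cc_def)
  next
    case V_ne: False
    define \<phi> where "\<phi> y = infdist y (- V) / (infdist y (- V) + infdist y K)" for y
    have pos: "0 < infdist y (- V) + infdist y K" for y
    proof -
      have "infdist y (- V) \<noteq> 0 \<or> infdist y K \<noteq> 0"
        using in_closed_iff_infdist_zero[of "- V" y] in_closed_iff_infdist_zero[of K y]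
          V V_ne False compact_imp_closed[OF K] by auto
      then show ?thesis using infdist_nonneg[of y "- V"] infdist_nonneg[of y K] by linarith
    qed
    have "continuous_on UNIV \<phi>"
      unfolding \<phi>_def using pos by (intro continuous_intros) (auto simp: less_le)
    moreover have "{y. \<phi> y \<noteq> 0} \<subseteq> V"
      using V_ne by (auto simp: \<phi>_def intro: ccontr)
    then have "compact (closure {y. \<phi> y \<noteq> 0})"
      using cV by (metis closed_closure closure_mono compact_Int_closed inf.absorb2)
    ultimately have "\<phi> \<in> Cc" by (simp add: Cc_def)
    moreover have "0 \<le> \<phi> y" "\<phi> y \<le> 1" for y
      using pos[of y] infdist_nonneg[of y "- V"] infdist_nonneg[of y K] by (auto simp: \<phi>_def field_simps)
    moreover have "\<phi> y = 1" if "y \<in> K" for y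
      using pos[of y] that by (simp add: \<phi>_def)
    ultimately show thesis by (rule that)
  qed
qed

text \<open>Inf-convolution with j times the distance of the function truncated at height j: the
  largest j-Lipschitz function below the truncation. The truncation makes the values real.\<close>

definition lip_approx :: "('z::metric_space \<Rightarrow> ennreal) \<Rightarrow> nat \<Rightarrow> 'z \<Rightarrow> real" where
  "lip_approx f j z = (INF w. enn2real (min (f w) (of_nat j)) + real j * dist z w)"

context
  fixes f :: "'z::metric_space \<Rightarrow> ennreal"
begin

lemma lip_approx_bdd: "bdd_below (range (\<lambda>w. enn2real (min (f w) (of_nat j)) + real j * dist z w))"
  by (rule bdd_belowI2[where m=0]) simp

lemma lip_approx_nonneg: "0 \<le> lip_approx f j z"
  unfolding lip_approx_def by (rule cINF_greatest) auto

lemma lip_approx_le: "lip_approx f j z \<le> enn2real (min (f w) (of_nat j)) + real j * dist z w"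
  unfolding lip_approx_def by (rule cINF_lower[OF lip_approx_bdd UNIV_I])

lemma lip_approx_le_fun: "ennreal (lip_approx f j z) \<le> f z"
proof -
  have "min (f z) (of_nat j) < \<top>" by (simp add: min_less_iff_disj of_nat_less_top)
  then have "ennreal (enn2real (min (f z) (of_nat j))) = min (f z) (of_nat j)" by simp
  moreover have "lip_approx f j z \<le> enn2real (min (f z) (of_nat j))" using lip_approx_le[of j z z] by simp
  ultimately show ?thesis by (metis ennreal_leI min.boundedE)
qed

lemma lip_approx_lipschitz: "\<bar>lip_approx f j z - lip_approx f j z'\<bar> \<le> real j * dist z z'"
proof -
  have *: "lip_approx f j z - real j * dist z z' \<le> lip_approx f j z'" for z z'
    unfolding lip_approx_def[of f j z']
  proof (rule cINF_greatest)
    fix w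
    have "real j * dist z w \<le> real j * (dist z z' + dist z' w)" by (intro mult_left_mono dist_triangle) auto
    then show "lip_approx f j z - real j * dist z z' \<le> enn2real (min (f w) (of_nat j)) + real j * dist z' w"
      using lip_approx_le[of j z w] by (simp add: algebra_simps)
  qed simp
  show ?thesis using *[of z z'] *[of z' z] by (simp add: dist_commute abs_le_iff)
qed

lemma lip_approx_mono: "i \<le> j \<Longrightarrow> lip_approx f i z \<le> lip_approx f j z"
  unfolding lip_approx_def[of f j]
proof (rule cINF_greatest)
  fix w assume ij: "i \<le> j"
  have "enn2real (min (f w) (of_nat i)) \<le> enn2real (min (f w) (of_nat j))"
    using ij by (intro enn2real_mono min.mono) (auto simp: min_less_iff_disj of_nat_less_top)
  moreover have "real i * dist z w \<le> real j * dist z w" using ij by (intro mult_right_mono) auto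
  ultimately show "lip_approx f i z \<le> enn2real (min (f w) (of_nat j)) + real j * dist z w"
    using lip_approx_le[of i z w] by linarith
qed simp

text \<open>For r < f z, lower semicontinuity keeps f above r on a ball of radius d around z, and
  outside the ball the penalty is at least j d. Both regions give a value of at least r once j
  exceeds r and r / d.\<close>

lemma lip_approx_SUP:
  assumes "lower_semicontinuous f"
  shows "(SUP j. ennreal (lip_approx f j z)) = f z"
proof (rule antisym)
  show "(SUP j. ennreal (lip_approx f j z)) \<le> f z" by (rule SUP_least) (rule lip_approx_le_fun)
  show "f z \<le> (SUP j. ennreal (lip_approx f j z))"
  proof (rule dense_le)
    fix c assume c: "c < f z"
    have "c < \<top>" using c by (rule less_le_trans) simp
    then obtain r where r: "c = ennreal r" "0 \<le> r" by (cases c) auto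
    have "open {w. c < f w}" using assms by (simp add: lower_semicontinuous_def)
    then obtain d where d: "0 < d" "\<And>w. dist w z < d \<Longrightarrow> c < f w"
      using c unfolding open_dist by auto
    obtain j where j: "r \<le> real j" "r / d \<le> real j"
      using real_arch_simple[of "max r (r / d)"] by auto
    have "r \<le> lip_approx f j z"
      unfolding lip_approx_def
    proof (rule cINF_greatest)
      fix w
      show "r \<le> enn2real (min (f w) (of_nat j)) + real j * dist z w"
      proof (cases "dist w z < d")
        case True
        have "ennreal r \<le> min (f w) (of_nat j)"
          using d(2)[OF True] r j(1) by (auto simp: ennreal_of_nat_eq_real_of_nat less_imp_le intro: ennreal_leI)
        then have "enn2real (ennreal r) \<le> enn2real (min (f w) (of_nat j))"
          by (rule enn2real_mono) (auto simp: min_less_iff_disj of_nat_less_top)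
        then have "r \<le> enn2real (min (f w) (of_nat j))" using r(2) by simp
        moreover have "0 \<le> real j * dist z w" by simp
        ultimately show ?thesis by linarith
      next
        case False
        have "r \<le> real j * d" using j(2) d(1) by (simp add: field_simps)
        also have "\<dots> \<le> real j * dist z w" using False by (intro mult_left_mono) (auto simp: dist_commute)
        finally show ?thesis using enn2real_nonneg[of "min (f w) (of_nat j)"] by linarith
      qed
    qed simp
    then have "c \<le> ennreal (lip_approx f j z)" unfolding r(1) by (rule ennreal_leI)
    then show "c \<le> (SUP j. ennreal (lip_approx f j z))" by (rule order_trans) (auto intro: SUP_upper)
  qed
qed

end

lemma Cc_integrable:
  assumes "radon_measure \<nu>" "f \<in> Cc"
  shows "integrable \<nu> f"
proof -
  let ?K = "closure {x. f x \<noteq> 0}"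
  have K: "compact ?K" and cont: "continuous_on UNIV f" using assms(2) by (auto simp: Cc_def)
  have sets: "sets \<nu> = sets borel" using assms(1) by (simp add: radon_measure_def)
  have [measurable]: "f \<in> borel_measurable \<nu>"
    unfolding measurable_cong_sets[OF sets refl] using cont by (rule borel_measurable_continuous_onI)
  obtain B where B: "\<And>x. x \<in> ?K \<Longrightarrow> norm (f x) \<le> B"
    using compact_imp_bounded[OF compact_continuous_image[OF continuous_on_subset[OF cont subset_UNIV] K]]
    unfolding bounded_iff by blast
  have "emeasure \<nu> ?K < \<infinity>" using assms(1) K by (simp add: radon_measure_def)
  then have "integrable \<nu> (\<lambda>x. indicator ?K x *\<^sub>R B)"
    using sets by (intro integrable_scaleR_left impI integrable_real_indicator) auto
  then show ?thesis
  proof (rule Bochner_Integration.integrable_bound)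
    show "AE x in \<nu>. norm (f x) \<le> norm (indicator ?K x *\<^sub>R B)"
    proof (rule AE_I2)
      fix x
      show "norm (f x) \<le> norm (indicator ?K x *\<^sub>R B)"
      proof (cases "f x = 0")
        case False
        then have "x \<in> ?K" using closure_subset by fastforce
        then show ?thesis using B[of x] by simp
      qed simp
    qed
  qed simp
qed

lemma Cc_mult:
  assumes "\<phi> \<in> Cc" "continuous_on UNIV f"
  shows "(\<lambda>x. f x * \<phi> x) \<in> Cc"
proof -
  have "closure {x. f x * \<phi> x \<noteq> 0} \<subseteq> closure {x. \<phi> x \<noteq> 0}" by (intro closure_mono) auto
  then have "compact (closure {x. f x * \<phi> x \<noteq> 0})"
    using assms(1) by (metis (mono_tags, lifting) Cc_def closed_closure compact_Int_closed inf.absorb2 mem_Collect_eq)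
  then show ?thesis using assms by (auto simp: Cc_def intro: continuous_on_mult)
qed

text \<open>A Fatou lemma in which measure and base point both vary. The Lipschitz approximants of
  the jointly lower semicontinuous kernel allow the base point to be moved from \<open>xs k\<close>
  to x at a cost of j times their distance times the convergent mass of a cut-off; what is left is
  vague convergence tested on one fixed function.\<close>

lemma vague_lsc_liminf:
  fixes G :: "'x::{metric_space, second_countable_topology} \<Rightarrow> 'x \<Rightarrow> ennreal" and f :: "'x \<Rightarrow> real"
  assumes lc: "locally compact (UNIV :: 'x set)"
    and lsc: "lower_semicontinuous (\<lambda>(x, y). G x y)"
    and radon: "\<And>k. radon_measure (\<nu> k)" "radon_measure \<nu>'" and vague: "vague_limit \<nu> \<nu>'"
    and x: "xs \<longlonglongrightarrow> x" and f: "continuous_on UNIV f" "\<And>y. 0 \<le> f y" "\<And>y. f y \<le> 1"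
  shows "(\<integral>\<^sup>+y. G x y * ennreal (f y) \<partial>\<nu>') \<le> liminf (\<lambda>k. \<integral>\<^sup>+y. G (xs k) y * ennreal (f y) \<partial>\<nu> k)" (is "_ \<le> ?L")
proof -
  let ?g = "lip_approx (\<lambda>(x, y). G x y)"
  have sets' [measurable_cong]: "sets \<nu>' = sets borel" using radon by (simp add: radon_measure_def)
  have f_meas [measurable]: "f \<in> borel_measurable borel" using f(1) by (rule borel_measurable_continuous_onI)
  have g_lip: "\<bar>?g j (x, y) - ?g j (x', y')\<bar> \<le> real j * (dist x x' + dist y y')" for j x y x' y'
  proof -
    have "dist (x, y) (x', y') \<le> dist x x' + dist y y'"
      by (simp add: dist_Pair_Pair sqrt_sum_squares_le_sum)
    then show ?thesis using lip_approx_lipschitz[of "\<lambda>(x, y). G x y" j "(x, y)" "(x', y')"]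
      by (smt (verit) mult_left_mono of_nat_0_le_iff)
  qed
  have g_cont: "continuous_on UNIV (\<lambda>y. ?g j (x, y))" for j x
  proof (rule lipschitz_on_continuous_on)
    show "(real j)-lipschitz_on UNIV (\<lambda>y. ?g j (x, y))"
      by (rule lipschitz_onI) (use g_lip[of j x _ x] in \<open>auto simp: dist_real_def dist_commute\<close>)
  qed
  have g_meas [measurable]: "(\<lambda>y. ?g j (x, y)) \<in> borel_measurable borel" for j x
    by (rule borel_measurable_continuous_onI[OF g_cont])
  have main: "(\<integral>\<^sup>+y. ennreal (?g j (x, y)) * ennreal (f y) * indicator K y \<partial>\<nu>') \<le> ?L"
    if K: "compact K" for K j
  proof -
    obtain \<phi> where \<phi>: "\<phi> \<in> Cc" "\<And>y. 0 \<le> \<phi> y" "\<And>y. \<phi> y \<le> 1" "\<And>y. y \<in> K \<Longrightarrow> \<phi> y = 1"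
      by (rule compact_cutoff[OF lc K]) (rule that)
    define h where "h z y = ?g j (z, y) * f y * \<phi> y" for z y
    have h_Cc: "h z \<in> Cc" for z
      unfolding h_def by (intro Cc_mult[OF \<phi>(1)] continuous_on_mult g_cont f(1))
    have h_nn: "0 \<le> h z y" for z y
      unfolding h_def by (intro mult_nonneg_nonneg lip_approx_nonneg f \<phi>)
    have h_diff: "\<bar>h x y - h z y\<bar> \<le> real j * dist z x * \<phi> y" for z y
    proof -
      have "\<bar>h x y - h z y\<bar> = \<bar>?g j (x, y) - ?g j (z, y)\<bar> * f y * \<phi> y"
        using f(2) \<phi>(2) by (simp add: h_def left_diff_distrib[symmetric] abs_mult)
      also have "\<dots> \<le> (real j * dist z x) * 1 * \<phi> y"
        using g_lip[of j x y z y] f(2,3) \<phi>(2) by (intro mult_mono) (auto simp: dist_commute)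
      finally show ?thesis by simp
    qed
    have "(\<lambda>k. \<integral>y. h (xs k) y \<partial>\<nu> k) \<longlonglongrightarrow> (\<integral>y. h x y \<partial>\<nu>')"
    proof (rule Lim_transform)
      show "(\<lambda>k. \<integral>y. h x y \<partial>\<nu> k) \<longlonglongrightarrow> (\<integral>y. h x y \<partial>\<nu>')"
        using vague h_Cc by (simp add: vague_limit_def)
      have "(\<lambda>k. real j * dist (xs k) x * (\<integral>y. \<phi> y \<partial>\<nu> k)) \<longlonglongrightarrow> real j * 0 * (\<integral>y. \<phi> y \<partial>\<nu>')"
        using vague \<phi>(1) x by (intro tendsto_intros tendsto_dist_iff[THEN iffD1]) (auto simp: vague_limit_def)
      then have lim0: "(\<lambda>k. real j * dist (xs k) x * (\<integral>y. \<phi> y \<partial>\<nu> k)) \<longlonglongrightarrow> 0" by simp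
      show "(\<lambda>k. (\<integral>y. h (xs k) y \<partial>\<nu> k) - (\<integral>y. h x y \<partial>\<nu> k)) \<longlonglongrightarrow> 0"
      proof (rule Lim_null_comparison[OF always_eventually[OF allI] lim0])
        fix k
        note int = Cc_integrable[OF radon(1)[of k]]
        have "norm ((\<integral>y. h x y \<partial>\<nu> k) - (\<integral>y. h (xs k) y \<partial>\<nu> k)) = \<bar>\<integral>y. h x y - h (xs k) y \<partial>\<nu> k\<bar>"
          by (simp add: Bochner_Integration.integral_diff[OF int[OF h_Cc] int[OF h_Cc]])
        also have "\<dots> \<le> (\<integral>y. \<bar>h x y - h (xs k) y\<bar> \<partial>\<nu> k)" by (rule integral_abs_bound)
        also have "\<dots> \<le> (\<integral>y. real j * dist (xs k) x * \<phi> y \<partial>\<nu> k)"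
          using h_diff by (intro integral_mono integrable_abs Bochner_Integration.integrable_diff int[OF h_Cc]
              integrable_mult_right int[OF \<phi>(1)]) auto
        finally show "norm ((\<integral>y. h (xs k) y \<partial>\<nu> k) - (\<integral>y. h x y \<partial>\<nu> k)) \<le> real j * dist (xs k) x * (\<integral>y. \<phi> y \<partial>\<nu> k)"
          by (simp add: norm_minus_commute)
      qed
    qed
    then have lim: "(\<lambda>k. ennreal (\<integral>y. h (xs k) y \<partial>\<nu> k)) \<longlonglongrightarrow> ennreal (\<integral>y. h x y \<partial>\<nu>')"
      by (rule tendsto_ennrealI)
    have "(\<integral>\<^sup>+y. ennreal (?g j (x, y)) * ennreal (f y) * indicator K y \<partial>\<nu>') \<le> (\<integral>\<^sup>+y. ennreal (h x y) \<partial>\<nu>')"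
      using \<phi>(4) by (intro nn_integral_mono)
        (auto simp: h_def indicator_def ennreal_mult lip_approx_nonneg f(2))
    also have "\<dots> = ennreal (\<integral>y. h x y \<partial>\<nu>')"
      by (rule nn_integral_eq_integral[OF Cc_integrable[OF radon(2) h_Cc]]) (simp add: h_nn)
    also have "\<dots> = liminf (\<lambda>k. ennreal (\<integral>y. h (xs k) y \<partial>\<nu> k))"
      using lim by (simp add: lim_imp_Liminf)
    also have "\<dots> = liminf (\<lambda>k. \<integral>\<^sup>+y. ennreal (h (xs k) y) \<partial>\<nu> k)"
      by (intro arg_cong[where f=liminf] ext nn_integral_eq_integral[symmetric] Cc_integrable[OF radon(1) h_Cc]) (simp add: h_nn)
    also have "\<dots> \<le> ?L"
    proof (intro Liminf_mono always_eventually allI nn_integral_mono)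
      fix k y
      have "ennreal (h (xs k) y) \<le> ennreal (?g j (xs k, y)) * ennreal (f y)"
        unfolding h_def using \<phi>(2,3)[of y]
        by (simp add: ennreal_mult[symmetric] lip_approx_nonneg f(2) mult_left_le)
      also have "\<dots> \<le> G (xs k) y * ennreal (f y)"
        using lip_approx_le_fun[of "\<lambda>(x, y). G x y" j "(xs k, y)"] by (intro mult_right_mono) auto
      finally show "ennreal (h (xs k) y) \<le> G (xs k) y * ennreal (f y)" .
    qed
    finally show ?thesis .
  qed
  obtain K :: "nat \<Rightarrow> 'x set" where K: "\<And>i. compact (K i)" "incseq K" "(\<Union>i. K i) = UNIV"
    by (rule compact_exhaustion[OF lc]) (rule that)
  have [measurable]: "K i \<in> sets borel" for i using K(1) by (rule borel_compact)
  have g_sup: "(SUP j. ennreal (?g j (x, y))) = G x y" for y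
    using lip_approx_SUP[OF lsc, of "(x, y)"] by simp
  \<comment> \<open>One index serves both the Lipschitz approximants and the exhaustion, so that a
    single increasing sequence reaches the kernel.\<close>
  let ?s = "\<lambda>i y. ennreal (?g i (x, y)) * ennreal (f y) * indicator (K i) y"
  have mono: "incseq ?s"
    using K(2) by (intro incseq_SucI le_funI mult_mono ennreal_leI lip_approx_mono)
      (auto simp: indicator_def incseq_Suc_iff)
  have "G x y * ennreal (f y) = (SUP i. ?s i y)" for y
  proof (rule antisym)
    obtain i0 where i0: "y \<in> K i0" using K(3) by blast
    have "G x y * ennreal (f y) = (SUP j. ennreal (?g j (x, y)) * ennreal (f y))"
      unfolding g_sup[symmetric] by (rule SUP_mult_right_ennreal)
    also have "\<dots> \<le> (SUP i. ?s i y)"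
    proof (rule SUP_mono)
      fix j
      have "y \<in> K (max i0 j)" using i0 K(2) by (meson incseqD max.cobounded1 subsetD)
      moreover have "ennreal (?g j (x, y)) * ennreal (f y) \<le> ennreal (?g (max i0 j) (x, y)) * ennreal (f y)"
        by (intro mult_right_mono ennreal_leI lip_approx_mono) auto
      ultimately show "\<exists>i\<in>UNIV. ennreal (?g j (x, y)) * ennreal (f y) \<le> ?s i y"
        by (intro bexI[of _ "max i0 j"]) auto
    qed
    finally show "G x y * ennreal (f y) \<le> (SUP i. ?s i y)" .
    show "(SUP i. ?s i y) \<le> G x y * ennreal (f y)"
    proof (rule SUP_least)
      fix i
      have "?s i y \<le> G x y * ennreal (f y) * 1"
        using lip_approx_le_fun[of "\<lambda>(x, y). G x y" i "(x, y)"]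
        by (intro mult_mono) (auto simp: indicator_def)
      then show "?s i y \<le> G x y * ennreal (f y)" by simp
    qed
  qed
  then have "(\<integral>\<^sup>+y. G x y * ennreal (f y) \<partial>\<nu>') = (\<integral>\<^sup>+y. (SUP i. ?s i y) \<partial>\<nu>')" by simp
  also have "\<dots> = (SUP i. \<integral>\<^sup>+y. ?s i y \<partial>\<nu>')"
    by (rule nn_integral_monotone_convergence_SUP[OF mono]) measurable
  also have "\<dots> \<le> ?L" by (rule SUP_least) (rule main[OF K(1)])
  finally show ?thesis .
qed

section \<open>Potentials of Kato measures\<close>

lemma C0_continuous: "u \<in> C0 \<Longrightarrow> continuous_on UNIV u"
  by (simp add: C0_def)

lemma C0_bounded:
  fixes u :: "'x::topological_space \<Rightarrow> real"
  assumes "u \<in> C0"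
  obtains B where "\<And>x. \<bar>u x\<bar> \<le> B"
proof -
  obtain K where K: "compact K" "\<And>x. x \<notin> K \<Longrightarrow> \<bar>u x\<bar> < 1"
    using assms unfolding C0_def by (auto dest: spec[of _ 1])
  have "bounded (u ` K)"
    by (intro compact_imp_bounded compact_continuous_image K(1) continuous_on_subset[OF C0_continuous[OF assms]]) auto
  then obtain B where B: "\<And>x. x \<in> K \<Longrightarrow> \<bar>u x\<bar> \<le> B" by (auto simp: bounded_iff)
  have "\<bar>u x\<bar> \<le> max B 1" for x using B[of x] K(2)[of x] by (cases "x \<in> K") auto
  then show thesis by (rule that)
qed

lemma kato_radon: "kato_measure G \<mu> \<Longrightarrow> radon_measure \<mu>"
  by (simp add: kato_measure_def)

lemma kato_sets: "kato_measure G \<mu> \<Longrightarrow> sets \<mu> = sets borel"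
  by (simp add: kato_measure_def radon_measure_def)

lemma kato_finite: "kato_measure G \<mu> \<Longrightarrow> (\<integral>\<^sup>+y. G x y \<partial>\<mu>) < \<infinity>"
  by (simp add: kato_measure_def green_op_def)

lemma lsc_section_measurable:
  assumes "lower_semicontinuous (\<lambda>(x, y). G x y)"
  shows "G x \<in> borel_measurable borel"
proof (rule lower_semicontinuous_measurable)
  show "lower_semicontinuous (G x)"
    unfolding lower_semicontinuous_def
  proof
    fix c
    have "open (Pair x -` {z. c < (case z of (x, y) \<Rightarrow> G x y)})"
      using assms unfolding lower_semicontinuous_def
      by (intro open_vimage continuous_intros) auto
    then show "open {y. c < G x y}" by (simp add: vimage_def)
  qed
qed

text \<open>Real-valued: \<open>enn2real\<close> replaces infinite values of G by 0, and for a Kato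
  measure these occur, for each x, only on a null set.\<close>

definition potential :: "('x \<Rightarrow> 'x \<Rightarrow> ennreal) \<Rightarrow> 'x measure \<Rightarrow> ('x \<Rightarrow> real) \<Rightarrow> 'x \<Rightarrow> real" where
  "potential G \<mu> f x = (\<integral>y. enn2real (G x y) * f y \<partial>\<mu>)"

context
  fixes G :: "'x::{metric_space, second_countable_topology} \<Rightarrow> 'x \<Rightarrow> ennreal"
  assumes lsc: "lower_semicontinuous (\<lambda>(x, y). G x y)"
begin

lemma G_measurable: "sets \<mu> = sets borel \<Longrightarrow> G x \<in> borel_measurable \<mu>"
  using lsc_section_measurable[OF lsc] by (simp cong: measurable_cong_sets)

lemma AE_G_finite: "kato_measure G \<mu> \<Longrightarrow> AE y in \<mu>. G x y < \<infinity>"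
  using nn_integral_PInf_AE[OF G_measurable[OF kato_sets], of G \<mu> x] kato_finite[of G \<mu> x]
  by (auto simp: less_top)

lemma integrable_G:
  assumes \<mu>: "kato_measure G \<mu>"
  shows "integrable \<mu> (\<lambda>y. enn2real (G x y))"
proof (rule integrableI_nonneg)
  have [measurable]: "G x \<in> borel_measurable \<mu>" by (rule G_measurable[OF kato_sets[OF \<mu>]])
  show "(\<lambda>y. enn2real (G x y)) \<in> borel_measurable \<mu>" by measurable
  have "(\<integral>\<^sup>+y. ennreal (enn2real (G x y)) \<partial>\<mu>) = (\<integral>\<^sup>+y. G x y \<partial>\<mu>)"
    using AE_G_finite[OF \<mu>, of x] by (intro nn_integral_cong_AE) (auto elim: eventually_mono)
  then show "(\<integral>\<^sup>+y. ennreal (enn2real (G x y)) \<partial>\<mu>) < \<infinity>" using kato_finite[OF \<mu>, of x] by simp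
qed simp

lemma integrable_G_mult:
  assumes \<mu>: "kato_measure G \<mu>" and f: "f \<in> borel_measurable borel" "\<And>y. \<bar>f y\<bar> \<le> B"
  shows "integrable \<mu> (\<lambda>y. enn2real (G x y) * f y)"
proof (rule Bochner_Integration.integrable_bound)
  show "integrable \<mu> (\<lambda>y. enn2real (G x y) * B)" by (intro integrable_mult_left integrable_G[OF \<mu>])
  have [measurable]: "G x \<in> borel_measurable \<mu>" by (rule G_measurable[OF kato_sets[OF \<mu>]])
  have [measurable]: "f \<in> borel_measurable \<mu>" using f(1) kato_sets[OF \<mu>] by (simp cong: measurable_cong_sets)
  show "(\<lambda>y. enn2real (G x y) * f y) \<in> borel_measurable \<mu>" by measurable
  show "AE y in \<mu>. norm (enn2real (G x y) * f y) \<le> norm (enn2real (G x y) * B)"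
    using order_trans[OF f(2) abs_ge_self] by (intro AE_I2) (auto simp: abs_mult intro!: mult_left_mono)
qed

lemma nn_potential:
  assumes \<mu>: "kato_measure G \<mu>" and f: "f \<in> borel_measurable borel" "\<And>y. 0 \<le> f y" "\<And>y. f y \<le> B"
  shows "(\<integral>\<^sup>+y. G x y * ennreal (f y) \<partial>\<mu>) = ennreal (potential G \<mu> f x)"
proof -
  have "(\<integral>\<^sup>+y. G x y * ennreal (f y) \<partial>\<mu>) = (\<integral>\<^sup>+y. ennreal (enn2real (G x y) * f y) \<partial>\<mu>)"
    using AE_G_finite[OF \<mu>, of x] f(2) by (intro nn_integral_cong_AE) (auto elim!: eventually_mono simp: ennreal_mult)
  also have "\<dots> = ennreal (potential G \<mu> f x)"
    unfolding potential_def using f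
    by (intro nn_integral_eq_integral integrable_G_mult[OF \<mu>, where B=B] AE_I2) auto
  finally show ?thesis .
qed

lemma potential_one: "kato_measure G \<mu> \<Longrightarrow> potential G \<mu> (\<lambda>_. 1) x = enn2real (green_op G \<mu> (\<lambda>_. 1) x)"
  using nn_potential[of \<mu> "\<lambda>_. 1" 1 x] integrable_G[of \<mu> x]
  by (simp add: green_op_def potential_def)

lemma potential_affine:
  assumes \<mu>: "kato_measure G \<mu>" and f: "f \<in> borel_measurable borel" "\<And>y. \<bar>f y\<bar> \<le> B"
  shows "potential G \<mu> (\<lambda>y. a * f y + b) x = a * potential G \<mu> f x + b * potential G \<mu> (\<lambda>_. 1) x"
proof -
  have "potential G \<mu> (\<lambda>y. a * f y + b) x = (\<integral>y. a * (enn2real (G x y) * f y) + b * (enn2real (G x y) * 1) \<partial>\<mu>)"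
    unfolding potential_def by (intro Bochner_Integration.integral_cong) (auto simp: algebra_simps)
  also have "\<dots> = a * potential G \<mu> f x + b * potential G \<mu> (\<lambda>_. 1) x"
    unfolding potential_def
    using integrable_G_mult[OF \<mu> f, of x] integrable_G[OF \<mu>, of x] by (subst Bochner_Integration.integral_add) auto
  finally show ?thesis .
qed

lemma potential_abs_le:
  assumes \<mu>: "kato_measure G \<mu>" and f: "f \<in> borel_measurable borel" "\<And>y. \<bar>f y\<bar> \<le> B"
  shows "\<bar>potential G \<mu> f x\<bar> \<le> B * potential G \<mu> (\<lambda>_. 1) x"
proof -
  have "\<bar>potential G \<mu> f x\<bar> \<le> (\<integral>y. \<bar>enn2real (G x y) * f y\<bar> \<partial>\<mu>)"
    unfolding potential_def by (rule integral_abs_bound)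
  also have "\<dots> \<le> (\<integral>y. B * enn2real (G x y) \<partial>\<mu>)"
    using f(2) by (intro integral_mono integrable_abs integrable_G_mult[OF \<mu> f] integrable_mult_right integrable_G[OF \<mu>])
      (auto simp: abs_mult mult.commute mult_right_mono)
  finally show ?thesis by (simp add: potential_def)
qed

text \<open>Base points vary together with the measures for two reasons: a constant sequence of
  measures yields continuity of a single potential, and convergent sequences of base points yield
  uniformity on compact sets.\<close>

lemma potential_sequential:
  fixes f :: "'x \<Rightarrow> real"
  assumes lc: "locally compact (UNIV :: 'x set)"
    and kato: "\<And>k. kato_measure G (\<nu> k)" "kato_measure G \<nu>'" and vague: "vague_limit \<nu> \<nu>'"
    and one: "(\<lambda>k. potential G (\<nu> k) (\<lambda>_. 1) (xs k)) \<longlonglongrightarrow> potential G \<nu>' (\<lambda>_. 1) x"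
    and x: "xs \<longlonglongrightarrow> x" and f: "continuous_on UNIV f" "\<And>y. \<bar>f y\<bar> \<le> B"
  shows "(\<lambda>k. potential G (\<nu> k) f (xs k)) \<longlonglongrightarrow> potential G \<nu>' f x"
proof -
  have eventually_gt: "\<forall>\<^sub>F k in sequentially. potential G \<nu>' h x - e < potential G (\<nu> k) h (xs k)"
    if h: "continuous_on UNIV h" "\<And>y. 0 \<le> h y" "\<And>y. h y \<le> 1" and e: "0 < e" for h e
  \<comment> \<open>The liminf inequality lives in \<open>ennreal\<close>, where a negative level is
    truncated to 0; such levels are trivial because potentials of h are nonnegative.\<close>
  proof (cases "potential G \<nu>' h x - e < 0")
    case True
    moreover have "0 \<le> potential G (\<nu> k) h (xs k)" for k
      unfolding potential_def using h by (intro integral_nonneg_AE AE_I2) auto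
    ultimately show ?thesis by (intro always_eventually allI) (rule less_le_trans)
  next
    case False
    have [measurable]: "h \<in> borel_measurable borel" using h(1) by (rule borel_measurable_continuous_onI)
    have "ennreal (potential G \<nu>' h x) \<le> liminf (\<lambda>k. ennreal (potential G (\<nu> k) h (xs k)))"
      using vague_lsc_liminf[OF lc lsc kato(1)[THEN kato_radon] kato(2)[THEN kato_radon] vague x h]
      by (simp add: nn_potential[OF kato(1) _ h(2,3)] nn_potential[OF kato(2) _ h(2,3)])
    moreover have "ennreal (potential G \<nu>' h x - e) < ennreal (potential G \<nu>' h x)"
      using False e by (simp add: ennreal_less_iff)
    ultimately have "ennreal (potential G \<nu>' h x - e) < liminf (\<lambda>k. ennreal (potential G (\<nu> k) h (xs k)))"
      by (rule less_le_trans[rotated])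
    then have "\<forall>\<^sub>F k in sequentially. ennreal (potential G \<nu>' h x - e) < ennreal (potential G (\<nu> k) h (xs k))"
      by (rule less_LiminfD)
    then show ?thesis
    proof eventually_elim
      case (elim k)
      then show ?case using False by (simp add: ennreal_less_iff)
    qed
  qed
  have unit: "(\<lambda>k. potential G (\<nu> k) h (xs k)) \<longlonglongrightarrow> potential G \<nu>' h x"
    if h: "continuous_on UNIV h" "\<And>y. 0 \<le> h y" "\<And>y. h y \<le> 1" for h
  proof (rule order_tendstoI)
    fix a assume "a < potential G \<nu>' h x"
    then show "\<forall>\<^sub>F k in sequentially. a < potential G (\<nu> k) h (xs k)"
      using eventually_gt[OF h, of "potential G \<nu>' h x - a"] by simp
  next
    fix a assume a: "potential G \<nu>' h x < a"
    define e where "e = (a - potential G \<nu>' h x) / 2"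
    have e: "0 < e" using a by (simp add: e_def)
    have hm: "h \<in> borel_measurable borel" using h(1) by (rule borel_measurable_continuous_onI)
    have hb: "\<bar>h y\<bar> \<le> 1" for y using h(2,3)[of y] by simp
    have compl: "potential G \<mu> (\<lambda>y. 1 - h y) z = potential G \<mu> (\<lambda>_. 1) z - potential G \<mu> h z"
      if "kato_measure G \<mu>" for \<mu> z
      using potential_affine[OF that hm hb, of "-1" 1 z] by simp
    have "continuous_on UNIV (\<lambda>y. 1 - h y)" using h(1) by (intro continuous_intros)
    from eventually_gt[OF this _ _ e]
    have "\<forall>\<^sub>F k in sequentially. potential G \<nu>' (\<lambda>y. 1 - h y) x - e < potential G (\<nu> k) (\<lambda>y. 1 - h y) (xs k)"
      using h(2,3) by auto
    moreover have "\<forall>\<^sub>F k in sequentially. potential G (\<nu> k) (\<lambda>_. 1) (xs k) < potential G \<nu>' (\<lambda>_. 1) x + e"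
      using e by (intro order_tendstoD(2)[OF one]) auto
    ultimately show "\<forall>\<^sub>F k in sequentially. potential G (\<nu> k) h (xs k) < a"
    proof eventually_elim
      case (elim k)
      then show ?case unfolding compl[OF kato(1)] compl[OF kato(2)] e_def by (simp add: field_simps)
    qed
  qed
  \<comment> \<open>The + 1 keeps c positive even for B = 0, so that h = (f + c) / (2 c) is defined
    and takes values in [0, 1].\<close>
  define c where "c = \<bar>B\<bar> + 1"
  have c: "0 < c" by (simp add: c_def)
  have fc: "\<bar>f y\<bar> \<le> c" for y using f(2)[of y] unfolding c_def by arith
  define h where "h y = (f y + c) / (2 * c)" for y
  have h: "continuous_on UNIV h" "\<And>y. 0 \<le> h y" "\<And>y. h y \<le> 1"
  proof -
    show "continuous_on UNIV h" unfolding h_def using c by (intro continuous_intros f(1)) auto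
    show "0 \<le> h y" "h y \<le> 1" for y
      using fc[of y] c unfolding h_def by (auto simp: divide_le_eq_1 zero_le_divide_iff)
  qed
  have hm: "h \<in> borel_measurable borel" using h(1) by (rule borel_measurable_continuous_onI)
  have hb: "\<bar>h y\<bar> \<le> 1" for y using h(2,3)[of y] by simp
  have f_eq: "f = (\<lambda>y. (2 * c) * h y + (- c))" using c by (auto simp: h_def)
  have pf: "potential G \<mu> f z = (2 * c) * potential G \<mu> h z + (- c) * potential G \<mu> (\<lambda>_. 1) z"
    if "kato_measure G \<mu>" for \<mu> z
    unfolding f_eq by (rule potential_affine[OF that hm hb])
  show ?thesis unfolding pf[OF kato(1)] pf[OF kato(2)] by (intro tendsto_intros unit[OF h] one)
qed

text \<open>Continuity is the sequential statement for a constant sequence of measures; decay at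
  infinity is inherited from the potential of 1.\<close>

lemma potential_C0:
  fixes f :: "'x \<Rightarrow> real"
  assumes lc: "locally compact (UNIV :: 'x set)" and \<mu>: "kato_measure G \<mu>"
    and f: "continuous_on UNIV f" "\<And>y. \<bar>f y\<bar> \<le> B"
  shows "potential G \<mu> f \<in> C0"
  unfolding C0_def
proof (intro CollectI conjI allI impI)
  have one: "potential G \<mu> (\<lambda>_. 1) \<in> C0"
    using \<mu> unfolding kato_measure_def potential_one[OF \<mu>, abs_def] by simp
  have fm: "f \<in> borel_measurable borel" using f(1) by (rule borel_measurable_continuous_onI)
  show "continuous_on UNIV (potential G \<mu> f)"
    unfolding continuous_on_sequentially
  proof (intro allI ballI impI, elim conjE)
    fix xs x assume x: "xs \<longlonglongrightarrow> (x :: 'x)"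
    have "(\<lambda>k. potential G \<mu> (\<lambda>_. 1) (xs k)) \<longlonglongrightarrow> potential G \<mu> (\<lambda>_. 1) x"
      using C0_continuous[OF one] x by (auto simp: continuous_on_sequentially o_def)
    then show "(potential G \<mu> f \<circ> xs) \<longlonglongrightarrow> potential G \<mu> f x"
      unfolding o_def by (intro potential_sequential[OF lc \<mu> \<mu> _ _ x f]) (auto simp: vague_limit_def)
  qed
  fix e :: real assume e: "0 < e"
  have "0 < e / (\<bar>B\<bar> + 1)" using e by simp
  then obtain K where K: "compact K" "\<And>x. x \<notin> K \<Longrightarrow> \<bar>potential G \<mu> (\<lambda>_. 1) x\<bar> < e / (\<bar>B\<bar> + 1)"
    using one unfolding C0_def by blast
  have "\<bar>potential G \<mu> f x\<bar> < e" if "x \<notin> K" for x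
  proof -
    have fB: "\<bar>f y\<bar> \<le> \<bar>B\<bar> + 1" for y using f(2)[of y] by simp
    have "\<bar>potential G \<mu> f x\<bar> \<le> (\<bar>B\<bar> + 1) * potential G \<mu> (\<lambda>_. 1) x"
      by (rule potential_abs_le[OF \<mu> fm fB])
    also have "\<dots> < e" using K(2)[OF that] by (simp add: field_simps abs_less_iff)
    finally show ?thesis .
  qed
  then show "\<exists>K. compact K \<and> (\<forall>x. x \<notin> K \<longrightarrow> \<bar>potential G \<mu> f x\<bar> < e)" using K(1) by blast
qed

text \<open>By contradiction. Outside a compact set the potentials of 1, and with them those of f,
  are small for all large indices, so bad points stay in a compact set; along a convergent
  subsequence of them both potentials have the same limit.\<close>

lemma potential_uniform_limit:
  fixes f :: "'x \<Rightarrow> real"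
  assumes lc: "locally compact (UNIV :: 'x set)"
    and kato: "\<And>k. kato_measure G (\<nu> k)" "kato_measure G \<nu>'" and vague: "vague_limit \<nu> \<nu>'"
    and one: "uniform_limit UNIV (\<lambda>k. potential G (\<nu> k) (\<lambda>_. 1)) (potential G \<nu>' (\<lambda>_. 1)) sequentially"
    and f: "continuous_on UNIV f" "\<And>y. \<bar>f y\<bar> \<le> B"
  shows "uniform_limit UNIV (\<lambda>k. potential G (\<nu> k) f) (potential G \<nu>' f) sequentially"
proof (rule uniform_limitI, rule ccontr)
  fix e :: real assume e: "0 < e"
    and "\<not> (\<forall>\<^sub>F k in sequentially. \<forall>x\<in>UNIV. dist (potential G (\<nu> k) f x) (potential G \<nu>' f x) < e)"
  then have inf: "\<exists>\<^sub>F k in sequentially. \<exists>x. e \<le> dist (potential G (\<nu> k) f x) (potential G \<nu>' f x)"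
    by (simp add: not_eventually not_less)
  have fm: "f \<in> borel_measurable borel" using f(1) by (rule borel_measurable_continuous_onI)
  have fB: "\<bar>f y\<bar> \<le> \<bar>B\<bar> + 1" for y using f(2)[of y] by simp
  \<comment> \<open>Off K the potentials of 1 are at most d in the limit and at most 2 d along the
    sequence; multiplied by |B| + 1 these give a total of 3 e / 4.\<close>
  define d where "d = e / (4 * (\<bar>B\<bar> + 1))"
  have aux: "0 < e / (4 * b) \<and> b * (e / (4 * b)) = e / 4" if "0 < b" for b using e that by auto
  have d: "0 < d" "(\<bar>B\<bar> + 1) * d = e / 4" using aux[OF abs_add_one_gt_zero, of B] unfolding d_def add.commute[of 1] by blast+
  have one0: "potential G \<nu>' (\<lambda>_. 1) \<in> C0" by (rule potential_C0[OF lc kato(2), where B=1]) auto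
  obtain K where K: "compact K" "\<And>x. x \<notin> K \<Longrightarrow> \<bar>potential G \<nu>' (\<lambda>_. 1) x\<bar> < d"
    using one0 d(1) unfolding C0_def by blast
  have "\<forall>\<^sub>F k in sequentially. \<forall>x\<in>UNIV. dist (potential G (\<nu> k) (\<lambda>_. 1) x) (potential G \<nu>' (\<lambda>_. 1) x) < d"
    by (rule uniform_limitD[OF one d(1)])
  then have "\<forall>\<^sub>F k in sequentially. \<forall>x. x \<notin> K \<longrightarrow> dist (potential G (\<nu> k) f x) (potential G \<nu>' f x) < e"
  proof eventually_elim
    case (elim k)
    show ?case
    proof (intro allI impI)
      fix x assume x: "x \<notin> K"
      have a: "potential G (\<nu> k) (\<lambda>_. 1) x \<le> 2 * d" "potential G \<nu>' (\<lambda>_. 1) x \<le> d"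
        using K(2)[OF x] bspec[OF elim UNIV_I, of x] unfolding dist_real_def by arith+
      have "\<bar>potential G (\<nu> k) f x\<bar> \<le> (\<bar>B\<bar> + 1) * potential G (\<nu> k) (\<lambda>_. 1) x"
        by (rule potential_abs_le[OF kato(1) fm fB])
      also have "\<dots> \<le> (\<bar>B\<bar> + 1) * (2 * d)" using a by (intro mult_left_mono) auto
      finally have 1: "\<bar>potential G (\<nu> k) f x\<bar> \<le> 2 * (e / 4)" using d(2) by simp
      have "\<bar>potential G \<nu>' f x\<bar> \<le> (\<bar>B\<bar> + 1) * potential G \<nu>' (\<lambda>_. 1) x"
        by (rule potential_abs_le[OF kato(2) fm fB])
      also have "\<dots> \<le> (\<bar>B\<bar> + 1) * d" using a by (intro mult_left_mono) auto
      finally have 2: "\<bar>potential G \<nu>' f x\<bar> \<le> e / 4" using d(2) by simp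
      show "dist (potential G (\<nu> k) f x) (potential G \<nu>' f x) < e"
        using 1 2 e unfolding dist_real_def by arith
    qed
  qed
  from frequently_eventually_frequently[OF inf this]
  have "\<exists>\<^sub>F k in sequentially. \<exists>x\<in>K. e \<le> dist (potential G (\<nu> k) f x) (potential G \<nu>' f x)"
    by (rule frequently_elim1) (meson not_le)
  then have inf: "infinite {k. \<exists>x\<in>K. e \<le> dist (potential G (\<nu> k) f x) (potential G \<nu>' f x)}" (is "infinite ?S")
    by (simp add: frequently_cofinite[symmetric] cofinite_eq_sequentially)
  \<comment> \<open>r picks indices at which K contains a bad point; s below makes the chosen bad
    points converge.\<close>
  obtain r :: "nat \<Rightarrow> nat" where r: "strict_mono r" "\<forall>k. r k \<in> ?S"
    using infinite_enumerate[OF inf] by blast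
  then have "\<forall>k. \<exists>x. x \<in> K \<and> e \<le> dist (potential G (\<nu> (r k)) f x) (potential G \<nu>' f x)" by blast
  from choice[OF this]
  obtain xs where xs: "\<And>k. xs k \<in> K" "\<And>k. e \<le> dist (potential G (\<nu> (r k)) f (xs k)) (potential G \<nu>' f (xs k))"
    by blast
  obtain x s where s: "strict_mono s" and x: "(xs \<circ> s) \<longlonglongrightarrow> x"
    using K(1) xs(1) unfolding compact_def by blast
  have rs: "strict_mono (r \<circ> s)" using r(1) s by (rule strict_mono_o)
  have "(\<lambda>k. potential G \<nu>' (\<lambda>_. 1) ((xs \<circ> s) k)) \<longlonglongrightarrow> potential G \<nu>' (\<lambda>_. 1) x"
    using C0_continuous[OF one0] x by (auto simp: continuous_on_sequentially o_def)
  moreover have "(\<lambda>k. potential G (\<nu> (r (s k))) (\<lambda>_. 1) (xs (s k)) - potential G \<nu>' (\<lambda>_. 1) (xs (s k))) \<longlonglongrightarrow> 0"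
  proof (rule LIMSEQ_I)
    fix d :: real assume "0 < d"
    have "\<forall>\<^sub>F k in sequentially. \<forall>x\<in>UNIV. dist (potential G (\<nu> k) (\<lambda>_. 1) x) (potential G \<nu>' (\<lambda>_. 1) x) < d"
      by (rule uniform_limitD[OF one \<open>0 < d\<close>])
    then obtain N where N: "\<And>k x. N \<le> k \<Longrightarrow> dist (potential G (\<nu> k) (\<lambda>_. 1) x) (potential G \<nu>' (\<lambda>_. 1) x) < d"
      unfolding eventually_sequentially by auto
    have sub: "k \<le> r (s k)" for k using seq_suble[OF rs, of k] by simp
    show "\<exists>N. \<forall>k\<ge>N. norm (potential G (\<nu> (r (s k))) (\<lambda>_. 1) (xs (s k)) - potential G \<nu>' (\<lambda>_. 1) (xs (s k)) - 0) < d"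
      unfolding diff_zero dist_norm[symmetric] by (intro exI[of _ N] allI impI N order_trans[OF _ sub])
  qed
  ultimately have one': "(\<lambda>k. potential G (\<nu> (r (s k))) (\<lambda>_. 1) ((xs \<circ> s) k)) \<longlonglongrightarrow> potential G \<nu>' (\<lambda>_. 1) x"
    using Lim_transform[of "\<lambda>k. potential G \<nu>' (\<lambda>_. 1) ((xs \<circ> s) k)" "potential G \<nu>' (\<lambda>_. 1) x" sequentially
        "\<lambda>k. potential G (\<nu> (r (s k))) (\<lambda>_. 1) ((xs \<circ> s) k)"] by simp
  have "vague_limit (\<lambda>k. \<nu> (r (s k))) \<nu>'"
    unfolding vague_limit_def
  proof
    fix h :: "'x \<Rightarrow> real" assume "h \<in> Cc"
    then have "(\<lambda>n. \<integral>x. h x \<partial>\<nu> n) \<longlonglongrightarrow> (\<integral>x. h x \<partial>\<nu>')" using vague by (simp add: vague_limit_def)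
    from LIMSEQ_subseq_LIMSEQ[OF this rs]
    show "(\<lambda>n. \<integral>x. h x \<partial>\<nu> (r (s n))) \<longlonglongrightarrow> (\<integral>x. h x \<partial>\<nu>')" by (simp add: o_def)
  qed
  from potential_sequential[OF lc kato(1) kato(2) this one' x f]
  have 1: "(\<lambda>k. potential G (\<nu> (r (s k))) f ((xs \<circ> s) k)) \<longlonglongrightarrow> potential G \<nu>' f x" .
  have 2: "(\<lambda>k. potential G \<nu>' f ((xs \<circ> s) k)) \<longlonglongrightarrow> potential G \<nu>' f x"
    using C0_continuous[OF potential_C0[OF lc kato(2) f]] x by (auto simp: continuous_on_sequentially o_def)
  have "(\<lambda>k. dist (potential G (\<nu> (r (s k))) f ((xs \<circ> s) k)) (potential G \<nu>' f ((xs \<circ> s) k))) \<longlonglongrightarrow> dist (potential G \<nu>' f x) (potential G \<nu>' f x)"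
    by (rule tendsto_dist[OF 1 2])
  moreover have "e \<le> dist (potential G (\<nu> (r (s k))) f ((xs \<circ> s) k)) (potential G \<nu>' f ((xs \<circ> s) k))" for k
    using xs(2)[of "s k"] by simp
  ultimately have "e \<le> dist (potential G \<nu>' f x) (potential G \<nu>' f x)"
    by (intro LIMSEQ_le_const) auto
  then show False using e by simp
qed

end

section \<open>The state space with cemetery\<close>

lemma space_borel_cem [simp]: "space borel_cem = UNIV"
  by (simp add: borel_cem_def space_measure_of_conv)

lemma openin_sets_borel_cem: "openin one_point_topology U \<Longrightarrow> U \<in> sets borel_cem"
  unfolding borel_cem_def by (subst sets_measure_of) auto

lemma Some_image_borel_cem:
  assumes "B \<in> sets borel"
  shows "Some ` B \<in> sets (borel_cem :: 'x::t2_space option measure)"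
proof -
  have top: "range Some \<in> sets (borel_cem :: 'x option measure)"
    by (rule openin_sets_borel_cem) (simp add: openin_one_point_topology inj_vimage_image_eq image_iff)
  have "B \<in> sigma_sets UNIV {U. open U}" using assms by (simp add: borel_def)
  then show ?thesis
  proof induction
    case (Basic U)
    then show ?case by (intro openin_sets_borel_cem) (auto simp: openin_one_point_topology inj_vimage_image_eq)
  next
    case (Compl B)
    have "Some ` (UNIV - B) = range Some - Some ` B" by auto
    then show ?case using Compl top by (metis sets.Diff)
  next
    case (Union B)
    have "Some ` (\<Union>i. B i) = (\<Union>i. Some ` B i)" by auto
    then show ?case using Union by auto
  qed simp
qed

lemma None_borel_cem: "{None} \<in> sets (borel_cem :: 'x::t2_space option measure)"
proof -
  have "{None} = space borel_cem - Some ` (UNIV :: 'x set)" by (auto simp: notin_range_Some)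
  then show ?thesis using Some_image_borel_cem[of UNIV] by (metis sets.compl_sets sets.top space_borel)
qed

lemma measurable_ext0:
  assumes u: "u \<in> borel \<rightarrow>\<^sub>M M" and 0: "0 \<in> space M"
  shows "ext0 u \<in> (borel_cem :: 'x::t2_space option measure) \<rightarrow>\<^sub>M M"
proof (rule measurableI)
  show "ext0 u z \<in> space M" for z
    using measurable_space[OF u] 0 by (cases z) (auto simp: ext0_def)
  fix A assume A: "A \<in> sets M"
  have eq: "ext0 u -` A \<inter> space borel_cem = Some ` (u -` A \<inter> space borel) \<union> (if 0 \<in> A then {None} else {})"
  proof (rule set_eqI)
    fix z :: "'x option"
    show "z \<in> ext0 u -` A \<inter> space borel_cem \<longleftrightarrow> z \<in> Some ` (u -` A \<inter> space borel) \<union> (if 0 \<in> A then {None} else {})"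
      by (cases z) (auto simp: ext0_def)
  qed
  then show "ext0 u -` A \<inter> space borel_cem \<in> sets borel_cem"
    unfolding eq using None_borel_cem[where 'x='x] Some_image_borel_cem[OF measurable_sets[OF u A]]
    by (cases "0 \<in> A") (simp_all add: sets.Un del: Un_insert_right)
qed

lemma initial_lawD: "initial_law \<nu> \<Longrightarrow> prob_space \<nu>" "initial_law \<nu> \<Longrightarrow> sets \<nu> = sets borel_cem"
  by (auto simp: initial_law_def)

section \<open>The strong Markov property for path functionals\<close>

locale standard_markov =
  fixes X :: "('w, 'x::t2_space) process"
  assumes std: "standard_process X"
begin

lemma markov: "markov_process X"
  using std by (simp add: standard_process_def)

lemma space_events: "space (events X) = UNIV"
  using markov by (simp add: markov_process_def)

lemma filtration_filt: "filtration UNIV (filt X)"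
  using markov by (simp add: markov_process_def)

sublocale F: filtration UNIV "filt X" by (rule filtration_filt)

lemma filt_events: "sets (filt X t) \<subseteq> sets (events X)"
  using markov by (simp add: markov_process_def)

lemma prob_law: "prob_space (law X z)"
  using markov by (simp add: markov_process_def)

lemma sets_law [measurable_cong]: "sets (law X z) = sets (events X)"
  using markov by (simp add: markov_process_def)

lemma space_law [simp]: "space (law X z) = UNIV"
  using sets_eq_imp_space_eq[OF sets_law] space_events by simp

lemma emeasure_law_UNIV [simp]: "emeasure (law X z) UNIV = 1"
  using prob_space.emeasure_space_1[OF prob_law] by simp

lemma pos_filt: "pos X t \<in> filt X t \<rightarrow>\<^sub>M borel_cem"
  using markov by (simp add: markov_process_def)

lemma pos_measurable [measurable]: "pos X t \<in> events X \<rightarrow>\<^sub>M borel_cem"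
  using pos_filt[of t] filt_events[of t] space_events F.space_F[of t]
  by (auto simp: measurable_def)

lemma pos_infinity: "pos X \<infinity> \<omega> = None"
  using markov by (simp add: markov_process_def)

lemma pos_absorbing: "s \<le> t \<Longrightarrow> pos X s \<omega> = None \<Longrightarrow> pos X t \<omega> = None"
  using markov unfolding markov_process_def by blast

lemma pos_shift: "pos X s (shift X t \<omega>) = pos X (t + s) \<omega>"
  using markov by (simp add: markov_process_def)

lemma transition_measurable:
  "B \<in> sets borel_cem \<Longrightarrow> (\<lambda>z. emeasure (law X z) {\<omega>. pos X t \<omega> \<in> B}) \<in> borel_measurable borel_cem"
  using markov by (simp add: markov_process_def)

lemma normal: "AE \<omega> in law X z. pos X 0 \<omega> = z"
  using std by (simp add: standard_process_def)

lemma completed_filt: "completed X (sets (filt X t)) \<subseteq> sets (filt X t)"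
  using std by (simp add: standard_process_def)

lemma filt_right_continuous: "t < \<infinity> \<Longrightarrow> sets (filt X t) = (\<Inter>s\<in>{t<..}. sets (filt X s))"
  using std by (simp add: standard_process_def)

lemma paths_right_continuous:
  "AE \<omega> in law X z. \<forall>t<\<infinity>. limitin one_point_topology (\<lambda>s. pos X s \<omega>) (pos X t \<omega>) (at_right t)"
proof -
  have "AE \<omega> in law X z. (\<forall>t<\<infinity>. limitin one_point_topology (\<lambda>s. pos X s \<omega>) (pos X t \<omega>) (at_right t)) \<and>
        (\<forall>t. 0 < t \<and> t < lifetime X \<omega> \<longrightarrow> (\<exists>l. limitin one_point_topology (\<lambda>s. pos X s \<omega>) l (at_left t)))"
    using std unfolding standard_process_def by blast
  then show ?thesis by eventually_elim blast
qed

lemma quasi_left_continuous: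
  assumes "\<And>n::nat. stopping_time (filt X) (T n)" "\<And>\<omega>. incseq (\<lambda>n. T n \<omega>)"
  shows "AE \<omega> in law X z. (SUP n. T n \<omega>) < lifetime X \<omega> \<longrightarrow>
           limitin one_point_topology (\<lambda>n. pos X (T n \<omega>) \<omega>) (pos X (SUP n. T n \<omega>) \<omega>) sequentially"
  using std assms unfolding standard_process_def by blast

lemma pos_stopping_pre_sigma:
  "stopping_time (filt X) T \<Longrightarrow> (\<lambda>\<omega>. pos X (T \<omega>) \<omega>) \<in> F.pre_sigma T \<rightarrow>\<^sub>M borel_cem"
  using std unfolding standard_process_def by blast

lemma strong_markov_one:
  assumes "stopping_time (filt X) T" "s < \<infinity>" "B \<in> sets borel_cem" "\<Lambda> \<in> sets (F.pre_sigma T)"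
  shows "emeasure (law X z) (\<Lambda> \<inter> {\<omega>. pos X (T \<omega> + s) \<omega> \<in> B}) =
           (\<integral>\<^sup>+\<omega>\<in>\<Lambda>. emeasure (law X (pos X (T \<omega>) \<omega>)) {\<omega>'. pos X s \<omega>' \<in> B} \<partial>law X z)"
  using std assms unfolding standard_process_def by blast

lemma pre_sigma_events:
  assumes "stopping_time (filt X) T"
  shows "sets (F.pre_sigma T) \<subseteq> sets (events X)"
proof
  fix A assume "A \<in> sets (F.pre_sigma T)"
  from F.sets_pre_sigmaD[OF assms this, of \<infinity>] have "A \<in> sets (filt X \<infinity>)" by simp
  then show "A \<in> sets (events X)" using filt_events by blast
qed

lemma pos_stopping [measurable]:
  assumes "stopping_time (filt X) T"
  shows "(\<lambda>\<omega>. pos X (T \<omega>) \<omega>) \<in> events X \<rightarrow>\<^sub>M borel_cem"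
  using pos_stopping_pre_sigma[OF assms] pre_sigma_events[OF assms] space_events F.space_pre_sigma[of T]
  by (auto simp: measurable_def)

lemma stopping_time_add:
  assumes "stopping_time (filt X) T" "s < \<infinity>"
  shows "stopping_time (filt X) (\<lambda>\<omega>. T \<omega> + s)"
proof
  fix t
  show "Measurable.pred (filt X t) (\<lambda>\<omega>. T \<omega> + s \<le> t)"
  proof (cases "t < \<infinity> \<and> s \<le> t")
    case True
    have "T \<omega> + s \<le> t \<longleftrightarrow> T \<omega> \<le> t - s" for \<omega>
      using True assms(2) by (cases "T \<omega>"; cases s; cases t)
        (auto simp: ennreal_plus[symmetric] ennreal_minus top_add top_unique simp del: ennreal_plus)
    moreover have "t - s \<le> t" by (rule diff_le_self_ennreal)
    ultimately show ?thesis using F.stopping_time_le_const[OF assms(1)] by simp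
  next
    case False
    have "(\<lambda>\<omega>. T \<omega> + s \<le> t) = (\<lambda>_. t = \<infinity>)"
    proof (cases "t = \<infinity>")
      case t: False
      then have "t < s" using False by (auto simp: less_top not_le)
      then have "\<not> T \<omega> + s \<le> t" for \<omega> using add_increasing[of "T \<omega>" s s] by (auto simp: not_le intro: less_le_trans)
      then show ?thesis using t by auto
    qed simp
    then show ?thesis by simp
  qed
qed

text \<open>The process axioms describe \<open>shift\<close> only through the coordinates
  \<open>pos\<close>. This is therefore the sigma-algebra into which a random shift can be proved
  measurable.\<close>

definition path_space :: "'w measure" where
  "path_space = sigma UNIV {pos X s -` B | s B. s \<le> \<infinity> \<and> B \<in> sets borel_cem}"

lemma sets_path_space: "sets path_space = natural0 X \<infinity>"
  unfolding path_space_def natural0_def by (subst sets_measure_of) auto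

lemma space_path_space [simp]: "space path_space = UNIV"
  unfolding path_space_def by (simp add: space_measure_of_conv)

lemma measurable_into_path_space:
  assumes "f \<in> space M \<rightarrow> UNIV" "\<And>s. (\<lambda>\<omega>. pos X s (f \<omega>)) \<in> M \<rightarrow>\<^sub>M borel_cem"
  shows "f \<in> M \<rightarrow>\<^sub>M path_space"
  unfolding path_space_def
proof (rule measurable_measure_of)
  fix A assume "A \<in> {pos X s -` B | s B. s \<le> \<infinity> \<and> B \<in> sets borel_cem}"
  then obtain s B where A: "A = pos X s -` B" "B \<in> sets borel_cem" by blast
  have "f -` A \<inter> space M = (\<lambda>\<omega>. pos X s (f \<omega>)) -` B \<inter> space M" by (auto simp: A)
  then show "f -` A \<inter> space M \<in> sets M" using measurable_sets[OF assms(2) A(2)] by simp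
qed auto

lemma id_path_space [measurable]: "(\<lambda>\<omega>. \<omega>) \<in> events X \<rightarrow>\<^sub>M path_space"
  by (rule measurable_into_path_space) auto

lemma natural0_events: "natural0 X \<infinity> \<subseteq> sets (events X)"
  using measurable_sets[OF id_path_space] sets_path_space space_events by auto

lemma shift_measurable:
  assumes T: "stopping_time (filt X) T"
  shows "(\<lambda>\<omega>. shift X (T \<omega>) \<omega>) \<in> events X \<rightarrow>\<^sub>M path_space"
proof (rule measurable_into_path_space)
  fix s
  show "(\<lambda>\<omega>. pos X s (shift X (T \<omega>) \<omega>)) \<in> events X \<rightarrow>\<^sub>M borel_cem"
  proof (cases "s = \<infinity>")
    case True
    then show ?thesis by (simp add: pos_shift pos_infinity[simplified])
  next
    case False
    then have "s < \<infinity>" by (simp add: less_top)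
    then show ?thesis unfolding pos_shift by (intro pos_stopping stopping_time_add T)
  qed
qed simp

lemma transition_kernel:
  "(\<lambda>z. distr (law X z) borel_cem (pos X t)) \<in> borel_cem \<rightarrow>\<^sub>M subprob_algebra borel_cem"
proof (rule measurable_subprob_algebra)
  fix z
  have m: "pos X t \<in> law X z \<rightarrow>\<^sub>M borel_cem" by measurable
  show "subprob_space (distr (law X z) borel_cem (pos X t))"
    by (intro prob_space_imp_subprob_space prob_space.prob_space_distr[OF prob_law m])
next
  fix B :: "'x option set" assume B: "B \<in> sets borel_cem"
  have "emeasure (distr (law X z) borel_cem (pos X t)) B = emeasure (law X z) {\<omega>. pos X t \<omega> \<in> B}" for z
  proof -
    have m: "pos X t \<in> law X z \<rightarrow>\<^sub>M borel_cem" by measurable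
    show ?thesis using emeasure_distr[OF m B] by (simp add: vimage_def)
  qed
  then show "(\<lambda>z. emeasure (distr (law X z) borel_cem (pos X t)) B) \<in> borel_measurable borel_cem"
    using transition_measurable[OF B] by simp
qed simp

lemma transition_nn_measurable:
  assumes f: "f \<in> borel_measurable borel_cem"
  shows "(\<lambda>z. \<integral>\<^sup>+\<omega>. f (pos X t \<omega>) \<partial>law X z) \<in> borel_measurable borel_cem"
proof -
  have "(\<integral>\<^sup>+\<omega>. f (pos X t \<omega>) \<partial>law X z) = (\<integral>\<^sup>+y. f y \<partial>distr (law X z) borel_cem (pos X t))" for z
    using f by (intro nn_integral_distr[symmetric]) auto
  then show ?thesis
    using measurable_compose[OF transition_kernel nn_integral_measurable_subprob_algebra[OF f]] by simp
qed

text \<open>The passage from sets to functions is an identity of measures: the law of the position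
  at T + s on \<Lambda> is the law of the position at T on \<Lambda>, followed by the transition
  kernel.\<close>

lemma strong_markov_one_nn:
  assumes T: "stopping_time (filt X) T" and s: "s < \<infinity>" and \<Lambda>: "\<Lambda> \<in> sets (F.pre_sigma T)"
    and f: "f \<in> borel_measurable borel_cem"
  shows "(\<integral>\<^sup>+\<omega>\<in>\<Lambda>. f (pos X (T \<omega> + s) \<omega>) \<partial>law X z) = (\<integral>\<^sup>+\<omega>\<in>\<Lambda>. (\<integral>\<^sup>+\<omega>'. f (pos X s \<omega>') \<partial>law X (pos X (T \<omega>) \<omega>)) \<partial>law X z)"
proof -
  have \<Lambda>' [measurable]: "\<Lambda> \<in> sets (events X)" using \<Lambda> pre_sigma_events[OF T] by blast
  have [measurable]: "(\<lambda>\<omega>. pos X (T \<omega>) \<omega>) \<in> events X \<rightarrow>\<^sub>M borel_cem" by (rule pos_stopping[OF T])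
  have [measurable]: "(\<lambda>\<omega>. pos X (T \<omega> + s) \<omega>) \<in> events X \<rightarrow>\<^sub>M borel_cem"
    by (rule pos_stopping[OF stopping_time_add[OF T s]])
  let ?L = "density (law X z) (indicator \<Lambda>)"
  let ?N = "distr ?L borel_cem (\<lambda>\<omega>. pos X (T \<omega>) \<omega>)"
  let ?K = "\<lambda>z. distr (law X z) borel_cem (pos X s)"
  have K: "?K \<in> ?N \<rightarrow>\<^sub>M subprob_algebra borel_cem" using transition_kernel[of s] by simp
  have "distr ?L borel_cem (\<lambda>\<omega>. pos X (T \<omega> + s) \<omega>) = ?N \<bind> ?K"
  proof (rule measure_eqI)
    show "sets (distr ?L borel_cem (\<lambda>\<omega>. pos X (T \<omega> + s) \<omega>)) = sets (?N \<bind> ?K)"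
      by (subst sets_bind[where N=borel_cem]) auto
    fix B assume "B \<in> sets (distr ?L borel_cem (\<lambda>\<omega>. pos X (T \<omega> + s) \<omega>))"
    then have B [measurable]: "B \<in> sets borel_cem" by simp
    have KB: "emeasure (?K y) B = emeasure (law X y) {\<omega>'. pos X s \<omega>' \<in> B}" for y
      by (subst emeasure_distr) (auto simp: vimage_def)
    have S [measurable]: "{\<omega>. pos X (T \<omega> + s) \<omega> \<in> B} \<in> sets (law X z)"
      using measurable_sets[OF pos_stopping[OF stopping_time_add[OF T s]] B]
      by (simp add: sets_law vimage_def space_events)
    have "emeasure (distr ?L borel_cem (\<lambda>\<omega>. pos X (T \<omega> + s) \<omega>)) B
        = emeasure ?L {\<omega>. pos X (T \<omega> + s) \<omega> \<in> B}"
      by (subst emeasure_distr) (auto simp: vimage_def)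
    also have "\<dots> = emeasure (law X z) (\<Lambda> \<inter> {\<omega>. pos X (T \<omega> + s) \<omega> \<in> B})"
      using S \<Lambda>' by (intro emeasure_restricted) (simp_all add: sets_law)
    also have "\<dots> = (\<integral>\<^sup>+\<omega>. emeasure (?K (pos X (T \<omega>) \<omega>)) B \<partial>?L)"
      unfolding strong_markov_one[OF T s B \<Lambda>] KB
      by (subst nn_integral_density) (auto simp: mult.commute intro!: measurable_compose[OF _ transition_measurable])
    also have "\<dots> = (\<integral>\<^sup>+y. emeasure (?K y) B \<partial>?N)"
      by (subst nn_integral_distr) (auto simp: KB intro!: transition_measurable)
    also have "\<dots> = emeasure (?N \<bind> ?K) B"
      by (rule emeasure_bind[symmetric, OF _ K B]) simp
    finally show "emeasure (distr ?L borel_cem (\<lambda>\<omega>. pos X (T \<omega> + s) \<omega>)) B = emeasure (?N \<bind> ?K) B" .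
  qed
  then have eq: "(\<integral>\<^sup>+y. f y \<partial>distr ?L borel_cem (\<lambda>\<omega>. pos X (T \<omega> + s) \<omega>)) = (\<integral>\<^sup>+y. f y \<partial>(?N \<bind> ?K))" by simp
  have Kf: "(\<integral>\<^sup>+w. f w \<partial>?K y) = (\<integral>\<^sup>+\<omega>'. f (pos X s \<omega>') \<partial>law X y)" for y
    using f by (intro nn_integral_distr) auto
  note [measurable] = transition_nn_measurable[OF f, of s] f
  have "(\<integral>\<^sup>+y. f y \<partial>distr ?L borel_cem (\<lambda>\<omega>. pos X (T \<omega> + s) \<omega>)) = (\<integral>\<^sup>+\<omega>\<in>\<Lambda>. f (pos X (T \<omega> + s) \<omega>) \<partial>law X z)"
    by (subst nn_integral_distr) (auto simp: nn_integral_density mult.commute)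
  moreover have "(\<integral>\<^sup>+y. f y \<partial>(?N \<bind> ?K)) = (\<integral>\<^sup>+\<omega>\<in>\<Lambda>. (\<integral>\<^sup>+\<omega>'. f (pos X s \<omega>') \<partial>law X (pos X (T \<omega>) \<omega>)) \<partial>law X z)"
    by (subst nn_integral_bind[OF f K], unfold Kf, subst nn_integral_distr)
      (auto simp: nn_integral_density mult.commute)
  ultimately show ?thesis using eq by simp
qed

text \<open>Finite-dimensional distributions as iterated kernels. The listed times are absolute and
  meant to be sorted; a is the present time, so the kernel waits for t - a.\<close>

fun cylinder_prob :: "ennreal \<Rightarrow> ennreal list \<Rightarrow> (ennreal \<Rightarrow> 'x option set) \<Rightarrow> 'x option \<Rightarrow> ennreal" where
  "cylinder_prob a [] B z = 1"
| "cylinder_prob a (t # ts) B z =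
     (\<integral>\<^sup>+\<omega>. indicator (B t) (pos X (t - a) \<omega>) * cylinder_prob t ts B (pos X (t - a) \<omega>) \<partial>law X z)"

lemma cylinder_prob_measurable [measurable]:
  assumes [measurable]: "\<And>t. B t \<in> sets borel_cem"
  shows "cylinder_prob a ts B \<in> borel_measurable borel_cem"
proof (induction ts arbitrary: a)
  case Nil
  have "cylinder_prob a [] B = (\<lambda>_. 1)" by (rule ext) simp
  then show ?case by simp
next
  case (Cons t ts)
  have "(\<lambda>z. \<integral>\<^sup>+\<omega>. (\<lambda>y. indicator (B t) y * cylinder_prob t ts B y) (pos X (t - a) \<omega>) \<partial>law X z) \<in> borel_measurable borel_cem"
    using Cons.IH by (intro transition_nn_measurable) measurable
  then show ?case by simp
qed

text \<open>In the induction the event at the first time is absorbed into \<Lambda> and the process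
  restarts at T + (t - a). Hence T and \<Lambda> have to be general in the induction
  hypothesis.\<close>

lemma strong_markov_cylinder:
  assumes B [measurable]: "\<And>t. B t \<in> sets borel_cem"
    and "stopping_time (filt X) T" "\<Lambda> \<in> sets (F.pre_sigma T)"
    and "sorted ts" "\<forall>t\<in>set ts. a \<le> t \<and> t < \<infinity>" "a < \<infinity>"
  shows "emeasure (law X z) (\<Lambda> \<inter> {\<omega>. \<forall>t\<in>set ts. pos X (T \<omega> + (t - a)) \<omega> \<in> B t}) =
    (\<integral>\<^sup>+\<omega>\<in>\<Lambda>. cylinder_prob a ts B (pos X (T \<omega>) \<omega>) \<partial>law X z)"
  using assms(2-)
proof (induction ts arbitrary: a T \<Lambda>)
  case Nil
  have "\<Lambda> \<in> sets (law X z)" using Nil pre_sigma_events by (auto simp: sets_law)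
  then show ?case by simp
next
  case (Cons t ts)
  define T' where "T' \<omega> = T \<omega> + (t - a)" for \<omega>
  have ta: "t - a < \<infinity>" "a \<le> t" "t < \<infinity>" using Cons.prems by (auto intro: le_less_trans[OF diff_le_self_ennreal])
  have T': "stopping_time (filt X) T'" unfolding T'_def by (rule stopping_time_add[OF Cons.prems(1) ta(1)])
  define \<Lambda>' where "\<Lambda>' = \<Lambda> \<inter> {\<omega>. pos X (T' \<omega>) \<omega> \<in> B t}"
  have "(\<lambda>\<omega>. pos X (T' \<omega>) \<omega>) -` B t \<inter> space (F.pre_sigma T') \<in> sets (F.pre_sigma T')"
    by (rule measurable_sets[OF pos_stopping_pre_sigma[OF T'] B])
  moreover have "\<Lambda> \<in> sets (F.pre_sigma T')"
    using F.mono_pre_sigma[OF Cons.prems(1) T'] Cons.prems(2) by (auto simp: T'_def)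
  ultimately have \<Lambda>': "\<Lambda>' \<in> sets (F.pre_sigma T')"
    by (auto simp: \<Lambda>'_def F.space_pre_sigma vimage_def)
  have shift: "T' \<omega> + (s - t) = T \<omega> + (s - a)" if "s \<in> set ts" for s \<omega>
  proof -
    have "t \<le> s" using Cons.prems(3) that by simp
    moreover have "s < \<infinity>" using Cons.prems(4) that by simp
    ultimately have "(t - a) + (s - t) = s - a"
      using ta by (cases a; cases t; cases s) (auto simp: ennreal_minus ennreal_plus[symmetric] top_unique simp del: ennreal_plus)
    then show ?thesis by (simp add: T'_def add.assoc)
  qed
  have "\<Lambda> \<inter> {\<omega>. \<forall>s\<in>set (t # ts). pos X (T \<omega> + (s - a)) \<omega> \<in> B s} = \<Lambda>' \<inter> {\<omega>. \<forall>s\<in>set ts. pos X (T' \<omega> + (s - t)) \<omega> \<in> B s}"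
    using shift by (auto simp: \<Lambda>'_def) (auto simp: T'_def)
  also have "emeasure (law X z) \<dots> = (\<integral>\<^sup>+\<omega>\<in>\<Lambda>'. cylinder_prob t ts B (pos X (T' \<omega>) \<omega>) \<partial>law X z)"
    using Cons.prems ta by (intro Cons.IH T' \<Lambda>') auto
  also have "\<dots> = (\<integral>\<^sup>+\<omega>\<in>\<Lambda>. (\<lambda>y. indicator (B t) y * cylinder_prob t ts B y) (pos X (T \<omega> + (t - a)) \<omega>) \<partial>law X z)"
    by (intro nn_integral_cong) (auto simp: \<Lambda>'_def T'_def indicator_def)
  also have "\<dots> = (\<integral>\<^sup>+\<omega>\<in>\<Lambda>. cylinder_prob a (t # ts) B (pos X (T \<omega>) \<omega>) \<partial>law X z)"
    by (subst strong_markov_one_nn[OF Cons.prems(1) ta(1) Cons.prems(2)]) auto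
  finally show ?case .
qed

end

section \<open>Laws of shifted paths, random starting points and completions\<close>

context standard_markov begin

definition cylinder :: "ennreal set \<Rightarrow> (ennreal \<Rightarrow> 'x option set) \<Rightarrow> 'w set" where
  "cylinder J B = {\<omega>. \<forall>t\<in>J. pos X t \<omega> \<in> B t}"

definition cylinders :: "'w set set" where
  "cylinders = {cylinder J B | J B. finite J \<and> J \<subseteq> {..<\<infinity>} \<and> (\<forall>t. B t \<in> sets borel_cem)}"

lemma Int_stable_cylinders: "Int_stable cylinders"
proof (rule Int_stableI)
  fix S S' assume "S \<in> cylinders" "S' \<in> cylinders"
  then obtain J B J' B' where S: "S = cylinder J B" "finite J" "J \<subseteq> {..<\<infinity>}" "\<And>t. B t \<in> sets borel_cem"
    and S': "S' = cylinder J' B'" "finite J'" "J' \<subseteq> {..<\<infinity>}" "\<And>t. B' t \<in> sets borel_cem"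
    by (auto simp: cylinders_def)
  let ?B = "\<lambda>t. (if t \<in> J then B t else UNIV) \<inter> (if t \<in> J' then B' t else UNIV)"
  have "S \<inter> S' = cylinder (J \<union> J') ?B" unfolding S(1) S'(1) cylinder_def by auto
  moreover have "?B t \<in> sets borel_cem" for t
    using S(4)[of t] S'(4)[of t] sets.top[of "borel_cem :: 'x option measure"] by (auto intro!: sets.Int)
  ultimately show "S \<inter> S' \<in> cylinders"
    using S(2,3) S'(2,3) unfolding cylinders_def
    by (intro CollectI exI[of _ "J \<union> J'"] exI[of _ ?B]) auto
qed

lemma cylinder_measurable:
  assumes "finite J" "\<And>t. B t \<in> sets borel_cem"
  shows "cylinder J B \<in> sets path_space"
proof -
  have "pos X t -` B t \<in> sets path_space" for t
    unfolding path_space_def using assms(2) by (intro in_measure_of) auto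
  then have "{\<omega> \<in> space path_space. \<forall>t\<in>J. pos X t \<omega> \<in> B t} \<in> sets path_space"
    using assms(1) by (intro sets.sets_Collect_finite_All) (simp_all add: vimage_def)
  then show ?thesis by (simp add: cylinder_def)
qed

text \<open>Finite times suffice: at time \<infinity> every path is at the cemetery, so the events
  there are trivial.\<close>

lemma natural0_cylinders: "natural0 X \<infinity> = sigma_sets UNIV cylinders"
proof
  show "natural0 X \<infinity> \<subseteq> sigma_sets UNIV cylinders"
    unfolding natural0_def
  proof (rule sigma_sets_mono, rule subsetI)
    fix A assume "A \<in> {pos X s -` B | s B. s \<le> \<infinity> \<and> B \<in> sets borel_cem}"
    then obtain s B where A: "A = pos X s -` B" "B \<in> sets borel_cem" by blast
    show "A \<in> sigma_sets UNIV cylinders"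
    proof (cases "s = \<infinity>")
      case True
      then have "A = (if None \<in> B then UNIV else {})" using A(1) pos_infinity by auto
      then show ?thesis using sigma_sets_top[of UNIV cylinders] sigma_sets.Empty[of UNIV cylinders] by simp
    next
      case False
      then have "A = cylinder {s} (\<lambda>_. B)" using A(1) by (auto simp: cylinder_def)
      then have "A \<in> cylinders" using A(2) False by (auto simp: cylinders_def less_top)
      then show ?thesis by (rule sigma_sets.Basic)
    qed
  qed
  have "cylinders \<subseteq> sets path_space" unfolding cylinders_def by (auto intro: cylinder_measurable)
  then show "sigma_sets UNIV cylinders \<subseteq> natural0 X \<infinity>"
    using sets.sigma_sets_subset[of cylinders path_space] by (simp add: sets_path_space)
qed

lemma strong_markov_cylinders:
  assumes T: "stopping_time (filt X) T" and J: "finite J" "J \<subseteq> {..<\<infinity>}" and B: "\<And>t. B t \<in> sets borel_cem"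
  shows "emeasure (law X z) {\<omega>. shift X (T \<omega>) \<omega> \<in> cylinder J B} =
    (\<integral>\<^sup>+\<omega>. cylinder_prob 0 (sorted_list_of_set J) B (pos X (T \<omega>) \<omega>) \<partial>law X z)"
proof -
  have "{\<omega>. shift X (T \<omega>) \<omega> \<in> cylinder J B} =
      UNIV \<inter> {\<omega>. \<forall>t\<in>set (sorted_list_of_set J). pos X (T \<omega> + (t - 0)) \<omega> \<in> B t}"
    using J(1) by (auto simp: cylinder_def pos_shift)
  also have "emeasure (law X z) \<dots> = (\<integral>\<^sup>+\<omega>\<in>UNIV. cylinder_prob 0 (sorted_list_of_set J) B (pos X (T \<omega>) \<omega>) \<partial>law X z)"
  proof (rule strong_markov_cylinder[OF B T])
    show "UNIV \<in> sets (F.pre_sigma T)" using sets.top[of "F.pre_sigma T"] by (simp add: F.space_pre_sigma)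
  qed (use J in auto)
  finally show ?thesis by simp
qed

lemma law_cylinder:
  assumes J: "finite J" "J \<subseteq> {..<\<infinity>}" and B: "\<And>t. B t \<in> sets borel_cem"
  shows "emeasure (law X z) (cylinder J B) = cylinder_prob 0 (sorted_list_of_set J) B z"
proof -
  have "emeasure (law X z) (cylinder J B) = emeasure (law X z) {\<omega>. shift X 0 \<omega> \<in> cylinder J B}"
    by (simp add: cylinder_def pos_shift)
  also have "\<dots> = (\<integral>\<^sup>+\<omega>. cylinder_prob 0 (sorted_list_of_set J) B (pos X 0 \<omega>) \<partial>law X z)"
    by (rule strong_markov_cylinders[OF stopping_time_const J B])
  also have "\<dots> = (\<integral>\<^sup>+\<omega>. cylinder_prob 0 (sorted_list_of_set J) B z \<partial>law X z)"
    using normal[of z] by (intro nn_integral_cong_AE) (auto elim: eventually_mono)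
  finally show ?thesis by simp
qed

lemma law_path_measurable:
  assumes "S \<in> natural0 X \<infinity>"
  shows "(\<lambda>z. emeasure (law X z) S) \<in> borel_measurable borel_cem"
proof -
  have S: "S \<in> sigma_sets UNIV cylinders" using assms unfolding natural0_cylinders .
  have "cylinders \<subseteq> Pow UNIV" by simp
  from Int_stable_cylinders this S
  show ?thesis
  proof (induction rule: sigma_sets_induct_disjoint)
    case (basic A)
    then obtain J B where A: "A = cylinder J B" "finite J" "J \<subseteq> {..<\<infinity>}" "\<And>t. B t \<in> sets borel_cem"
      by (auto simp: cylinders_def)
    then show ?case by (simp add: law_cylinder[OF A(2-4)] cylinder_prob_measurable)
  next
    case empty
    show ?case by simp
  next
    case (compl A)
    have "A \<in> sets (events X)" using compl(1) natural0_events unfolding natural0_cylinders by blast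
    then have "emeasure (law X z) (UNIV - A) = 1 - emeasure (law X z) A" for z
    proof -
      have "emeasure (law X z) A \<noteq> \<infinity>"
        using neq_top_trans[OF ennreal_one_neq_top prob_space.emeasure_le_1[OF prob_law, of z A]] by simp
      then show ?thesis using \<open>A \<in> sets (events X)\<close> emeasure_compl[of A "law X z"] by (simp add: sets_law)
    qed
    then show ?case using compl(2) by simp
  next
    case (union A)
    have "A i \<in> sets (events X)" for i using union(2) natural0_events unfolding natural0_cylinders by blast
    then have "emeasure (law X z) (\<Union>i. A i) = (\<Sum>i. emeasure (law X z) (A i))" for z
      using union(1) by (intro suminf_emeasure[symmetric]) (auto simp: sets_law)
    then show ?case using union(3) by simp
  qed
qed

lemma path_kernel: "(\<lambda>z. distr (law X z) path_space (\<lambda>\<omega>. \<omega>)) \<in> borel_cem \<rightarrow>\<^sub>M subprob_algebra path_space"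
proof (rule measurable_subprob_algebra)
  have m: "(\<lambda>\<omega>. \<omega>) \<in> law X z \<rightarrow>\<^sub>M path_space" for z by measurable
  show "subprob_space (distr (law X z) path_space (\<lambda>\<omega>. \<omega>))" for z
    by (intro prob_space_imp_subprob_space prob_space.prob_space_distr[OF prob_law m])
  fix S assume S: "S \<in> sets path_space"
  have "emeasure (distr (law X z) path_space (\<lambda>\<omega>. \<omega>)) S = emeasure (law X z) S" for z
    using emeasure_distr[OF m S, of z] by simp
  then show "(\<lambda>z. emeasure (distr (law X z) path_space (\<lambda>\<omega>. \<omega>)) S) \<in> borel_measurable borel_cem"
    using S by (simp add: law_path_measurable sets_path_space)
qed simp

text \<open>The mixture \<open>P_\<nu>\<close> of the laws over the starting point, as an actual
  measure on coordinate events; \<open>negligible_under\<close> becomes nullity for it.\<close>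

definition path_law :: "'x option measure \<Rightarrow> 'w measure" where
  "path_law \<nu> = \<nu> \<bind> (\<lambda>z. distr (law X z) path_space (\<lambda>\<omega>. \<omega>))"

context
  fixes \<nu> :: "'x option measure"
  assumes \<nu>: "initial_law \<nu>"
begin

lemma space_initial: "space \<nu> = UNIV"
  using sets_eq_imp_space_eq[OF initial_lawD(2)[OF \<nu>]] by simp

lemma path_kernel': "(\<lambda>z. distr (law X z) path_space (\<lambda>\<omega>. \<omega>)) \<in> \<nu> \<rightarrow>\<^sub>M subprob_algebra path_space"
  using path_kernel initial_lawD(2)[OF \<nu>] by (simp cong: measurable_cong_sets)

lemma sets_path_law [simp]: "sets (path_law \<nu>) = sets path_space"
  unfolding path_law_def by (rule sets_bind) (auto simp: space_initial)

lemma space_path_law [simp]: "space (path_law \<nu>) = UNIV"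
  using sets_eq_imp_space_eq[OF sets_path_law] by simp

lemma emeasure_path_law:
  assumes S: "S \<in> natural0 X \<infinity>"
  shows "emeasure (path_law \<nu>) S = (\<integral>\<^sup>+z. emeasure (law X z) S \<partial>\<nu>)"
proof -
  have S': "S \<in> sets path_space" using S by (simp add: sets_path_space)
  have m: "(\<lambda>\<omega>. \<omega>) \<in> law X z \<rightarrow>\<^sub>M path_space" for z by measurable
  have "emeasure (path_law \<nu>) S = (\<integral>\<^sup>+z. emeasure (distr (law X z) path_space (\<lambda>\<omega>. \<omega>)) S \<partial>\<nu>)"
    unfolding path_law_def by (rule emeasure_bind[OF _ path_kernel' S']) (simp add: space_initial)
  then show ?thesis using emeasure_distr[OF m S'] by simp
qed

lemma nn_integral_path_law:
  assumes Y: "Y \<in> borel_measurable path_space"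
  shows "(\<integral>\<^sup>+\<omega>. Y \<omega> \<partial>path_law \<nu>) = (\<integral>\<^sup>+z. (\<integral>\<^sup>+\<omega>. Y \<omega> \<partial>law X z) \<partial>\<nu>)"
proof -
  have m: "(\<lambda>\<omega>. \<omega>) \<in> law X z \<rightarrow>\<^sub>M path_space" for z by measurable
  have "(\<integral>\<^sup>+\<omega>. Y \<omega> \<partial>distr (law X z) path_space (\<lambda>\<omega>. \<omega>)) = (\<integral>\<^sup>+\<omega>. Y \<omega> \<partial>law X z)" for z
    using Y by (intro nn_integral_distr m) simp
  then show ?thesis
    unfolding path_law_def by (subst nn_integral_bind[OF Y path_kernel']) simp
qed

lemma law_nn_integral_measurable:
  assumes Y: "Y \<in> borel_measurable path_space"
  shows "(\<lambda>z. \<integral>\<^sup>+\<omega>. Y \<omega> \<partial>law X z) \<in> borel_measurable borel_cem"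
proof -
  have m: "(\<lambda>\<omega>. \<omega>) \<in> law X z \<rightarrow>\<^sub>M path_space" for z by measurable
  have "(\<integral>\<^sup>+\<omega>. Y \<omega> \<partial>distr (law X z) path_space (\<lambda>\<omega>. \<omega>)) = (\<integral>\<^sup>+\<omega>. Y \<omega> \<partial>law X z)" for z
    using Y by (intro nn_integral_distr m) simp
  then show ?thesis
    using measurable_compose[OF path_kernel nn_integral_measurable_subprob_algebra[OF Y]] by simp
qed

lemma negligible_iff: "negligible_under X \<nu> S \<longleftrightarrow> (\<exists>N\<in>natural0 X \<infinity>. S \<subseteq> N \<and> emeasure (path_law \<nu>) N = 0)"
  unfolding negligible_under_def using emeasure_path_law by (metis (no_types, lifting))

lemma completed_completion: "completed X (natural0 X \<infinity>) \<subseteq> sets (completion (path_law \<nu>))"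
proof
  fix S assume "S \<in> completed X (natural0 X \<infinity>)"
  then obtain B N where B: "B \<in> natural0 X \<infinity>" and N: "N \<in> natural0 X \<infinity>" "sym_diff S B \<subseteq> N" "emeasure (path_law \<nu>) N = 0"
  proof -
    have "\<exists>B\<in>natural0 X \<infinity>. negligible_under X \<nu> (sym_diff S B)"
      using \<open>S \<in> completed X (natural0 X \<infinity>)\<close> \<nu> by (simp only: completed_def mem_Collect_eq)
    then obtain B where B: "B \<in> natural0 X \<infinity>" and "negligible_under X \<nu> (sym_diff S B)" by (rule bexE)
    then obtain N where "N \<in> natural0 X \<infinity>" "sym_diff S B \<subseteq> N" "emeasure (path_law \<nu>) N = 0"
      unfolding negligible_iff by (elim bexE conjE)
    with B show ?thesis by (rule that)
  qed
  have S: "S = (B - N) \<union> (S \<inter> N)" using N(2) by blast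
  show "S \<in> sets (completion (path_law \<nu>))"
  proof (rule sets_completionI[OF S, of N])
    have "B \<in> sets path_space" "N \<in> sets path_space" using B N(1) unfolding sets_path_space .
    then show "N \<in> null_sets (path_law \<nu>)" "B - N \<in> sets (path_law \<nu>)"
      using N(3) by (simp_all add: null_sets_def sets.Diff)
  qed simp
qed

text \<open>For a fixed starting law, sets of the completed sigma-algebra lie in the completion of
  the path law, so Y agrees off a null set with a coordinate functional. Version and null set depend
  on \<nu>.\<close>

lemma natural_measurable_version:
  fixes Y :: "'w \<Rightarrow> ennreal"
  assumes Y: "Y \<in> borel_measurable (natural X \<infinity>)"
  obtains Y0 N where "Y0 \<in> borel_measurable path_space" "N \<in> natural0 X \<infinity>" "emeasure (path_law \<nu>) N = 0"
    "\<And>\<omega>. \<omega> \<notin> N \<Longrightarrow> Y \<omega> = Y0 \<omega>"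
proof -
  have "sets (natural X \<infinity>) \<subseteq> sets (completion (path_law \<nu>))"
    unfolding natural_def using sets.sigma_sets_subset[OF completed_completion]
    by (subst sets_measure_of) auto
  then have "Y \<in> borel_measurable (completion (path_law \<nu>))"
    using Y by (auto simp: measurable_def natural_def space_measure_of_conv)
  from completion_ex_borel_measurable[OF this] obtain Y0
    where Y0: "Y0 \<in> borel_measurable (path_law \<nu>)" "AE \<omega> in path_law \<nu>. Y \<omega> = Y0 \<omega>" by blast
  obtain N where N: "{\<omega> \<in> space (path_law \<nu>). Y \<omega> \<noteq> Y0 \<omega>} \<subseteq> N" "emeasure (path_law \<nu>) N = 0" "N \<in> sets (path_law \<nu>)"
    using AE_E[OF Y0(2)] by blast
  have "Y0 \<in> borel_measurable path_space" using Y0(1) by (simp cong: measurable_cong_sets)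
  then show thesis using N by (intro that[of Y0 N]) (auto simp: sets_path_space)
qed

end

lemma natural_filt: "sets (natural X t) \<subseteq> sets (filt X t)"
proof -
  have "natural0 X t \<subseteq> sets (filt X t)"
    unfolding natural0_def
  proof (rule sets.sigma_sets_subset[of _ "filt X t", unfolded F.space_F], rule subsetI)
    fix A assume "A \<in> {pos X s -` B | s B. s \<le> t \<and> B \<in> sets borel_cem}"
    then obtain s B where "A = pos X s -` B" "s \<le> t" "B \<in> sets borel_cem" by blast
    then show "A \<in> sets (filt X t)"
      using measurable_sets[OF pos_filt[of s], of B] F.sets_F_mono[of s t] by (auto simp: F.space_F)
  qed
  then have "completed X (natural0 X t) \<subseteq> completed X (sets (filt X t))"
    unfolding completed_def by blast
  then have "completed X (natural0 X t) \<subseteq> sets (filt X t)" using completed_filt by blast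
  then show ?thesis
    unfolding natural_def using sets.sigma_sets_subset[of _ "filt X t"] by (subst sets_measure_of) (auto simp: F.space_F)
qed

lemma natural_mono: "s \<le> t \<Longrightarrow> sets (natural X s) \<subseteq> sets (natural X t)"
proof -
  assume st: "s \<le> t"
  have "natural0 X s \<subseteq> natural0 X t"
    unfolding natural0_def using st by (intro sigma_sets_mono') (auto intro: order_trans)
  then have "completed X (natural0 X s) \<subseteq> completed X (natural0 X t)" unfolding completed_def by blast
  then show ?thesis
    unfolding natural_def by (simp add: sets_measure_of_conv sigma_sets_mono')
qed

lemma space_natural [simp]: "space (natural X t) = UNIV"
  by (simp add: natural_def space_measure_of_conv)

lemma natural_events: "sets (natural X t) \<subseteq> sets (events X)"
  using natural_filt filt_events by blast

lemma measurable_natural_events: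
  "f \<in> natural X t \<rightarrow>\<^sub>M M \<Longrightarrow> f \<in> events X \<rightarrow>\<^sub>M M"
  using natural_events[of t] space_events by (auto simp: measurable_def)

lemma measurable_natural_infinity:
  "f \<in> natural X t \<rightarrow>\<^sub>M M \<Longrightarrow> f \<in> natural X \<infinity> \<rightarrow>\<^sub>M M"
  using natural_mono[of t \<infinity>] by (auto simp: measurable_def)

lemma pos_natural: "pos X t \<in> natural X \<infinity> \<rightarrow>\<^sub>M borel_cem"
proof (rule measurableI)
  fix B :: "'x option set" assume B: "B \<in> sets borel_cem"
  have "pos X t -` B \<in> natural0 X \<infinity>"
    unfolding natural0_def using B by (intro sigma_sets.Basic) auto
  moreover have "negligible_under X \<nu> (sym_diff S S)" for \<nu> S
    unfolding negligible_under_def natural0_def by (intro bexI[of _ "{}"] sigma_sets.Empty) auto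
  ultimately have "pos X t -` B \<in> completed X (natural0 X \<infinity>)"
    unfolding completed_def by blast
  then show "pos X t -` B \<inter> space (natural X \<infinity>) \<in> sets (natural X \<infinity>)"
    by (simp add: natural_def)
qed simp

text \<open>Nullity under every law passes to each mixture, and the filtration is complete with
  respect to all of them. Since N is only an event of the completed sigma-algebra, it is first
  replaced by a version of its indicator, separately for each \<nu>. The result allows a functional
  to be changed on a set of this kind without losing adaptedness.\<close>

lemma polar_subset_filt:
  assumes N: "N \<in> sets (natural X \<infinity>)" "\<And>z. emeasure (law X z) N = 0" and S: "S \<subseteq> N"
  shows "S \<in> sets (filt X t)"
proof -
  have "negligible_under X \<nu> (sym_diff S {})" if \<nu>: "initial_law \<nu>" for \<nu>
  proof -
    have "indicator N \<in> borel_measurable (natural X \<infinity>)" using N(1) by simp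
    then obtain Y0 :: "'w \<Rightarrow> ennreal" and N0 where Y0: "Y0 \<in> borel_measurable path_space" "N0 \<in> natural0 X \<infinity>" "emeasure (path_law \<nu>) N0 = 0"
        "\<And>\<omega>. \<omega> \<notin> N0 \<Longrightarrow> indicator N \<omega> = Y0 \<omega>"
      by (rule natural_measurable_version[OF \<nu>]) (rule that)
    have N0_law: "AE z in \<nu>. emeasure (law X z) N0 = 0"
      using Y0(3) law_path_measurable[OF Y0(2)] initial_lawD(2)[OF \<nu>]
      by (simp add: emeasure_path_law[OF \<nu> Y0(2)] nn_integral_0_iff_AE cong: measurable_cong_sets)
    have N_ev: "N \<in> sets (events X)" and N0_ev: "N0 \<in> sets (events X)"
      using N(1) natural_events Y0(2) natural0_events by auto
    have "(\<integral>\<^sup>+\<omega>. Y0 \<omega> \<partial>law X z) = 0" if "emeasure (law X z) N0 = 0" for z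
    proof -
      have "AE \<omega> in law X z. \<omega> \<notin> N0 \<and> \<omega> \<notin> N"
        using that N(2)[of z] N_ev N0_ev by (auto intro!: AE_not_in simp: null_sets_def sets_law)
      then have "AE \<omega> in law X z. Y0 \<omega> = 0"
      proof eventually_elim
        case (elim \<omega>)
        then show ?case using Y0(4)[of \<omega>] by simp
      qed
      then show ?thesis by (simp cong: nn_integral_cong_AE)
    qed
    then have "AE z in \<nu>. (\<integral>\<^sup>+\<omega>. Y0 \<omega> \<partial>law X z) = 0" using N0_law by (auto elim: eventually_mono)
    then have "(\<integral>\<^sup>+z. (\<integral>\<^sup>+\<omega>. Y0 \<omega> \<partial>law X z) \<partial>\<nu>) = (\<integral>\<^sup>+z. 0 \<partial>\<nu>)" by (rule nn_integral_cong_AE)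
    then have "(\<integral>\<^sup>+\<omega>. Y0 \<omega> \<partial>path_law \<nu>) = 0" unfolding nn_integral_path_law[OF \<nu> Y0(1)] by simp
    then have "AE \<omega> in path_law \<nu>. Y0 \<omega> = 0"
      using Y0(1) by (subst (asm) nn_integral_0_iff_AE) (auto simp: \<nu> cong: measurable_cong_sets)
    then obtain N1 where N1: "{\<omega> \<in> space (path_law \<nu>). \<not> Y0 \<omega> = 0} \<subseteq> N1" "emeasure (path_law \<nu>) N1 = 0" "N1 \<in> sets (path_law \<nu>)"
      using AE_E by blast
    have "sym_diff S {} \<subseteq> N0 \<union> N1"
    proof
      fix \<omega> assume "\<omega> \<in> sym_diff S {}"
      then have "\<omega> \<in> N" using S by auto
      moreover have "Y0 \<omega> \<noteq> 0 \<Longrightarrow> \<omega> \<in> N1" using N1(1) by (auto simp: space_path_law[OF \<nu>])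
      ultimately show "\<omega> \<in> N0 \<union> N1" using Y0(4)[of \<omega>] by (cases "\<omega> \<in> N0") auto
    qed
    moreover have "N0 \<in> null_sets (path_law \<nu>)" "N1 \<in> null_sets (path_law \<nu>)"
      using Y0(2,3) N1(2,3) by (simp_all add: null_sets_def sets_path_law[OF \<nu>] sets_path_space)
    then have "N0 \<union> N1 \<in> null_sets (path_law \<nu>)" by (rule null_sets.Un)
    then have "N0 \<union> N1 \<in> natural0 X \<infinity>" "emeasure (path_law \<nu>) (N0 \<union> N1) = 0"
      by (simp_all add: null_sets_def sets_path_law[OF \<nu>] sets_path_space)
    ultimately show ?thesis unfolding negligible_iff[OF \<nu>] by blast
  qed
  then have "S \<in> completed X (sets (filt X t))" unfolding completed_def by blast
  then show ?thesis using completed_filt by blast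
qed

text \<open>Right continuity of the filtration. The strict inequality is the form in which right
  inverses and infima of countably many times are directly measurable.\<close>

lemma stopping_time_lessI:
  assumes less: "\<And>u. {\<omega>. T \<omega> < u} \<in> sets (filt X u)"
  shows "stopping_time (filt X) T"
proof
  fix s
  show "Measurable.pred (filt X s) (\<lambda>\<omega>. T \<omega> \<le> s)"
  proof (cases "s = \<infinity>")
    case False
    then have s: "s < \<infinity>" by (simp add: less_top)
    have "{\<omega>. T \<omega> \<le> s} \<in> sets (filt X r)" if r: "s < r" for r
    proof -
      obtain u where u: "\<And>n::nat. s < u n" "u \<longlonglongrightarrow> s"
        using approx_from_above_dense_linorder[OF r] by auto
      have "{\<omega>. T \<omega> \<le> s} = (\<Inter>n. {\<omega>. T \<omega> < min (u n) r})"
      proof (intro set_eqI iffI)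
        fix \<omega> assume "\<omega> \<in> {\<omega>. T \<omega> \<le> s}"
        then show "\<omega> \<in> (\<Inter>n. {\<omega>. T \<omega> < min (u n) r})" using u(1) r by (auto intro: le_less_trans)
      next
        fix \<omega> assume "\<omega> \<in> (\<Inter>n. {\<omega>. T \<omega> < min (u n) r})"
        then have le: "T \<omega> \<le> u n" for n by (auto intro: less_imp_le)
        have "T \<omega> \<le> s" by (rule LIMSEQ_le_const[OF u(2)]) (use le in blast)
        then show "\<omega> \<in> {\<omega>. T \<omega> \<le> s}" by simp
      qed
      moreover have "{\<omega>. T \<omega> < min (u n) r} \<in> sets (filt X r)" for n
        using less[of "min (u n) r"] F.sets_F_mono[of "min (u n) r" r] by auto
      ultimately show ?thesis by auto
    qed
    then show ?thesis using filt_right_continuous[OF s] by (simp add: pred_def F.space_F)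
  qed simp
qed

text \<open>\<open>Y0\<close> is a version of \<open>Y\<close> with respect to the path law started from the distribution of
  \<open>pos X T\<close>.\<close>
lemma strong_markov_functional:
  fixes Y :: "'w \<Rightarrow> ennreal"
  assumes T: "stopping_time (filt X) T" and Y: "Y \<in> borel_measurable (natural X \<infinity>)"
  obtains Y0 where "Y0 \<in> borel_measurable path_space"
    "AE \<omega> in law X z. Y (shift X (T \<omega>) \<omega>) = Y0 (shift X (T \<omega>) \<omega>)"
    "AE \<omega> in law X z. (\<integral>\<^sup>+\<omega>'. Y \<omega>' \<partial>law X (pos X (T \<omega>) \<omega>)) = (\<integral>\<^sup>+\<omega>'. Y0 \<omega>' \<partial>law X (pos X (T \<omega>) \<omega>))"
    "(\<integral>\<^sup>+\<omega>. Y0 (shift X (T \<omega>) \<omega>) \<partial>law X z) = (\<integral>\<^sup>+\<omega>. (\<integral>\<^sup>+\<omega>'. Y0 \<omega>' \<partial>law X (pos X (T \<omega>) \<omega>)) \<partial>law X z)"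
proof -
  have XT: "(\<lambda>\<omega>. pos X (T \<omega>) \<omega>) \<in> law X z \<rightarrow>\<^sub>M borel_cem" using pos_stopping[OF T] by (simp cong: measurable_cong_sets)
  have \<theta>: "(\<lambda>\<omega>. shift X (T \<omega>) \<omega>) \<in> law X z \<rightarrow>\<^sub>M path_space" using shift_measurable[OF T] by (simp cong: measurable_cong_sets)
  define \<nu> where "\<nu> = distr (law X z) borel_cem (\<lambda>\<omega>. pos X (T \<omega>) \<omega>)"
  have \<nu>: "initial_law \<nu>"
    unfolding \<nu>_def initial_law_def by (simp add: prob_space.prob_space_distr[OF prob_law XT])
  \<comment> \<open>The path shifted by T has the law of the process started from the distribution
    of the position at T. Agreement on cylinders is enough, as they are stable under
    intersection.\<close>
  have eq: "distr (law X z) path_space (\<lambda>\<omega>. shift X (T \<omega>) \<omega>) = path_law \<nu>"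
  proof (rule measure_eqI_generator_eq[OF Int_stable_cylinders, where \<Omega>=UNIV and A="\<lambda>_. UNIV"])
    show "sets (distr (law X z) path_space (\<lambda>\<omega>. shift X (T \<omega>) \<omega>)) = sigma_sets UNIV cylinders"
      unfolding natural0_cylinders[symmetric] by (simp add: sets_path_space)
    show "sets (path_law \<nu>) = sigma_sets UNIV cylinders"
      unfolding natural0_cylinders[symmetric] by (simp add: sets_path_law[OF \<nu>] sets_path_space)
    have "UNIV = cylinder {} (\<lambda>_. {})" by (auto simp: cylinder_def)
    then show "range (\<lambda>_::nat. UNIV) \<subseteq> cylinders"
      by (auto simp: cylinders_def intro!: exI[of _ "{}"] exI[of _ "\<lambda>_. {}"])
    show "emeasure (distr (law X z) path_space (\<lambda>\<omega>. shift X (T \<omega>) \<omega>)) UNIV \<noteq> \<infinity>" for i :: nat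
      using emeasure_distr[OF \<theta>, of UNIV] sets.top[of path_space] by simp
    fix S assume "S \<in> cylinders"
    then obtain J B where S: "S = cylinder J B" "finite J" "J \<subseteq> {..<\<infinity>}" "\<And>t. B t \<in> sets borel_cem"
      by (auto simp: cylinders_def)
    have S': "S \<in> natural0 X \<infinity>" using cylinder_measurable[OF S(2,4)] S(1) by (simp add: sets_path_space)
    have "emeasure (distr (law X z) path_space (\<lambda>\<omega>. shift X (T \<omega>) \<omega>)) S = emeasure (law X z) {\<omega>. shift X (T \<omega>) \<omega> \<in> S}"
      using S' by (subst emeasure_distr[OF \<theta>]) (auto simp: sets_path_space vimage_def)
    also have "\<dots> = (\<integral>\<^sup>+\<omega>. emeasure (law X (pos X (T \<omega>) \<omega>)) S \<partial>law X z)"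
      unfolding S(1) strong_markov_cylinders[OF T S(2-4)] law_cylinder[OF S(2-4)] ..
    also have "\<dots> = emeasure (path_law \<nu>) S"
    proof -
      have "(\<integral>\<^sup>+y. emeasure (law X y) S \<partial>\<nu>) = (\<integral>\<^sup>+\<omega>. emeasure (law X (pos X (T \<omega>) \<omega>)) S \<partial>law X z)"
        unfolding \<nu>_def by (rule nn_integral_distr[OF XT]) (simp add: law_path_measurable[OF S'])
      then show ?thesis using emeasure_path_law[OF \<nu> S'] by simp
    qed
    finally show "emeasure (distr (law X z) path_space (\<lambda>\<omega>. shift X (T \<omega>) \<omega>)) S = emeasure (path_law \<nu>) S" .
  qed auto
  obtain Y0 N where Y0: "Y0 \<in> borel_measurable path_space" "N \<in> natural0 X \<infinity>" "emeasure (path_law \<nu>) N = 0"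
    "\<And>\<omega>. \<omega> \<notin> N \<Longrightarrow> Y \<omega> = Y0 \<omega>"
    by (rule natural_measurable_version[OF \<nu> Y]) (rule that)
  show thesis
  proof (rule that[OF Y0(1)])
    have "AE \<omega> in distr (law X z) path_space (\<lambda>\<omega>. shift X (T \<omega>) \<omega>). \<omega> \<notin> N"
      unfolding eq using Y0(2,3) by (intro AE_not_in) (auto simp: null_sets_def sets_path_law[OF \<nu>] sets_path_space)
    then have "AE \<omega> in law X z. shift X (T \<omega>) \<omega> \<notin> N" by (rule AE_distrD[OF \<theta>])
    then show "AE \<omega> in law X z. Y (shift X (T \<omega>) \<omega>) = Y0 (shift X (T \<omega>) \<omega>)"
      by eventually_elim (rule Y0(4))
    have "AE y in \<nu>. emeasure (law X y) N = 0"
      using Y0(3) law_path_measurable[OF Y0(2)] initial_lawD(2)[OF \<nu>]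
      by (simp add: emeasure_path_law[OF \<nu> Y0(2)] nn_integral_0_iff_AE cong: measurable_cong_sets)
    then have "AE \<omega> in law X z. emeasure (law X (pos X (T \<omega>) \<omega>)) N = 0"
      unfolding \<nu>_def by (rule AE_distrD[OF XT])
    then show "AE \<omega> in law X z. (\<integral>\<^sup>+\<omega>'. Y \<omega>' \<partial>law X (pos X (T \<omega>) \<omega>)) = (\<integral>\<^sup>+\<omega>'. Y0 \<omega>' \<partial>law X (pos X (T \<omega>) \<omega>))"
    proof eventually_elim
      case (elim \<omega>)
      have "AE \<omega>' in law X (pos X (T \<omega>) \<omega>). \<omega>' \<notin> N"
        using elim Y0(2) natural0_events by (intro AE_not_in) (auto simp: null_sets_def sets_law)
      then have "AE \<omega>' in law X (pos X (T \<omega>) \<omega>). Y \<omega>' = Y0 \<omega>'" by eventually_elim (rule Y0(4))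
      then show ?case by (rule nn_integral_cong_AE)
    qed
    have "(\<integral>\<^sup>+\<omega>. Y0 (shift X (T \<omega>) \<omega>) \<partial>law X z) = (\<integral>\<^sup>+\<omega>. Y0 \<omega> \<partial>path_law \<nu>)"
      unfolding eq[symmetric] using Y0(1) by (intro nn_integral_distr[symmetric] \<theta>) simp
    also have "\<dots> = (\<integral>\<^sup>+y. (\<integral>\<^sup>+\<omega>. Y0 \<omega> \<partial>law X y) \<partial>\<nu>)" by (rule nn_integral_path_law[OF \<nu> Y0(1)])
    also have "\<dots> = (\<integral>\<^sup>+\<omega>. (\<integral>\<^sup>+\<omega>'. Y0 \<omega>' \<partial>law X (pos X (T \<omega>) \<omega>)) \<partial>law X z)"
      unfolding \<nu>_def by (intro nn_integral_distr XT) (simp add: law_nn_integral_measurable[OF \<nu> Y0(1)])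
    finally show "(\<integral>\<^sup>+\<omega>. Y0 (shift X (T \<omega>) \<omega>) \<partial>law X z) = (\<integral>\<^sup>+\<omega>. (\<integral>\<^sup>+\<omega>'. Y0 \<omega>' \<partial>law X (pos X (T \<omega>) \<omega>)) \<partial>law X z)" .
  qed
qed

text \<open>Y is measurable for a completed sigma-algebra only, so both sides are compared, almost
  everywhere, with a common coordinate version.\<close>

lemma strong_markov_nn:
  fixes Y :: "'w \<Rightarrow> ennreal"
  assumes T: "stopping_time (filt X) T" and Y: "Y \<in> borel_measurable (natural X \<infinity>)"
    and Z: "AE \<omega> in law X z. Z \<omega> = Y (shift X (T \<omega>) \<omega>)"
  shows "(\<integral>\<^sup>+\<omega>. Z \<omega> \<partial>law X z) = (\<integral>\<^sup>+\<omega>. (\<integral>\<^sup>+\<omega>'. Y \<omega>' \<partial>law X (pos X (T \<omega>) \<omega>)) \<partial>law X z)"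
proof -
  obtain Y0 where Y0: "Y0 \<in> borel_measurable path_space"
    "AE \<omega> in law X z. Y (shift X (T \<omega>) \<omega>) = Y0 (shift X (T \<omega>) \<omega>)"
    "AE \<omega> in law X z. (\<integral>\<^sup>+\<omega>'. Y \<omega>' \<partial>law X (pos X (T \<omega>) \<omega>)) = (\<integral>\<^sup>+\<omega>'. Y0 \<omega>' \<partial>law X (pos X (T \<omega>) \<omega>))"
    "(\<integral>\<^sup>+\<omega>. Y0 (shift X (T \<omega>) \<omega>) \<partial>law X z) = (\<integral>\<^sup>+\<omega>. (\<integral>\<^sup>+\<omega>'. Y0 \<omega>' \<partial>law X (pos X (T \<omega>) \<omega>)) \<partial>law X z)"
    by (rule strong_markov_functional[OF T Y]) (rule that)
  have "(\<integral>\<^sup>+\<omega>. Z \<omega> \<partial>law X z) = (\<integral>\<^sup>+\<omega>. Y0 (shift X (T \<omega>) \<omega>) \<partial>law X z)"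
    by (rule nn_integral_cong_AE) (use Z Y0(2) in eventually_elim, simp)
  also note Y0(4)
  also have "(\<integral>\<^sup>+\<omega>. (\<integral>\<^sup>+\<omega>'. Y0 \<omega>' \<partial>law X (pos X (T \<omega>) \<omega>)) \<partial>law X z) = (\<integral>\<^sup>+\<omega>. (\<integral>\<^sup>+\<omega>'. Y \<omega>' \<partial>law X (pos X (T \<omega>) \<omega>)) \<partial>law X z)"
    by (rule nn_integral_cong_AE) (use Y0(3) in eventually_elim, simp)
  finally show ?thesis .
qed

text \<open>Both conditions say that the same nonnegative expectation vanishes. The equivalence is
  used in both directions: to learn about the law at the position reached, and to transfer a
  property of that law to the shifted path.\<close>

lemma strong_markov_null:
  assumes T: "stopping_time (filt X) T" and S: "S \<in> sets (natural X \<infinity>)"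
  shows "(AE \<omega> in law X z. emeasure (law X (pos X (T \<omega>) \<omega>)) S = 0) \<longleftrightarrow> (AE \<omega> in law X z. shift X (T \<omega>) \<omega> \<notin> S)"
proof -
  have S_ev: "S \<in> sets (law X y)" for y using S natural_events by (auto simp: sets_law)
  have "indicator S \<in> borel_measurable (natural X \<infinity>)" using S by simp
  then obtain Y0 :: "'w \<Rightarrow> ennreal" where Y0: "Y0 \<in> borel_measurable path_space"
    "AE \<omega> in law X z. indicator S (shift X (T \<omega>) \<omega>) = Y0 (shift X (T \<omega>) \<omega>)"
    "AE \<omega> in law X z. (\<integral>\<^sup>+\<omega>'. indicator S \<omega>' \<partial>law X (pos X (T \<omega>) \<omega>)) = (\<integral>\<^sup>+\<omega>'. Y0 \<omega>' \<partial>law X (pos X (T \<omega>) \<omega>))"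
    "(\<integral>\<^sup>+\<omega>. Y0 (shift X (T \<omega>) \<omega>) \<partial>law X z) = (\<integral>\<^sup>+\<omega>. (\<integral>\<^sup>+\<omega>'. Y0 \<omega>' \<partial>law X (pos X (T \<omega>) \<omega>)) \<partial>law X z)"
    by (rule strong_markov_functional[OF T]) (rule that)
  have "prob_space (distr (law X z) borel_cem (\<lambda>\<omega>. pos X (T \<omega>) \<omega>))"
    using pos_stopping[OF T] by (intro prob_space.prob_space_distr[OF prob_law]) (simp cong: measurable_cong_sets)
  then have il: "initial_law (distr (law X z) borel_cem (\<lambda>\<omega>. pos X (T \<omega>) \<omega>))" by (simp add: initial_law_def)
  have m1: "(\<lambda>\<omega>. Y0 (shift X (T \<omega>) \<omega>)) \<in> borel_measurable (law X z)"
    using measurable_compose[OF shift_measurable[OF T] Y0(1)] by (simp cong: measurable_cong_sets)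
  have m2: "(\<lambda>\<omega>. \<integral>\<^sup>+\<omega>'. Y0 \<omega>' \<partial>law X (pos X (T \<omega>) \<omega>)) \<in> borel_measurable (law X z)"
    using measurable_compose[OF pos_stopping[OF T] law_nn_integral_measurable[OF il Y0(1)]] by (simp cong: measurable_cong_sets)
  have "(AE \<omega> in law X z. emeasure (law X (pos X (T \<omega>) \<omega>)) S = 0) \<longleftrightarrow> (AE \<omega> in law X z. (\<integral>\<^sup>+\<omega>'. Y0 \<omega>' \<partial>law X (pos X (T \<omega>) \<omega>)) = 0)"
    using Y0(3) S_ev by (auto elim!: eventually_elim2)
  also have "\<dots> \<longleftrightarrow> (AE \<omega> in law X z. Y0 (shift X (T \<omega>) \<omega>) = 0)"
    using Y0(4) unfolding nn_integral_0_iff_AE[OF m1, symmetric] nn_integral_0_iff_AE[OF m2, symmetric] by simp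
  also have "\<dots> \<longleftrightarrow> (AE \<omega> in law X z. shift X (T \<omega>) \<omega> \<notin> S)"
    using Y0(2) by (auto elim!: eventually_elim2 simp: indicator_def split: if_splits)
  finally show ?thesis .
qed

end

section \<open>Inverses of continuous clocks\<close>

text \<open>The sequence may touch s, where the right filter says nothing; this is harmless because
  the limit is \<open>f s\<close> itself.\<close>

lemma tendsto_at_right_seq:
  fixes s :: "'a::linorder_topology"
  assumes "(f \<longlongrightarrow> f s) (at_right s)" "x \<longlonglongrightarrow> s" "\<And>k. s \<le> x k"
  shows "(\<lambda>k. f (x k)) \<longlonglongrightarrow> f s"
proof -
  have "{s..} - {s} = {s<..} - {s}" by auto
  then have "at s within {s..} = at_right s" unfolding at_within_def by simp
  then have "continuous (at s within {s..}) f" using assms(1) by (simp add: continuous_within)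
  then show ?thesis by (rule continuous_within_tendsto_compose'[OF _ _ assms(2)]) (simp add: assms(3))
qed

definition gen_inverse :: "(ennreal \<Rightarrow> ennreal) \<Rightarrow> ennreal \<Rightarrow> ennreal" where
  "gen_inverse a r = Inf {s. r < a s}"

lemma at_right_ennreal_nontrivial: "s < \<top> \<Longrightarrow> at_right (s :: ennreal) \<noteq> bot"
  unfolding trivial_limit_def by (subst eventually_at_right) (auto dest: dense)

lemma right_inverse_eq: "right_inverse A t \<omega> = gen_inverse (\<lambda>s. A s \<omega>) (ennreal t)"
  by (simp add: right_inverse_def gen_inverse_def)

definition dyadic :: "nat \<Rightarrow> nat \<Rightarrow> ennreal" where
  "dyadic k j = ennreal (real j / 2 ^ k)"

lemma dyadic_finite [simp]: "dyadic k j < \<top>"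
  by (simp add: dyadic_def)

text \<open>Right end points make the sums converge for right continuous integrands.\<close>
definition riemann_sum :: "(ennreal \<Rightarrow> ennreal) \<Rightarrow> (ennreal \<Rightarrow> ennreal) \<Rightarrow> nat \<Rightarrow> ennreal" where
  "riemann_sum \<phi> a k = (\<Sum>j<4 ^ k. \<phi> (dyadic k (Suc j)) * (a (dyadic k (Suc j)) - a (dyadic k j)))"

locale clock =
  fixes a :: "ennreal \<Rightarrow> ennreal"
  assumes cont: "continuous_on UNIV a" and mono: "mono a" and zero: "a 0 = 0"
    and finite: "t < \<infinity> \<Longrightarrow> a t < \<infinity>"
begin

lemma isCont: "isCont a s"
  using cont by (simp add: continuous_on_eq_continuous_at)

text \<open>The Galois connection from which the other properties of the inverse follow. Left
  continuity of the clock makes the infimum strictly smaller than s.\<close>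

lemma gen_inverse_less_iff: "gen_inverse a r < s \<longleftrightarrow> r < a s"
proof
  assume "gen_inverse a r < s"
  then obtain s' where "s' < s" "r < a s'" unfolding gen_inverse_def by (auto simp: Inf_less_iff)
  then show "r < a s" using monoD[OF mono, of s' s] by (auto intro: less_le_trans)
next
  assume r: "r < a s"
  then have "s \<noteq> 0" using zero by auto
  then have "0 < s" by (simp add: zero_less_iff_neq_zero)
  have "\<forall>\<^sub>F s' in at_left s. r < a s'"
    using isCont[of s] r unfolding isCont_def by (intro order_tendstoD(1)[of a "a s"]) (auto intro: tendsto_within_subset)
  then obtain b where b: "b < s" "\<And>s'. b < s' \<Longrightarrow> s' < s \<Longrightarrow> r < a s'"
    using \<open>0 < s\<close> by (subst (asm) eventually_at_left) auto
  obtain s' where "b < s'" "s' < s" using dense[OF b(1)] by blast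
  then have "r < a s'" "s' < s" using b(2) by auto
  then show "gen_inverse a r < s" unfolding gen_inverse_def by (auto simp: Inf_less_iff)
qed

lemma le_gen_inverse_iff: "s \<le> gen_inverse a r \<longleftrightarrow> a s \<le> r"
  using gen_inverse_less_iff[of r s] by (simp add: not_less[symmetric])

lemma a_gen_inverse_le: "a (gen_inverse a r) \<le> r"
  using le_gen_inverse_iff[of "gen_inverse a r" r] by simp

lemma a_gen_inverse:
  assumes "gen_inverse a r < \<infinity>"
  shows "a (gen_inverse a r) = r"
proof (rule antisym[OF a_gen_inverse_le])
  let ?s = "gen_inverse a r"
  have "(a \<longlongrightarrow> a ?s) (at_right ?s)"
    using isCont[of ?s] unfolding isCont_def by (rule tendsto_within_subset) simp
  moreover have "\<forall>\<^sub>F s in at_right ?s. r \<le> a s"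
    unfolding eventually_at_filter by (intro always_eventually) (simp add: gen_inverse_less_iff less_imp_le)
  moreover have "at_right ?s \<noteq> bot" using assms by (intro at_right_ennreal_nontrivial) simp
  ultimately show "r \<le> a ?s" by (intro tendsto_lowerbound)
qed

lemma gen_inverse_mono: "r \<le> r' \<Longrightarrow> gen_inverse a r \<le> gen_inverse a r'"
  unfolding gen_inverse_def by (intro Inf_superset_mono) auto

lemma gen_inverse_right_continuous: "(gen_inverse a \<longlongrightarrow> gen_inverse a r) (at_right r)"
proof (rule order_tendstoI)
  fix l assume l: "l < gen_inverse a r"
  have "l < gen_inverse a r'" if "r < r'" for r'
    using less_le_trans[OF l gen_inverse_mono[of r r']] that by simp
  then show "\<forall>\<^sub>F r' in at_right r. l < gen_inverse a r'"
    unfolding eventually_at_filter by (intro always_eventually) simp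
next
  fix u assume "gen_inverse a r < u"
  then have "r < a u" by (simp add: gen_inverse_less_iff)
  then have "\<forall>\<^sub>F r' in at_right r. r' < a u" by (auto simp: eventually_at_right)
  then show "\<forall>\<^sub>F r' in at_right r. gen_inverse a r' < u" by (simp add: gen_inverse_less_iff)
qed

lemma shifted:
  assumes T: "T < \<infinity>" and top: "a \<infinity> < \<infinity>"
  shows "clock (\<lambda>s. a (T + s) - a T)"
proof
  have fin: "a s \<noteq> \<top>" for s using monoD[OF mono, of s \<infinity>] top by (auto simp: top_unique)
  have "continuous_on UNIV (\<lambda>s. a (T + s))"
    by (rule continuous_on_compose2[OF cont]) (auto intro!: continuous_on_add_ennreal continuous_on_const continuous_on_id)
  then show "continuous_on UNIV (\<lambda>s. a (T + s) - a T)"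
    using fin by (intro continuous_on_diff_ennreal continuous_on_const) auto
  show "mono (\<lambda>s. a (T + s) - a T)"
    by (intro monoI ennreal_minus_mono monoD[OF mono] add_left_mono) auto
  show "a (T + 0) - a T = 0" using fin by (simp add: diff_eq_0_iff_ennreal less_top)
  fix t :: ennreal
  show "a (T + t) - a T < \<infinity>" using fin[of "T + t"] by (intro le_less_trans[OF diff_le_self_ennreal]) (simp add: less_top)
qed

text \<open>Two extended numbers agree if they lie strictly below the same bounds u. For u >= T both
  comparisons reduce, by the Galois connection, to a T + r < a u.\<close>

lemma gen_inverse_shifted:
  assumes T: "T < \<infinity>" and top: "a \<infinity> < \<infinity>"
  shows "T + gen_inverse (\<lambda>s. a (T + s) - a T) r = gen_inverse a (a T + r)"
proof -
  interpret S: clock "\<lambda>s. a (T + s) - a T" by (rule shifted[OF T top])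
  have ge: "T \<le> gen_inverse a (a T + r)" by (simp add: le_gen_inverse_iff)
  have iff: "T + gen_inverse (\<lambda>s. a (T + s) - a T) r < u \<longleftrightarrow> gen_inverse a (a T + r) < u" for u
  proof (cases "T \<le> u")
    case True
    define s where "s = u - T"
    have u: "u = T + s" unfolding s_def by (rule add_diff_inverse_ennreal[OF True, symmetric])
    have "T + gen_inverse (\<lambda>s. a (T + s) - a T) r < T + s \<longleftrightarrow> gen_inverse (\<lambda>s. a (T + s) - a T) r < s"
      using T by (auto simp: ennreal_add_left_cancel_less)
    also have "\<dots> \<longleftrightarrow> r < a (T + s) - a T" by (rule S.gen_inverse_less_iff)
    also have "\<dots> \<longleftrightarrow> a T + r < a (T + s)"
      using finite[OF T] by (subst less_diff_eq_ennreal) (auto simp: add.commute)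
    finally show ?thesis unfolding u gen_inverse_less_iff .
  next
    case False
    then have "u \<le> T" by simp
    then have "u \<le> T + gen_inverse (\<lambda>s. a (T + s) - a T) r" "u \<le> gen_inverse a (a T + r)"
      using ge by (auto intro: order_trans add_increasing2)
    then show ?thesis by (simp add: not_less[symmetric])
  qed
  show ?thesis
    using iff[of "T + gen_inverse (\<lambda>s. a (T + s) - a T) r"] iff[of "gen_inverse a (a T + r)"]
    by (auto simp: not_less intro!: antisym)
qed

text \<open>Both limits below come from the same Riemann sums, once with the cells cut in the time scale of
  the inverse and once with the cells cut in real time.\<close>

context
  fixes \<phi> :: "ennreal \<Rightarrow> ennreal" and c :: ennreal
  assumes top: "a \<infinity> < \<infinity>" and c: "c < \<top>" and \<phi>_le: "\<And>s. \<phi> s \<le> c" and \<phi>_top: "\<phi> \<infinity> = 0"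
    and \<phi>_right: "\<And>s. s < \<infinity> \<Longrightarrow> (\<phi> \<longlongrightarrow> \<phi> s) (at_right s)"
begin

lemma a_finite: "a s \<noteq> \<top>"
  using monoD[OF mono, of s \<infinity>] top by (auto simp: top_unique)

lemma ennreal_a: "ennreal (enn2real (a s)) = a s"
  using a_finite[of s] by (simp add: less_top)

text \<open>A change of variables by step functions. \<open>f k\<close> is constant on the image of
  each dyadic cell under a, so its integral is exactly the Riemann sum, and its value at r is \<phi>
  at the right end of the dyadic cell containing the inverse at r.\<close>

lemma riemann_sum_tendsto_inverse:
  "riemann_sum \<phi> a \<longlonglongrightarrow> (\<integral>\<^sup>+r\<in>{0..}. \<phi> (gen_inverse a (ennreal r)) \<partial>lborel)"
proof -
  define f where "f k r = (\<Sum>j<4 ^ k. \<phi> (dyadic k (Suc j)) *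
      indicator {enn2real (a (dyadic k j))..<enn2real (a (dyadic k (Suc j)))} r)" for k and r :: real
  have [measurable]: "f k \<in> borel_measurable lborel" for k
    unfolding f_def by measurable
  have f_int: "(\<integral>\<^sup>+r. f k r \<partial>lborel) = riemann_sum \<phi> a k" for k
  proof -
    have le: "enn2real (a (dyadic k j)) \<le> enn2real (a (dyadic k (Suc j)))" for j
      using a_finite by (intro enn2real_mono monoD[OF mono]) (auto simp: dyadic_def divide_right_mono less_top)
    have "(\<integral>\<^sup>+r. f k r \<partial>lborel) = (\<Sum>j<4 ^ k. \<phi> (dyadic k (Suc j)) *
        emeasure lborel {enn2real (a (dyadic k j))..<enn2real (a (dyadic k (Suc j)))})"
      unfolding f_def by (subst nn_integral_sum) (auto simp: nn_integral_cmult)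
    also have "\<dots> = riemann_sum \<phi> a k"
      unfolding riemann_sum_def
      by (intro sum.cong refl) (simp add: emeasure_lborel_Ico[OF le] ennreal_minus[symmetric] ennreal_a)
    finally show ?thesis .
  qed
  have f_cell: "f k r = (\<Sum>j<4 ^ k. \<phi> (dyadic k (Suc j)) *
      (if dyadic k j \<le> gen_inverse a (ennreal r) \<and> gen_inverse a (ennreal r) < dyadic k (Suc j) then 1 else 0))"
    if r: "0 \<le> r" for k r
    unfolding f_def
  proof (intro sum.cong refl arg_cong2[where f=times])
    fix j
    have "enn2real (a (dyadic k j)) \<le> r \<longleftrightarrow> a (dyadic k j) \<le> ennreal r"
      using r by (metis ennreal_a ennreal_le_iff)
    moreover have "r < enn2real (a (dyadic k (Suc j))) \<longleftrightarrow> ennreal r < a (dyadic k (Suc j))"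
      using r by (metis ennreal_a ennreal_less_iff)
    ultimately show "indicator {enn2real (a (dyadic k j))..<enn2real (a (dyadic k (Suc j)))} r =
        (if dyadic k j \<le> gen_inverse a (ennreal r) \<and> gen_inverse a (ennreal r) < dyadic k (Suc j) then 1 else 0 :: ennreal)"
      by (simp add: le_gen_inverse_iff gen_inverse_less_iff indicator_def)
  qed
  have f_val: "f k r = (if nat \<lfloor>\<sigma> * 2 ^ k\<rfloor> < 4 ^ k then \<phi> (dyadic k (Suc (nat \<lfloor>\<sigma> * 2 ^ k\<rfloor>))) else 0)"
    if r: "0 \<le> r" and \<sigma>: "gen_inverse a (ennreal r) = ennreal \<sigma>" "0 \<le> \<sigma>" for k r \<sigma>
  proof -
    have "(dyadic k j \<le> ennreal \<sigma> \<and> ennreal \<sigma> < dyadic k (Suc j)) \<longleftrightarrow> j = nat \<lfloor>\<sigma> * 2 ^ k\<rfloor>" for j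
    proof -
      have "(dyadic k j \<le> ennreal \<sigma> \<and> ennreal \<sigma> < dyadic k (Suc j)) \<longleftrightarrow> real j \<le> \<sigma> * 2 ^ k \<and> \<sigma> * 2 ^ k < real j + 1"
        using \<sigma>(2) by (simp add: dyadic_def ennreal_less_iff pos_divide_le_eq pos_less_divide_eq add.commute)
      also have "\<dots> \<longleftrightarrow> \<lfloor>\<sigma> * 2 ^ k\<rfloor> = int j" by (simp add: floor_eq_iff)
      also have "\<dots> \<longleftrightarrow> j = nat \<lfloor>\<sigma> * 2 ^ k\<rfloor>" using \<sigma>(2) by (auto simp: nat_eq_iff2)
      finally show ?thesis .
    qed
    then show ?thesis unfolding f_cell[OF r] \<sigma>(1) by (simp add: if_distrib sum.delta' cong: if_cong)
  qed
  have f_lim: "(\<lambda>k. f k r) \<longlonglongrightarrow> \<phi> (gen_inverse a (ennreal r))" if r: "0 \<le> r" for r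
  proof (cases "gen_inverse a (ennreal r)")
    \<comment> \<open>An infinite inverse lies in no dyadic cell, so \<open>f k r\<close> is 0, in
      agreement with the value of \<phi> at \<infinity>.\<close>
    case top
    then have "f k r = 0" for k
      unfolding f_cell[OF r] top using dyadic_finite by (intro sum.neutral) (auto simp: less_top[symmetric])
    then show ?thesis using \<phi>_top top by simp
  next
    case (real \<sigma>)
    define x where "x k = (real_of_int \<lfloor>\<sigma> * 2 ^ k\<rfloor> + 1) / 2 ^ k" for k :: nat
    have x_ge: "\<sigma> \<le> x k" for k
      unfolding x_def by (simp add: pos_le_divide_eq)
    have x_le: "x k \<le> \<sigma> + (1 / 2) ^ k" for k
    proof -
      have "real_of_int \<lfloor>\<sigma> * 2 ^ k\<rfloor> + 1 \<le> \<sigma> * 2 ^ k + 1" by linarith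
      then have "x k \<le> (\<sigma> * 2 ^ k + 1) / 2 ^ k" unfolding x_def by (intro divide_right_mono) auto
      then show ?thesis by (simp add: add_divide_distrib power_one_over)
    qed
    have "(\<lambda>k. \<sigma> + (1 / 2) ^ k) \<longlonglongrightarrow> \<sigma> + 0" by (intro tendsto_intros LIMSEQ_realpow_zero) auto
    then have "x \<longlonglongrightarrow> \<sigma>"
      using tendsto_sandwich[of "\<lambda>_. \<sigma>" x sequentially "\<lambda>k. \<sigma> + (1 / 2) ^ k" \<sigma>] x_ge x_le by simp
    then have x_lim: "(\<lambda>k. ennreal (x k)) \<longlonglongrightarrow> ennreal \<sigma>" by (rule tendsto_ennrealI)
    have lim: "(\<lambda>k. \<phi> (ennreal (x k))) \<longlonglongrightarrow> \<phi> (ennreal \<sigma>)"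
      by (rule tendsto_at_right_seq[OF \<phi>_right x_lim]) (auto intro: ennreal_leI x_ge)
    \<comment> \<open>The 4^k cells of length 2^-k reach up to 2^k and thus eventually cover the
      fixed time \<sigma>.\<close>
    obtain k0 where k0: "\<sigma> < 2 ^ k0" using real_arch_pow[of 2 \<sigma>] by auto
    have "\<forall>\<^sub>F k in sequentially. \<phi> (ennreal (x k)) = f k r"
      using eventually_ge_at_top[of k0]
    proof eventually_elim
      case (elim k)
      have "\<sigma> * 2 ^ k < 2 ^ k * 2 ^ k"
        using less_le_trans[OF k0 power_increasing[OF elim, of "2::real"]] by (intro mult_strict_right_mono) auto
      then have "\<lfloor>\<sigma> * 2 ^ k\<rfloor> < 4 ^ k"
        by (simp add: floor_less_iff power_mult_distrib[symmetric])
      then have "nat \<lfloor>\<sigma> * 2 ^ k\<rfloor> < 4 ^ k"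
        using real(1) by (simp add: nat_less_iff)
      moreover have "dyadic k (Suc (nat \<lfloor>\<sigma> * 2 ^ k\<rfloor>)) = ennreal (x k)"
        using real(1) by (simp add: dyadic_def x_def)
      ultimately show ?case using f_val[OF r real(2,1)] by simp
    qed
    from Lim_transform_eventually[OF lim this] show ?thesis using real by simp
  qed
  \<comment> \<open>Integrable domination: a finite inverse forces r below the total clock a
    \<infinity>, which is finite.\<close>
  have f_bound: "f k r \<le> c * indicator {0..<enn2real (a \<infinity>)} r" if r: "0 \<le> r" for k r
  proof (cases "gen_inverse a (ennreal r)")
    case top
    then have "f k r = 0"
      unfolding f_cell[OF r] top using dyadic_finite by (intro sum.neutral) (auto simp: less_top[symmetric])
    then show ?thesis by simp
  next
    case (real \<sigma>)
    have "gen_inverse a (ennreal r) < \<infinity>" using real by simp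
    then have "ennreal r < a \<infinity>" by (simp only: gen_inverse_less_iff)
    then have "r < enn2real (a \<infinity>)" using r by (metis ennreal_a ennreal_less_iff)
    then show ?thesis using r f_val[OF r real(2,1)] \<phi>_le by simp
  qed
  have "(\<lambda>k. \<integral>\<^sup>+r. f k r * indicator {0..} r \<partial>lborel) \<longlonglongrightarrow>
      (\<integral>\<^sup>+r. \<phi> (gen_inverse a (ennreal r)) * indicator {0..} r \<partial>lborel)"
  proof (rule nn_integral_dominated_convergence[where w="\<lambda>r. c * indicator {0..<enn2real (a \<infinity>)} r"])
    have lim: "(\<lambda>k. f k r * indicator {0..} r) \<longlonglongrightarrow> \<phi> (gen_inverse a (ennreal r)) * indicator {0..} r" for r
      using f_lim[of r] by (cases "0 \<le> r") auto
    then show "(\<lambda>r. \<phi> (gen_inverse a (ennreal r)) * indicator {0..} r) \<in> borel_measurable lborel"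
      by (rule borel_measurable_LIMSEQ_order) measurable
    show "AE r in lborel. (\<lambda>k. f k r * indicator {0..} r) \<longlonglongrightarrow> \<phi> (gen_inverse a (ennreal r)) * indicator {0..} r"
      using lim by simp
    show "AE r in lborel. f k r * indicator {0..} r \<le> c * indicator {0..<enn2real (a \<infinity>)} r" for k
    proof (rule AE_I2)
      fix r
      show "f k r * indicator {0..} r \<le> c * indicator {0..<enn2real (a \<infinity>)} r"
        using f_bound[of r k] by (cases "0 \<le> r") (simp_all del: infinity_ennreal_def)
    qed
    show "(\<integral>\<^sup>+r. c * indicator {0..<enn2real (a \<infinity>)} r \<partial>lborel) < \<infinity>"
      using c by (simp add: nn_integral_cmult ennreal_mult_less_top)
  qed measurable
  moreover have "f k r * indicator {0..} r = f k r" for k r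
    by (auto simp: f_def indicator_def not_le intro!: sum.neutral dest: order_trans[OF enn2real_nonneg])
  ultimately show ?thesis by (simp add: f_int)
qed

end

lemma stieltjes_Ioc:
  assumes "s \<le> t"
  shows "emeasure (interval_measure (\<lambda>t. enn2real (a (ennreal t)))) {s<..t} = a (ennreal t) - a (ennreal s)"
    and "continuous_on UNIV (\<lambda>t. enn2real (a (ennreal t)))"
    and "mono (\<lambda>t. enn2real (a (ennreal t)))"
proof -
  have fin: "a (ennreal u) \<noteq> \<top>" for u using finite[of "ennreal u"] by simp
  have e: "ennreal (enn2real (a (ennreal u))) = a (ennreal u)" for u using fin[of u] by (simp add: less_top)
  show m: "mono (\<lambda>t. enn2real (a (ennreal t)))"
    using fin by (intro monoI enn2real_mono monoD[OF mono] ennreal_leI) (auto simp: less_top)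
  have "continuous_on UNIV (\<lambda>t. a (ennreal t))"
    by (rule continuous_on_compose2[OF cont]) (auto intro!: continuous_on_ennreal continuous_on_id)
  then show ct: "continuous_on UNIV (\<lambda>t. enn2real (a (ennreal t)))"
    unfolding continuous_on_def using fin by (auto intro!: tendsto_enn2real simp: e less_top)
  have "emeasure (interval_measure (\<lambda>t. enn2real (a (ennreal t)))) {s<..t}
      = ennreal (enn2real (a (ennreal t)) - enn2real (a (ennreal s)))"
  proof (rule emeasure_interval_measure_Ioc[OF assms])
    show "continuous (at_right u) (\<lambda>t. enn2real (a (ennreal t)))" for u
      using ct by (auto simp: continuous_on_eq_continuous_at intro: continuous_within_subset[OF _ subset_UNIV])
  qed (use m in \<open>auto dest: monoD\<close>)
  then show "emeasure (interval_measure (\<lambda>t. enn2real (a (ennreal t)))) {s<..t} = a (ennreal t) - a (ennreal s)"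
    by (simp add: ennreal_minus[symmetric] e)
qed

lemma stieltjes_Ioi_finite:
  assumes top: "a \<infinity> < \<infinity>"
  shows "emeasure (interval_measure (\<lambda>t. enn2real (a (ennreal t)))) {0<..} < \<infinity>"
proof -
  let ?M = "interval_measure (\<lambda>t. enn2real (a (ennreal t)))"
  have "{0<..} = (\<Union>n. {0<..real n})" by (auto simp: real_arch_simple)
  then have "emeasure ?M {0<..} = (SUP n. emeasure ?M {0<..real n})"
    by (subst SUP_emeasure_incseq) (auto simp: incseq_def)
  also have "\<dots> \<le> a \<infinity>"
  proof (rule SUP_least)
    fix n
    have "a (ennreal (real n)) - a (ennreal 0) \<le> a \<infinity>"
      by (rule order_trans[OF diff_le_self_ennreal monoD[OF mono]]) simp
    then show "emeasure ?M {0<..real n} \<le> a \<infinity>" by (subst stieltjes_Ioc(1)) auto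
  qed
  finally show ?thesis using top by (rule le_less_trans)
qed

lemma stieltjes_singleton: "emeasure (interval_measure (\<lambda>t. enn2real (a (ennreal t)))) {s} = 0"
  using emeasure_interval_measure_Icc[of s s "\<lambda>t. enn2real (a (ennreal t))"]
    stieltjes_Ioc(2,3)[OF order_refl] by (simp add: mono_def)

context
  fixes \<phi> :: "ennreal \<Rightarrow> ennreal" and c :: ennreal
  assumes top: "a \<infinity> < \<infinity>" and c: "c < \<top>" and \<phi>_le: "\<And>s. \<phi> s \<le> c"
    and \<phi>_right: "\<And>s. s < \<infinity> \<Longrightarrow> (\<phi> \<longlongrightarrow> \<phi> s) (at_right s)"
begin

text \<open>The cells are open on the left because the Stieltjes measure of (s, t] is the increment;
  hence ceilings here where the inverse required floors.\<close>

lemma riemann_sum_tendsto_stieltjes: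
  "riemann_sum \<phi> a \<longlonglongrightarrow> (\<integral>\<^sup>+t\<in>{0..}. \<phi> (ennreal t) \<partial>interval_measure (\<lambda>t. enn2real (a (ennreal t))))"
proof -
  let ?M = "interval_measure (\<lambda>t. enn2real (a (ennreal t)))"
  define f where "f k t = (\<Sum>j<4 ^ k. \<phi> (dyadic k (Suc j)) *
      indicator {real j / 2 ^ k<..real (Suc j) / 2 ^ k} t)" for k and t :: real
  have [measurable]: "f k \<in> borel_measurable ?M" for k
    unfolding f_def by measurable
  have f_int: "(\<integral>\<^sup>+t. f k t \<partial>?M) = riemann_sum \<phi> a k" for k
  proof -
    have "(\<integral>\<^sup>+t. f k t \<partial>?M) = (\<Sum>j<4 ^ k. \<phi> (dyadic k (Suc j)) * emeasure ?M {real j / 2 ^ k<..real (Suc j) / 2 ^ k})"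
      unfolding f_def by (subst nn_integral_sum) (auto simp: nn_integral_cmult)
    also have "\<dots> = riemann_sum \<phi> a k"
      unfolding riemann_sum_def dyadic_def
      by (intro sum.cong refl arg_cong2[where f=times] stieltjes_Ioc(1)) (simp add: divide_right_mono)
    finally show ?thesis .
  qed
  have f_val: "f k t = (if nat (\<lceil>t * 2 ^ k\<rceil> - 1) < 4 ^ k then \<phi> (ennreal (real_of_int \<lceil>t * 2 ^ k\<rceil> / 2 ^ k)) else 0)"
    if t: "0 < t" for k t
  proof -
    have pos: "1 \<le> \<lceil>t * 2 ^ k\<rceil>" using t by (simp add: one_le_ceiling)
    have cell: "t \<in> {real j / 2 ^ k<..real (Suc j) / 2 ^ k} \<longleftrightarrow> j = nat (\<lceil>t * 2 ^ k\<rceil> - 1)" for j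
    proof -
      have "t \<in> {real j / 2 ^ k<..real (Suc j) / 2 ^ k} \<longleftrightarrow> real j < t * 2 ^ k \<and> t * 2 ^ k \<le> real j + 1"
        by (simp add: pos_divide_less_eq pos_le_divide_eq add.commute)
      also have "\<dots> \<longleftrightarrow> \<lceil>t * 2 ^ k\<rceil> = int j + 1" by (simp add: ceiling_eq_iff)
      also have "\<dots> \<longleftrightarrow> j = nat (\<lceil>t * 2 ^ k\<rceil> - 1)" using pos by auto
      finally show ?thesis .
    qed
    have "f k t = (\<Sum>j<4 ^ k. if j = nat (\<lceil>t * 2 ^ k\<rceil> - 1) then \<phi> (dyadic k (Suc j)) else 0)"
      unfolding f_def indicator_def cell by (intro sum.cong) auto
    also have "\<dots> = (if nat (\<lceil>t * 2 ^ k\<rceil> - 1) < 4 ^ k then \<phi> (dyadic k (Suc (nat (\<lceil>t * 2 ^ k\<rceil> - 1)))) else 0)"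
      by (simp add: sum.delta)
    also have "dyadic k (Suc (nat (\<lceil>t * 2 ^ k\<rceil> - 1))) = ennreal (real_of_int \<lceil>t * 2 ^ k\<rceil> / 2 ^ k)"
      using pos by (simp add: dyadic_def)
    finally show ?thesis .
  qed
  have f_neg: "f k t = 0" if "t \<le> 0" for k t
    unfolding f_def
  proof (intro sum.neutral ballI)
    fix j
    have "t \<le> real j / 2 ^ k" using that by (rule order_trans) simp
    then show "\<phi> (dyadic k (Suc j)) * indicator {real j / 2 ^ k<..real (Suc j) / 2 ^ k} t = 0" by simp
  qed
  have f_lim: "(\<lambda>k. f k t) \<longlonglongrightarrow> \<phi> (ennreal t)" if t: "0 < t" for t
  proof -
    define x where "x k = real_of_int \<lceil>t * 2 ^ k\<rceil> / 2 ^ k" for k :: nat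
    have x_ge: "t \<le> x k" for k unfolding x_def by (simp add: pos_le_divide_eq)
    have x_le: "x k \<le> t + (1 / 2) ^ k" for k
    proof -
      have "real_of_int \<lceil>t * 2 ^ k\<rceil> \<le> t * 2 ^ k + 1" by linarith
      then have "x k \<le> (t * 2 ^ k + 1) / 2 ^ k" unfolding x_def by (intro divide_right_mono) auto
      then show ?thesis by (simp add: add_divide_distrib power_one_over)
    qed
    have "(\<lambda>k. t + (1 / 2) ^ k) \<longlonglongrightarrow> t + 0" by (intro tendsto_intros LIMSEQ_realpow_zero) auto
    then have "x \<longlonglongrightarrow> t"
      using tendsto_sandwich[of "\<lambda>_. t" x sequentially "\<lambda>k. t + (1 / 2) ^ k" t] x_ge x_le by simp
    then have x_lim: "(\<lambda>k. ennreal (x k)) \<longlonglongrightarrow> ennreal t" by (rule tendsto_ennrealI)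
    have lim: "(\<lambda>k. \<phi> (ennreal (x k))) \<longlonglongrightarrow> \<phi> (ennreal t)"
      by (rule tendsto_at_right_seq[OF \<phi>_right x_lim]) (auto intro: ennreal_leI x_ge)
    obtain k0 where k0: "t < 2 ^ k0" using real_arch_pow[of 2 t] by auto
    have "\<forall>\<^sub>F k in sequentially. \<phi> (ennreal (x k)) = f k t"
      using eventually_ge_at_top[of k0]
    proof eventually_elim
      case (elim k)
      have "t * 2 ^ k < 2 ^ k * 2 ^ k"
        using less_le_trans[OF k0 power_increasing[OF elim, of "2::real"]] by (intro mult_strict_right_mono) auto
      then have "\<lceil>t * 2 ^ k\<rceil> \<le> 4 ^ k"
        by (simp add: ceiling_le_iff power_mult_distrib[symmetric])
      moreover have "1 \<le> \<lceil>t * 2 ^ k\<rceil>" using t by (simp add: one_le_ceiling)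
      ultimately have "nat (\<lceil>t * 2 ^ k\<rceil> - 1) < 4 ^ k"
        by (simp add: nat_less_iff)
      then show ?case unfolding f_val[OF t] x_def by simp
    qed
    from Lim_transform_eventually[OF lim this] show ?thesis .
  qed
  have "(\<lambda>k. \<integral>\<^sup>+t. f k t \<partial>?M) \<longlonglongrightarrow> (\<integral>\<^sup>+t. \<phi> (ennreal t) * indicator {0<..} t \<partial>?M)"
  proof (rule nn_integral_dominated_convergence[where w="\<lambda>t. c * indicator {0<..} t"])
    have lim: "(\<lambda>k. f k t) \<longlonglongrightarrow> \<phi> (ennreal t) * indicator {0<..} t" for t
      using f_lim[of t] f_neg[of t] by (cases "0 < t") auto
    then show "(\<lambda>t. \<phi> (ennreal t) * indicator {0<..} t) \<in> borel_measurable ?M"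
      by (rule borel_measurable_LIMSEQ_order) measurable
    show "AE t in ?M. (\<lambda>k. f k t) \<longlonglongrightarrow> \<phi> (ennreal t) * indicator {0<..} t"
      using lim by simp
    show "AE t in ?M. f k t \<le> c * indicator {0<..} t" for k
    proof (rule AE_I2)
      fix t
      show "f k t \<le> c * indicator {0<..} t"
        using f_val[of t k] f_neg[of t k] \<phi>_le by (cases "0 < t") auto
    qed
    show "(\<integral>\<^sup>+t. c * indicator {0<..} t \<partial>?M) < \<infinity>"
      using c stieltjes_Ioi_finite[OF top] by (simp add: nn_integral_cmult ennreal_mult_less_top)
  qed measurable
  \<comment> \<open>The cells see only t > 0, and a continuous clock puts no mass at 0.\<close>
  moreover have "(\<integral>\<^sup>+t. \<phi> (ennreal t) * indicator {0<..} t \<partial>?M) = (\<integral>\<^sup>+t. \<phi> (ennreal t) * indicator {0..} t \<partial>?M)"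
  proof (rule nn_integral_cong_AE)
    have "AE t in ?M. t \<notin> {0}"
      using stieltjes_singleton[of 0] by (intro AE_not_in) (simp add: null_sets_def)
    then show "AE t in ?M. \<phi> (ennreal t) * indicator {0<..} t = \<phi> (ennreal t) * indicator {0..} t"
      by eventually_elim (auto simp: indicator_def)
  qed
  ultimately show ?thesis by (simp add: f_int)
qed

end

end

section \<open>Additive functionals and their inverses\<close>

lemma ext0_simps [simp]: "ext0 g None = 0" "ext0 g (Some x) = g x"
  by (simp_all add: ext0_def)

context standard_markov begin

text \<open>At the cemetery the path is absorbed and \<open>ext0 g\<close> stays 0; at a point of X,
  open sets of X are open in the compactification. So continuity of g on X is enough.\<close>

lemma ext0_path_right_continuous:
  fixes g :: "'x \<Rightarrow> 'b::{topological_space, zero}"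
  assumes lim: "limitin one_point_topology (\<lambda>s. pos X s \<omega>) (pos X t \<omega>) (at_right t)"
    and g: "continuous_on UNIV g"
  shows "((\<lambda>s. ext0 g (pos X s \<omega>)) \<longlongrightarrow> ext0 g (pos X t \<omega>)) (at_right t)"
proof (cases "pos X t \<omega>")
  case None
  have "\<forall>\<^sub>F s in at_right t. ext0 g (pos X s \<omega>) = 0"
    unfolding eventually_at_filter
    by (intro always_eventually) (auto simp: pos_absorbing[OF less_imp_le None])
  then show ?thesis unfolding None by (simp add: tendsto_eventually)
next
  case (Some x)
  show ?thesis
  proof (rule topological_tendstoI)
    fix V :: "'b set" assume V: "open V" "ext0 g (pos X t \<omega>) \<in> V"
    have "open (g -` V)" using V(1) g by (simp add: continuous_on_open_vimage)
    then have "openin one_point_topology (Some ` (g -` V))"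
      by (auto simp: openin_one_point_topology inj_vimage_image_eq)
    moreover have "pos X t \<omega> \<in> Some ` (g -` V)" using V(2) Some by auto
    ultimately have "\<forall>\<^sub>F s in at_right t. pos X s \<omega> \<in> Some ` (g -` V)"
      using lim unfolding limitin_def by blast
    then show "\<forall>\<^sub>F s in at_right t. ext0 g (pos X s \<omega>) \<in> V" by eventually_elim auto
  qed
qed

end

text \<open>Dyadic times strictly to the right of r approximate it; for fixed k they take countably
  many values, which gives joint measurability of each approximation.\<close>

lemma joint_measurable_right_continuous:
  fixes U :: "real \<Rightarrow> 'w \<Rightarrow> ennreal"
  assumes meas: "\<And>r. U r \<in> borel_measurable M"
    and right: "\<And>r x \<omega>. 0 \<le> r \<Longrightarrow> x \<longlonglongrightarrow> r \<Longrightarrow> (\<And>k. r \<le> x k) \<Longrightarrow> (\<lambda>k. U (x k) \<omega>) \<longlonglongrightarrow> U r \<omega>"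
  shows "(\<lambda>(r, \<omega>). U r \<omega> * indicator {0..} r) \<in> borel_measurable (lborel \<Otimes>\<^sub>M M)"
proof -
  define x where "x k r = (real_of_int \<lfloor>r * 2 ^ k\<rfloor> + 1) / 2 ^ k" for k and r :: real
  have x_ge: "r \<le> x k r" for k r unfolding x_def by (simp add: pos_le_divide_eq)
  have x_lim: "(\<lambda>k. x k r) \<longlonglongrightarrow> r" for r
  proof -
    have "x k r \<le> r + (1 / 2) ^ k" for k
    proof -
      have "real_of_int \<lfloor>r * 2 ^ k\<rfloor> + 1 \<le> r * 2 ^ k + 1" by linarith
      then have "x k r \<le> (r * 2 ^ k + 1) / 2 ^ k" unfolding x_def by (intro divide_right_mono) auto
      then show ?thesis by (simp add: add_divide_distrib power_one_over)
    qed
    moreover have "(\<lambda>k. r + (1 / 2) ^ k) \<longlonglongrightarrow> r + 0" by (intro tendsto_intros LIMSEQ_realpow_zero) auto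
    ultimately show ?thesis
      using tendsto_sandwich[of "\<lambda>_. r" "\<lambda>k. x k r" sequentially "\<lambda>k. r + (1 / 2) ^ k" r] x_ge by simp
  qed
  have "(\<lambda>z. U (x k (fst z)) (snd z)) \<in> borel_measurable (lborel \<Otimes>\<^sub>M M)" for k
  proof -
    have "(\<lambda>z. U ((real_of_int i + 1) / 2 ^ k) (snd z)) \<in> borel_measurable (lborel \<Otimes>\<^sub>M M)" for i :: int
      by (rule measurable_compose[OF measurable_snd meas])
    moreover have "(\<lambda>z. \<lfloor>fst z * (2::real) ^ k\<rfloor>) \<in> (lborel \<Otimes>\<^sub>M M) \<rightarrow>\<^sub>M count_space UNIV" by measurable
    ultimately show ?thesis unfolding x_def by (rule measurable_compose_countable)
  qed
  then have m: "(\<lambda>z. U (x k (fst z)) (snd z) * indicator {0..} (fst z)) \<in> borel_measurable (lborel \<Otimes>\<^sub>M M)" for k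
    by measurable
  have "(\<lambda>k. U (x k (fst z)) (snd z) * indicator {0..} (fst z)) \<longlonglongrightarrow> U (fst z) (snd z) * indicator {0..} (fst z)" for z
    using right[OF _ x_lim x_ge, of "fst z" "snd z"] by (cases "0 \<le> fst z") auto
  then have "(\<lambda>z. U (fst z) (snd z) * indicator {0..} (fst z)) \<in> borel_measurable (lborel \<Otimes>\<^sub>M M)"
    by (intro borel_measurable_LIMSEQ_order[OF _ m])
  then show ?thesis by (simp add: case_prod_beta)
qed

locale pcaf_process = standard_markov X
  for X :: "('w, 'x::{metric_space, second_countable_topology}) process" +
  fixes p :: "real \<Rightarrow> 'x \<Rightarrow> 'x \<Rightarrow> ennreal" and A :: "ennreal \<Rightarrow> 'w \<Rightarrow> ennreal" and \<mu> :: "'x measure"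
  assumes pcaf: "pcaf X A" and green: "green_potential_of X p A \<mu>"
    and kato: "kato_measure (green p 0) \<mu>"
    and lsc: "lower_semicontinuous (\<lambda>(x, y). green p 0 x y)"
    and lc: "locally compact (UNIV :: 'x set)"
begin

abbreviation "G \<equiv> green p 0"

text \<open>One defining set of the functional is fixed for good, so that its properties hold on it
  exactly and survive shifts.\<close>

definition good :: "'w set" where
  "good = (SOME \<Lambda>. \<Lambda> \<in> sets (natural X \<infinity>) \<and>
        (\<forall>x. AE \<omega> in law X (Some x). \<omega> \<in> \<Lambda>) \<and>
        (\<forall>t<\<infinity>. shift X t ` \<Lambda> \<subseteq> \<Lambda>) \<and>
        (\<forall>\<omega>\<in>\<Lambda>. A 0 \<omega> = 0 \<and>
           continuous_on UNIV (\<lambda>t. A t \<omega>) \<and>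
           (\<forall>t<\<infinity>. A t \<omega> < \<infinity>) \<and>
           (\<forall>t\<ge>lifetime X \<omega>. A t \<omega> = A (lifetime X \<omega>) \<omega>) \<and>
           (\<forall>t<\<infinity>. \<forall>s. A (t + s) \<omega> = A t \<omega> + A s (shift X t \<omega>))))"

lemma good_all: "good \<in> sets (natural X \<infinity>) \<and>
        (\<forall>x. AE \<omega> in law X (Some x). \<omega> \<in> good) \<and>
        (\<forall>t<\<infinity>. shift X t ` good \<subseteq> good) \<and>
        (\<forall>\<omega>\<in>good. A 0 \<omega> = 0 \<and>
           continuous_on UNIV (\<lambda>t. A t \<omega>) \<and>
           (\<forall>t<\<infinity>. A t \<omega> < \<infinity>) \<and>
           (\<forall>t\<ge>lifetime X \<omega>. A t \<omega> = A (lifetime X \<omega>) \<omega>) \<and>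
           (\<forall>t<\<infinity>. \<forall>s. A (t + s) \<omega> = A t \<omega> + A s (shift X t \<omega>)))"
  unfolding good_def
proof (rule someI_ex)
  show "\<exists>\<Lambda>. \<Lambda> \<in> sets (natural X \<infinity>) \<and>
        (\<forall>x. AE \<omega> in law X (Some x). \<omega> \<in> \<Lambda>) \<and>
        (\<forall>t<\<infinity>. shift X t ` \<Lambda> \<subseteq> \<Lambda>) \<and>
        (\<forall>\<omega>\<in>\<Lambda>. A 0 \<omega> = 0 \<and>
           continuous_on UNIV (\<lambda>t. A t \<omega>) \<and>
           (\<forall>t<\<infinity>. A t \<omega> < \<infinity>) \<and>
           (\<forall>t\<ge>lifetime X \<omega>. A t \<omega> = A (lifetime X \<omega>) \<omega>) \<and>
           (\<forall>t<\<infinity>. \<forall>s. A (t + s) \<omega> = A t \<omega> + A s (shift X t \<omega>)))"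
    using pcaf unfolding pcaf_def Bex_def by (elim conjE)
qed

lemma good_natural: "good \<in> sets (natural X \<infinity>)" using good_all by (elim conjE)

lemma AE_good: "AE \<omega> in law X (Some x). \<omega> \<in> good" using good_all by blast

lemma good_shift: "\<omega> \<in> good \<Longrightarrow> t < \<infinity> \<Longrightarrow> shift X t \<omega> \<in> good" using good_all by blast

lemma good_zero: "\<omega> \<in> good \<Longrightarrow> A 0 \<omega> = 0" using good_all by blast

lemma good_cont: "\<omega> \<in> good \<Longrightarrow> continuous_on UNIV (\<lambda>t. A t \<omega>)" using good_all by blast

lemma good_finite: "\<omega> \<in> good \<Longrightarrow> t < \<infinity> \<Longrightarrow> A t \<omega> < \<infinity>" using good_all by blast

lemma good_lifetime: "\<omega> \<in> good \<Longrightarrow> lifetime X \<omega> \<le> t \<Longrightarrow> A t \<omega> = A (lifetime X \<omega>) \<omega>" using good_all by blast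

lemma good_add: "\<omega> \<in> good \<Longrightarrow> t < \<infinity> \<Longrightarrow> A (t + s) \<omega> = A t \<omega> + A s (shift X t \<omega>)" using good_all by blast

lemma A_measurable: "A t \<in> borel_measurable (natural X t)" using pcaf by (simp add: pcaf_def)

text \<open>A version that is a clock for every path, so that its inverses are stopping times exactly.\<close>
definition clk :: "ennreal \<Rightarrow> 'w \<Rightarrow> ennreal" where
  "clk s \<omega> = (if \<omega> \<in> good \<and> pos X 0 \<omega> \<noteq> None then A s \<omega> else 0)"

text \<open>Paths starting at the cemetery are left out because \<open>good\<close> has full
  probability only from points of X. The remaining set is null under every law, that of
  \<open>None\<close> included, so all its subsets belong to the filtration.\<close>

definition exceptional :: "'w set" where
  "exceptional = {\<omega>. \<omega> \<notin> good \<and> pos X 0 \<omega> \<noteq> None}"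

definition tau :: "real \<Rightarrow> 'w \<Rightarrow> ennreal" where
  "tau t \<omega> = gen_inverse (\<lambda>s. clk s \<omega>) (ennreal t)"

text \<open>Monotonicity is not among the defining properties of the functional; it follows from
  additivity with nonnegative increments.\<close>

lemma clock_clk: "clock (\<lambda>s. clk s \<omega>)"
proof (cases "\<omega> \<in> good \<and> pos X 0 \<omega> \<noteq> None")
  case True
  then have \<omega>: "\<omega> \<in> good" and eq: "(\<lambda>s. clk s \<omega>) = (\<lambda>s. A s \<omega>)" by (auto simp: clk_def)
  show ?thesis
    unfolding eq
  proof
    show "mono (\<lambda>s. A s \<omega>)"
    proof (rule monoI)
      fix s t :: ennreal assume st: "s \<le> t"
      show "A s \<omega> \<le> A t \<omega>"
      proof (cases "s < \<infinity>")
        case True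
        have "A (s + (t - s)) \<omega> = A s \<omega> + A (t - s) (shift X s \<omega>)" by (rule good_add[OF \<omega> True])
        then show ?thesis using add_diff_inverse_ennreal[OF st] by simp
      next
        case False
        then show ?thesis using st by (simp add: less_top[symmetric] top_unique)
      qed
    qed
  qed (use good_cont[OF \<omega>] good_zero[OF \<omega>] good_finite[OF \<omega>] in auto)
next
  case False
  then have eq: "(\<lambda>s. clk s \<omega>) = (\<lambda>s. 0)" by (auto simp: clk_def)
  show ?thesis unfolding eq by standard (auto simp: monoI)
qed

lemma pos_alive_natural: "{\<omega>. pos X 0 \<omega> \<noteq> None} \<in> sets (natural X \<infinity>)"
proof -
  have "pos X 0 -` (space borel_cem - {None}) \<inter> space (natural X \<infinity>) \<in> sets (natural X \<infinity>)"
    by (intro measurable_sets[OF pos_natural] sets.compl_sets None_borel_cem)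
  then show ?thesis by (simp add: vimage_def Collect_neg_eq[symmetric])
qed

lemma exceptional_natural: "exceptional \<in> sets (natural X \<infinity>)"
proof -
  have "exceptional = {\<omega>. pos X 0 \<omega> \<noteq> None} - good" by (auto simp: exceptional_def)
  then show ?thesis using pos_alive_natural good_natural by (simp add: sets.Diff)
qed

lemma AE_not_exceptional: "AE \<omega> in law X z. \<omega> \<notin> exceptional"
proof (cases z)
  case None
  show ?thesis using normal[of None] unfolding None by eventually_elim (simp add: exceptional_def)
next
  case (Some x)
  show ?thesis using AE_good[of x] unfolding Some by eventually_elim (simp add: exceptional_def)
qed

lemma exceptional_null: "emeasure (law X z) exceptional = 0"
proof -
  have "exceptional \<in> sets (law X z)" using exceptional_natural natural_events by (auto simp: sets_law)
  then show ?thesis using AE_not_exceptional[of z]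
    by (subst (asm) AE_iff_measurable[of exceptional]) auto
qed

lemma exceptional_subset_filt: "S \<subseteq> exceptional \<Longrightarrow> S \<in> sets (filt X t)"
  by (rule polar_subset_filt[OF exceptional_natural exceptional_null])

lemma clk_natural [measurable]: "clk s \<in> borel_measurable (natural X \<infinity>)"
proof -
  have [measurable]: "A s \<in> borel_measurable (natural X \<infinity>)" by (rule measurable_natural_infinity[OF A_measurable])
  have "{\<omega>. \<omega> \<in> good \<and> pos X 0 \<omega> \<noteq> None} \<in> sets (natural X \<infinity>)"
    using sets.Int[OF good_natural pos_alive_natural] by (simp add: Int_def)
  then have [measurable]: "Measurable.pred (natural X \<infinity>) (\<lambda>\<omega>. \<omega> \<in> good \<and> pos X 0 \<omega> \<noteq> None)" by (simp add: pred_def)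
  show ?thesis unfolding clk_def by measurable
qed

lemma clk_events [measurable]: "clk s \<in> borel_measurable (events X)"
  by (rule measurable_natural_events[OF clk_natural])

text \<open>The modified clock differs from A by initial information and by the exceptional set, and
  completeness of the filtration absorbs the latter.\<close>

lemma clk_filt: "{\<omega>. r < clk t \<omega>} \<in> sets (filt X t)"
proof -
  have "{\<omega>. r < A t \<omega>} \<in> sets (filt X t)"
    using measurable_sets[OF A_measurable[of t], of "{r<..}"] natural_filt[of t] by (auto simp: vimage_def)
  moreover have "{\<omega>. pos X 0 \<omega> \<noteq> None} \<in> sets (filt X t)"
  proof -
    have "pos X 0 -` (space borel_cem - {None}) \<inter> space (filt X 0) \<in> sets (filt X 0)"
      by (intro measurable_sets[OF pos_filt] sets.compl_sets None_borel_cem)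
    then show ?thesis using F.sets_F_mono[of 0 t] by (auto simp: vimage_def F.space_F Collect_neg_eq[symmetric])
  qed
  moreover have "{\<omega>. r < clk t \<omega>} = {\<omega>. r < A t \<omega>} \<inter> ({\<omega>. pos X 0 \<omega> \<noteq> None} - exceptional)"
    by (auto simp: clk_def exceptional_def)
  ultimately show ?thesis using exceptional_subset_filt[OF order_refl, of t] by (simp add: sets.Int sets.Diff)
qed

lemma tau_less_iff: "tau t \<omega> < s \<longleftrightarrow> ennreal t < clk s \<omega>"
  unfolding tau_def by (rule clock.gen_inverse_less_iff[OF clock_clk])

lemma stopping_time_tau: "stopping_time (filt X) (tau t)"
  by (rule stopping_time_lessI) (simp add: tau_less_iff clk_filt)

text \<open>Additivity, with two degenerate cases: a path dead at 0 has clock 0, and a path dead at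
  T has a frozen functional, matching the zero clock of the shifted path.\<close>

lemma clk_shift:
  assumes \<omega>: "\<omega> \<notin> exceptional" and T: "T < \<infinity>"
  shows "clk s (shift X T \<omega>) = clk (T + s) \<omega> - clk T \<omega>"
proof (cases "pos X 0 \<omega> = None")
  case True
  then have "pos X 0 (shift X T \<omega>) = None" using pos_absorbing[OF _ True, of "T + 0"] by (simp add: pos_shift)
  then show ?thesis using True by (simp add: clk_def)
next
  case False
  then have g: "\<omega> \<in> good" using \<omega> by (simp add: exceptional_def)
  then have gs: "shift X T \<omega> \<in> good" by (rule good_shift[OF _ T])
  show ?thesis
  proof (cases "pos X T \<omega> = None")
    case True
    then have "lifetime X \<omega> \<le> T" unfolding lifetime_def by (intro Inf_lower) simp
    moreover have "T \<le> T + s" by simp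
    ultimately have "A (T + s) \<omega> = A T \<omega>" using good_lifetime[OF g, of T] good_lifetime[OF g, of "T + s"] order_trans by metis
    then show ?thesis using True False g good_finite[OF g T] by (simp add: clk_def pos_shift diff_eq_0_iff_ennreal)
  next
    case alive: False
    then show ?thesis using False g gs good_add[OF g T, of s] good_finite[OF g T]
      by (simp add: clk_def pos_shift less_top)
  qed
qed

text \<open>The occupation integral on the right has a Green potential as its expectation, so this
  bound leads to finiteness of the total clock.\<close>

lemma clk_infinity_le:
  assumes \<omega>: "\<omega> \<in> good" "pos X 0 \<omega> \<noteq> None"
  shows "clk \<infinity> \<omega> \<le> (\<integral>\<^sup>+t\<in>{0..}. ext0 (\<lambda>_. 1) (pos X (ennreal t) \<omega>) \<partial>stieltjes A \<omega>)" (is "_ \<le> ?I")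
proof -
  interpret clock "\<lambda>s. clk s \<omega>" by (rule clock_clk)
  have eq: "stieltjes A \<omega> = interval_measure (\<lambda>t. enn2real (clk (ennreal t) \<omega>))"
    using \<omega> by (simp add: stieltjes_def clk_def)
  have "clk (of_nat n) \<omega> \<le> ?I" for n
  proof -
    \<comment> \<open>Cut at the lifetime, after which the functional is frozen. The path may be
      dead at the end point m itself, but a continuous clock gives that point no mass.\<close>
    define m where "m = enn2real (min (of_nat n) (lifetime X \<omega>))"
    have m: "ennreal m = min (of_nat n) (lifetime X \<omega>)" "0 \<le> m"
      unfolding m_def by (auto simp: min_less_iff_disj of_nat_less_top)
    have "clk (of_nat n) \<omega> = clk (ennreal m) \<omega>"
      using \<omega> good_lifetime[OF \<omega>(1), of "of_nat n"] unfolding m(1) by (auto simp: clk_def min_def)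
    also have "\<dots> = emeasure (stieltjes A \<omega>) {0<..m}"
      unfolding eq using zero by (simp add: stieltjes_Ioc(1)[OF m(2)])
    also have "\<dots> = (\<integral>\<^sup>+t. indicator {0<..m} t \<partial>stieltjes A \<omega>)"
      by (simp add: eq)
    also have "\<dots> \<le> ?I"
    proof (rule nn_integral_mono_AE)
      have "AE t in stieltjes A \<omega>. t \<notin> {m}"
        using stieltjes_singleton[of m] unfolding eq by (intro AE_not_in) (simp add: null_sets_def)
      then show "AE t in stieltjes A \<omega>. indicator {0<..m} t \<le> ext0 (\<lambda>_. 1 :: ennreal) (pos X (ennreal t) \<omega>) * indicator {0..} t"
      proof eventually_elim
        case (elim t)
        show ?case
        proof (cases "t \<in> {0<..m}")
          case True
          then have "ennreal t < ennreal m" using elim by (simp add: ennreal_less_iff)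
          also have "ennreal m \<le> lifetime X \<omega>" using m by simp
          finally have "\<not> lifetime X \<omega> \<le> ennreal t" by (simp add: not_le)
          then have "pos X (ennreal t) \<omega> \<noteq> None" unfolding lifetime_def by (auto intro: Inf_lower)
          then obtain y where "pos X (ennreal t) \<omega> = Some y" by auto
          then have "ext0 (\<lambda>_. 1 :: ennreal) (pos X (ennreal t) \<omega>) * indicator {0..} t = 1" using True by simp
          then show ?thesis using True by (simp only: indicator_simps order_refl)
        qed simp
      qed
    qed
    finally show ?thesis .
  qed
  moreover have "(\<lambda>n. clk (of_nat n) \<omega>) \<longlonglongrightarrow> clk \<infinity> \<omega>"
    using isCont[of \<infinity>] of_nat_tendsto_top_ennreal by (auto intro: isCont_tendsto_compose)
  ultimately show ?thesis by (intro LIMSEQ_le_const2) auto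
qed

lemma green_zero:
  assumes "u \<in> borel_measurable borel"
  shows "(\<integral>\<^sup>+\<omega>. (\<integral>\<^sup>+t\<in>{0..}. ext0 u (pos X (ennreal t) \<omega>) \<partial>stieltjes A \<omega>) \<partial>law X (Some x)) = green_op G \<mu> u x"
proof -
  have "\<forall>x. \<forall>u\<in>borel_measurable borel. (\<integral>\<^sup>+\<omega>. (\<integral>\<^sup>+t\<in>{0..}. ennreal (exp (- 0 * t)) * ext0 u (pos X (ennreal t) \<omega>)
           \<partial>stieltjes A \<omega>) \<partial>law X (Some x)) = green_op (green p 0) \<mu> u x"
    using green unfolding green_potential_of_def by (rule allE[of _ 0]) (erule impE, rule order_refl)
  then show ?thesis using assms by simp
qed

lemma AE_clk_finite: "AE \<omega> in law X (Some x). clk \<infinity> \<omega> < \<infinity>"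
proof -
  have [measurable]: "clk \<infinity> \<in> borel_measurable (law X (Some x))" by measurable
  have "(\<integral>\<^sup>+\<omega>. clk \<infinity> \<omega> \<partial>law X (Some x)) \<le>
      (\<integral>\<^sup>+\<omega>. (\<integral>\<^sup>+t\<in>{0..}. ext0 (\<lambda>_. 1) (pos X (ennreal t) \<omega>) \<partial>stieltjes A \<omega>) \<partial>law X (Some x))"
  proof (rule nn_integral_mono_AE)
    show "AE \<omega> in law X (Some x). clk \<infinity> \<omega> \<le> (\<integral>\<^sup>+t\<in>{0..}. ext0 (\<lambda>_. 1) (pos X (ennreal t) \<omega>) \<partial>stieltjes A \<omega>)"
      using AE_good[of x] normal[of "Some x"] by eventually_elim (use clk_infinity_le in simp)
  qed
  also have "\<dots> = green_op G \<mu> (\<lambda>_. 1) x"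
    by (rule green_zero) simp
  also have "\<dots> < \<infinity>" using kato by (simp add: kato_measure_def)
  finally have "(\<integral>\<^sup>+\<omega>. clk \<infinity> \<omega> \<partial>law X (Some x)) \<noteq> \<infinity>" by simp
  from nn_integral_PInf_AE[OF _ this] show ?thesis by (auto simp: less_top)
qed

definition regular :: "'w \<Rightarrow> bool" where
  "regular \<omega> \<longleftrightarrow> \<omega> \<notin> exceptional \<and> clk \<infinity> \<omega> < \<infinity> \<and>
     (\<forall>t<\<infinity>. limitin one_point_topology (\<lambda>s. pos X s \<omega>) (pos X t \<omega>) (at_right t))"

lemma AE_regular: "AE \<omega> in law X z. regular \<omega>"
proof -
  have "AE \<omega> in law X z. clk \<infinity> \<omega> < \<infinity>"
  proof (cases z)
    case None
    show ?thesis using normal[of None] unfolding None by eventually_elim (simp add: clk_def)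
  next
    case (Some x)
    show ?thesis unfolding Some by (rule AE_clk_finite)
  qed
  then show ?thesis
    using AE_not_exceptional[of z] paths_right_continuous[of z] by eventually_elim (simp add: regular_def)
qed

lemma regular_right_continuous:
  fixes g :: "'x \<Rightarrow> 'b::{topological_space, zero}"
  assumes "regular \<omega>" "continuous_on UNIV g" "t < \<infinity>"
  shows "((\<lambda>s. ext0 g (pos X s \<omega>)) \<longlongrightarrow> ext0 g (pos X t \<omega>)) (at_right t)"
  using assms unfolding regular_def by (intro ext0_path_right_continuous) auto

lemma tau_mono: "s \<le> t \<Longrightarrow> tau s \<omega> \<le> tau t \<omega>"
  unfolding tau_def by (intro clock.gen_inverse_mono[OF clock_clk] ennreal_leI)

lemma clk_tau: "tau t \<omega> < \<infinity> \<Longrightarrow> clk (tau t \<omega>) \<omega> = ennreal t"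
  unfolding tau_def by (rule clock.a_gen_inverse[OF clock_clk])

lemma tau_right_seq:
  fixes g :: "'x \<Rightarrow> 'b::{topological_space, zero}"
  assumes \<omega>: "regular \<omega>" and g: "continuous_on UNIV g" and x: "x \<longlonglongrightarrow> r" "\<And>k. r \<le> x k"
  shows "(\<lambda>k. ext0 g (pos X (tau (x k) \<omega>) \<omega>)) \<longlonglongrightarrow> ext0 g (pos X (tau r \<omega>) \<omega>)"
proof (cases "tau r \<omega> < \<infinity>")
  case True
  have "(\<lambda>k. gen_inverse (\<lambda>s. clk s \<omega>) (ennreal (x k))) \<longlonglongrightarrow> gen_inverse (\<lambda>s. clk s \<omega>) (ennreal r)"
    by (rule tendsto_at_right_seq[OF clock.gen_inverse_right_continuous[OF clock_clk]])
      (auto intro: tendsto_ennrealI x ennreal_leI)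
  then have lim: "(\<lambda>k. tau (x k) \<omega>) \<longlonglongrightarrow> tau r \<omega>" by (simp add: tau_def)
  show ?thesis
    by (rule tendsto_at_right_seq[OF regular_right_continuous[OF \<omega> g True] lim]) (auto intro: tau_mono x)
next
  case False
  then have "tau (x k) \<omega> = tau r \<omega>" for k
    using tau_mono[OF x(2), of \<omega> k] by (simp add: less_top[symmetric] top_unique)
  then show ?thesis by simp
qed

text \<open>The integral of g along the path against the clock. As a liminf of Riemann sums it is
  defined and measurable on all paths; on regular paths, for continuous bounded g, it is both a
  Stieltjes integral and an integral along the inverse clock.\<close>

definition additive :: "('x \<Rightarrow> ennreal) \<Rightarrow> 'w \<Rightarrow> ennreal" where
  "additive g \<omega> = liminf (\<lambda>k. riemann_sum (\<lambda>s. ext0 g (pos X s \<omega>)) (\<lambda>s. clk s \<omega>) k)"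

lemma additive_natural [measurable]:
  assumes "g \<in> borel_measurable borel"
  shows "additive g \<in> borel_measurable (natural X \<infinity>)"
proof -
  have [measurable]: "(\<lambda>\<omega>. ext0 g (pos X s \<omega>)) \<in> borel_measurable (natural X \<infinity>)" for s
    by (rule measurable_compose[OF pos_natural measurable_ext0[OF assms]]) simp
  show ?thesis unfolding additive_def riemann_sum_def by measurable
qed

context
  fixes g :: "'x \<Rightarrow> ennreal" and c :: ennreal
  assumes g: "continuous_on UNIV g" and g_le: "\<And>y. g y \<le> c" and c: "c < \<top>"
begin

lemma ext0_g_le: "ext0 g z \<le> c"
  using g_le by (cases z) auto

lemma g_borel [measurable]: "g \<in> borel_measurable borel"
  using g by (rule borel_measurable_continuous_onI)

lemma additive_tau:
  assumes \<omega>: "regular \<omega>"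
  shows "additive g \<omega> = (\<integral>\<^sup>+r\<in>{0..}. ext0 g (pos X (tau r \<omega>) \<omega>) \<partial>lborel)"
proof -
  have top: "clk \<infinity> \<omega> < \<infinity>" using \<omega> by (simp add: regular_def)
  have "riemann_sum (\<lambda>s. ext0 g (pos X s \<omega>)) (\<lambda>s. clk s \<omega>) \<longlonglongrightarrow> (\<integral>\<^sup>+r\<in>{0..}. ext0 g (pos X (tau r \<omega>) \<omega>) \<partial>lborel)"
    unfolding tau_def
    by (rule clock.riemann_sum_tendsto_inverse[OF clock_clk top c ext0_g_le _ regular_right_continuous[OF \<omega> g]])
      (auto simp: pos_infinity[simplified])
  then show ?thesis unfolding additive_def by (rule lim_imp_Liminf[OF sequentially_bot])
qed

lemma additive_stieltjes:
  assumes \<omega>: "regular \<omega>" "\<omega> \<in> good" "pos X 0 \<omega> \<noteq> None"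
  shows "additive g \<omega> = (\<integral>\<^sup>+t\<in>{0..}. ext0 g (pos X (ennreal t) \<omega>) \<partial>stieltjes A \<omega>)"
proof -
  have top: "clk \<infinity> \<omega> < \<infinity>" using \<omega> by (simp add: regular_def)
  have eq: "stieltjes A \<omega> = interval_measure (\<lambda>t. enn2real (clk (ennreal t) \<omega>))"
    using \<omega> by (simp add: stieltjes_def clk_def)
  have "riemann_sum (\<lambda>s. ext0 g (pos X s \<omega>)) (\<lambda>s. clk s \<omega>) \<longlonglongrightarrow> (\<integral>\<^sup>+t\<in>{0..}. ext0 g (pos X (ennreal t) \<omega>) \<partial>stieltjes A \<omega>)"
    unfolding eq
    by (rule clock.riemann_sum_tendsto_stieltjes[OF clock_clk top c ext0_g_le regular_right_continuous[OF \<omega>(1) g]])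
  then show ?thesis unfolding additive_def by (rule lim_imp_Liminf[OF sequentially_bot])
qed

lemma additive_expectation:
  "(\<integral>\<^sup>+\<omega>. additive g \<omega> \<partial>law X z) = ext0 (green_op G \<mu> g) z"
proof (cases z)
  case None
  have "AE \<omega> in law X z. additive g \<omega> = 0"
    using normal[of None] unfolding None
    by eventually_elim (simp add: additive_def riemann_sum_def clk_def Liminf_const)
  then have "(\<integral>\<^sup>+\<omega>. additive g \<omega> \<partial>law X z) = (\<integral>\<^sup>+\<omega>. 0 \<partial>law X z)" by (rule nn_integral_cong_AE)
  then show ?thesis using None by simp
next
  case (Some x)
  have "(\<integral>\<^sup>+\<omega>. additive g \<omega> \<partial>law X z) =
      (\<integral>\<^sup>+\<omega>. (\<integral>\<^sup>+t\<in>{0..}. ext0 g (pos X (ennreal t) \<omega>) \<partial>stieltjes A \<omega>) \<partial>law X (Some x))"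
    unfolding Some
  proof (rule nn_integral_cong_AE)
    show "AE \<omega> in law X (Some x). additive g \<omega> = (\<integral>\<^sup>+t\<in>{0..}. ext0 g (pos X (ennreal t) \<omega>) \<partial>stieltjes A \<omega>)"
      using AE_regular[of "Some x"] AE_good[of x] normal[of "Some x"]
      by eventually_elim (use additive_stieltjes in simp)
  qed
  also have "\<dots> = green_op G \<mu> g x"
    by (rule green_zero[OF g_borel])
  finally show ?thesis using Some by simp
qed

text \<open>After \<open>tau t\<close> the remaining clock is the old one minus t, so its inverse at
  r is \<open>tau (t + r)\<close> measured from \<open>tau t\<close>.\<close>

lemma additive_shift_tau:
  assumes \<omega>: "regular \<omega>" and t: "0 \<le> t"
  shows "additive g (shift X (tau t \<omega>) \<omega>) = (\<integral>\<^sup>+r\<in>{0..}. ext0 g (pos X (tau (t + r) \<omega>) \<omega>) \<partial>lborel)"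
proof (cases "tau t \<omega> < \<infinity>")
  \<comment> \<open>If \<open>tau t\<close> is infinite, the shifted path is at the cemetery from
    time 0 on, and both sides vanish.\<close>
  case False
  then have inf: "tau t \<omega> = \<infinity>" by (simp add: less_top[symmetric])
  have "clk s (shift X (tau t \<omega>) \<omega>) = 0" for s by (simp add: clk_def pos_shift inf pos_infinity[simplified])
  then have "additive g (shift X (tau t \<omega>) \<omega>) = 0" by (simp add: additive_def riemann_sum_def Liminf_const)
  moreover have "ext0 g (pos X (tau (t + r) \<omega>) \<omega>) * indicator {0..} r = 0" for r
    using tau_mono[of t "t + r" \<omega>] by (auto simp: indicator_def inf top_unique pos_infinity[simplified])
  then have "(\<integral>\<^sup>+r\<in>{0..}. ext0 g (pos X (tau (t + r) \<omega>) \<omega>) \<partial>lborel) = (\<integral>\<^sup>+r. 0 \<partial>(lborel :: real measure))"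
    by (intro nn_integral_cong)
  ultimately show ?thesis by simp
next
  case True
  define T where "T = tau t \<omega>"
  have T: "T < \<infinity>" using True by (simp add: T_def)
  have N: "\<omega> \<notin> exceptional" and top: "clk \<infinity> \<omega> < \<infinity>" using \<omega> by (auto simp: regular_def)
  have clkT: "clk T \<omega> = ennreal t" unfolding T_def by (rule clk_tau[OF True])
  interpret clock "\<lambda>s. clk s \<omega>" by (rule clock_clk)
  interpret S: clock "\<lambda>s. clk (T + s) \<omega> - clk T \<omega>" by (rule shifted[OF T top])
  have right: "((\<lambda>s. ext0 g (pos X (T + s) \<omega>)) \<longlongrightarrow> ext0 g (pos X (T + s) \<omega>)) (at_right s)" if "s < \<infinity>" for s
  proof (rule filterlim_compose[OF regular_right_continuous[OF \<omega> g]])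
    show "T + s < \<infinity>" using T that by simp
    have "((\<lambda>s. T + s) \<longlongrightarrow> T + s) (at_right s)" by (intro tendsto_intros)
    then show "filterlim (\<lambda>s. T + s) (at_right (T + s)) (at_right s)"
      using T unfolding filterlim_at eventually_at_filter
      by (auto intro!: always_eventually simp: ennreal_add_left_cancel_less)
  qed
  have "riemann_sum (\<lambda>s. ext0 g (pos X (T + s) \<omega>)) (\<lambda>s. clk (T + s) \<omega> - clk T \<omega>) \<longlonglongrightarrow>
      (\<integral>\<^sup>+r\<in>{0..}. ext0 g (pos X (T + gen_inverse (\<lambda>s. clk (T + s) \<omega> - clk T \<omega>) (ennreal r)) \<omega>) \<partial>lborel)"
  proof (rule S.riemann_sum_tendsto_inverse[OF _ c ext0_g_le _ right])
    show "clk (T + \<infinity>) \<omega> - clk T \<omega> < \<infinity>" using top by (intro le_less_trans[OF diff_le_self_ennreal]) simp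
    show "ext0 g (pos X (T + \<infinity>) \<omega>) = 0" by (simp add: pos_infinity[simplified])
  qed
  then have "additive g (shift X T \<omega>) = (\<integral>\<^sup>+r\<in>{0..}. ext0 g (pos X (T + gen_inverse (\<lambda>s. clk (T + s) \<omega> - clk T \<omega>) (ennreal r)) \<omega>) \<partial>lborel)"
    unfolding additive_def clk_shift[OF N T] pos_shift by (rule lim_imp_Liminf[OF sequentially_bot])
  also have "\<dots> = (\<integral>\<^sup>+r\<in>{0..}. ext0 g (pos X (tau (t + r) \<omega>) \<omega>) \<partial>lborel)"
    unfolding gen_inverse_shifted[OF T top] unfolding clkT tau_def using t
    by (intro nn_integral_cong) (auto simp: indicator_def)
  finally show ?thesis by (simp add: T_def)
qed

definition Q :: "real \<Rightarrow> 'x \<Rightarrow> ennreal" where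
  "Q t x = (\<integral>\<^sup>+\<omega>. ext0 g (pos X (tau t \<omega>) \<omega>) \<partial>law X (Some x))"

lemma pos_tau_measurable: "(\<lambda>\<omega>. ext0 g (pos X (tau t \<omega>) \<omega>)) \<in> borel_measurable (law X z)"
  using measurable_compose[OF pos_stopping[OF stopping_time_tau] measurable_ext0[OF g_borel]]
  by (simp cong: measurable_cong_sets)

lemma tonelli_tau:
  assumes "0 \<le> t"
  shows "(\<integral>\<^sup>+\<omega>. (\<integral>\<^sup>+r\<in>{0..}. ext0 g (pos X (tau (t + r) \<omega>) \<omega>) \<partial>lborel) \<partial>law X (Some x)) = (\<integral>\<^sup>+r\<in>{0..}. Q (t + r) x \<partial>lborel)"
    and "(\<lambda>r. Q (t + r) x * indicator {0..} r) \<in> borel_measurable lborel"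
proof -
  interpret prob_space "law X (Some x)" by (rule prob_law)
  interpret pair_sigma_finite lborel "law X (Some x)" ..
  obtain N where N': "{\<omega> \<in> space (law X (Some x)). \<not> regular \<omega>} \<subseteq> N" "emeasure (law X (Some x)) N = 0" "N \<in> sets (law X (Some x))"
    by (rule AE_E[OF AE_regular[of "Some x"]])
  have N: "N \<in> sets (law X (Some x))" "emeasure (law X (Some x)) N = 0" "\<And>\<omega>. \<omega> \<notin> N \<Longrightarrow> regular \<omega>"
    using N' by auto
  have AE_N: "AE \<omega> in law X (Some x). \<omega> \<notin> N" using N(1,2) by (intro AE_not_in) (simp add: null_sets_def)
  \<comment> \<open>Deleting a null set that contains all irregular paths makes U right continuous
    in r for every path, as joint measurability requires.\<close>
  define U where "U r \<omega> = ext0 g (pos X (tau (t + r) \<omega>) \<omega>) * indicator (- N) \<omega>" for r \<omega>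
  have [measurable]: "- N \<in> sets (law X (Some x))" using sets.compl_sets[OF N(1)] by (simp add: Compl_eq_Diff_UNIV)
  note [measurable] = pos_tau_measurable
  have U_joint: "(\<lambda>(r, \<omega>). U r \<omega> * indicator {0..} r) \<in> borel_measurable (lborel \<Otimes>\<^sub>M law X (Some x))"
  proof (rule joint_measurable_right_continuous)
    show "U r \<in> borel_measurable (law X (Some x))" for r unfolding U_def by measurable
    fix r :: real and x' :: "nat \<Rightarrow> real" and \<omega> assume "x' \<longlonglongrightarrow> r" "\<And>k. r \<le> x' k"
    then have "(\<lambda>k. ext0 g (pos X (tau (t + x' k) \<omega>) \<omega>)) \<longlonglongrightarrow> ext0 g (pos X (tau (t + r) \<omega>) \<omega>)" if "\<omega> \<notin> N"
      using N(3)[OF that] by (intro tau_right_seq g tendsto_intros) auto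
    then show "(\<lambda>k. U (x' k) \<omega>) \<longlonglongrightarrow> U r \<omega>" by (cases "\<omega> \<in> N") (auto simp: U_def)
  qed
  have QU: "Q (t + r) x = (\<integral>\<^sup>+\<omega>. U r \<omega> \<partial>law X (Some x))" for r
    unfolding Q_def U_def using AE_N by (intro nn_integral_cong_AE) (auto elim!: eventually_mono)
  have "(\<integral>\<^sup>+\<omega>. (\<integral>\<^sup>+r\<in>{0..}. ext0 g (pos X (tau (t + r) \<omega>) \<omega>) \<partial>lborel) \<partial>law X (Some x))
      = (\<integral>\<^sup>+\<omega>. (\<integral>\<^sup>+r. U r \<omega> * indicator {0..} r \<partial>lborel) \<partial>law X (Some x))"
    using AE_N by (intro nn_integral_cong_AE) (auto simp: U_def elim!: eventually_mono)
  also have "\<dots> = (\<integral>\<^sup>+r. (\<integral>\<^sup>+\<omega>. U r \<omega> * indicator {0..} r \<partial>law X (Some x)) \<partial>lborel)"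
    using Fubini'[OF U_joint] by simp
  also have eq: "(\<lambda>r. \<integral>\<^sup>+\<omega>. U r \<omega> * indicator {0..} r \<partial>law X (Some x)) = (\<lambda>r. Q (t + r) x * indicator {0..} r)"
    unfolding QU by (intro ext nn_integral_multc) (simp add: U_def)
  finally show "(\<integral>\<^sup>+\<omega>. (\<integral>\<^sup>+r\<in>{0..}. ext0 g (pos X (tau (t + r) \<omega>) \<omega>) \<partial>lborel) \<partial>law X (Some x)) = (\<integral>\<^sup>+r\<in>{0..}. Q (t + r) x \<partial>lborel)" .
  show "(\<lambda>r. Q (t + r) x * indicator {0..} r) \<in> borel_measurable lborel"
    using sigma_finite_measure.borel_measurable_nn_integral[OF prob_space_imp_sigma_finite[OF prob_law] U_joint] unfolding eq[symmetric] by simp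
qed

lemma occupation: "(\<integral>\<^sup>+r\<in>{0..}. Q r x \<partial>lborel) = green_op G \<mu> g x"
proof -
  have "(\<integral>\<^sup>+r\<in>{0..}. Q r x \<partial>lborel) = (\<integral>\<^sup>+\<omega>. (\<integral>\<^sup>+r\<in>{0..}. ext0 g (pos X (tau (0 + r) \<omega>) \<omega>) \<partial>lborel) \<partial>law X (Some x))"
    using tonelli_tau(1)[of 0 x] by simp
  also have "\<dots> = (\<integral>\<^sup>+\<omega>. additive g \<omega> \<partial>law X (Some x))"
    using AE_regular[of "Some x"] by (intro nn_integral_cong_AE) (auto simp: additive_tau elim!: eventually_mono)
  finally show ?thesis by (simp add: additive_expectation)
qed

text \<open>The strong Markov property at the stopping time \<open>tau t\<close>, applied to
  \<open>additive g\<close>. This is the extended nonnegative form of the locale assumption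
  \<open>q_R\<close>.\<close>

lemma occupation_tail:
  assumes t: "0 \<le> t"
  shows "(\<integral>\<^sup>+\<omega>. ext0 (green_op G \<mu> g) (pos X (tau t \<omega>) \<omega>) \<partial>law X (Some x)) = (\<integral>\<^sup>+r\<in>{0..}. Q (t + r) x \<partial>lborel)"
proof -
  have "(\<integral>\<^sup>+\<omega>. (\<integral>\<^sup>+r\<in>{0..}. ext0 g (pos X (tau (t + r) \<omega>) \<omega>) \<partial>lborel) \<partial>law X (Some x))
      = (\<integral>\<^sup>+\<omega>. (\<integral>\<^sup>+\<omega>'. additive g \<omega>' \<partial>law X (pos X (tau t \<omega>) \<omega>)) \<partial>law X (Some x))"
  proof (rule strong_markov_nn[OF stopping_time_tau])
    show "additive g \<in> borel_measurable (natural X \<infinity>)" by (rule additive_natural[OF g_borel])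
    show "AE \<omega> in law X (Some x). (\<integral>\<^sup>+r\<in>{0..}. ext0 g (pos X (tau (t + r) \<omega>) \<omega>) \<partial>lborel) = additive g (shift X (tau t \<omega>) \<omega>)"
      using AE_regular[of "Some x"] by eventually_elim (simp add: additive_shift_tau[OF _ t])
  qed
  then show ?thesis unfolding additive_expectation tonelli_tau(1)[OF t] by simp
qed

end

end

section \<open>The time-changed process\<close>

lemma AE_lborel_interval_ex:
  fixes a b :: real
  assumes "AE r in lborel. P r" "a < b"
  shows "\<exists>r. a < r \<and> r < b \<and> P r"
proof (rule ccontr)
  assume "\<not> ?thesis"
  then have "AE r in lborel. r \<notin> {a<..<b}" using assms(1) by (auto elim!: eventually_mono)
  then have "emeasure lborel {a<..<b} = 0" by (subst (asm) AE_iff_measurable[of "{a<..<b}"]) auto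
  then show False using assms(2) by simp
qed

lemma bcontfun_nonneg_diff:
  fixes f :: "'x::metric_space \<Rightarrow>\<^sub>C real"
  obtains f1 f2 :: "'x \<Rightarrow>\<^sub>C real" where "f = f1 - f2" "\<And>y. 0 \<le> f1 y" "\<And>y. 0 \<le> f2 y"
proof
  show "f = (f + const_bcontfun (norm f)) - const_bcontfun (norm f)" by simp
  show "0 \<le> (f + const_bcontfun (norm f)) y" for y using norm_bounded[of f y] by simp
qed simp

section \<open>The time-changed semigroup as a sub-Markovian flow\<close>

context pcaf_process begin

abbreviation flow :: "real \<Rightarrow> 'x \<Rightarrow> ('x \<Rightarrow>\<^sub>C real) \<Rightarrow> real" where
  "flow t x f \<equiv> time_changed X A t (apply_bcontfun f) x"

definition pot :: "('x \<Rightarrow>\<^sub>C real) \<Rightarrow> ('x \<Rightarrow>\<^sub>C real)" where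
  "pot f = Bcontfun (potential G \<mu> (apply_bcontfun f))"

lemma pot_C0: "potential G \<mu> (apply_bcontfun f) \<in> C0"
  by (rule potential_C0[OF lsc lc kato continuous_on_apply_bcontfun, where B="norm f"])
    (use norm_bounded[of f] in simp)

lemma apply_pot: "apply_bcontfun (pot f) = potential G \<mu> (apply_bcontfun f)"
proof -
  obtain B where "\<And>x. \<bar>potential G \<mu> (apply_bcontfun f) x\<bar> \<le> B" by (rule C0_bounded[OF pot_C0[of f]]) (rule that)
  then have "potential G \<mu> (apply_bcontfun f) \<in> bcontfun"
    by (intro bcontfun_normI[where b=B] C0_continuous pot_C0) simp
  then show ?thesis unfolding pot_def by (rule Bcontfun_inverse)
qed

lemma ext0_pos_measurable:
  assumes "u \<in> borel_measurable borel"
  shows "(\<lambda>\<omega>. ext0 u (pos X (tau t \<omega>) \<omega>) :: real) \<in> borel_measurable (law X z)"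
  using measurable_compose[OF pos_stopping[OF stopping_time_tau] measurable_ext0[OF assms]]
  by (simp cong: measurable_cong_sets)

lemma right_inverse_tau:
  assumes "\<omega> \<notin> exceptional"
  shows "pos X (right_inverse A t \<omega>) \<omega> = pos X (tau t \<omega>) \<omega>"
proof (cases "pos X 0 \<omega> = None")
  case True
  then have "pos X s \<omega> = None" for s by (intro pos_absorbing[of 0 s]) auto
  then show ?thesis by simp
next
  case False
  then have "clk s \<omega> = A s \<omega>" for s using assms by (simp add: clk_def exceptional_def)
  then show ?thesis by (simp add: tau_def right_inverse_eq)
qed

lemma time_changed_eq:
  assumes u: "u \<in> borel_measurable borel"
  shows "time_changed X A t u x = (\<integral>\<omega>. ext0 u (pos X (tau t \<omega>) \<omega>) \<partial>law X (Some x))"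
  unfolding time_changed_def
proof (rule integral_cong_AE)
  show m: "(\<lambda>\<omega>. ext0 u (pos X (tau t \<omega>) \<omega>)) \<in> borel_measurable (law X (Some x))"
    by (rule ext0_pos_measurable[OF u])
  show "AE \<omega> in law X (Some x). ext0 u (pos X (right_inverse A t \<omega>) \<omega>) = ext0 u (pos X (tau t \<omega>) \<omega>)"
    using AE_not_exceptional[of "Some x"] by eventually_elim (simp add: right_inverse_tau)
  show "(\<lambda>\<omega>. ext0 u (pos X (right_inverse A t \<omega>) \<omega>)) \<in> borel_measurable (law X (Some x))"
  proof (rule measurableI)
    fix B :: "real set" assume B: "B \<in> sets borel"
    let ?f = "\<lambda>\<omega>. ext0 u (pos X (right_inverse A t \<omega>) \<omega>)" and ?g = "\<lambda>\<omega>. ext0 u (pos X (tau t \<omega>) \<omega>)"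
    \<comment> \<open>The original inverse agrees with \<open>tau\<close> only off the exceptional
      set, but every subset of that set is an event.\<close>
    have exc: "S \<in> sets (law X (Some x))" if "S \<subseteq> exceptional" for S
      using exceptional_subset_filt[OF that, of 0] filt_events by (auto simp: sets_law)
    have eq: "?f -` B = (?g -` B - exceptional) \<union> (?f -` B \<inter> exceptional)"
      using right_inverse_tau by auto
    have g: "?g -` B \<in> sets (law X (Some x))" using measurable_sets[OF m B] by simp
    have "?f -` B \<in> sets (law X (Some x))"
      by (subst eq) (rule sets.Un[OF sets.Diff[OF g exc[OF order_refl]] exc], simp)
    then show "?f -` B \<inter> space (law X (Some x)) \<in> sets (law X (Some x))" by simp
  qed simp
qed

lemma flow_eq: "flow t x f = (\<integral>\<omega>. ext0 f (pos X (tau t \<omega>) \<omega>) \<partial>law X (Some x))"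
  by (intro time_changed_eq borel_measurable_continuous_onI) simp

lemma ext0_abs_le: "(\<And>y. \<bar>u y\<bar> \<le> e) \<Longrightarrow> 0 \<le> e \<Longrightarrow> \<bar>ext0 u z :: real\<bar> \<le> e"
  by (cases z) auto

lemma flow_integrable:
  fixes f :: "'x \<Rightarrow>\<^sub>C real"
  shows "integrable (law X (Some x)) (\<lambda>\<omega>. ext0 (apply_bcontfun f) (pos X (tau t \<omega>) \<omega>))"
proof -
  interpret P: prob_space "law X (Some x)" by (rule prob_law)
  show ?thesis
  proof (rule P.integrable_const_bound[where B="norm f"])
    show "AE \<omega> in law X (Some x). norm (ext0 f (pos X (tau t \<omega>) \<omega>)) \<le> norm f"
      using norm_bounded[of f] by (intro AE_I2) (auto intro!: ext0_abs_le)
  qed (intro ext0_pos_measurable borel_measurable_continuous_onI, simp)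
qed

lemma flow_add: "flow t x (f + g) = flow t x f + flow t x g"
proof -
  have "ext0 (f + g) z = ext0 f z + ext0 g z" for z by (cases z) simp_all
  then show ?thesis unfolding flow_eq
    by (simp add: Bochner_Integration.integral_add[OF flow_integrable flow_integrable])
qed

lemma flow_scale: "flow t x (c *\<^sub>R f) = c * flow t x f"
proof -
  have "ext0 (c *\<^sub>R f) z = c * ext0 f z" for z by (cases z) simp_all
  then show ?thesis unfolding flow_eq by simp
qed

lemma flow_diff: "flow t x (f - g) = flow t x f - flow t x g"
  using flow_add[of t f "(-1) *\<^sub>R g" x] flow_scale[of t "-1" g x] by simp

lemma flow_nonneg: "(\<And>y. 0 \<le> apply_bcontfun f y) \<Longrightarrow> 0 \<le> flow t x f"
  unfolding flow_eq by (intro integral_nonneg_AE AE_I2) (metis ext0_simps not_None_eq order_refl)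

lemma flow_bound: "\<bar>flow t x f\<bar> \<le> norm f"
proof -
  interpret prob_space "law X (Some x)" by (rule prob_law)
  have "\<bar>flow t x f\<bar> \<le> (\<integral>\<omega>. \<bar>ext0 f (pos X (tau t \<omega>) \<omega>)\<bar> \<partial>law X (Some x))"
    unfolding flow_eq by (rule integral_abs_bound)
  also have "\<dots> \<le> (\<integral>\<omega>. norm f \<partial>law X (Some x))"
    using norm_bounded[of f] by (intro integral_mono integrable_abs flow_integrable) (auto intro!: ext0_abs_le)
  finally show ?thesis by (simp add: prob_space[simplified])
qed

context
  fixes f :: "'x \<Rightarrow>\<^sub>C real"
  assumes nn: "\<And>y. 0 \<le> f y"
begin

abbreviation "ef \<equiv> (\<lambda>y. ennreal (apply_bcontfun f y))"

lemma ef_cont: "continuous_on UNIV ef" by (intro continuous_on_ennreal) simp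

lemma ef_le: "ef y \<le> ennreal (norm f)" using norm_bounded[of f y] by (intro ennreal_leI) simp

lemma flow_Q: "ennreal (flow t x f) = Q ef t x"
proof -
  have e: "ext0 ef z = ennreal (ext0 f z)" for z by (cases z) simp_all
  have "0 \<le> ext0 f z" for z using nn by (cases z) simp_all
  then show ?thesis
    unfolding flow_eq Q_def[OF ef_cont ef_le ennreal_less_top] e using flow_integrable
    by (intro nn_integral_eq_integral[symmetric] AE_I2) auto
qed

lemma green_op_pot: "green_op G \<mu> ef x = ennreal (pot f x)"
  unfolding green_op_def apply_pot using nn norm_bounded[of f]
  by (intro nn_potential[OF lsc kato, where B="norm f"] borel_measurable_continuous_onI)
    (auto intro: order_trans[OF abs_ge_self])

lemma flow_measurable_nonneg: "(\<lambda>t. flow t x f) \<in> borel_measurable borel"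
proof -
  have m: "(\<lambda>r. Q ef r x * indicator {0..} r) \<in> borel_measurable borel"
    using tonelli_tau(2)[OF ef_cont ef_le ennreal_less_top, of 0 x] by simp
  \<comment> \<open>Negative times are read as 0 by \<open>ennreal\<close>, so the flow is constant
    there and measurability extends to the whole line.\<close>
  have "Q ef t x = Q ef 0 x" if "t < 0" for t
    using that by (simp add: Q_def[OF ef_cont ef_le ennreal_less_top] tau_def ennreal_neg)
  then have "flow t x f = enn2real (Q ef t x * indicator {0..} t + Q ef 0 x * indicator {..<0} t)" for t
    using flow_Q[of t x, symmetric] flow_nonneg[OF nn, of t x] by (cases "t < 0") auto
  then show ?thesis using m by simp
qed

lemma flow_occupation_nonneg:
  "set_integrable lborel {0..} (\<lambda>t. flow t x f)" "pot f x = (LBINT t:{0..}. flow t x f)"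
proof -
  have eq: "(\<integral>\<^sup>+t. ennreal (indicator {0..} t * flow t x f) \<partial>lborel) = ennreal (pot f x)"
  proof -
    have "(\<integral>\<^sup>+t. ennreal (indicator {0..} t * flow t x f) \<partial>lborel) = (\<integral>\<^sup>+t\<in>{0..}. Q ef t x \<partial>lborel)"
      by (intro nn_integral_cong) (auto simp: indicator_def flow_Q)
    then show ?thesis using occupation[OF ef_cont ef_le ennreal_less_top, of x] by (simp add: green_op_pot)
  qed
  have int: "integrable lborel (\<lambda>t. indicator {0..} t * flow t x f)"
    using flow_measurable_nonneg eq flow_nonneg[OF nn] by (intro integrableI_nonneg) auto
  then show "set_integrable lborel {0..} (\<lambda>t. flow t x f)" by (simp add: set_integrable_def)
  have "ennreal (pot f x) = ennreal (LBINT t:{0..}. flow t x f)"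
    unfolding eq[symmetric] set_lebesgue_integral_def using int flow_nonneg[OF nn]
    by (subst nn_integral_eq_integral) auto
  moreover have "0 \<le> pot f x"
    unfolding apply_pot potential_def using nn by (intro integral_nonneg_AE AE_I2) auto
  moreover have "0 \<le> (LBINT t:{0..}. flow t x f)"
    unfolding set_lebesgue_integral_def using flow_nonneg[OF nn] by (intro integral_nonneg_AE AE_I2) auto
  ultimately show "pot f x = (LBINT t:{0..}. flow t x f)" by simp
qed

lemma pot_nonneg: "0 \<le> pot f x"
  unfolding apply_pot potential_def using nn by (intro integral_nonneg_AE AE_I2) auto

lemma flow_pot_nonneg:
  assumes t: "0 \<le> t"
  shows "flow t x (pot f) = (LBINT s:{t..}. flow s x f)"
proof -
  have e: "ext0 (green_op G \<mu> ef) z = ennreal (ext0 (pot f) z)" for z by (cases z) (simp_all add: green_op_pot)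
  have nn': "0 \<le> ext0 (pot f) z" for z using pot_nonneg by (cases z) simp_all
  have "ennreal (flow t x (pot f)) = (\<integral>\<^sup>+\<omega>. ext0 (green_op G \<mu> ef) (pos X (tau t \<omega>) \<omega>) \<partial>law X (Some x))"
    unfolding e flow_eq using flow_integrable nn' by (intro nn_integral_eq_integral[symmetric] AE_I2) auto
  also have "\<dots> = (\<integral>\<^sup>+r\<in>{0..}. Q ef (t + r) x \<partial>lborel)"
    by (rule occupation_tail[OF ef_cont ef_le ennreal_less_top t])
  also have "\<dots> = (\<integral>\<^sup>+r. ennreal (indicator {t..} (t + 1 * r) * flow (t + 1 * r) x f) \<partial>lborel)"
    by (intro nn_integral_cong) (auto simp: indicator_def flow_Q)
  also have "\<dots> = (\<integral>\<^sup>+s. ennreal (indicator {t..} s * flow s x f) \<partial>lborel)"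
  proof -
    have m: "(\<lambda>s. ennreal (indicator {t..} s * flow s x f)) \<in> borel_measurable borel"
      using flow_measurable_nonneg by measurable
    show ?thesis using nn_integral_real_affine[OF m, of 1 t] by simp
  qed
  also have "\<dots> = ennreal (LBINT s:{t..}. flow s x f)"
    unfolding set_lebesgue_integral_def
  proof (subst nn_integral_eq_integral)
    show "integrable lborel (\<lambda>s. indicator {t..} s * flow s x f)"
      using set_integrable_subset[OF flow_occupation_nonneg(1), of "{t..}" x] t by (simp add: set_integrable_def)
  qed (use flow_nonneg[OF nn] in auto)
  finally have "ennreal (flow t x (pot f)) = ennreal (LBINT s:{t..}. flow s x f)" .
  moreover have "0 \<le> (LBINT s:{t..}. flow s x f)"
    unfolding set_lebesgue_integral_def using flow_nonneg[OF nn] by (intro integral_nonneg_AE AE_I2) auto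
  ultimately show ?thesis using flow_nonneg[of "pot f" t x] pot_nonneg by simp
qed

end

lemma pot_diff: "pot (f - g) = pot f - pot g"
proof (rule bcontfun_eqI)
  fix x
  have i: "integrable \<mu> (\<lambda>y. enn2real (G x y) * apply_bcontfun f y)" for f
    by (rule integrable_G_mult[OF lsc kato, where B="norm f"])
      (use norm_bounded[of f] in \<open>auto intro: borel_measurable_continuous_onI\<close>)
  have "enn2real (G x y) * (f - g) y = enn2real (G x y) * f y - enn2real (G x y) * g y" for y
    by (simp add: right_diff_distrib)
  then show "(pot (f - g)) x = (pot f - pot g) x"
    by (simp add: apply_pot potential_def Bochner_Integration.integral_diff[OF i i])
qed

text \<open>For nonnegative f the integral identities come from \<open>ennreal\<close>; a general f
  is a difference of two nonnegative bounded continuous functions, and the identities are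
  linear.\<close>

lemma flow_sub_markov:
  assumes C: "\<And>x. potential G \<mu> (\<lambda>_. 1) x \<le> C"
  shows "sub_markov_flow flow pot C"
proof
  fix t x and f g :: "'x \<Rightarrow>\<^sub>C real" and c :: real
  show "flow t x (f + g) = flow t x f + flow t x g" by (rule flow_add)
  show "flow t x (c *\<^sub>R f) = c * flow t x f" by (rule flow_scale)
  show "0 \<le> flow t x f" if "\<And>y. 0 \<le> f y" using that by (rule flow_nonneg)
  show "\<bar>flow t x f\<bar> \<le> norm f" by (rule flow_bound)
  obtain f1 f2 :: "'x \<Rightarrow>\<^sub>C real" where f: "f = f1 - f2" "\<And>y. 0 \<le> f1 y" "\<And>y. 0 \<le> f2 y"
    by (rule bcontfun_nonneg_diff[of f]) (rule that)
  show "(\<lambda>t. flow t x f) \<in> borel_measurable borel"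
    unfolding f(1) flow_diff using flow_measurable_nonneg[OF f(2)] flow_measurable_nonneg[OF f(3)] by measurable
  show "set_integrable lborel {0..} (\<lambda>t. flow t x f)"
    unfolding f(1) flow_diff by (intro set_integral_diff flow_occupation_nonneg f)
  show "pot f x = (LBINT t:{0..}. flow t x f)"
    unfolding f(1) flow_diff pot_diff
    by (subst set_integral_diff) (auto intro!: flow_occupation_nonneg f simp: flow_occupation_nonneg(2)[symmetric] f)
  show "flow t x (pot f) = (LBINT s:{t..}. flow s x f)" if "0 \<le> t"
  proof -
    have i: "set_integrable lborel {t..} (\<lambda>s. flow s x h)" if "\<And>y. 0 \<le> h y" for h :: "'x \<Rightarrow>\<^sub>C real"
      by (rule set_integrable_subset[OF flow_occupation_nonneg(1)[OF that]]) (use \<open>0 \<le> t\<close> in auto)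
    show ?thesis
      unfolding f(1) flow_diff pot_diff flow_pot_nonneg[OF f(2) that] flow_pot_nonneg[OF f(3) that]
      by (subst set_integral_diff) (auto intro!: i f)
  qed
  show "norm (pot f) \<le> C * norm f"
  proof (rule norm_bound)
    fix x
    have "\<bar>potential G \<mu> (apply_bcontfun f) x\<bar> \<le> norm f * potential G \<mu> (\<lambda>_. 1) x"
      by (rule potential_abs_le[OF lsc kato]) (use norm_bounded[of f] in \<open>auto intro: borel_measurable_continuous_onI\<close>)
    also have "\<dots> \<le> norm f * C" using C by (intro mult_left_mono) auto
    finally show "norm (pot f x) \<le> C * norm f" by (simp add: apply_pot mult.commute)
  qed
qed

text \<open>A function g that vanishes exactly on F has potential 0, so almost surely it vanishes
  along the inverse clock at almost every clock time. Right continuity carries this to the given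
  t.\<close>

lemma AE_pos_tau_support:
  assumes F: "closed F" "AE y in \<mu>. y \<in> F" and t: "0 \<le> t"
  shows "AE \<omega> in law X (Some x). pos X (tau t \<omega>) \<omega> \<in> insert None (Some ` F)"
proof -
  \<comment> \<open>\<open>infdist\<close> to the empty set is 0, so F = {} takes the constant 1 to
    keep the zero set of g equal to F.\<close>
  define g where "g y = ennreal (if F = {} then 1 else min 1 (infdist y F))" for y
  have g: "continuous_on UNIV g"
    unfolding g_def by (cases "F = {}") (auto intro!: continuous_intros continuous_on_ennreal continuous_on_min)
  have g_le: "g y \<le> 1" for y by (auto simp: g_def)
  have g0: "g y = 0 \<longleftrightarrow> y \<in> F" for y
    using in_closed_iff_infdist_zero[OF F(1), of y] infdist_nonneg[of y F]
    by (auto simp: g_def min_def ennreal_eq_0_iff)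
  have [measurable]: "G x \<in> borel_measurable \<mu>" "g \<in> borel_measurable \<mu>"
    using G_measurable[OF lsc kato_sets[OF kato]] kato_sets[OF kato] borel_measurable_continuous_onI[OF g]
    by (simp_all cong: measurable_cong_sets)
  have "green_op G \<mu> g x = (\<integral>\<^sup>+y. 0 \<partial>\<mu>)"
    unfolding green_op_def using F(2) g0 by (intro nn_integral_cong_AE) (auto elim!: eventually_mono)
  then have z: "(\<integral>\<^sup>+\<omega>. additive g \<omega> \<partial>law X (Some x)) = 0"
    using additive_expectation[OF g g_le, of "Some x"] by simp
  have "additive g \<in> borel_measurable (law X (Some x))"
    using measurable_natural_events[OF additive_natural[OF borel_measurable_continuous_onI[OF g]]]
    by (simp cong: measurable_cong_sets)
  then have "AE \<omega> in law X (Some x). additive g \<omega> = 0" using z by (simp add: nn_integral_0_iff_AE)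
  then show ?thesis using AE_regular[of "Some x"]
  proof eventually_elim
    case (elim \<omega>)
    let ?h = "\<lambda>r. ext0 g (pos X (tau r \<omega>) \<omega>)"
    have right: "(\<lambda>k. ?h (y k)) \<longlonglongrightarrow> ?h r" if "y \<longlonglongrightarrow> r" "\<And>k. r \<le> y k" for y r
      by (rule tau_right_seq[OF elim(2) g that])
    have m: "(\<lambda>r. ?h r * indicator {0..} r) \<in> borel_measurable lborel"
    proof -
      \<comment> \<open>A one-point second factor reduces measurability in r alone to the joint
        statement.\<close>
      have "(\<lambda>(r, w). ?h r * indicator {0..} r) \<in> borel_measurable (lborel \<Otimes>\<^sub>M count_space {()})"
        by (rule joint_measurable_right_continuous[where U="\<lambda>r w. ?h r"]) (auto intro: right)
      moreover have "(\<lambda>r. (r, ())) \<in> (lborel :: real measure) \<rightarrow>\<^sub>M lborel \<Otimes>\<^sub>M count_space {()}" by measurable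
      ultimately show ?thesis using measurable_compose by fastforce
    qed
    have "(\<integral>\<^sup>+r\<in>{0..}. ?h r \<partial>lborel) = 0"
      using additive_tau[OF g g_le _ elim(2)] elim(1) by simp
    then have ae: "AE r in lborel. ?h r * indicator {0..} r = 0" using m by (simp add: nn_integral_0_iff_AE)
    have "\<exists>r. t < r \<and> r < t + 1 / real (Suc k) \<and> ?h r * indicator {0..} r = 0" for k
      by (rule AE_lborel_interval_ex[OF ae]) simp
    then obtain y where y: "\<And>k. t < y k" "\<And>k. y k < t + 1 / real (Suc k)" "\<And>k. ?h (y k) * indicator {0..} (y k) = 0" by metis
    have "(\<lambda>k. t + inverse (real (Suc k))) \<longlonglongrightarrow> t + 0" by (intro tendsto_intros LIMSEQ_inverse_real_of_nat)
    then have "y \<longlonglongrightarrow> t"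
      using tendsto_sandwich[of "\<lambda>_. t" y sequentially "\<lambda>k. t + inverse (real (Suc k))" t] y(1,2)
      by (simp add: less_imp_le inverse_eq_divide)
    then have "(\<lambda>k. ?h (y k)) \<longlonglongrightarrow> ?h t" using y(1) by (intro right) (auto intro: less_imp_le)
    moreover have "?h (y k) = 0" for k using y(1)[of k] y(3)[of k] t by (simp add: indicator_def split: if_splits)
    ultimately have "?h t = 0" by (simp add: LIMSEQ_const_iff)
    then show ?case using g0 by (cases "pos X (tau t \<omega>) \<omega>") auto
  qed
qed

lemma flow_support_bound:
  fixes f :: "'x \<Rightarrow>\<^sub>C real"
  assumes F: "closed F" "AE y in \<mu>. y \<in> F" and t: "0 \<le> t"
    and e: "0 \<le> e" "\<And>y. y \<in> F \<Longrightarrow> \<bar>f y\<bar> \<le> e"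
  shows "\<bar>flow t x f\<bar> \<le> e"
proof -
  interpret prob_space "law X (Some x)" by (rule prob_law)
  have "\<bar>flow t x f\<bar> \<le> (\<integral>\<omega>. \<bar>ext0 f (pos X (tau t \<omega>) \<omega>)\<bar> \<partial>law X (Some x))"
    unfolding flow_eq by (rule integral_abs_bound)
  also have "\<dots> \<le> (\<integral>\<omega>. e \<partial>law X (Some x))"
  proof (rule integral_mono_AE)
    show "AE \<omega> in law X (Some x). \<bar>ext0 f (pos X (tau t \<omega>) \<omega>)\<bar> \<le> e"
      using AE_pos_tau_support[OF F t, of x] by eventually_elim (use e in auto)
  qed (auto intro: integrable_abs flow_integrable)
  finally show ?thesis by (simp add: prob_space[simplified])
qed

end

section \<open>Regular points of the additive functional\<close>

text \<open>Prepares for hitting events whose measurability is not established: an almost sure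
  inclusion in a measurable event still bounds the outer measure.\<close>

lemma outer_measure_le_AE:
  assumes "M \<in> sets P" "AE \<omega> in P. \<omega> \<in> E \<longrightarrow> \<omega> \<in> M" "E \<subseteq> space P"
  shows "outer_measure_of P E \<le> emeasure P M"
proof -
  obtain N where N: "{\<omega> \<in> space P. \<not> (\<omega> \<in> E \<longrightarrow> \<omega> \<in> M)} \<subseteq> N" "emeasure P N = 0" "N \<in> sets P"
    by (rule AE_E[OF assms(2)])
  have "E \<subseteq> M \<union> N" using N(1) assms(3) by auto
  then have "outer_measure_of P E \<le> emeasure P (M \<union> N)"
    using assms(1) N(3) by (metis outer_measure_of_eq outer_measure_of_mono sets.Un)
  also have "\<dots> = emeasure P M" using N assms(1) by (intro emeasure_Un_null_set) (auto simp: null_sets_def)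
  finally show ?thesis .
qed

section \<open>Immediate start of the clock and the zero-one law\<close>

context pcaf_process begin

text \<open>Paths at the cemetery have clock 0 and infinite \<open>tau 0\<close>; they are excluded
  because shifted paths may start there.\<close>

definition delayed :: "'w set" where
  "delayed = {\<omega>. tau 0 \<omega> \<noteq> 0 \<and> pos X 0 \<omega> \<noteq> None}"

lemma tau_zero_iff: "tau 0 \<omega> = 0 \<longleftrightarrow> (\<forall>n. 0 < clk (ennreal (inverse (real (Suc n)))) \<omega>)"
proof
  assume "tau 0 \<omega> = 0"
  then have "tau 0 \<omega> < ennreal (inverse (real (Suc n)))" for n by simp
  then show "\<forall>n. 0 < clk (ennreal (inverse (real (Suc n)))) \<omega>" unfolding tau_less_iff by simp
next
  assume "\<forall>n. 0 < clk (ennreal (inverse (real (Suc n)))) \<omega>"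
  then have "tau 0 \<omega> < ennreal (inverse (real (Suc n)))" for n unfolding tau_less_iff by simp
  then have le: "tau 0 \<omega> \<le> ennreal (inverse (real (Suc n)))" for n by (rule less_imp_le)
  have "(\<lambda>n. ennreal (inverse (real (Suc n)))) \<longlonglongrightarrow> ennreal 0"
    by (intro tendsto_ennrealI LIMSEQ_inverse_real_of_nat)
  then have "tau 0 \<omega> \<le> ennreal 0" by (rule LIMSEQ_le_const) (use le in blast)
  then show "tau 0 \<omega> = 0" by simp
qed

lemma delayed_natural: "delayed \<in> sets (natural X \<infinity>)"
proof -
  have "{\<omega>. 0 < clk s \<omega>} \<in> sets (natural X \<infinity>)" for s
    using measurable_sets[OF clk_natural[of s], of "{0<..}"] by (simp add: vimage_def)
  then have "(\<Inter>n. {\<omega>. 0 < clk (ennreal (inverse (real (Suc n)))) \<omega>}) \<in> sets (natural X \<infinity>)" by auto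
  moreover have "delayed = {\<omega>. pos X 0 \<omega> \<noteq> None} - (\<Inter>n. {\<omega>. 0 < clk (ennreal (inverse (real (Suc n)))) \<omega>})"
    unfolding delayed_def tau_zero_iff by blast
  ultimately show ?thesis using pos_alive_natural by (simp add: sets.Diff)
qed

lemma delayed_law: "delayed \<in> sets (law X z)"
  using delayed_natural natural_events by (auto simp: sets_law)

lemma tau_shift_less_iff:
  assumes "\<omega> \<notin> exceptional" "T < \<infinity>"
  shows "tau 0 (shift X T \<omega>) < s \<longleftrightarrow> clk T \<omega> < clk (T + s) \<omega>"
  using clock.finite[OF clock_clk assms(2), of \<omega>]
  unfolding tau_less_iff clk_shift[OF assms] by (auto simp: diff_gt_0_iff_gt_ennreal)

text \<open>A right inverse is the last moment at which the clock reads t, so the clock moves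
  immediately afterwards.\<close>

lemma shift_tau_not_delayed:
  assumes \<omega>: "regular \<omega>" and t: "0 \<le> t"
  shows "shift X (tau t \<omega>) \<omega> \<notin> delayed"
proof (cases "tau t \<omega> < \<infinity>")
  case True
  have "tau 0 (shift X (tau t \<omega>) \<omega>) < s" if "0 < s" for s
  proof -
    have "tau t \<omega> + 0 < tau t \<omega> + s" using True that by (simp only: ennreal_add_left_cancel_less) simp
    then have "ennreal t < clk (tau t \<omega> + s) \<omega>" by (simp add: tau_less_iff)
    then show ?thesis
      using \<omega> by (simp only: tau_shift_less_iff[OF _ True] clk_tau[OF True] regular_def simp_thms)
  qed
  then have "tau 0 (shift X (tau t \<omega>) \<omega>) = 0" by (metis less_irrefl not_gr_zero)
  then show ?thesis by (simp add: delayed_def)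
next
  case False
  then have "tau t \<omega> = \<infinity>" by (simp add: less_top[symmetric])
  then show ?thesis by (simp add: delayed_def pos_shift pos_infinity[simplified])
qed

definition regular_points :: "'x set" where
  "regular_points = {x. emeasure (law X (Some x)) delayed = 0}"

lemma regular_points_iff: "x \<in> regular_points \<longleftrightarrow> (AE \<omega> in law X (Some x). tau 0 \<omega> = 0)"
proof -
  have "x \<in> regular_points \<longleftrightarrow> (AE \<omega> in law X (Some x). \<omega> \<notin> delayed)"
    unfolding regular_points_def using delayed_law[of "Some x"]
    by (subst AE_iff_measurable[of delayed]) auto
  also have "\<dots> \<longleftrightarrow> (AE \<omega> in law X (Some x). tau 0 \<omega> = 0)"
    using normal[of "Some x"] by (auto elim!: eventually_elim2 simp: delayed_def)
  finally show ?thesis .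
qed

lemma AE_law_tau_delayed:
  "0 \<le> t \<Longrightarrow> AE \<omega> in law X z. emeasure (law X (pos X (tau t \<omega>) \<omega>)) delayed = 0"
  unfolding strong_markov_null[OF stopping_time_tau delayed_natural]
  using AE_regular[of z] by eventually_elim (rule shift_tau_not_delayed)

lemma AE_pos_tau_regular:
  assumes "0 \<le> t"
  shows "AE \<omega> in law X z. pos X (tau t \<omega>) \<omega> \<in> insert None (Some ` regular_points)"
  using AE_law_tau_delayed[OF assms, of z]
proof eventually_elim
  case (elim \<omega>)
  then show ?case by (cases "pos X (tau t \<omega>) \<omega>") (auto simp: regular_points_def)
qed

text \<open>Blumenthal's zero-one law, by the strong Markov property at the time that is \<open>0\<close> if the clock
  starts at once and \<open>\<infinity>\<close> otherwise.\<close>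
lemma irregular_AE:
  assumes "x \<notin> regular_points"
  shows "AE \<omega> in law X (Some x). tau 0 \<omega> \<noteq> 0"
proof -
  define T where "T \<omega> = (if tau 0 \<omega> = 0 then 0 else \<infinity> :: ennreal)" for \<omega>
  have T: "stopping_time (filt X) T"
  proof
    fix t
    show "Measurable.pred (filt X t) (\<lambda>\<omega>. T \<omega> \<le> t)"
    proof (cases "t = \<infinity>")
      case False
      then have "(\<lambda>\<omega>. T \<omega> \<le> t) = (\<lambda>\<omega>. tau 0 \<omega> \<le> 0)" by (auto simp: T_def top_unique)
      then show ?thesis using F.stopping_time_le_const[OF stopping_time_tau, of 0 t] by simp
    qed simp
  qed
  have "AE \<omega> in law X (Some x). shift X (T \<omega>) \<omega> \<notin> delayed"
    using AE_regular[of "Some x"]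
  proof eventually_elim
    case (elim \<omega>)
    show ?case
    proof (cases "tau 0 \<omega> = 0")
      case True
      then show ?thesis using shift_tau_not_delayed[OF elim, of 0] by (simp add: T_def)
    next
      case False
      then show ?thesis by (simp add: T_def delayed_def pos_shift pos_infinity[simplified])
    qed
  qed
  then have "AE \<omega> in law X (Some x). emeasure (law X (pos X (T \<omega>) \<omega>)) delayed = 0"
    unfolding strong_markov_null[OF T delayed_natural] .
  then show ?thesis using normal[of "Some x"]
    by eventually_elim (use assms in \<open>auto simp: T_def regular_points_def\<close>)
qed

text \<open>Restricting \<open>delayed\<close> to starting points in K makes it null under every
  law, so the path shifted by T avoids it. If the clock were still at 0 beyond T, a path with
  position in K at T would have a delayed shift.\<close>

lemma tau_le_hitting:
  assumes T: "stopping_time (filt X) T" and K: "K \<subseteq> regular_points" "K \<in> sets borel"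
  shows "AE \<omega> in law X z. pos X (T \<omega>) \<omega> \<in> Some ` K \<longrightarrow> tau 0 \<omega> \<le> T \<omega>"
proof -
  let ?D = "delayed \<inter> {\<omega>. pos X 0 \<omega> \<in> Some ` K}"
  have "{\<omega>. pos X 0 \<omega> \<in> Some ` K} \<in> sets (natural X \<infinity>)"
    using measurable_sets[OF pos_natural[of 0] Some_image_borel_cem[OF K(2)]] by (simp add: vimage_def)
  then have D: "?D \<in> sets (natural X \<infinity>)" using delayed_natural by (rule sets.Int[rotated])
  have "emeasure (law X y) ?D = 0" for y
  proof -
    have "AE \<omega> in law X y. \<omega> \<notin> ?D"
    proof (cases "y \<in> Some ` K")
      case True
      then obtain u where u: "y = Some u" "u \<in> regular_points" using K(1) by blast
      have "AE \<omega> in law X y. tau 0 \<omega> = 0" using u(2) unfolding u(1) regular_points_iff .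
      then show ?thesis by eventually_elim (simp add: delayed_def)
    next
      case False
      show ?thesis using normal[of y] by eventually_elim (use False in simp)
    qed
    moreover have "?D \<in> sets (law X y)" using D natural_events by (auto simp: sets_law)
    ultimately show ?thesis by (subst (asm) AE_iff_measurable[of ?D]) auto
  qed
  then have "AE \<omega> in law X z. shift X (T \<omega>) \<omega> \<notin> ?D"
    unfolding strong_markov_null[OF T D, symmetric] by simp
  then show ?thesis using AE_regular[of z]
  proof eventually_elim
    case (elim \<omega>)
    show ?case
    proof
      assume pos: "pos X (T \<omega>) \<omega> \<in> Some ` K"
      then have "T \<omega> \<noteq> \<infinity>" using pos_infinity by force
      then have T: "T \<omega> < \<infinity>" by (simp add: less_top)
      have N: "\<omega> \<notin> exceptional" using elim by (simp add: regular_def)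
      have zero: "tau 0 (shift X (T \<omega>) \<omega>) = 0" using elim(1) pos by (auto simp: delayed_def pos_shift)
      show "tau 0 \<omega> \<le> T \<omega>"
      proof (rule ccontr)
        assume "\<not> tau 0 \<omega> \<le> T \<omega>"
        then have less: "T \<omega> < tau 0 \<omega>" by simp
        define s where "s = tau 0 \<omega> - T \<omega>"
        have s: "0 < s" "T \<omega> + s = tau 0 \<omega>"
          using less add_diff_inverse_ennreal[OF less_imp_le[OF less]] by (simp_all add: s_def diff_gt_0_iff_gt_ennreal)
        have "tau 0 (shift X (T \<omega>) \<omega>) < s" using zero s(1) by simp
        then have "clk (T \<omega>) \<omega> < clk (T \<omega> + s) \<omega>" using tau_shift_less_iff[OF N T] by blast
        then have "0 < clk (T \<omega> + s) \<omega>" by (rule le_less_trans[OF zero_le])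
        then have "tau 0 \<omega> < T \<omega> + s" by (simp add: tau_less_iff)
        then show False using s(2) by simp
      qed
    qed
  qed
qed

lemma flow_right_zero: "((\<lambda>t. flow t x f) \<longlongrightarrow> flow 0 x f) (at_right 0)"
proof (rule tendsto_at_right_sequentially[of 0 1])
  fix r :: "nat \<Rightarrow> real" assume r: "\<And>n. 0 < r n" "r \<longlonglongrightarrow> 0"
  interpret P: prob_space "law X (Some x)" by (rule prob_law)
  show "(\<lambda>n. flow (r n) x f) \<longlonglongrightarrow> flow 0 x f"
    unfolding flow_eq
  proof (rule integral_dominated_convergence[where w="\<lambda>_. norm f"])
    show "AE \<omega> in law X (Some x). (\<lambda>n. ext0 f (pos X (tau (r n) \<omega>) \<omega>)) \<longlonglongrightarrow> ext0 f (pos X (tau 0 \<omega>) \<omega>)"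
      using AE_regular[of "Some x"]
      by eventually_elim (rule tau_right_seq, auto intro: less_imp_le r)
    show "AE \<omega> in law X (Some x). norm (ext0 f (pos X (tau (r n) \<omega>) \<omega>)) \<le> norm f" for n
      using norm_bounded[of f] by (intro AE_I2) (auto intro!: ext0_abs_le)
  qed (auto intro!: ext0_pos_measurable borel_measurable_continuous_onI)
qed simp

lemma flow_zero_regular:
  assumes "x \<in> regular_points"
  shows "flow 0 x f = f x"
proof -
  interpret P: prob_space "law X (Some x)" by (rule prob_law)
  have "flow 0 x f = (\<integral>\<omega>. f x \<partial>law X (Some x))"
    unfolding flow_eq
  proof (rule integral_cong_AE)
    have "AE \<omega> in law X (Some x). tau 0 \<omega> = 0" using assms by (simp add: regular_points_iff)
    then show "AE \<omega> in law X (Some x). ext0 f (pos X (tau 0 \<omega>) \<omega>) = f x"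
      using normal[of "Some x"] by eventually_elim simp
  qed (auto intro!: ext0_pos_measurable borel_measurable_continuous_onI)
  then show ?thesis by (simp add: P.prob_space[simplified])
qed

text \<open>Test functions that take the value 1 at their centre only. They depend on the centre in
  a Lipschitz way in the sup norm, so a dense set of centres suffices.\<close>

definition tent :: "'x \<Rightarrow> ('x \<Rightarrow>\<^sub>C real)" where
  "tent y = Bcontfun (\<lambda>z. max 0 (1 - dist y z))"

lemma apply_tent: "apply_bcontfun (tent y) = (\<lambda>z. max 0 (1 - dist y z))"
proof -
  have "(\<lambda>z. max 0 (1 - dist y z)) \<in> bcontfun"
    by (rule bcontfun_normI[where b=1]) (auto intro!: continuous_intros continuous_on_max)
  then show ?thesis unfolding tent_def by (rule Bcontfun_inverse)
qed

lemma norm_tent_diff: "norm (tent y - tent y') \<le> dist y y'"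
proof (rule norm_bound)
  fix z
  show "norm ((tent y - tent y') z) \<le> dist y y'"
    using dist_triangle[of y z y'] dist_triangle[of y' z y]
    by (simp add: apply_tent dist_commute max_def abs_real_def)
qed

text \<open>By density \<open>flow 0\<close> also reproduces the tent centred at x, so the position
  at \<open>tau 0\<close> is x almost surely. Positions at \<open>tau 0\<close> are regular or the
  cemetery by the strong Markov property; hence x is regular.\<close>

lemma regular_point_tentI:
  assumes dense: "\<And>e. 0 < e \<Longrightarrow> \<exists>y\<in>Y. dist y x < e" and Y: "\<And>y. y \<in> Y \<Longrightarrow> flow 0 x (tent y) = tent y x"
  shows "x \<in> regular_points"
proof -
  interpret P: prob_space "law X (Some x)" by (rule prob_law)
  have "\<bar>flow 0 x (tent x) - 1\<bar> \<le> e" if e: "0 < e" for e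
  proof -
    obtain y where y: "y \<in> Y" "dist y x < e / 2" using dense[of "e / 2"] e by auto
    have "\<bar>flow 0 x (tent x) - flow 0 x (tent y)\<bar> \<le> dist y x"
      using flow_bound[of 0 "tent x - tent y" x] norm_tent_diff[of x y] unfolding flow_diff by (simp add: dist_commute)
    moreover have "\<bar>(tent x - tent y) x\<bar> \<le> dist y x"
      using norm_bounded[of "tent x - tent y" x] norm_tent_diff[of x y] by (simp add: dist_commute)
    moreover have "tent x x = 1" by (simp add: apply_tent)
    ultimately show ?thesis using y Y[OF y(1)] by (simp add: abs_real_def split: if_splits)
  qed
  then have "flow 0 x (tent x) = 1"
    by (metis abs_ge_zero diff_eq_eq dense_ge add.commute add.right_neutral abs_eq_0 order_antisym)
  then have "(\<integral>\<omega>. 1 - ext0 (tent x) (pos X (tau 0 \<omega>) \<omega>) \<partial>law X (Some x)) = 0"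
    unfolding flow_eq using flow_integrable[of x "tent x" 0]
    by (subst Bochner_Integration.integral_diff) (auto simp: P.prob_space[simplified])
  moreover have le1: "ext0 (tent x) z \<le> 1" for z by (cases z) (auto simp: apply_tent)
  ultimately have "AE \<omega> in law X (Some x). 1 - ext0 (tent x) (pos X (tau 0 \<omega>) \<omega>) = 0"
    using flow_integrable[of x "tent x" 0] by (subst (asm) integral_nonneg_eq_0_iff_AE) auto
  then have "AE \<omega> in law X (Some x). emeasure (law X (Some x)) delayed = 0"
    using AE_law_tau_delayed[of 0 "Some x", OF order_refl]
  proof eventually_elim
    case (elim \<omega>)
    have "pos X (tau 0 \<omega>) \<omega> = Some x"
      using elim(1) by (cases "pos X (tau 0 \<omega>) \<omega>") (auto simp: apply_tent max_def split: if_splits)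
    then show ?case using elim(2) by simp
  qed
  then show ?thesis unfolding regular_points_def by simp
qed

end

section \<open>Descriptive structure of the set of regular points\<close>

context pcaf_process begin

lemma flow_mass_bound:
  obtains C where "sub_markov_flow flow pot C"
proof -
  obtain B where B: "\<And>x. \<bar>potential G \<mu> (apply_bcontfun (const_bcontfun 1)) x\<bar> \<le> B"
    by (rule C0_bounded[OF pot_C0]) (rule that)
  have "potential G \<mu> (\<lambda>_. 1) x \<le> B" for x using B[of x] by simp
  from flow_sub_markov[OF this] show thesis by (rule that)
qed

text \<open>The exponential average of the flow at rate k + 1, written out so that no mass bound
  \<open>C\<close> has to be carried along. In contrast to the flow itself it is known to be
  continuous in x.\<close>

definition yosida :: "nat \<Rightarrow> ('x \<Rightarrow>\<^sub>C real) \<Rightarrow> 'x \<Rightarrow> real" where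
  "yosida k f x = (\<integral>t. flow (t / real (Suc k)) x f \<partial>exp_law)"

lemma yosida_tendsto: "(\<lambda>k. yosida k f x) \<longlonglongrightarrow> flow 0 x f"
proof -
  obtain C where "sub_markov_flow flow pot C" by (rule flow_mass_bound)
  then interpret M: sub_markov_flow flow pot C .
  show ?thesis using M.lap_tendsto[OF flow_right_zero] by (simp add: M.lap_def yosida_def)
qed

lemma yosida_pot:
  obtains h where "yosida k f = apply_bcontfun (pot h)"
proof -
  obtain C where "sub_markov_flow flow pot C" by (rule flow_mass_bound)
  then interpret M: sub_markov_flow flow pot C .
  obtain h where "(\<lambda>x. M.lap (real (Suc k)) x f) = pot h"
    by (rule M.lap_eq_R[of "real (Suc k)" f]) (simp, rule that)
  then show thesis by (intro that[of h]) (simp add: M.lap_def yosida_def[abs_def])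
qed

lemma yosida_bound: "\<bar>yosida k f x\<bar> \<le> norm f"
proof -
  obtain C where "sub_markov_flow flow pot C" by (rule flow_mass_bound)
  then interpret M: sub_markov_flow flow pot C .
  show ?thesis using M.lap_bound[of "real (Suc k)" x f] by (simp add: M.lap_def yosida_def)
qed

lemma yosida_continuous: "continuous_on UNIV (yosida k f)"
  by (rule yosida_pot[of k f]) simp

text \<open>For countable Y, regularity becomes countably many limit conditions on continuous
  functions. This gives the simple Borel form that the capacitability argument works with.\<close>

lemma regular_points_eq:
  assumes dense: "\<And>x e. 0 < e \<Longrightarrow> \<exists>y\<in>Y. dist y x < e"
  shows "regular_points = {x. \<forall>y\<in>Y. (\<lambda>k. \<bar>yosida k (tent y) x - tent y x\<bar>) \<longlonglongrightarrow> 0}"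
proof (intro set_eqI iffI)
  fix x assume x: "x \<in> regular_points"
  have "(\<lambda>k. \<bar>yosida k (tent y) x - tent y x\<bar>) \<longlonglongrightarrow> \<bar>tent y x - tent y x\<bar>" for y
    using yosida_tendsto[of "tent y" x] unfolding flow_zero_regular[OF x] by (intro tendsto_intros)
  then show "x \<in> {x. \<forall>y\<in>Y. (\<lambda>k. \<bar>yosida k (tent y) x - tent y x\<bar>) \<longlonglongrightarrow> 0}" by simp
next
  fix x assume x: "x \<in> {x. \<forall>y\<in>Y. (\<lambda>k. \<bar>yosida k (tent y) x - tent y x\<bar>) \<longlonglongrightarrow> 0}"
  show "x \<in> regular_points"
  proof (rule regular_point_tentI[OF dense])
    fix y assume "y \<in> Y"
    then have "(\<lambda>k. \<bar>yosida k (tent y) x - tent y x\<bar>) \<longlonglongrightarrow> 0" using x by simp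
    moreover have "(\<lambda>k. \<bar>yosida k (tent y) x - tent y x\<bar>) \<longlonglongrightarrow> \<bar>flow 0 x (tent y) - tent y x\<bar>"
      by (intro tendsto_intros yosida_tendsto)
    ultimately have "\<bar>flow 0 x (tent y) - tent y x\<bar> = 0" by (rule LIMSEQ_unique[symmetric])
    then show "flow 0 x (tent y) = tent y x" by simp
  qed
qed

lemma dense_sequence:
  obtains y :: "nat \<Rightarrow> 'x" where "\<And>x e. 0 < e \<Longrightarrow> \<exists>i. dist (y i) x < e"
proof -
  obtain D :: "'x set" where D: "countable D" "\<And>X. open X \<Longrightarrow> X \<noteq> {} \<Longrightarrow> \<exists>d\<in>D. d \<in> X"
    using countable_dense_setE by auto
  have ball: "\<exists>d\<in>D. dist d x < e" if "0 < e" for x and e :: real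
    using D(2)[of "ball x e"] that by (auto simp: dist_commute)
  then have "D \<noteq> {}" by (metis empty_iff zero_less_one)
  then have "range (from_nat_into D) = D" using D(1) by (rule range_from_nat_into)
  then show thesis using ball by (intro that[of "from_nat_into D"]) (metis image_iff)
qed

lemma regular_points_K_sigma_delta:
  obtains D :: "nat \<Rightarrow> nat \<Rightarrow> 'x set"
  where "\<And>i N. compact (D i N)" "\<And>i. incseq (D i)" "regular_points = (\<Inter>i. \<Union>N. D i N)"
proof -
  obtain y :: "nat \<Rightarrow> 'x" where y: "\<And>x e. 0 < e \<Longrightarrow> \<exists>i. dist (y i) x < e" by (rule dense_sequence) (rule that)
  obtain K :: "nat \<Rightarrow> 'x set" where K: "\<And>i. compact (K i)" "incseq K" "(\<Union>i. K i) = UNIV"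
    by (rule compact_exhaustion[OF lc]) (rule that)
  define v where "v i k x = \<bar>yosida k (tent (y i)) x - tent (y i) x\<bar>" for i k x
  define C where "C i m N = (\<Inter>k\<in>{N..}. {x. v i k x \<le> inverse (real (Suc m))})" for i m N :: nat
  have C: "closed (C i m N)" for i m N
    unfolding C_def v_def by (intro closed_INT ballI closed_Collect_le continuous_intros yosida_continuous) auto
  have C_mono: "N \<le> N' \<Longrightarrow> C i m N \<subseteq> C i m N'" for i m N N' by (auto simp: C_def)
  have null: "(\<lambda>k. v i k x) \<longlonglongrightarrow> 0 \<longleftrightarrow> (\<forall>m. \<exists>N. x \<in> C i m N)" for i x
  proof
    assume lim: "(\<lambda>k. v i k x) \<longlonglongrightarrow> 0"
    show "\<forall>m. \<exists>N. x \<in> C i m N"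
    proof
      fix m
      have "\<forall>\<^sub>F k in sequentially. v i k x < inverse (real (Suc m))" by (rule order_tendstoD(2)[OF lim]) simp
      then show "\<exists>N. x \<in> C i m N" by (auto simp: eventually_sequentially C_def intro: less_imp_le)
    qed
  next
    assume C: "\<forall>m. \<exists>N. x \<in> C i m N"
    show "(\<lambda>k. v i k x) \<longlonglongrightarrow> 0"
    proof (rule LIMSEQ_I)
      fix e :: real assume "0 < e"
      then obtain m where m: "inverse (real (Suc m)) < e" using reals_Archimedean by blast
      obtain N where "x \<in> C i m N" using C by blast
      then have "v i k x \<le> inverse (real (Suc m))" if "N \<le> k" for k using that by (auto simp: C_def)
      then show "\<exists>N. \<forall>k\<ge>N. norm (v i k x - 0) < e"
        using m by (intro exI[of _ N]) (auto simp: v_def intro: le_less_trans)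
    qed
  qed
  \<comment> \<open>One index codes a pair (i, m) of test function and accuracy. Intersecting with
    \<open>K N\<close> makes the closed sets compact and keeps them increasing in N.\<close>
  define D where "D n N = K N \<inter> C (fst (prod_decode n)) (snd (prod_decode n)) N" for n N
  show thesis
  proof
    show "compact (D n N)" for n N unfolding D_def by (intro compact_Int_closed K C)
    show "incseq (D n)" for n
      unfolding D_def incseq_def using K(2) C_mono by (auto simp: incseq_def) blast
    have "x \<in> regular_points \<longleftrightarrow> (\<forall>i. (\<lambda>k. v i k x) \<longlonglongrightarrow> 0)" for x
      using y by (subst regular_points_eq[of "range y"]) (auto simp: v_def)
    also have "\<dots> x \<longleftrightarrow> (\<forall>n. \<exists>N. x \<in> D n N)" for x
    proof -
      have "(\<exists>N. x \<in> C i m N) \<longleftrightarrow> (\<exists>N. x \<in> D (prod_encode (i, m)) N)" for i m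
      proof
        assume "\<exists>N. x \<in> C i m N"
        then obtain N where N: "x \<in> C i m N" ..
        obtain N' where "x \<in> K N'" using K(3) by blast
        then have "x \<in> K (max N N')" "x \<in> C i m (max N N')"
          using subsetD[OF incseqD[OF K(2), of N' "max N N'"]] subsetD[OF C_mono[of N "max N N'" i m]] N by auto
        then show "\<exists>N. x \<in> D (prod_encode (i, m)) N" by (auto simp: D_def)
      qed (auto simp: D_def)
      then show ?thesis unfolding null by (metis prod_decode_inverse surj_pair)
    qed
    finally show "regular_points = (\<Inter>i. \<Union>N. D i N)" by auto
  qed
qed

lemma regular_points_borel: "regular_points \<in> sets borel"
proof -
  obtain D :: "nat \<Rightarrow> nat \<Rightarrow> 'x set" where D: "\<And>i N. compact (D i N)" "\<And>i. incseq (D i)" "regular_points = (\<Inter>i. \<Union>N. D i N)"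
    by (rule regular_points_K_sigma_delta) (rule that)
  show ?thesis unfolding D(3) using borel_compact[OF D(1)] by auto
qed

text \<open>The approximation errors are bounded and tend to 0 at regular points. The time-changed
  process lives there, so the potentials of the errors tend to 0; these potentials also converge to
  the integral of G times the limiting error, which must vanish almost everywhere since G >
  0.\<close>

lemma AE_regular_points:
  assumes pos: "\<And>x y. 0 < G x y"
  shows "AE y in \<mu>. y \<in> regular_points"
proof -
  obtain y :: "nat \<Rightarrow> 'x" where y: "\<And>x e. 0 < e \<Longrightarrow> \<exists>i. dist (y i) x < e" by (rule dense_sequence) (rule that)
  have "AE z in \<mu>. (\<lambda>k. \<bar>yosida k (tent (y i)) z - tent (y i) z\<bar>) \<longlonglongrightarrow> 0" for i
  proof -
    define v where "v k z = \<bar>yosida k (tent (y i)) z - tent (y i) z\<bar>" for k z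
    define v0 where "v0 z = \<bar>flow 0 z (tent (y i)) - tent (y i) z\<bar>" for z
    have v_lim: "(\<lambda>k. v k z) \<longlonglongrightarrow> v0 z" for z
      unfolding v_def v0_def by (intro tendsto_intros yosida_tendsto)
    have nt: "norm (tent (y i)) \<le> 1" by (rule norm_bound) (simp add: apply_tent)
    have v_le: "\<bar>v k z\<bar> \<le> 2" for k z
      using yosida_bound[of k "tent (y i)" z] norm_bounded[of "tent (y i)" z] nt unfolding v_def real_norm_def by linarith
    have v_cont: "continuous_on UNIV (v k)" for k
      unfolding v_def by (intro continuous_intros yosida_continuous) auto
    define w :: "nat \<Rightarrow> ('x \<Rightarrow>\<^sub>C real)" where "w k = Bcontfun (v k)" for k
    have w: "apply_bcontfun (w k) = v k" for k
      unfolding w_def using v_le by (intro Bcontfun_inverse bcontfun_normI[where b=2] v_cont) simp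
    have v_regular: "(\<lambda>k. v k z) \<longlonglongrightarrow> 0" if "z \<in> regular_points" for z
      using v_lim[of z] flow_zero_regular[OF that] by (simp add: v0_def)
    have flow_lim: "(\<lambda>k. flow r x (w k)) \<longlonglongrightarrow> 0" if r: "0 \<le> r" for r x
    proof -
      interpret P: prob_space "law X (Some x)" by (rule prob_law)
      have "(\<lambda>k. \<integral>\<omega>. ext0 (w k) (pos X (tau r \<omega>) \<omega>) \<partial>law X (Some x)) \<longlonglongrightarrow> (\<integral>\<omega>. 0 \<partial>law X (Some x))"
      proof (rule integral_dominated_convergence[where w="\<lambda>_. 2"])
        show "AE \<omega> in law X (Some x). (\<lambda>k. ext0 (w k) (pos X (tau r \<omega>) \<omega>)) \<longlonglongrightarrow> 0"
          using AE_pos_tau_regular[OF r, of "Some x"] by eventually_elim (auto simp: w intro: v_regular)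
        show "AE \<omega> in law X (Some x). norm (ext0 (w k) (pos X (tau r \<omega>) \<omega>)) \<le> 2" for k
          using v_le by (intro AE_I2) (auto simp: w intro!: ext0_abs_le)
      qed (auto intro!: ext0_pos_measurable borel_measurable_continuous_onI)
      then show ?thesis unfolding flow_eq by simp
    qed
    obtain C where "sub_markov_flow flow pot C" by (rule flow_mass_bound)
    then interpret M: sub_markov_flow flow pot C .
    have pot_lim: "(\<lambda>k. pot (w k) x) \<longlonglongrightarrow> 0" for x
    proof -
      have "(\<lambda>k. \<integral>r. indicator {0..} r *\<^sub>R flow r x (w k) \<partial>lborel) \<longlonglongrightarrow> (\<integral>r. 0 \<partial>(lborel :: real measure))"
      proof (rule integral_dominated_convergence[where w="\<lambda>r. indicator {0..} r *\<^sub>R flow r x (const_bcontfun 2)"])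
        show "integrable lborel (\<lambda>r. indicator {0..} r *\<^sub>R flow r x (const_bcontfun 2))"
          using M.q_integrable[of "const_bcontfun 2" x] by (simp add: set_integrable_def)
        show "AE r in lborel. (\<lambda>k. indicator {0..} r *\<^sub>R flow r x (w k)) \<longlonglongrightarrow> 0"
          using flow_lim[of _ x] by (intro AE_I2) (auto simp: indicator_def)
        have le: "\<bar>flow r x (w k)\<bar> \<le> flow r x (const_bcontfun 2)" for r k
        proof -
          have b: "v k y \<le> 2" "0 \<le> 2 + v k y" for y using v_le[of k y] by linarith+
          have "0 \<le> flow r x (const_bcontfun 2 - w k)" by (rule flow_nonneg) (simp add: w b)
          moreover have "0 \<le> flow r x (const_bcontfun 2 + w k)" by (rule flow_nonneg) (simp add: w b)
          moreover note flow_diff[of r "const_bcontfun 2" "w k" x] flow_add[of r "const_bcontfun 2" "w k" x]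
          ultimately show ?thesis by linarith
        qed
        show "AE r in lborel. norm (indicator {0..} r *\<^sub>R flow r x (w k)) \<le> indicator {0..} r *\<^sub>R flow r x (const_bcontfun 2)" for k
          using le by (intro AE_I2) (auto simp: indicator_def)
      qed (auto simp: M.q_measurable)
      then show ?thesis by (simp add: M.R_eq set_lebesgue_integral_def)
    qed
    \<comment> \<open>Any base point will do, because \<open>G x0\<close> is positive
      everywhere.\<close>
    define x0 :: 'x where "x0 = undefined"
    let ?g = "\<lambda>z. enn2real (G x0 z)"
    have [measurable]: "?g \<in> borel_measurable \<mu>" using integrable_G[OF lsc kato] by (rule borel_measurable_integrable)
    have [measurable]: "v k \<in> borel_measurable \<mu>" for k
      using borel_measurable_continuous_onI[OF v_cont] kato_sets[OF kato] by (simp cong: measurable_cong_sets)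
    have [measurable]: "v0 \<in> borel_measurable \<mu>" by (rule borel_measurable_LIMSEQ_real[OF v_lim]) measurable
    have int: "integrable \<mu> (\<lambda>z. ?g z * 2)" by (intro integrable_mult_left integrable_G[OF lsc kato])
    have bnd: "AE z in \<mu>. norm (?g z * v k z) \<le> ?g z * 2" for k
      using v_le by (intro AE_I2) (auto simp: abs_mult intro!: mult_left_mono)
    have lim: "AE z in \<mu>. (\<lambda>k. ?g z * v k z) \<longlonglongrightarrow> ?g z * v0 z"
      by (intro AE_I2 tendsto_intros v_lim)
    have "(\<lambda>k. \<integral>z. ?g z * v k z \<partial>\<mu>) \<longlonglongrightarrow> (\<integral>z. ?g z * v0 z \<partial>\<mu>)"
      by (rule integral_dominated_convergence[OF _ _ int lim bnd]) measurable
    moreover have "(\<lambda>k. \<integral>z. ?g z * v k z \<partial>\<mu>) \<longlonglongrightarrow> 0"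
      using pot_lim[of x0] by (simp add: apply_pot potential_def w)
    ultimately have "(\<integral>z. ?g z * v0 z \<partial>\<mu>) = 0" by (rule LIMSEQ_unique)
    moreover have "integrable \<mu> (\<lambda>z. ?g z * v0 z)"
      by (rule integrable_dominated_convergence[OF _ _ int lim bnd]) measurable
    ultimately have "AE z in \<mu>. ?g z * v0 z = 0"
      by (subst (asm) integral_nonneg_eq_0_iff_AE) (auto simp: v0_def)
    then have "AE z in \<mu>. v0 z = 0"
      using AE_G_finite[OF lsc kato, of x0]
    proof eventually_elim
      case (elim z)
      have "0 < enn2real (G x0 z)" using pos[of x0 z] elim(2) by (simp add: enn2real_positive_iff)
      then show ?case using elim(1) by simp
    qed
    then show ?thesis
    proof eventually_elim
      case (elim z)
      then show ?case using v_lim[of z] by (simp add: v_def)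
    qed
  qed
  then have "AE z in \<mu>. \<forall>i. (\<lambda>k. \<bar>yosida k (tent (y i)) z - tent (y i) z\<bar>) \<longlonglongrightarrow> 0"
    by (subst AE_all_countable) simp
  then show ?thesis
  proof eventually_elim
    case (elim z)
    then show ?case using y by (subst regular_points_eq[of "range y"]) auto
  qed
qed

end

section \<open>Fine closedness of the set of regular points\<close>

lemma compact_decseq_subset_open:
  fixes K :: "nat \<Rightarrow> 'a::t2_space set"
  assumes "\<And>n. compact (K n)" "decseq K" "open U" "(\<Inter>n. K n) \<subseteq> U"
  obtains n where "K n \<subseteq> U"
proof -
  have "K 0 \<subseteq> (\<Union>n. - (K n \<inter> - U))" using assms(4) by auto
  moreover have "open (- (K n \<inter> - U))" for n
    using assms(1,3) by (intro open_Compl closed_Int compact_imp_closed closed_Compl)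
  moreover have "- (K m \<inter> - U) \<subseteq> - (K n \<inter> - U)" if "m \<le> n" for m n
    using decseqD[OF assms(2) that] by blast
  ultimately obtain n where n: "K 0 \<subseteq> - (K n \<inter> - U)"
    using compact_finite_stage[OF assms(1)[of 0], of "\<lambda>n. - (K n \<inter> - U)"] by metis
  have "K n \<subseteq> U" using n decseqD[OF assms(2), of 0 n] by blast
  then show thesis by (rule that)
qed

lemma outer_measure_Un_le:
  assumes "A \<subseteq> space M" "B \<in> sets M"
  shows "outer_measure_of M (A \<union> B) \<le> outer_measure_of M A + emeasure M B"
proof -
  obtain V where V: "V \<in> sets M" "A \<subseteq> V" "outer_measure_of M A = emeasure M V"
    using outer_measure_of_attain[OF assms(1)] by blast
  have "outer_measure_of M (A \<union> B) \<le> outer_measure_of M (V \<union> B)"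
    using V(2) by (intro outer_measure_of_mono) auto
  also have "\<dots> = emeasure M (V \<union> B)" using V(1) assms(2) by (intro outer_measure_of_eq) auto
  also have "\<dots> \<le> emeasure M V + emeasure M B" by (rule emeasure_subadditive[OF V(1) assms(2)])
  finally show ?thesis using V(3) by simp
qed

text \<open>The inductive step of Choquet's capacitability theorem: the outer measure is continuous
  along increasing sequences, so one can choose one set of each sequence while losing nothing.\<close>
lemma K_sigma_delta_selection:
  fixes D :: "nat \<Rightarrow> nat \<Rightarrow> 'a set" and E :: "'a set \<Rightarrow> 'b set"
  assumes D: "\<And>i. incseq (D i)"
    and E_UN: "\<And>S :: nat \<Rightarrow> 'a set. E (\<Union>n. S n) = (\<Union>n. E (S n))"
    and E_mono: "\<And>S T. S \<subseteq> T \<Longrightarrow> E S \<subseteq> E T" and E_space: "\<And>S. E S \<subseteq> space P"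
    and c: "c < outer_measure_of P (E (\<Inter>i. \<Union>N. D i N))"
  obtains j where "\<And>n. c < outer_measure_of P (E (\<Inter>i\<in>{..n}. D i (j i)))"
proof -
  let ?S = "\<Inter>i. \<Union>N. D i N"
  have "\<exists>f. \<forall>n. (f n \<subseteq> ?S \<and> c < outer_measure_of P (E (f n))) \<and> (\<exists>N. f (Suc n) = f n \<inter> D n N)"
  proof (rule dependent_nat_choice)
    fix S n assume S: "S \<subseteq> ?S \<and> c < outer_measure_of P (E S)"
    \<comment> \<open>Since S lies in every union over N, its pieces \<open>S \<inter> D n N\<close>
      exhaust it as N grows.\<close>
    have "incseq (\<lambda>N. E (S \<inter> D n N))"
      by (intro incseq_SucI E_mono Int_mono subset_refl incseq_SucD[OF D])
    then have "(SUP N. outer_measure_of P (E (S \<inter> D n N))) = outer_measure_of P (\<Union>N. E (S \<inter> D n N))"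
      by (intro SUP_outer_measure_of_incseq E_space)
    also have "(\<Union>N. E (S \<inter> D n N)) = E S"
    proof -
      have "(\<Union>N. S \<inter> D n N) = S" using S by blast
      then show ?thesis unfolding E_UN[symmetric] by simp
    qed
    finally have "c < (SUP N. outer_measure_of P (E (S \<inter> D n N)))" using S by simp
    then obtain N where "c < outer_measure_of P (E (S \<inter> D n N))" unfolding less_SUP_iff by blast
    then show "\<exists>S'. (S' \<subseteq> ?S \<and> c < outer_measure_of P (E S')) \<and> (\<exists>N. S' = S \<inter> D n N)"
      using S by (intro exI[of _ "S \<inter> D n N"]) auto
  qed (use c in blast)
  then obtain f where f: "\<And>n. c < outer_measure_of P (E (f n))" "\<And>n. \<exists>N. f (Suc n) = f n \<inter> D n N"
    by blast
  obtain j where j: "\<And>n. f (Suc n) = f n \<inter> D n (j n)" using f(2) by metis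
  have "f (Suc n) \<subseteq> (\<Inter>i\<in>{..n}. D i (j i))" for n
  proof (induction n)
    case (Suc n)
    then show ?case unfolding j[of "Suc n"] by (auto simp: atMost_Suc)
  qed (simp add: j)
  then have "outer_measure_of P (E (f (Suc n))) \<le> outer_measure_of P (E (\<Inter>i\<in>{..n}. D i (j i)))" for n
    by (intro outer_measure_of_mono E_mono)
  then show thesis using f(1) by (intro that[of j]) (metis less_le_trans)
qed

lemma ennreal_rat_between:
  fixes a b :: ennreal
  assumes "a < b"
  obtains q where "q \<in> range (\<lambda>r::rat. ennreal (real_of_rat r))" "a < q" "q < b"
  using ennreal_rat_dense[OF assms] by blast

lemma eventually_at_right_ennreal:
  fixes t :: ennreal
  assumes "\<forall>\<^sub>F s in at_right t. Q s" "t < \<infinity>" "t < u"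
  obtains b where "t < b" "b < u" "\<And>s. t < s \<Longrightarrow> s \<le> b \<Longrightarrow> Q s"
proof -
  obtain b where b: "t < b" "\<And>s. t < s \<Longrightarrow> s < b \<Longrightarrow> Q s"
    using assms(1) unfolding eventually_at_right[OF assms(2)] by blast
  obtain b' where "t < b'" "b' < min b u" using dense[of t "min b u"] b(1) assms(3) by auto
  then show thesis using b(2) by (intro that[of b']) auto
qed

section \<open>Entrance times of open sets\<close>

context standard_markov begin

definition right_path :: "'w \<Rightarrow> bool" where
  "right_path \<omega> \<longleftrightarrow> (\<forall>t<\<infinity>. limitin one_point_topology (\<lambda>s. pos X s \<omega>) (pos X t \<omega>) (at_right t))"

lemma AE_right_path: "AE \<omega> in law X z. right_path \<omega>"
  unfolding right_path_def by (rule paths_right_continuous)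

lemma pos_SomeD: "pos X t \<omega> = Some x \<Longrightarrow> t < \<infinity>"
  using pos_infinity by (metis less_top option.distinct(1) infinity_ennreal_def)

lemma openin_Some_image: "open U \<Longrightarrow> openin one_point_topology (Some ` U)"
  by (auto simp: openin_one_point_topology inj_vimage_image_eq)

lemma right_path_open:
  assumes \<omega>: "right_path \<omega>" and U: "open U" and pos: "pos X t \<omega> \<in> Some ` U"
  shows "\<forall>\<^sub>F s in at_right t. pos X s \<omega> \<in> Some ` U"
proof -
  have "t < \<infinity>" using pos pos_SomeD by blast
  then have "limitin one_point_topology (\<lambda>s. pos X s \<omega>) (pos X t \<omega>) (at_right t)"
    using \<omega> unfolding right_path_def by blast
  then show ?thesis using openin_Some_image[OF U] pos unfolding limitin_def by blast
qed

text \<open>X is open in its compactification, so a right continuous path that is in X stays there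
  for a moment.\<close>

lemma alive_less_lifetime:
  assumes \<omega>: "right_path \<omega>" and pos: "pos X t \<omega> \<noteq> None"
  shows "t < lifetime X \<omega>"
proof -
  obtain x where x: "pos X t \<omega> = Some x" using pos by blast
  have t: "t < \<infinity>" by (rule pos_SomeD[OF x])
  have "\<forall>\<^sub>F s in at_right t. pos X s \<omega> \<in> Some ` UNIV"
    by (rule right_path_open[OF \<omega>]) (simp_all add: x)
  then obtain b where b: "t < b" "\<And>s. t < s \<Longrightarrow> s \<le> b \<Longrightarrow> pos X s \<omega> \<in> Some ` UNIV"
    by (rule eventually_at_right_ennreal[OF _ t t]) (rule that)
  have "b \<le> lifetime X \<omega>"
    unfolding lifetime_def
  proof (rule Inf_greatest)
    fix s assume "s \<in> {t. pos X t \<omega> = None}"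
    then have "pos X b \<omega> = None" if "s \<le> b" using that pos_absorbing by blast
    then show "b \<le> s" using b(1) b(2)[of b] by (metis imageE linear order_refl option.distinct(1))
  qed
  then show ?thesis using b(1) by (rule less_le_trans[rotated])
qed

text \<open>Countably many times make this a stopping time directly. For open U and right continuous
  paths it still does not exceed any time spent in U. Negative rationals are read as 0.\<close>

definition rational_entrance :: "'x set \<Rightarrow> 'w \<Rightarrow> ennreal" where
  "rational_entrance U \<omega> =
     (INF q\<in>range (\<lambda>r::rat. ennreal (real_of_rat r)). if pos X q \<omega> \<in> Some ` U then q else \<infinity>)"

lemma rational_entrance_less_iff:
  "rational_entrance U \<omega> < u \<longleftrightarrow>
     (\<exists>r::rat. ennreal (real_of_rat r) < u \<and> pos X (ennreal (real_of_rat r)) \<omega> \<in> Some ` U)"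
  unfolding rational_entrance_def INF_less_iff by (auto split: if_splits)

lemma stopping_time_rational_entrance:
  assumes U: "U \<in> sets borel"
  shows "stopping_time (filt X) (rational_entrance U)"
proof (rule stopping_time_lessI)
  fix u
  have pos: "{\<omega>. pos X q \<omega> \<in> Some ` U} \<in> sets (filt X u)" if "q < u" for q
  proof -
    have "{\<omega>. pos X q \<omega> \<in> Some ` U} \<in> sets (filt X q)"
      using measurable_sets[OF pos_filt[of q] Some_image_borel_cem[OF U]] F.space_F[of q] by (simp add: vimage_def)
    then show ?thesis using F.sets_F_mono[OF less_imp_le[OF that]] by blast
  qed
  have "{\<omega>. rational_entrance U \<omega> < u} =
        (\<Union>r\<in>{r::rat. ennreal (real_of_rat r) < u}. {\<omega>. pos X (ennreal (real_of_rat r)) \<omega> \<in> Some ` U})"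
    unfolding rational_entrance_less_iff by blast
  also have "\<dots> \<in> sets (filt X u)" by (rule sets.countable_UN') (auto intro: pos)
  finally show "{\<omega>. rational_entrance U \<omega> < u} \<in> sets (filt X u)" .
qed

lemma rational_entrance_antimono: "U \<subseteq> V \<Longrightarrow> rational_entrance V \<omega> \<le> rational_entrance U \<omega>"
  unfolding rational_entrance_def by (rule INF_mono) (auto intro!: exI)

lemma rational_entrance_le:
  assumes \<omega>: "right_path \<omega>" and U: "open U" and pos: "pos X t \<omega> \<in> Some ` U"
  shows "rational_entrance U \<omega> \<le> t"
proof (rule dense_ge)
  fix u assume u: "t < u"
  have t: "t < \<infinity>" using pos pos_SomeD by blast
  obtain b where b: "t < b" "b < u" "\<And>s. t < s \<Longrightarrow> s \<le> b \<Longrightarrow> pos X s \<omega> \<in> Some ` U"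
    by (rule eventually_at_right_ennreal[OF right_path_open[OF \<omega> U pos] t u]) (rule that)
  obtain q where q: "q \<in> range (\<lambda>r::rat. ennreal (real_of_rat r))" "t < q" "q < b"
    by (rule ennreal_rat_between[OF b(1)]) (rule that)
  have "q < u" using q(3) b(2) by (rule less_trans)
  moreover have "pos X q \<omega> \<in> Some ` U" using b(3) q(2,3) by (simp add: less_imp_le)
  ultimately have "rational_entrance U \<omega> < u" using q(1) unfolding rational_entrance_less_iff by blast
  then show "rational_entrance U \<omega> \<le> u" by (rule less_imp_le)
qed

text \<open>Outside the closed set C the path would remain outside for a moment, contradicting the
  infimum over times spent in U.\<close>

lemma pos_rational_entrance:
  assumes \<omega>: "right_path \<omega>" and C: "closed C" "U \<subseteq> C"
    and alive: "pos X (rational_entrance U \<omega>) \<omega> \<noteq> None"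
  shows "pos X (rational_entrance U \<omega>) \<omega> \<in> Some ` C"
proof (rule ccontr)
  let ?t = "rational_entrance U \<omega>"
  assume "pos X ?t \<omega> \<notin> Some ` C"
  then have out: "pos X ?t \<omega> \<in> Some ` (- C)" using alive by blast
  then have t: "?t < \<infinity>" using pos_SomeD by blast
  have "open (- C)" using C(1) by (rule open_Compl)
  then obtain b where b: "?t < b" "\<And>s. ?t < s \<Longrightarrow> s \<le> b \<Longrightarrow> pos X s \<omega> \<in> Some ` (- C)"
    by (rule eventually_at_right_ennreal[OF right_path_open[OF \<omega> _ out] t t]) (rule that)
  obtain r :: rat where r: "ennreal (real_of_rat r) < b" "pos X (ennreal (real_of_rat r)) \<omega> \<in> Some ` U"
    using b(1) unfolding rational_entrance_less_iff by blast
  have le: "?t \<le> ennreal (real_of_rat r)"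
    unfolding rational_entrance_def by (rule INF_lower2[of "ennreal (real_of_rat r)"]) (use r(2) in auto)
  have "pos X (ennreal (real_of_rat r)) \<omega> \<in> Some ` (- C)"
  proof (cases "?t = ennreal (real_of_rat r)")
    case True
    show ?thesis using out unfolding True .
  next
    case False
    show ?thesis by (rule b(2)[OF le_neq_trans[OF le False] less_imp_le[OF r(1)]])
  qed
  then obtain y where y: "pos X (ennreal (real_of_rat r)) \<omega> = Some y" "y \<in> - C" by (rule imageE)
  obtain y' where y': "pos X (ennreal (real_of_rat r)) \<omega> = Some y'" "y' \<in> U" using r(2) by (rule imageE)
  have "y' \<in> C" using C(2) y'(2) by (rule subsetD)
  then show False using y y'(1) by simp
qed

lemma stopping_time_SUP:
  assumes T: "\<And>n::nat. stopping_time (filt X) (T n)"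
  shows "stopping_time (filt X) (\<lambda>\<omega>. SUP n. T n \<omega>)"
proof
  fix t
  have "Measurable.pred (filt X t) (\<lambda>\<omega>. T n \<omega> \<le> t)" for n
    using T[of n] by (simp add: stopping_time_def)
  then show "Measurable.pred (filt X t) (\<lambda>\<omega>. (SUP n. T n \<omega>) \<le> t)"
    unfolding SUP_le_iff by simp
qed

text \<open>Survival at r is part of the event because quasi-left-continuity is available only
  before the lifetime. The event is measured by outer measure, its measurability being left
  open.\<close>

definition alive_hitting :: "ennreal \<Rightarrow> 'x set \<Rightarrow> 'w set" where
  "alive_hitting r B = {\<omega>. (\<exists>t\<le>r. pos X t \<omega> \<in> Some ` B) \<and> pos X r \<omega> \<noteq> None}"

lemma alive_hitting_UN: "alive_hitting r (\<Union>n. S n) = (\<Union>n. alive_hitting r (S n))"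
  by (auto simp: alive_hitting_def)

lemma alive_hitting_mono: "S \<subseteq> T \<Longrightarrow> alive_hitting r S \<subseteq> alive_hitting r T"
  by (auto simp: alive_hitting_def)

lemma alive_events: "{\<omega>. pos X r \<omega> \<noteq> None} \<in> sets (law X z)"
proof -
  have "{\<omega>. pos X r \<omega> \<in> {None}} \<in> sets (events X)"
    using measurable_sets[OF pos_measurable[of r] None_borel_cem] space_events by (simp add: vimage_def)
  then have "UNIV - {\<omega>. pos X r \<omega> \<in> {None}} \<in> sets (events X)" using sets.compl_sets space_events by metis
  moreover have "UNIV - {\<omega>. pos X r \<omega> \<in> {None}} = {\<omega>. pos X r \<omega> \<noteq> None}" by (auto simp del: not_None_eq)
  ultimately show ?thesis by (simp add: sets_law)
qed

end

section \<open>Capacitability and fine closedness\<close>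

context pcaf_process begin

text \<open>The entrance times T j of shrinking neighbourhoods of K' increase to a limit S. For
  paths alive at r, quasi-left-continuity places the position at S in every closed neighbourhood V
  j, hence in K'; its points are regular, so the clock has started by S <= r. The sets
  \<open>K n\<close> themselves may contain irregular points.\<close>

lemma alive_hitting_compact:
  assumes K: "\<And>n. compact (K n)" "decseq K" "(\<Inter>n. K n) \<subseteq> regular_points"
    and c: "\<And>n::nat. c < outer_measure_of (law X z) (alive_hitting r (K n))"
  shows "c \<le> emeasure (law X z) {\<omega>. tau 0 \<omega> \<le> r}"
proof -
  interpret P: prob_space "law X z" by (rule prob_law)
  define K' where "K' = (\<Inter>n. K n)"
  have K'_K: "K' \<subseteq> K n" for n by (auto simp: K'_def)
  have K'_compact: "compact K'"
    unfolding K'_def using compact_Int_closed[OF K(1)[of 0] closed_INT[of UNIV K]] compact_imp_closed[OF K(1)]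
    by (metis Int_absorb1 K'_K K'_def)
  have K'_closed: "closed K'" using K'_compact by (rule compact_imp_closed)
  \<comment> \<open>Nonemptiness gives \<open>infdist\<close> its meaning. An empty K' would make
    some \<open>K n\<close> empty, and no path hits the empty set, against the strict bound by
    c.\<close>
  have K'_ne: "K' \<noteq> {}"
  proof
    assume "K' = {}"
    then obtain n where "K n \<subseteq> {}"
      by (rule compact_decseq_subset_open[OF K(1,2) open_empty, unfolded K'_def[symmetric], OF equalityD1])
    then show False using c[of n] outer_measure_of_eq[OF sets.empty_sets, of "law X z"] by (simp add: alive_hitting_def)
  qed
  define U where "U j = {y. infdist y K' < inverse (real (Suc j))}" for j
  define V where "V j = {y. infdist y K' \<le> inverse (real (Suc j))}" for j
  define T where "T j = rational_entrance (U j)" for j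
  have U_open: "open (U j)" for j
    unfolding U_def by (intro open_Collect_less continuous_on_infdist continuous_intros)
  have V_closed: "closed (V j)" for j
    unfolding V_def by (intro closed_Collect_le continuous_on_infdist continuous_intros)
  have U_V: "U j \<subseteq> V j" for j by (auto simp: U_def V_def)
  have inv: "inverse (real (Suc j)) \<le> inverse (real (Suc i))" if "i \<le> j" for i j using that by (simp add: field_simps)
  have U_mono: "U j \<subseteq> U i" if "i \<le> j" for i j
    unfolding U_def by (intro Collect_mono impI) (rule less_le_trans[OF _ inv[OF that]])
  have V_mono: "V j \<subseteq> V i" if "i \<le> j" for i j
    unfolding V_def by (intro Collect_mono impI) (rule order_trans[OF _ inv[OF that]])
  have T_stop: "stopping_time (filt X) (T j)" for j
    unfolding T_def by (intro stopping_time_rational_entrance borel_open U_open)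
  have T_inc: "incseq (\<lambda>j. T j \<omega>)" for \<omega>
    unfolding T_def incseq_def by (intro allI impI rational_entrance_antimono U_mono)
  define M where "M j = {\<omega>. T j \<omega> \<le> r} \<inter> {\<omega>. pos X r \<omega> \<noteq> None}" for j
  have le_sets: "{\<omega>. S \<omega> \<le> r} \<in> sets (law X z)" if "stopping_time (filt X) S" for S
  proof -
    have "{\<omega>. S \<omega> \<le> r} \<in> sets (filt X r)"
      using stopping_timeD[OF that, of r] F.space_F[of r] by (simp add: pred_def)
    then show ?thesis using filt_events by (auto simp: sets_law)
  qed
  have M_sets: "M j \<in> sets (law X z)" for j
    unfolding M_def by (intro sets.Int le_sets T_stop alive_events)
  have M_c: "c \<le> emeasure (law X z) (M j)" for j
  proof -
    \<comment> \<open>By compactness some \<open>K n\<close> already lies in U j, so hitting it by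
      time r forces T j <= r. The bound c thereby passes from outer measures to the measurable
      events M j.\<close>
    have "K' \<subseteq> U j" by (auto simp: U_def)
    then obtain n where n: "K n \<subseteq> U j"
      by (rule compact_decseq_subset_open[OF K(1,2) U_open, unfolded K'_def[symmetric]])
    have "AE \<omega> in law X z. \<omega> \<in> alive_hitting r (K n) \<longrightarrow> \<omega> \<in> M j"
      using AE_right_path[of z]
    proof eventually_elim
      case (elim \<omega>)
      show ?case
      proof
        assume hit: "\<omega> \<in> alive_hitting r (K n)"
        then obtain t where t: "t \<le> r" "pos X t \<omega> \<in> Some ` K n" by (auto simp: alive_hitting_def)
        have "pos X t \<omega> \<in> Some ` U j" by (rule subsetD[OF image_mono[OF n] t(2)])
        then have "T j \<omega> \<le> t" unfolding T_def by (rule rational_entrance_le[OF elim U_open])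
        then have "T j \<omega> \<le> r" using t(1) by (rule order_trans)
        moreover have "pos X r \<omega> \<noteq> None" using hit unfolding alive_hitting_def by blast
        ultimately show "\<omega> \<in> M j" unfolding M_def by blast
      qed
    qed
    then have "outer_measure_of (law X z) (alive_hitting r (K n)) \<le> emeasure (law X z) (M j)"
      by (rule outer_measure_le_AE[OF M_sets]) simp
    then show ?thesis using c[of n] by (rule order_trans[OF less_imp_le, rotated])
  qed
  have "decseq M"
    unfolding M_def decseq_def using T_inc by (auto simp: incseq_def intro: order_trans)
  then have "emeasure (law X z) (\<Inter>j. M j) = (INF j. emeasure (law X z) (M j))"
    using M_sets by (intro INF_emeasure_decseq[symmetric]) auto
  then have "c \<le> emeasure (law X z) (\<Inter>j. M j)" using M_c by (simp add: le_INF_iff)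
  also have "\<dots> \<le> emeasure (law X z) {\<omega>. tau 0 \<omega> \<le> r}"
  proof (rule emeasure_mono_AE)
    define S where "S \<omega> = (SUP j. T j \<omega>)" for \<omega>
    have S_stop: "stopping_time (filt X) S" unfolding S_def by (intro stopping_time_SUP T_stop)
    show "AE \<omega> in law X z. \<omega> \<in> (\<Inter>j. M j) \<longrightarrow> \<omega> \<in> {\<omega>. tau 0 \<omega> \<le> r}"
      using AE_right_path[of z] quasi_left_continuous[OF T_stop T_inc, of z, folded S_def]
        tau_le_hitting[OF S_stop K(3)[folded K'_def] borel_closed[OF K'_closed], of z]
    proof eventually_elim
      case (elim \<omega>)
      show ?case
      proof
        assume M: "\<omega> \<in> (\<Inter>j. M j)"
        then have T_le: "T j \<omega> \<le> r" and alive: "pos X r \<omega> \<noteq> None" for j by (auto simp: M_def)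
        have S_le: "S \<omega> \<le> r" unfolding S_def by (intro SUP_least T_le)
        have alive': "pos X s \<omega> \<noteq> None" if "s \<le> r" for s
        proof
          assume "pos X s \<omega> = None"
          then have "pos X r \<omega> = None" by (rule pos_absorbing[OF that])
          with alive show False by contradiction
        qed
        have "S \<omega> < lifetime X \<omega>" by (rule le_less_trans[OF S_le alive_less_lifetime[OF elim(1) alive]])
        then have lim: "limitin one_point_topology (\<lambda>n. pos X (T n \<omega>) \<omega>) (pos X (S \<omega>) \<omega>) sequentially"
          by (rule mp[OF elim(2)])
        obtain y where y: "pos X (S \<omega>) \<omega> = Some y" using alive'[OF S_le] by (auto simp only: not_None_eq)
        have T_V: "pos X (T i \<omega>) \<omega> \<in> Some ` V j" if "j \<le> i" for i j
        proof -
          have "pos X (T i \<omega>) \<omega> \<in> Some ` V i"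
            unfolding T_def by (rule pos_rational_entrance[OF elim(1) V_closed U_V alive'[OF T_le, unfolded T_def]])
          then show ?thesis by (rule subsetD[OF image_mono[OF V_mono[OF that]]])
        qed
        have "y \<in> V j" for j
        proof (rule ccontr)
          assume "y \<notin> V j"
          then have "pos X (S \<omega>) \<omega> \<in> Some ` (- V j)" unfolding y by simp
          then have "\<forall>\<^sub>F n in sequentially. pos X (T n \<omega>) \<omega> \<in> Some ` (- V j)"
            using lim openin_Some_image[OF open_Compl[OF V_closed]] unfolding limitin_def by blast
          then obtain N where N: "\<And>n. N \<le> n \<Longrightarrow> pos X (T n \<omega>) \<omega> \<in> Some ` (- V j)"
            unfolding eventually_sequentially by blast
          show False using N[of "max N j"] T_V[of j "max N j"] by auto
        qed
        then have "infdist y K' \<le> inverse (real (Suc j))" for j by (simp add: V_def)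
        then have "infdist y K' \<le> 0"
          by (intro LIMSEQ_le_const[OF LIMSEQ_inverse_real_of_nat]) blast
        then have "infdist y K' = 0" using infdist_nonneg[of y K'] by linarith
        then have "y \<in> K'" using in_closed_iff_infdist_zero[OF K'_closed K'_ne] by blast
        then have "pos X (S \<omega>) \<omega> \<in> Some ` K'" unfolding y by (rule imageI)
        then have "tau 0 \<omega> \<le> S \<omega>" by (rule mp[OF elim(3)])
        then show "\<omega> \<in> {\<omega>. tau 0 \<omega> \<le> r}" using S_le by auto
      qed
    qed
    show "{\<omega>. tau 0 \<omega> \<le> r} \<in> sets (law X z)" by (rule le_sets[OF stopping_time_tau])
  qed
  finally show ?thesis .
qed

text \<open>For c below the outer measure, one compact piece of each union is selected. Their finite
  intersections are compact, decrease, and have their total intersection inside the set of regular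
  points.\<close>

lemma alive_hitting_regular_points:
  "outer_measure_of (law X z) (alive_hitting r regular_points) \<le> emeasure (law X z) {\<omega>. tau 0 \<omega> \<le> r}"
proof (rule dense_le)
  fix c assume c: "c < outer_measure_of (law X z) (alive_hitting r regular_points)"
  obtain D :: "nat \<Rightarrow> nat \<Rightarrow> 'x set"
    where D: "\<And>i N. compact (D i N)" "\<And>i. incseq (D i)" "regular_points = (\<Inter>i. \<Union>N. D i N)"
    by (rule regular_points_K_sigma_delta) (rule that)
  obtain j where j: "\<And>n. c < outer_measure_of (law X z) (alive_hitting r (\<Inter>i\<in>{..n}. D i (j i)))"
    by (rule K_sigma_delta_selection[where E="alive_hitting r", OF D(2) alive_hitting_UN alive_hitting_mono _ c[unfolded D(3)]])
      (assumption, simp, rule that)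
  show "c \<le> emeasure (law X z) {\<omega>. tau 0 \<omega> \<le> r}"
  proof (rule alive_hitting_compact[OF _ _ _ j])
    show "compact (\<Inter>i\<in>{..n}. D i (j i))" for n
    proof -
      have "compact (D 0 (j 0) \<inter> (\<Inter>i\<in>{..n}. D i (j i)))"
        by (intro compact_Int_closed closed_INT ballI D(1) compact_imp_closed)
      also have "D 0 (j 0) \<inter> (\<Inter>i\<in>{..n}. D i (j i)) = (\<Inter>i\<in>{..n}. D i (j i))" by auto
      finally show ?thesis .
    qed
    show "decseq (\<lambda>n. \<Inter>i\<in>{..n}. D i (j i))" by (force simp: decseq_def)
    show "(\<Inter>n. \<Inter>i\<in>{..n}. D i (j i)) \<subseteq> regular_points" unfolding D(3) by auto
  qed
qed

text \<open>A path that hits regular points at arbitrarily small times either does so by time r n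
  and is alive at r n, or is dead at r n. As r n tends to 0 the first probability is dominated by
  that of \<open>tau 0 \<le> r n\<close>, which tends to 0 by the zero-one law, and the second tends
  to the probability of immediate death, which is 0 by right continuity.\<close>

lemma regular_points_hitting_time:
  assumes x: "x \<notin> regular_points"
  shows "AE \<omega> in law X (Some x). 0 < hitting_time X regular_points \<omega>"
proof -
  let ?P = "law X (Some x)"
  interpret P: prob_space ?P by (rule prob_law)
  define r where "r n = ennreal (inverse (real (Suc n)))" for n
  have r_lim: "r \<longlonglongrightarrow> 0"
    using tendsto_ennrealI[OF LIMSEQ_inverse_real_of_nat] by (simp add: r_def[abs_def])
  have r_pos: "0 < r n" for n by (simp add: r_def)
  have r_dec: "r n \<le> r m" if "m \<le> n" for m n
    using that unfolding r_def by (intro ennreal_leI) (simp add: field_simps)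
  define Z where "Z = {\<omega>. hitting_time X regular_points \<omega> = 0}"
  define A where "A n = {\<omega>. tau 0 \<omega> \<le> r n}" for n
  define B where "B n = - {\<omega>. pos X (r n) \<omega> \<noteq> None}" for n
  have A_sets: "A n \<in> sets ?P" for n
  proof -
    have "A n \<in> sets (filt X (r n))"
      using stopping_timeD[OF stopping_time_tau, of 0 "r n"] F.space_F[of "r n"] by (simp add: pred_def A_def)
    then show ?thesis using filt_events by (auto simp: sets_law)
  qed
  have B_sets: "B n \<in> sets ?P" for n
    using sets.compl_sets[OF alive_events[of "r n" "Some x"]] by (simp add: B_def Compl_eq_Diff_UNIV)
  have "Z \<subseteq> alive_hitting (r n) regular_points \<union> B n" for n
  proof
    fix \<omega> assume "\<omega> \<in> Z"
    then have "Inf {t. 0 < t \<and> pos X t \<omega> \<in> Some ` regular_points} < r n"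
      using r_pos by (simp add: Z_def hitting_time_def)
    then obtain t where "pos X t \<omega> \<in> Some ` regular_points" "t < r n"
      unfolding Inf_less_iff by blast
    then show "\<omega> \<in> alive_hitting (r n) regular_points \<union> B n"
      unfolding alive_hitting_def B_def using less_imp_le by blast
  qed
  then have Z_le: "outer_measure_of ?P Z \<le> emeasure ?P (A n) + emeasure ?P (B n)" for n
  proof -
    have "outer_measure_of ?P Z \<le> outer_measure_of ?P (alive_hitting (r n) regular_points \<union> B n)"
      by (rule outer_measure_of_mono) fact
    also have "\<dots> \<le> outer_measure_of ?P (alive_hitting (r n) regular_points) + emeasure ?P (B n)"
      by (rule outer_measure_Un_le[OF _ B_sets]) simp
    also have "\<dots> \<le> emeasure ?P (A n) + emeasure ?P (B n)"
      unfolding A_def by (intro add_right_mono alive_hitting_regular_points)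
    finally show ?thesis .
  qed
  have "decseq A" unfolding A_def decseq_def using r_dec by (auto intro: order_trans)
  then have A_lim: "(\<lambda>n. emeasure ?P (A n)) \<longlonglongrightarrow> emeasure ?P (\<Inter>n. A n)"
    using A_sets by (intro Lim_emeasure_decseq) auto
  have "AE \<omega> in ?P. \<omega> \<notin> (\<Inter>n. A n)"
    using irregular_AE[OF x]
  proof eventually_elim
    case (elim \<omega>)
    show ?case
    proof
      assume "\<omega> \<in> (\<Inter>n. A n)"
      then have "tau 0 \<omega> \<le> r n" for n by (auto simp: A_def)
      then have "tau 0 \<omega> \<le> 0" by (intro LIMSEQ_le_const[OF r_lim]) blast
      then show False using elim by simp
    qed
  qed
  then have A_null: "emeasure ?P (\<Inter>n. A n) = 0"
    using A_sets by (subst (asm) AE_iff_measurable[of "\<Inter>n. A n"]) auto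
  have "decseq B" 
    unfolding B_def decseq_def
  proof (intro allI impI subsetI)
    fix m n :: nat and \<omega> assume mn: "m \<le> n" and B: "\<omega> \<in> - {\<omega>. pos X (r n) \<omega> \<noteq> None}"
    have "pos X (r n) \<omega> = None" using B by (simp del: not_None_eq)
    then have "pos X (r m) \<omega> = None" by (rule pos_absorbing[OF r_dec[OF mn]])
    then show "\<omega> \<in> - {\<omega>. pos X (r m) \<omega> \<noteq> None}" by simp
  qed
  then have B_lim: "(\<lambda>n. emeasure ?P (B n)) \<longlonglongrightarrow> emeasure ?P (\<Inter>n. B n)"
    using B_sets by (intro Lim_emeasure_decseq) auto
  have "AE \<omega> in ?P. \<omega> \<notin> (\<Inter>n. B n)"
    using AE_right_path[of "Some x"] normal[of "Some x"]
  proof eventually_elim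
    case (elim \<omega>)
    have "0 < lifetime X \<omega>" using elim(2) by (intro alive_less_lifetime[OF elim(1)]) simp
    then obtain n where n: "r n < lifetime X \<omega>"
      using order_tendstoD(2)[OF r_lim] by (metis eventually_happens sequentially_bot)
    have "pos X (r n) \<omega> \<noteq> None"
    proof
      assume "pos X (r n) \<omega> = None"
      then have "lifetime X \<omega> \<le> r n" unfolding lifetime_def by (intro Inf_lower) simp
      then show False using n by simp
    qed
    then show ?case unfolding B_def by blast
  qed
  then have B_null: "emeasure ?P (\<Inter>n. B n) = 0"
    using B_sets by (subst (asm) AE_iff_measurable[of "\<Inter>n. B n"]) auto
  have "(\<lambda>n. emeasure ?P (A n) + emeasure ?P (B n)) \<longlonglongrightarrow> 0 + 0"
    using A_lim B_lim unfolding A_null B_null by (rule tendsto_add)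
  then have "outer_measure_of ?P Z \<le> 0 + 0" by (rule LIMSEQ_le_const) (use Z_le in blast)
  then have Z: "outer_measure_of ?P Z = 0" by simp
  have "Z \<subseteq> space ?P" by simp
  then obtain N where N: "N \<in> sets ?P" "Z \<subseteq> N" "outer_measure_of ?P Z = emeasure ?P N"
    using outer_measure_of_attain[of Z ?P] by blast
  have "N \<in> null_sets ?P" using N(1,3) Z by (simp add: null_sets_def)
  then show ?thesis
    by (rule AE_I') (use N(2) in \<open>auto simp: Z_def\<close>)
qed

lemma regular_points_nearly_borel: "nearly_borel X regular_points"
  unfolding nearly_borel_def negligible_under_def natural0_def
  by (intro allI impI bexI[of _ regular_points] conjI regular_points_borel subset_refl bexI[of _ "{}"] sigma_sets.Empty)
    auto

lemma fine_support_regular_points: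
  assumes F: "fine_support X \<mu> F" and pos: "\<And>x y. 0 < G x y"
  shows "F \<subseteq> regular_points"
proof -
  have "finely_closed X regular_points"
    unfolding finely_closed_def finely_open_def
    using regular_points_hitting_time regular_points_nearly_borel by auto
  then show ?thesis
    using F regular_points_nearly_borel AE_regular_points[OF pos] unfolding fine_support_def by blast
qed

end

section \<open>Convergence of the time-changed semigroups\<close>

lemma sup_norm_le:
  assumes "\<And>x. \<bar>f x\<bar> \<le> e"
  shows "0 \<le> sup_norm f" "sup_norm f \<le> e"
proof -
  have "bdd_above (range (\<lambda>x. \<bar>f x\<bar>))" using assms by (intro bdd_aboveI2)
  then have "\<bar>f undefined\<bar> \<le> sup_norm f" unfolding sup_norm_def by (rule cSUP_upper[rotated]) simp
  then show "0 \<le> sup_norm f" by linarith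
  show "sup_norm f \<le> e" unfolding sup_norm_def using assms by (intro cSUP_least) auto
qed

lemma C0_dominated:
  assumes "u \<in> C0" "continuous_on UNIV v" "\<And>x. \<bar>v x\<bar> \<le> \<bar>u x\<bar>"
  shows "v \<in> C0"
  using assms unfolding C0_def by simp (meson le_less_trans)

text \<open>The density is positive at each t > 0, so its time integral cannot vanish. Its joint
  measurability, given on t > 0, is first restricted to the section at (x, y).\<close>

lemma green_pos:
  fixes p :: "real \<Rightarrow> 'x::{metric_space, second_countable_topology} \<Rightarrow> 'x \<Rightarrow> ennreal"
  assumes p: "transition_density X m p" and pos: "\<And>t x y. t > 0 \<Longrightarrow> p t x y > 0"
  shows "0 < green p 0 x y"
proof -
  have "(\<lambda>t. (t, x, y)) \<in> restrict_space borel {0<..} \<rightarrow>\<^sub>M restrict_space borel ({0<..} \<times> UNIV \<times> UNIV)"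
    by (rule measurable_restrict_space3) (auto intro!: borel_measurable_continuous_onI continuous_intros)
  moreover have "(\<lambda>(t, x, y). p t x y) \<in> borel_measurable (restrict_space borel ({0<..} \<times> UNIV \<times> UNIV))"
    using p by (simp add: transition_density_def)
  ultimately have "(\<lambda>t. (\<lambda>(t, x, y). p t x y) (t, x, y)) \<in> borel_measurable (restrict_space borel {0<..})"
    by (rule measurable_compose)
  then have m: "(\<lambda>t. p t x y * indicator {0<..} t) \<in> borel_measurable borel"
    by (subst (asm) borel_measurable_restrict_space_iff_ennreal) auto
  have "green p 0 x y \<noteq> 0"
  proof
    assume "green p 0 x y = 0"
    then have "(\<integral>\<^sup>+t. p t x y * indicator {0<..} t \<partial>lborel) = 0" by (simp add: green_def)
    then have "AE t in lborel. p t x y * indicator {0<..} t = 0"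
      by (subst (asm) nn_integral_0_iff_AE) (use m in simp_all)
    then obtain t where "0 < t" "t < 1" "p t x y * indicator {0<..} t = 0"
      using AE_lborel_interval_ex[OF _ zero_less_one] by blast
    then show False using pos[of t x y] by simp
  qed
  then show ?thesis by (simp add: zero_less_iff_neq_zero)
qed

section \<open>Approximation on the fine support and conclusion\<close>

context pcaf_process begin

text \<open>Positive and negative parts: with h = min u 0, both u - h and - h are nonnegative,
  dominated by |u|, and have difference u.\<close>

lemma approximable_C0:
  assumes F: "closed F" "F \<subseteq> regular_points" and M: "sub_markov_flow flow pot C"
    and u: "apply_bcontfun u \<in> C0"
  shows "sub_markov_flow.approximable pot F u"
proof -
  interpret M: sub_markov_flow flow pot C by (rule M)
  have reg: "((\<lambda>t. flow t x f) \<longlongrightarrow> f x) (at_right 0)" if "x \<in> F" for x f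
    using flow_right_zero[of f x] flow_zero_regular[of x f] F(2) that by auto
  have C0: "apply_bcontfun (pot f) \<in> C0" for f unfolding apply_pot by (rule pot_C0)
  obtain h :: "'x \<Rightarrow>\<^sub>C real" where h: "\<And>x. h x = min (u x) ((0 :: 'x \<Rightarrow>\<^sub>C real) x)"
    by (rule bcontfun_min[of u 0]) (rule that)
  have "apply_bcontfun (u - h) \<in> C0" "apply_bcontfun (- h) \<in> C0"
    by (rule C0_dominated[OF u], rule continuous_on_apply_bcontfun, simp add: h min_def)+
  then have "M.approximable F (u - h)" "M.approximable F (- h)"
    using M.approximable_C0_nonneg[OF F(1) reg C0, of "u - h"] M.approximable_C0_nonneg[OF F(1) reg C0, of "- h"]
    by (simp_all add: h)
  from M.approximable_diff[OF this] show ?thesis by simp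
qed

end

theorem proposition3p1:
  fixes m :: "'x::{metric_space, second_countable_topology} measure"
    and X :: "('w, 'x) process"
    and X_dual :: "('v, 'x) process"
    and p :: "real \<Rightarrow> 'x \<Rightarrow> 'x \<Rightarrow> ennreal"
    and \<mu> :: "enat \<Rightarrow> 'x measure"
    and A :: "enat \<Rightarrow> ennreal \<Rightarrow> 'w \<Rightarrow> ennreal"
    and F :: "enat \<Rightarrow> 'x set"
  assumes "locally compact (UNIV :: 'x set)"
    and "radon_measure m" and "full_support m"
    and "standard_process X" and "transient X"
    and "standard_process X_dual" and "transient X_dual" and "in_duality m X X_dual"
    and "transition_density X m p"
    and "\<And>t x y. t > 0 \<Longrightarrow> p t x y > 0"
    and "\<exists>x y. green p 0 x y \<noteq> \<infinity>"
    and "lower_semicontinuous (\<lambda>(x, y). green p 0 x y)"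
    and "\<And>n. kato_measure (green p 0) (\<mu> n)"
    and "\<And>n. pcaf X (A n)" and "\<And>n. revuz_measure X m (A n) (\<mu> n)"
    and "\<And>n. green_potential_of X p (A n) (\<mu> n)"
    and "vague_limit (\<lambda>n. \<mu> (enat n)) (\<mu> \<infinity>)"
    and "uniform_limit UNIV (\<lambda>n x. enn2real (green_op (green p 0) (\<mu> (enat n)) (\<lambda>_. 1) x))
           (\<lambda>x. enn2real (green_op (green p 0) (\<mu> \<infinity>) (\<lambda>_. 1) x)) sequentially"
    and "\<And>n. fine_support X (\<mu> n) (F n)"
    and "\<And>n. closed (F n)"
    and "\<And>n. F (enat n) \<subseteq> F \<infinity>"
  shows "\<forall>u\<in>C0. \<forall>T\<ge>0. uniform_limit {0..T}
           (\<lambda>n t. sup_norm (\<lambda>x. time_changed X (A (enat n)) t u x - time_changed X (A \<infinity>) t u x))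
           (\<lambda>_. 0) sequentially"
proof (intro ballI allI impI)
  let ?G = "green p 0"
  note lc = assms(1) and lsc = assms(12) and kato = assms(13) and closed = assms(20) and sub = assms(21)
  have process: "pcaf_process X p (A n) (\<mu> n)" for n
    using assms(1,4,12,13,14,16) by (intro pcaf_process.intro standard_markov.intro pcaf_process_axioms.intro)
  interpret N: pcaf_process X p "A n" "\<mu> n" for n by (rule process)
  have one: "uniform_limit UNIV (\<lambda>n. potential ?G (\<mu> (enat n)) (\<lambda>_. 1)) (potential ?G (\<mu> \<infinity>) (\<lambda>_. 1)) sequentially"
    using assms(18) unfolding potential_one[OF lsc kato, abs_def] .
  have "\<exists>b. \<forall>x. potential ?G (\<mu> n) (\<lambda>_. 1) x \<le> b" for n
  proof -
    have "potential ?G (\<mu> n) (\<lambda>_. 1) \<in> C0" by (rule potential_C0[OF lsc lc kato, where B=1]) auto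
    then obtain b where "\<And>x. \<bar>potential ?G (\<mu> n) (\<lambda>_. 1) x\<bar> \<le> b" by (rule C0_bounded) (rule that)
    then show ?thesis by (meson abs_le_D1)
  qed
  then obtain b where b: "\<And>n x. potential ?G (\<mu> n) (\<lambda>_. 1) x \<le> b n" by metis
  obtain k where k: "\<And>n x. k \<le> n \<Longrightarrow> dist (potential ?G (\<mu> (enat n)) (\<lambda>_. 1) x) (potential ?G (\<mu> \<infinity>) (\<lambda>_. 1) x) < 1"
    using uniform_limitD[OF one, of 1] unfolding eventually_sequentially by auto
  \<comment> \<open>A mass bound common to all flows: from index k on the potentials of 1 are within
    1 of the limit, and the finitely many earlier bounds are added.\<close>
  define C where "C = \<bar>b \<infinity>\<bar> + 1 + (\<Sum>n<k. \<bar>b (enat n)\<bar>)"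
  have C_lim: "potential ?G (\<mu> \<infinity>) (\<lambda>_. 1) x \<le> C" for x
    using b[of \<infinity> x] sum_nonneg[of "{..<k}" "\<lambda>n. \<bar>b (enat n)\<bar>"] unfolding C_def by linarith
  have C: "potential ?G (\<mu> (enat n)) (\<lambda>_. 1) x \<le> C" for n x
  proof (cases "n < k")
    case True
    then have "\<bar>b (enat n)\<bar> \<le> (\<Sum>n<k. \<bar>b (enat n)\<bar>)" by (intro member_le_sum) auto
    then show ?thesis using b[of "enat n" x] unfolding C_def by linarith
  next
    case False
    then have "dist (potential ?G (\<mu> (enat n)) (\<lambda>_. 1) x) (potential ?G (\<mu> \<infinity>) (\<lambda>_. 1) x) < 1"
      by (intro k) simp
    then show ?thesis
      using b[of \<infinity> x] sum_nonneg[of "{..<k}" "\<lambda>n. \<bar>b (enat n)\<bar>"]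
      unfolding C_def dist_real_def by linarith
  qed
  note flow = N.flow_sub_markov[OF C] and flow_lim = N.flow_sub_markov[OF C_lim]
  interpret L: sub_markov_flow "N.flow \<infinity>" "N.pot \<infinity>" C by (rule flow_lim)
  have conv: "(\<lambda>n. N.pot (enat n) f) \<longlonglongrightarrow> N.pot \<infinity> f" for f
  proof (rule metric_LIMSEQ_I)
    fix e :: real assume e: "0 < e"
    have "uniform_limit UNIV (\<lambda>n. potential ?G (\<mu> (enat n)) f) (potential ?G (\<mu> \<infinity>) f) sequentially"
      by (rule potential_uniform_limit[OF lsc lc kato kato assms(17) one, where B="norm f"])
        (use norm_bounded[of f] in auto)
    from uniform_limitD[OF this, of "e / 2"]
    have "\<forall>\<^sub>F n in sequentially. \<forall>x. dist (potential ?G (\<mu> (enat n)) f x) (potential ?G (\<mu> \<infinity>) f x) < e / 2"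
      using e by simp
    then obtain n0 where n0: "\<And>n x. n0 \<le> n \<Longrightarrow> dist (potential ?G (\<mu> (enat n)) f x) (potential ?G (\<mu> \<infinity>) f x) < e / 2"
      unfolding eventually_sequentially by blast
    have "dist (N.pot (enat n) f) (N.pot \<infinity> f) < e" if "n0 \<le> n" for n
    proof -
      have "dist (N.pot (enat n) f) (N.pot \<infinity> f) \<le> e / 2"
        by (rule dist_bound) (use n0[OF that] in \<open>auto simp: N.apply_pot intro: less_imp_le\<close>)
      then show ?thesis using e by linarith
    qed
    then show "\<exists>n0. \<forall>n\<ge>n0. dist (N.pot (enat n) f) (N.pot \<infinity> f) < e" by blast
  qed
  fix u :: "'x \<Rightarrow> real" and T :: real assume u: "u \<in> C0" and T: "0 \<le> T"
  obtain B where "\<And>x. \<bar>u x\<bar> \<le> B" by (rule C0_bounded[OF u]) (rule that)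
  then have "u \<in> bcontfun" by (intro bcontfun_normI C0_continuous u) simp
  then have U: "apply_bcontfun (Bcontfun u) = u" by (rule Bcontfun_inverse)
  define v where "v = Bcontfun u"
  have v: "apply_bcontfun v = u" unfolding v_def by (rule U)
  have F_regular: "F \<infinity> \<subseteq> N.regular_points \<infinity>"
    by (rule N.fine_support_regular_points[OF assms(19) green_pos[OF assms(9,10)]])
  have appr: "L.approximable (F \<infinity>) v"
    by (rule N.approximable_C0[OF closed F_regular flow_lim]) (simp add: v u)
  show "uniform_limit {0..T}
           (\<lambda>n t. sup_norm (\<lambda>x. time_changed X (A (enat n)) t u x - time_changed X (A \<infinity>) t u x))
           (\<lambda>_. 0) sequentially"
  proof (rule uniform_limitI)
    fix e :: real assume e: "0 < e"
    \<comment> \<open>Four errors of size e / 8 add up to e / 2: replacing u by the limit potential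
      in flow n and in the limit flow, changing the potential operator inside flow n, and the
      convergence of the flows applied to their own potentials. The remaining half keeps the
      supremum strictly below e.\<close>
    obtain g where g: "\<And>x. x \<in> F \<infinity> \<Longrightarrow> \<bar>v x - N.pot \<infinity> g x\<bar> < e / 8"
      using L.approximableD[OF appr, of "e / 8"] e by auto
    have supp: "AE y in \<mu> n. y \<in> F n" for n using assms(19) unfolding fine_support_def by blast
    \<comment> \<open>The approximation is valid only on the limiting support; since each F n is
      contained in it, one estimate serves all the flows.\<close>
    have "\<bar>(v - N.pot \<infinity> g) y\<bar> \<le> e / 8" if "y \<in> F n" for n y
    proof -
      have "y \<in> F \<infinity>" using that sub by (cases n) auto
      from g[OF this] show ?thesis by simp
    qed
    then have near: "\<bar>N.flow n t x (v - N.pot \<infinity> g)\<bar> \<le> e / 8" if "0 \<le> t" for n t x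
      using e by (intro N.flow_support_bound[OF closed supp that]) auto
    have "\<forall>\<^sub>F n in sequentially. dist (N.pot (enat n) g) (N.pot \<infinity> g) < e / 8"
      by (rule tendstoD[OF conv]) (use e in simp)
    moreover have "\<forall>\<^sub>F n in sequentially. \<forall>x. \<forall>t\<in>{0..T}.
        \<bar>N.flow (enat n) t x (N.pot (enat n) g) - N.flow \<infinity> t x (N.pot \<infinity> g)\<bar> < e / 8"
      by (rule sub_markov_flow_converges[OF flow flow_lim conv]) (use e in simp)
    ultimately show "\<forall>\<^sub>F n in sequentially. \<forall>t\<in>{0..T}.
        dist (sup_norm (\<lambda>x. time_changed X (A (enat n)) t u x - time_changed X (A \<infinity>) t u x)) 0 < e"
    proof eventually_elim
      case (elim n)
      show ?case
      proof
        fix t assume t: "t \<in> {0..T}"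
        have "\<bar>time_changed X (A (enat n)) t u x - time_changed X (A \<infinity>) t u x\<bar> \<le> e / 2" for x
        proof -
          have "\<bar>N.flow (enat n) t x (N.pot \<infinity> g - N.pot (enat n) g)\<bar> \<le> e / 8"
            using N.flow_bound[of "enat n" t "N.pot \<infinity> g - N.pot (enat n) g" x] elim(1)
            by (simp add: dist_norm norm_minus_commute)
          moreover have "\<bar>N.flow (enat n) t x (N.pot (enat n) g) - N.flow \<infinity> t x (N.pot \<infinity> g)\<bar> < e / 8"
            using elim(2) t by blast
          moreover have "\<bar>time_changed X (A n) t u x - N.flow n t x (N.pot \<infinity> g)\<bar> \<le> e / 8" for n
            using near[of t n x] t unfolding N.flow_diff v by simp
          note this[of "enat n"] this[of \<infinity>]
          ultimately show ?thesis
            using e unfolding N.flow_diff by linarith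
        qed
        then have "0 \<le> sup_norm (\<lambda>x. time_changed X (A (enat n)) t u x - time_changed X (A \<infinity>) t u x)"
          "sup_norm (\<lambda>x. time_changed X (A (enat n)) t u x - time_changed X (A \<infinity>) t u x) \<le> e / 2"
          by (rule sup_norm_le)+
        then show "dist (sup_norm (\<lambda>x. time_changed X (A (enat n)) t u x - time_changed X (A \<infinity>) t u x)) 0 < e"
          using e by (simp add: dist_real_def)
      qed
    qed
  qed
qed

end
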